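(* Let $\mathcal{A}(c)=\mathbb{C}[L^{c,c^{-1}}]$, with its structure of a (complexified) cluster algebra with principal coefficients at the initial seed with cluster $\mathbf{x}=(x_{\omega_i;c}:i\in I)$, coefficient tuple $(y_{i;c}:i\in I)$ and exchange matrix $B(c)$. Let $z=x_{\gamma;c}$ (with $\gamma\in\Pi(c)$) be a cluster variable not belonging to $\mathbf{x}$. Identifying $\mathbb{Z}^n$ with the root lattice by means of the basis $\alpha_1,\dots,\alpha_n$ of simple roots, the denominator vector $\mathbf{d}_{z;\mathbf{x}}$ gets identified with $c^{-1}\gamma-\gamma$.
   Context: Root data. $G$ is a simply connected semisimple complex group with Cartan matrix $A=(a_{i,j})_{i,j\in I}$, $I=\{1,\dots,n\}$, simple roots $\alpha_i$, simple coroots $\alpha_i^\vee$, $a_{i,j}=\alpha_j(\alpha_i^\vee)$, fundamental weights $\omega_i$ ($\alpha_j=\sum_i a_{i,j}\omega_i$), and Weyl group $W$ generated by simple reflections $s_i$, with longest element $w_\circ$; $\omega_{i^\star}=-w_\circ\omega_i$. The index set is numbered so that the fixed Coxeter element is $c=s_1\cdots s_n$. Write $i\prec_c j$ if $a_{i,j}\ne0$ and $i<j$. $B(c)=(b_{i,j})$: $b_{i,j}=-a_{i,j}$ if $i\prec_c j$, $b_{i,j}=a_{i,j}$ if $j\prec_c i$, $b_{i,j}=0$ otherwise. Order weights by $\gamma\ge\delta$ iff $\gamma-\delta$ is a nonnegative integer combination of simple roots; $h(i;c)$ is the (unique) positive integer with $\omega_i>c\omega_i>\cdots>c^{h(i;c)}\omega_i=-\omega_{i^\star}$;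 $\Pi(c)=\{c^m\omega_i:i\in I,\,0\le m\le h(i;c)\}$. Group. Let $\varphi_i:SL_2\to G$ be the canonical embedding for $\alpha_i$, $x_i(t)=\varphi_i\begin{pmatrix}1&t\\0&1\end{pmatrix}$, $x_{\bar i}(t)=\varphi_i\begin{pmatrix}1&0\\t&1\end{pmatrix}$, $\overline{s_i}=\varphi_i\begin{pmatrix}0&-1\\1&0\end{pmatrix}$. $N$ (resp. $N_-$) is generated by all $x_i(t)$ (resp. $x_{\bar i}(t)$), $H$ is the maximal torus, $B_-=HN_-$. $\overline{w}=\overline{s_{i_1}}\cdots\overline{s_{i_\ell}}$ for any reduced word of $w\in W$. Each $x\in N_-HN$ is uniquely $[x]_-[x]_0[x]_+$ with factors in $N_-,H,N$; a weight $\gamma$ is a character $a\mapsto a^\gamma$ of $H$. The generalized minor $\Delta_{u\omega_i,v\omega_i}$ ($u,v\in W$) is the regular function on $G$ restricting to $x\mapsto([\overline{u}^{-1}x\overline{v}]_0)^{\omega_i}$ on $\overline{u}N_-HN\overline{v}^{-1}$; it depends only on $u\omega_i,v\omega_i$. $L^{c,c^{-1}}=N\overline{c}N\cap B_-c^{-1}B_-$. $x_{\gamma;c}$ is the restriction of $\Delta_{\gamma,\gamma}$ to $L^{c,c^{-1}}$; each $\Delta_{\omega_i,c\omega_i}$ vanishes nowhere on $L^{c,c^{-1}}$, and $y_{j;c}$ is the restriction of $\Delta_{\omega_j,c\omega_j}\prod_{i\prec_c j}\Delta_{\omega_i,c\omega_i}^{a_{i,j}}$. Cluster algebras. $\mathrm{Trop}(u_j:j\in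 J)$ is the free abelian multiplicative group on the $u_j$ with $\prod u_j^{a_j}\oplus\prod u_j^{b_j}=\prod u_j^{\min(a_j,b_j)}$. Here the coefficient semifield is $\mathbb{P}=\mathrm{Trop}(y_{i;c}:i\in I)$ (principal coefficients) and the ambient field is the fraction field of $\mathbb{C}[L^{c,c^{-1}}]$, generated over $\mathbb{C}$ by the algebraically independent elements $x_{\omega_i;c},y_{i;c}$. A seed is $(\mathbf{x},\mathbf{y},B)$ with cluster $\mathbf{x}$, coefficient tuple $\mathbf{y}$ in $\mathbb{P}$, and exchange matrix $B$. With $[b]_+=\max(b,0)$, the mutation $\mu_k$ gives $(\mathbf{x}',\mathbf{y}',B')$: $b'_{i,j}=-b_{i,j}$ if $i=k$ or $j=k$, otherwise $b'_{i,j}=b_{i,j}+[b_{i,k}]_+[b_{k,j}]_+-[-b_{i,k}]_+[-b_{k,j}]_+$; $y'_k=y_k^{-1}$, $y'_j=y_jy_k^{[b_{k,j}]_+}(y_k\oplus1)^{-b_{k,j}}$ for $j\ne k$; $x'_j=x_j$ for $j\ne k$, $x_kx'_k=\dfrac{y_k\prod_i x_i^{[b_{i,k}]_+}+\prod_i x_i^{[-b_{i,k}]_+}}{y_k\oplus1}$. Cluster variables are all elements of clusters of seeds obtained from the initial seed by sequences of mutations; they are exactly the $x_{\gamma;c}$ with $\gamma\in\Pi(c)$. Denominator vector. Every cluster variable $z$ can be uniquely written as $z=N(x_1,\dots,x_n)/(x_1^{d_1}\cdots x_n^{d_n})$, where $\mathbf{x}=(x_1,\dots,x_n)$ and $N$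 is a polynomial (with coefficients in the ground ring, i.e. Laurent polynomials in the $y_{i;c}$) not divisible by any $x_i$; $\mathbf{d}_{z;\mathbf{x}}=(d_1,\dots,d_n)\in\mathbb{Z}^n$. *)

theory Defs
  imports "HOL-Analysis.Analysis" "HOL-Algebra.Solvable_Groups" "HOL-Library.Poly_Mapping"
begin

section \<open>Linear algebraic groups over the complex numbers\<close>

text \<open>
  A linear algebraic group is a Zariski closed subgroup of some \<open>GL\<^sub>m\<close>, with \<open>m\<close> the cardinality
  of an arbitrary finite type.
\<close>

inductive_set entry_polys :: "(complex^'m^'m \<Rightarrow> complex) set" where
  const: "(\<lambda>g. a) \<in> entry_polys"
| entry: "(\<lambda>g. g $ i $ j) \<in> entry_polys"
| add: "p \<in> entry_polys \<Longrightarrow> q \<in> entry_polys \<Longrightarrow> (\<lambda>g. p g + q g) \<in> entry_polys"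
| mult: "p \<in> entry_polys \<Longrightarrow> q \<in> entry_polys \<Longrightarrow> (\<lambda>g. p g * q g) \<in> entry_polys"

text \<open>Regular functions on a Zariski locally closed set: locally (for the Zariski topology)
  a quotient of two polynomials.\<close>

definition regular_on :: "(complex^'m^'m) set \<Rightarrow> (complex^'m^'m \<Rightarrow> complex) \<Rightarrow> bool" where
  "regular_on X f \<longleftrightarrow>
     (\<forall>x\<in>X. \<exists>p\<in>entry_polys. \<exists>q\<in>entry_polys. q x \<noteq> 0 \<and> (\<forall>y\<in>X. q y \<noteq> 0 \<longrightarrow> f y = p y / q y))"

definition matrix_monoid :: "(complex^'m^'m) set \<Rightarrow> (complex^'m^'m) monoid" where
  "matrix_monoid X = \<lparr>carrier = X, monoid.mult = (**), one = mat 1\<rparr>"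

definition algebraic_group :: "(complex^'m^'m) set \<Rightarrow> bool" where
  "algebraic_group X \<longleftrightarrow> group (matrix_monoid X) \<and>
     (\<exists>P\<subseteq>entry_polys. X = {g. invertible g \<and> (\<forall>p\<in>P. p g = 0)})"

text \<open>Trivial radical. For complex algebraic groups, connectedness in the Euclidean and in the
  Zariski topology agree.\<close>

definition semisimple_group :: "(complex^'m^'m) set \<Rightarrow> bool" where
  "semisimple_group X \<longleftrightarrow> algebraic_group X \<and> connected X \<and>
     (\<forall>R. algebraic_group R \<and> connected R \<and> R \<lhd> matrix_monoid X \<and> solvable (matrix_monoid R)
        \<longrightarrow> R = {mat 1})"

definition algebraic_torus :: "(complex^'m^'m) set \<Rightarrow> bool" where
  "algebraic_torus T \<longleftrightarrow> algebraic_group T \<and> connected T \<and>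
     (\<exists>g :: complex^'m^'m. invertible g \<and>
        (\<forall>t\<in>T. \<forall>i j. i \<noteq> j \<longrightarrow> (g ** t ** matrix_inv g) $ i $ j = 0))"

definition maximal_torus :: "(complex^'m^'m) set \<Rightarrow> (complex^'m^'m) set \<Rightarrow> bool" where
  "maximal_torus X T \<longleftrightarrow> algebraic_torus T \<and> T \<subseteq> X \<and>
     (\<forall>T'. algebraic_torus T' \<and> T \<subseteq> T' \<and> T' \<subseteq> X \<longrightarrow> T' = T)"

definition character_on :: "(complex^'m^'m) set \<Rightarrow> (complex^'m^'m \<Rightarrow> complex) \<Rightarrow> bool" where
  "character_on T \<psi> \<longleftrightarrow> regular_on T \<psi> \<and>
     (\<forall>a\<in>T. \<psi> a \<noteq> 0) \<and> (\<forall>a\<in>T. \<forall>b\<in>T. \<psi> (a ** b) = \<psi> a * \<psi> b)"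

definition SL2 :: "(complex^2^2) set" where
  "SL2 = {g. det g = 1}"

definition algebraic_embedding_SL2 ::
    "(complex^'m^'m) set \<Rightarrow> (complex^2^2 \<Rightarrow> complex^'m^'m) \<Rightarrow> bool" where
  "algebraic_embedding_SL2 X \<phi> \<longleftrightarrow>
     \<phi> \<in> hom (matrix_monoid SL2) (matrix_monoid X) \<and> inj_on \<phi> SL2 \<and>
     (\<forall>a b. regular_on SL2 (\<lambda>g. \<phi> g $ a $ b))"

section \<open>Weights and the Weyl group\<close>

text \<open>
  A weight is written in the basis of fundamental weights: \<open>\<gamma> :: int^'i\<close> stands for
  \<open>\<Sum>i. \<gamma> $ i \<cdot> \<omega>\<^sub>i\<close>, so that \<open>\<gamma> $ i\<close> is the value of \<open>\<gamma>\<close> on the coroot \<open>\<alpha>\<^sub>i\<^sup>\<or>\<close>.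
  The Cartan matrix is \<open>A $ i $ j = \<alpha>\<^sub>j(\<alpha>\<^sub>i\<^sup>\<or>)\<close>.  The index set \<open>I = {1,...,n}\<close> is the
  finite linearly ordered type \<open>'i\<close>, whose order is the numbering for which
  \<open>c = s\<^sub>1 \<cdots> s\<^sub>n\<close>.
\<close>

type_synonym 'i weight = "(int, 'i) vec"
type_synonym 'i int_mat = "((int, 'i) vec, 'i) vec"

definition fund_weight :: "'i::finite \<Rightarrow> 'i weight" where
  "fund_weight i = axis i 1"

definition simple_root :: "'i int_mat \<Rightarrow> 'i::finite \<Rightarrow> 'i weight" where
  "simple_root A j = (\<Sum>i\<in>UNIV. (A $ i $ j) *s fund_weight i)"

definition root_comb :: "'i int_mat \<Rightarrow> 'i weight \<Rightarrow> 'i::finite weight" where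
  "root_comb A d = (\<Sum>i\<in>UNIV. (d $ i) *s simple_root A i)"

definition weight_ge :: "'i int_mat \<Rightarrow> 'i weight \<Rightarrow> 'i::finite weight \<Rightarrow> bool" where
  "weight_ge A \<gamma> \<delta> \<longleftrightarrow> (\<exists>k. (\<forall>i. k $ i \<ge> 0) \<and> \<gamma> - \<delta> = root_comb A k)"

definition weight_gt :: "'i int_mat \<Rightarrow> 'i weight \<Rightarrow> 'i::finite weight \<Rightarrow> bool" where
  "weight_gt A \<gamma> \<delta> \<longleftrightarrow> weight_ge A \<gamma> \<delta> \<and> \<gamma> \<noteq> \<delta>"

definition simple_refl :: "'i int_mat \<Rightarrow> 'i \<Rightarrow> 'i weight \<Rightarrow> 'i::finite weight" where
  "simple_refl A i \<gamma> = \<gamma> - (\<gamma> $ i) *s simple_root A i"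

text \<open>Elements of the Weyl group are given by words \<open>[i\<^sub>1,...,i\<^sub>l]\<close>, acting as
  \<open>s\<^bsub>i\<^sub>1\<^esub> \<cdots> s\<^bsub>i\<^sub>l\<^esub>\<close>; this action on the weight lattice is faithful.\<close>

definition word_act :: "'i int_mat \<Rightarrow> 'i list \<Rightarrow> 'i weight \<Rightarrow> 'i::finite weight" where
  "word_act A ws \<gamma> = foldr (simple_refl A) ws \<gamma>"

definition reduced_word :: "'i int_mat \<Rightarrow> 'i::finite list \<Rightarrow> bool" where
  "reduced_word A ws \<longleftrightarrow> (\<forall>vs. word_act A vs = word_act A ws \<longrightarrow> length ws \<le> length vs)"

definition longest_word :: "'i int_mat \<Rightarrow> 'i::finite list \<Rightarrow> bool" where
  "longest_word A ws \<longleftrightarrow>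
     reduced_word A ws \<and> (\<forall>vs. reduced_word A vs \<longrightarrow> length vs \<le> length ws)"

definition cox_word :: "'i::{finite,linorder} list" where
  "cox_word = sorted_list_of_set UNIV"

definition cox :: "'i::{finite,linorder} int_mat \<Rightarrow> 'i weight \<Rightarrow> 'i weight" where
  "cox A = word_act A cox_word"

definition cox_inv :: "'i::{finite,linorder} int_mat \<Rightarrow> 'i weight \<Rightarrow> 'i weight" where
  "cox_inv A = word_act A (rev cox_word)"

text \<open>\<open>h = h(i;c)\<close>; the last weight of the chain is \<open>-\<omega>\<^bsub>i\<^sup>\<star>\<^esub>\<close>, that is \<open>w\<^sub>\<circ> \<omega>\<^sub>i\<close>.\<close>

definition is_h :: "'i::{finite,linorder} int_mat \<Rightarrow> 'i \<Rightarrow> nat \<Rightarrow> bool" where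
  "is_h A i h \<longleftrightarrow> h > 0 \<and>
     (\<forall>m<h. weight_gt A ((cox A ^^ m) (fund_weight i)) ((cox A ^^ Suc m) (fund_weight i))) \<and>
     (\<exists>ws. longest_word A ws \<and> (cox A ^^ h) (fund_weight i) = word_act A ws (fund_weight i))"

definition Pi_c :: "'i::{finite,linorder} int_mat \<Rightarrow> 'i weight set" where
  "Pi_c A = {\<gamma>. \<exists>i h m. is_h A i h \<and> m \<le> h \<and> \<gamma> = (cox A ^^ m) (fund_weight i)}"

definition prec :: "'i::{finite,linorder} int_mat \<Rightarrow> 'i \<Rightarrow> 'i \<Rightarrow> bool" where
  "prec A i j \<longleftrightarrow> A $ i $ j \<noteq> 0 \<and> i < j"

definition B_c :: "'i::{finite,linorder} int_mat \<Rightarrow> 'i int_mat" where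
  "B_c A = (\<chi> i j. if prec A i j then - A $ i $ j else if prec A j i then A $ i $ j else 0)"

section \<open>The group with its root data\<close>

text \<open>
  \<open>fchar D i\<close> is the fundamental weight \<open>\<omega>\<^sub>i\<close> as a character of the maximal torus.
\<close>

record ('i::finite, 'm::finite) group_datum =
  Grp :: "(complex^'m^'m) set"
  Tor :: "(complex^'m^'m) set"
  emb :: "'i \<Rightarrow> complex^2^2 \<Rightarrow> complex^'m^'m"
  Cartan :: "'i int_mat"
  fchar :: "'i \<Rightarrow> complex^'m^'m \<Rightarrow> complex"

definition wchar :: "('i::finite,'m::finite) group_datum \<Rightarrow> 'i weight \<Rightarrow> complex^'m^'m \<Rightarrow> complex" where
  "wchar D \<gamma> a = (\<Prod>i\<in>UNIV. fchar D i a powi (\<gamma> $ i))"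

definition x_up :: "('i::finite,'m::finite) group_datum \<Rightarrow> 'i \<Rightarrow> complex \<Rightarrow> complex^'m^'m" where
  "x_up D i t = emb D i (vector [vector [1, t], vector [0, 1]])"

definition x_low :: "('i::finite,'m::finite) group_datum \<Rightarrow> 'i \<Rightarrow> complex \<Rightarrow> complex^'m^'m" where
  "x_low D i t = emb D i (vector [vector [1, 0], vector [t, 1]])"

definition coroot :: "('i::finite,'m::finite) group_datum \<Rightarrow> 'i \<Rightarrow> complex \<Rightarrow> complex^'m^'m" where
  "coroot D i t = emb D i (vector [vector [t, 0], vector [0, inverse t]])"

definition s_bar :: "('i::finite,'m::finite) group_datum \<Rightarrow> 'i \<Rightarrow> complex^'m^'m" where
  "s_bar D i = emb D i (vector [vector [0, -1], vector [1, 0]])"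

text \<open>\<open>\<beta>\<close> is a root if it is a nonzero weight having a root subgroup, i.e. an injective morphism
  \<open>x\<close> from the additive group to the group with \<open>h x(t) h\<^sup>-\<^sup>1 = x(h\<^sup>\<beta> t)\<close> for \<open>h\<close> in the torus.
  In a simply connected group every character of the torus is of the form \<open>wchar D \<beta>\<close>.\<close>

definition is_root :: "('i::finite,'m::finite) group_datum \<Rightarrow> 'i weight \<Rightarrow> bool" where
  "is_root D \<beta> \<longleftrightarrow> \<beta> \<noteq> 0 \<and>
     (\<exists>x. inj x \<and> range x \<subseteq> Grp D \<and> (\<forall>s t. x (s + t) = x s ** x t) \<and>
        (\<forall>a b. \<exists>p. \<forall>t. x t $ a $ b = poly p t) \<and>
        (\<forall>h\<in>Tor D. \<forall>t. h ** x t ** matrix_inv h = x (wchar D \<beta> h * t)))"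

text \<open>A simply connected semisimple complex group with a maximal torus, a base
  \<open>\<alpha>\<^sub>1,...,\<alpha>\<^sub>n\<close> of its root system, its Cartan matrix, and \<open>SL\<^sub>2\<close>-embeddings for the
  simple roots.  By the conditions on \<open>fchar\<close> and on the action of the torus, \<open>\<alpha>\<^sub>j\<close> takes the value
  \<open>t ^ a\<^sub>i\<^sub>j\<close> at \<open>coroot D i t\<close>.\<close>

definition simply_connected_group_datum :: "('i::finite,'m::finite) group_datum \<Rightarrow> bool" where
  "simply_connected_group_datum D \<longleftrightarrow>
     semisimple_group (Grp D) \<and> simply_connected (Grp D) \<and> maximal_torus (Grp D) (Tor D) \<and>
     (\<forall>i. algebraic_embedding_SL2 (Grp D) (emb D i)) \<and>
     (\<forall>i t. t \<noteq> 0 \<longrightarrow> coroot D i t \<in> Tor D) \<and>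
     (\<forall>i. character_on (Tor D) (fchar D i)) \<and>
     (\<forall>i j t. t \<noteq> 0 \<longrightarrow> fchar D i (coroot D j t) = (if i = j then t else 1)) \<and>
     (\<forall>i. \<forall>h\<in>Tor D. \<forall>t.
        h ** x_up D i t ** matrix_inv h = x_up D i (wchar D (simple_root (Cartan D) i) h * t) \<and>
        h ** x_low D i t ** matrix_inv h = x_low D i (wchar D (- simple_root (Cartan D) i) h * t)) \<and>
     inj (root_comb (Cartan D)) \<and>
     (\<forall>\<beta>. is_root D \<beta> \<longrightarrow> weight_ge (Cartan D) \<beta> 0 \<or> weight_ge (Cartan D) 0 \<beta>)"

definition N_up :: "('i::finite,'m::finite) group_datum \<Rightarrow> (complex^'m^'m) set" where
  "N_up D = generate (matrix_monoid (Grp D)) {x_up D i t | i t. True}"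

definition N_low :: "('i::finite,'m::finite) group_datum \<Rightarrow> (complex^'m^'m) set" where
  "N_low D = generate (matrix_monoid (Grp D)) {x_low D i t | i t. True}"

definition B_low :: "('i::finite,'m::finite) group_datum \<Rightarrow> (complex^'m^'m) set" where
  "B_low D = {a ** n | a n. a \<in> Tor D \<and> n \<in> N_low D}"

text \<open>The representative \<open>w_bar D ws\<close> of a Weyl group element is only meant for reduced \<open>ws\<close>.\<close>

definition w_bar :: "('i::finite,'m::finite) group_datum \<Rightarrow> 'i list \<Rightarrow> complex^'m^'m" where
  "w_bar D ws = foldr (\<lambda>i g. s_bar D i ** g) ws (mat 1)"

text \<open>The generalized minors: \<open>\<Delta> \<gamma> \<delta>\<close> is \<open>\<Delta>\<^bsub>\<gamma>,\<delta>\<^esub>\<close>.  The conditions determine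
  \<open>\<Delta> \<gamma> \<delta>\<close> on the group for \<open>\<gamma> = u \<omega>\<^sub>i\<close>, \<open>\<delta> = v \<omega>\<^sub>i\<close>, because
  \<open>u N\<^sub>- H N v\<^sup>-\<^sup>1\<close> is dense; other pairs of weights play no role.\<close>

definition generalized_minors ::
    "('i::finite,'m::finite) group_datum \<Rightarrow> ('i weight \<Rightarrow> 'i weight \<Rightarrow> complex^'m^'m \<Rightarrow> complex) \<Rightarrow> bool" where
  "generalized_minors D \<Delta> \<longleftrightarrow>
     (\<forall>us vs i. reduced_word (Cartan D) us \<and> reduced_word (Cartan D) vs \<longrightarrow>
        (let f = \<Delta> (word_act (Cartan D) us (fund_weight i)) (word_act (Cartan D) vs (fund_weight i)) in
         regular_on (Grp D) f \<and>
         (\<forall>n'\<in>N_low D. \<forall>a\<in>Tor D. \<forall>n\<in>N_up D.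
            f (w_bar D us ** (n' ** a ** n) ** matrix_inv (w_bar D vs)) = wchar D (fund_weight i) a)))"

text \<open>The reduced double cell \<open>L\<^bsup>c,c\<^sup>-\<^sup>1\<^esup>\<close>.\<close>

definition L_cell :: "('i::{finite,linorder},'m::finite) group_datum \<Rightarrow> (complex^'m^'m) set" where
  "L_cell D =
     {n ** w_bar D cox_word ** n' | n n'. n \<in> N_up D \<and> n' \<in> N_up D} \<inter>
     {b ** w_bar D (rev cox_word) ** b' | b b'. b \<in> B_low D \<and> b' \<in> B_low D}"

text \<open>Functions on \<open>X\<close> are represented by their extension by zero.\<close>

definition fun_restrict :: "'a set \<Rightarrow> ('a \<Rightarrow> complex) \<Rightarrow> 'a \<Rightarrow> complex" where
  "fun_restrict X f = (\<lambda>x. if x \<in> X then f x else 0)"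

definition coord_ring :: "(complex^'m^'m) set \<Rightarrow> (complex^'m^'m \<Rightarrow> complex) set" where
  "coord_ring X = {f. regular_on X f \<and> (\<forall>x. x \<notin> X \<longrightarrow> f x = 0)}"

text \<open>\<open>\<iota>\<close> exhibits the field \<open>'f\<close> as the field of fractions of \<open>coord_ring X\<close>.\<close>

definition fraction_field_of ::
    "(complex^'m^'m) set \<Rightarrow> ((complex^'m^'m \<Rightarrow> complex) \<Rightarrow> 'f::field) \<Rightarrow> bool" where
  "fraction_field_of X \<iota> \<longleftrightarrow>
     \<iota> (fun_restrict X (\<lambda>_. 1)) = 1 \<and>
     (\<forall>f\<in>coord_ring X. \<forall>g\<in>coord_ring X.
        \<iota> (\<lambda>x. f x + g x) = \<iota> f + \<iota> g \<and> \<iota> (\<lambda>x. f x * g x) = \<iota> f * \<iota> g) \<and>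
     inj_on \<iota> (coord_ring X) \<and>
     (\<forall>z. \<exists>f\<in>coord_ring X. \<exists>g\<in>coord_ring X. \<iota> g \<noteq> 0 \<and> z = \<iota> f / \<iota> g)"

definition x_gamma ::
    "('i::{finite,linorder},'m::finite) group_datum \<Rightarrow> ('i weight \<Rightarrow> 'i weight \<Rightarrow> complex^'m^'m \<Rightarrow> complex) \<Rightarrow>
     'i weight \<Rightarrow> complex^'m^'m \<Rightarrow> complex" where
  "x_gamma D \<Delta> \<gamma> = fun_restrict (L_cell D) (\<Delta> \<gamma> \<gamma>)"

definition y_coef ::
    "('i::{finite,linorder},'m::finite) group_datum \<Rightarrow> ('i weight \<Rightarrow> 'i weight \<Rightarrow> complex^'m^'m \<Rightarrow> complex) \<Rightarrow>
     'i \<Rightarrow> complex^'m^'m \<Rightarrow> complex" where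
  "y_coef D \<Delta> j = fun_restrict (L_cell D)
     (\<lambda>x. \<Delta> (fund_weight j) (cox (Cartan D) (fund_weight j)) x *
        (\<Prod>i\<in>{i. prec (Cartan D) i j}.
           \<Delta> (fund_weight i) (cox (Cartan D) (fund_weight i)) x powi (Cartan D $ i $ j)))"

section \<open>Seeds with coefficients in a tropical semifield\<close>

text \<open>\<open>Trop(u\<^sub>j)\<close> in exponent notation: the vector \<open>a\<close> stands for \<open>\<Prod>j. u\<^sub>j ^ a\<^sub>j\<close>, so the product
  of the semifield is \<open>+\<close>, its unit is \<open>0\<close>, and \<open>b\<close>-th powers are \<open>b *s _\<close>.\<close>

definition trop_plus :: "'i weight \<Rightarrow> 'i weight \<Rightarrow> 'i::finite weight" where
  "trop_plus a b = (\<chi> j. min (a $ j) (b $ j))"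

definition pos_part :: "int \<Rightarrow> int" where
  "pos_part b = max b 0"

definition monomial_val :: "('i::finite \<Rightarrow> 'f::field) \<Rightarrow> 'i weight \<Rightarrow> 'f" where
  "monomial_val u a = (\<Prod>j\<in>UNIV. u j powi (a $ j))"

type_synonym ('i, 'f) seed = "('i \<Rightarrow> 'f) \<times> ('i \<Rightarrow> 'i weight) \<times> 'i int_mat"

definition mutate_B :: "'i \<Rightarrow> 'i int_mat \<Rightarrow> 'i::finite int_mat" where
  "mutate_B k B = (\<chi> i j. if i = k \<or> j = k then - B $ i $ j
     else B $ i $ j + pos_part (B $ i $ k) * pos_part (B $ k $ j)
                    - pos_part (- B $ i $ k) * pos_part (- B $ k $ j))"

definition mutate_y :: "'i \<Rightarrow> 'i int_mat \<Rightarrow> ('i \<Rightarrow> 'i weight) \<Rightarrow> 'i::finite \<Rightarrow> 'i weight" where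
  "mutate_y k B y j = (if j = k then - y k
     else y j + pos_part (B $ k $ j) *s y k + (- B $ k $ j) *s trop_plus (y k) 0)"

text \<open>\<open>u\<close> is the tuple of elements of the ambient field represented by the generators
  of the tropical semifield.\<close>

definition mutate_x ::
    "('i \<Rightarrow> 'f) \<Rightarrow> 'i \<Rightarrow> 'i int_mat \<Rightarrow> ('i \<Rightarrow> 'i weight) \<Rightarrow> ('i \<Rightarrow> 'f) \<Rightarrow> 'i::finite \<Rightarrow> 'f::field" where
  "mutate_x u k B y x j = (if j = k then
       (monomial_val u (y k) * (\<Prod>i\<in>UNIV. x i powi pos_part (B $ i $ k))
          + (\<Prod>i\<in>UNIV. x i powi pos_part (- B $ i $ k)))
       / monomial_val u (trop_plus (y k) 0) / x k
     else x j)"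

inductive_set seeds :: "('i::finite \<Rightarrow> 'f::field) \<Rightarrow> ('i, 'f) seed \<Rightarrow> ('i, 'f) seed set"
  for u :: "'i \<Rightarrow> 'f" and S0 :: "('i, 'f) seed" where
  initial: "S0 \<in> seeds u S0"
| mutation: "(x, y, B) \<in> seeds u S0 \<Longrightarrow>
     (mutate_x u k B y x, mutate_y k B y, mutate_B k B) \<in> seeds u S0"

text \<open>Principal coefficients: the initial coefficient tuple consists of the generators
  of the tropical semifield.\<close>

definition cluster_variables ::
    "('i::finite \<Rightarrow> 'f::field) \<Rightarrow> ('i \<Rightarrow> 'f) \<Rightarrow> 'i int_mat \<Rightarrow> 'f set" where
  "cluster_variables u x0 B0 =
     {x j | x y B j. (x, y, B) \<in> seeds u (x0, (\<lambda>i. axis i 1), B0)}"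

section \<open>Denominator vectors\<close>

text \<open>Laurent polynomials in the \<open>y\<^sub>i\<close> over the complex numbers (the complexified ground ring), and
  polynomials in the \<open>x\<^sub>i\<close> over that ring.\<close>

type_synonym 'i ground_ring = "'i weight \<Rightarrow>\<^sub>0 complex"
type_synonym 'i cluster_poly = "(nat^'i) \<Rightarrow>\<^sub>0 'i ground_ring"

definition X_var :: "'i::finite \<Rightarrow> 'i cluster_poly" where
  "X_var i = Poly_Mapping.single (axis i 1) 1"

definition ground_val :: "(complex \<Rightarrow> 'f) \<Rightarrow> ('i::finite \<Rightarrow> 'f::field) \<Rightarrow> 'i ground_ring \<Rightarrow> 'f" where
  "ground_val cst y p = (\<Sum>l\<in>Poly_Mapping.keys p. cst (Poly_Mapping.lookup p l) * monomial_val y l)"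

definition cluster_poly_val ::
    "(complex \<Rightarrow> 'f) \<Rightarrow> ('i::finite \<Rightarrow> 'f::field) \<Rightarrow> ('i \<Rightarrow> 'f) \<Rightarrow> 'i cluster_poly \<Rightarrow> 'f" where
  "cluster_poly_val cst y x P =
     (\<Sum>m\<in>Poly_Mapping.keys P. ground_val cst y (Poly_Mapping.lookup P m) * (\<Prod>i\<in>UNIV. x i ^ (m $ i)))"

definition is_denominator_vector ::
    "(complex \<Rightarrow> 'f) \<Rightarrow> ('i::finite \<Rightarrow> 'f::field) \<Rightarrow> ('i \<Rightarrow> 'f) \<Rightarrow> 'f \<Rightarrow> 'i weight \<Rightarrow> bool" where
  "is_denominator_vector cst y x z d \<longleftrightarrow>
     (\<exists>P. (\<forall>i. \<not> X_var i dvd P) \<and> z = cluster_poly_val cst y x P / monomial_val x d)"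

definition denominator_vector ::
    "(complex \<Rightarrow> 'f) \<Rightarrow> ('i::finite \<Rightarrow> 'f::field) \<Rightarrow> ('i \<Rightarrow> 'f) \<Rightarrow> 'f \<Rightarrow> 'i weight" where
  "denominator_vector cst y x z = (THE d. is_denominator_vector cst y x z d)"

end

theory Submission
  imports Defs "HOL-Computational_Algebra.Polynomial_Factorial" "HOL-Computational_Algebra.Field_as_Ring"
    "HOL-Computational_Algebra.Fundamental_Theorem_Algebra"
begin

text \<open>Let \<open>L\<close> be the reduced double cell.  Its points at which no \<open>x\<^bsub>\<omega>\<^sub>i;c\<^esub>\<close> vanishes are parametrized by the values \<open>\<tau>\<^sub>i\<close> of
  \<open>x\<^bsub>\<omega>\<^sub>i;c\<^esub>\<close> and \<open>y\<^sub>i\<close> of \<open>y\<^bsub>i;c\<^esub>\<close>, through an explicit product of a lower unipotent, a torus element and an upper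
  unipotent.  On this chart the identity
  \<open>f\<^sub>k(g) f\<^sub>k(s\<^sup>-\<^sup>1gs) = f\<^sub>k(s\<^sup>-\<^sup>1g) f\<^sub>k(gs) + \<Prod>\<^bsub>i\<noteq>k\<^esub> f\<^sub>i(g)\<^bsup>-a\<^sub>i\<^sub>k\<^esup>\<close> for the principal minors \<open>f\<^sub>i\<close> and \<open>s = s\<^sub>k\<close> becomes a recursion in which
  \<open>x\<^bsub>\<gamma>;c\<^esub> x\<^bsub>c\<gamma>;c\<^esub>\<close>, for \<open>\<gamma> = c\<^sup>p\<omega>\<^sub>k\<close>, is a monomial in the coefficients plus a product of neighbouring
  variables.  Everything is positive for positive \<open>\<tau>\<close> and \<open>y\<close>, so the order of growth as \<open>\<tau>\<^sub>j\<close> tends to \<open>0\<close> obeys the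
  tropical form of the recursion, and \<open>c\<^sup>-\<^sup>1\<gamma> - \<gamma>\<close> solves it because
  \<open>\<omega>\<^sub>k + c\<omega>\<^sub>k = - \<Sum>\<^bsub>i<k\<^esub> a\<^sub>i\<^sub>k c\<omega>\<^sub>i - \<Sum>\<^bsub>i>k\<^esub> a\<^sub>i\<^sub>k \<omega>\<^sub>i\<close>.  On the other hand \<open>x\<^bsub>\<gamma>;c\<^esub>\<close> is regular, so it is a Laurent polynomial in
  each coordinate of the chart, hence in all of them together, and the order of growth is its exponent in the denominator.

  Representation theory is replaced by two devices: the product of the lower unipotents, the torus and the upper unipotents is dense in the group they
  generate, and a minor of an extremal weight is seen to be invariant under a root subgroup by contracting the latter
  with a cocharacter.\<close>


section \<open>Rational functions of one variable\<close>

text \<open>The datum offers no Lie algebra and no modules: a root is a weight with a root subgroup,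
  and N is whatever the x_i(t) generate. Facts of structure theory are therefore forced by limits.
  Root elements x_i(s) and x_{bar j}(t) with i different from j commute, since otherwise a limit of
  conjugates would be a root subgroup of mixed sign. Conjugates of x_j(t) by the SL_2 of i stay in N
  for generic elements of SL_2, and for all of them because N is closed; closedness comes from a
  grading.

  The recursion at c^m omega_k involves neighbours i, and growth orders can be propagated only while
  the chains of these neighbours still descend. They do, because a chain can stop descending only at
  some -omega_l, the lowest weight of its orbit, and this would contradict the descent of the chain
  of k.

  Denominators are claimed in an abstract fraction field, while the computation takes place at
  complex points. The way back needs the chart to reach every point of the cell at which the initial
  cluster variables are nonzero.\<close>

definition loc_rat :: "complex set \<Rightarrow> (complex \<Rightarrow> complex) \<Rightarrow> bool" where
  "loc_rat S f \<longleftrightarrow> (\<forall>t\<in>S. \<exists>p q. poly q t \<noteq> 0 \<and> (\<forall>u\<in>S. poly q u \<noteq> 0 \<longrightarrow> f u = poly p u / poly q u))"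

lemma loc_rat_poly: "loc_rat S (poly p)"
  unfolding loc_rat_def by (intro ballI exI[of _ p] exI[of _ 1]) auto

lemma loc_rat_const: "loc_rat S (\<lambda>t. c)"
  using loc_rat_poly[of S "[:c:]"] by (simp add: loc_rat_def)

lemma loc_rat_id: "loc_rat S (\<lambda>t. t)"
  using loc_rat_poly[of S "[:0,1:]"] by (simp add: loc_rat_def)

lemma loc_rat_add: 
  assumes "loc_rat S f" "loc_rat S g" shows "loc_rat S (\<lambda>t. f t + g t)"
  unfolding loc_rat_def
proof
  fix t assume t: "t \<in> S"
  obtain p q where 1: "poly q t \<noteq> 0" "\<And>u. u\<in>S \<Longrightarrow> poly q u \<noteq> 0 \<Longrightarrow> f u = poly p u / poly q u"
    using assms(1) t unfolding loc_rat_def by metis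
  obtain p' q' where 2: "poly q' t \<noteq> 0" "\<And>u. u\<in>S \<Longrightarrow> poly q' u \<noteq> 0 \<Longrightarrow> g u = poly p' u / poly q' u"
    using assms(2) t unfolding loc_rat_def by metis
  show "\<exists>p q. poly q t \<noteq> 0 \<and> (\<forall>u\<in>S. poly q u \<noteq> 0 \<longrightarrow> f u + g u = poly p u / poly q u)"
    by (rule exI[of _ "p * q' + p' * q"], rule exI[of _ "q * q'"]) (use 1 2 in \<open>auto simp: field_simps\<close>)
qed

lemma loc_rat_mult: 
  assumes "loc_rat S f" "loc_rat S g" shows "loc_rat S (\<lambda>t. f t * g t)"
  unfolding loc_rat_def
proof
  fix t assume t: "t \<in> S"
  obtain p q where 1: "poly q t \<noteq> 0" "\<And>u. u\<in>S \<Longrightarrow> poly q u \<noteq> 0 \<Longrightarrow> f u = poly p u / poly q u"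
    using assms(1) t unfolding loc_rat_def by metis
  obtain p' q' where 2: "poly q' t \<noteq> 0" "\<And>u. u\<in>S \<Longrightarrow> poly q' u \<noteq> 0 \<Longrightarrow> g u = poly p' u / poly q' u"
    using assms(2) t unfolding loc_rat_def by metis
  show "\<exists>p q. poly q t \<noteq> 0 \<and> (\<forall>u\<in>S. poly q u \<noteq> 0 \<longrightarrow> f u * g u = poly p u / poly q u)"
    by (rule exI[of _ "p * p'"], rule exI[of _ "q * q'"]) (use 1 2 in auto)
qed

lemma loc_rat_sum: "(\<And>a. a \<in> A \<Longrightarrow> loc_rat S (f a)) \<Longrightarrow> loc_rat S (\<lambda>t. \<Sum>a\<in>A. f a t)"
  by (induction A rule: infinite_finite_induct) (auto intro: loc_rat_add loc_rat_const)

lemma loc_rat_power: "loc_rat S f \<Longrightarrow> loc_rat S (\<lambda>t. f t ^ n)"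
  by (induction n) (auto intro: loc_rat_mult loc_rat_const)

text \<open>The zero set of the denominator of a rational function shrinks under division, so local
  rationality is preserved when the divisor vanishes nowhere on \<open>S\<close> near the base point.\<close>

lemma loc_rat_divide_local:
  assumes "\<And>t. t \<in> S \<Longrightarrow> \<exists>g h. loc_rat S g \<and> loc_rat S h \<and> h t \<noteq> 0 \<and> (\<forall>u\<in>S. h u \<noteq> 0 \<longrightarrow> f u = g u / h u)"
  shows "loc_rat S f"
  unfolding loc_rat_def
proof
  fix t assume t: "t \<in> S"
  obtain g h where gh: "loc_rat S g" "loc_rat S h" "h t \<noteq> 0" "\<And>u. u\<in>S \<Longrightarrow> h u \<noteq> 0 \<Longrightarrow> f u = g u / h u"
    using assms[OF t] by blast
  obtain p q where 1: "poly q t \<noteq> 0" "\<And>u. u\<in>S \<Longrightarrow> poly q u \<noteq> 0 \<Longrightarrow> g u = poly p u / poly q u"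
    using gh(1) t unfolding loc_rat_def by metis
  obtain p' q' where 2: "poly q' t \<noteq> 0" "\<And>u. u\<in>S \<Longrightarrow> poly q' u \<noteq> 0 \<Longrightarrow> h u = poly p' u / poly q' u"
    using gh(2) t unfolding loc_rat_def by metis
  have p't: "poly p' t \<noteq> 0" using 2 t gh(3) by fastforce
  show "\<exists>p q. poly q t \<noteq> 0 \<and> (\<forall>u\<in>S. poly q u \<noteq> 0 \<longrightarrow> f u = poly p u / poly q u)"
    by (rule exI[of _ "p * q' * q'"], rule exI[of _ "q * p' * q'"]) (use 1 2 p't gh(4) t in auto)
qed

lemma loc_rat_inverse: "loc_rat S f \<Longrightarrow> (\<And>t. t \<in> S \<Longrightarrow> f t \<noteq> 0) \<Longrightarrow> loc_rat S (\<lambda>t. inverse (f t))"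
  by (rule loc_rat_divide_local) (use loc_rat_const in \<open>force simp: divide_simps\<close>)

lemma loc_rat_divide: "loc_rat S g \<Longrightarrow> loc_rat S h \<Longrightarrow> (\<And>t. t \<in> S \<Longrightarrow> h t \<noteq> 0) \<Longrightarrow> loc_rat S (\<lambda>t. g t / h t)"
  unfolding divide_inverse by (intro loc_rat_mult loc_rat_inverse)

lemma loc_rat_powi: "loc_rat S f \<Longrightarrow> (\<And>t. t \<in> S \<Longrightarrow> f t \<noteq> 0) \<Longrightarrow> loc_rat S (\<lambda>t. f t powi n)"
  using loc_rat_power[of S "\<lambda>t. f t" "nat n"] loc_rat_power[OF loc_rat_inverse[of S f], of "nat (- n)"]
  by (cases "n \<ge> 0") (auto simp: power_int_def)

text \<open>Reduce one local representation p0/q0 to lowest terms p/q. Any other local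
  representation p1/q1 agrees with it at all but finitely many points of the infinite set S, so p q1
  = p1 q as polynomials. At a zero of q where q1 does not vanish, p would vanish too, against
  coprimality. Hence p/q is valid on all of S.\<close>

lemma loc_rat_global:
  assumes f: "loc_rat S f" and fin: "finite (- S)"
  shows "\<exists>p q. (\<forall>t\<in>S. poly q t \<noteq> 0 \<and> f t = poly p t / poly q t)"
proof -
  have "infinite S" using fin infinite_UNIV_char_0[where 'a=complex] by (metis finite_Un Compl_partition)
  then obtain t0 where t0: "t0 \<in> S" by fastforce
  obtain p0 q0 where 0: "poly q0 t0 \<noteq> 0" "\<And>u. u\<in>S \<Longrightarrow> poly q0 u \<noteq> 0 \<Longrightarrow> f u = poly p0 u / poly q0 u"
    using f t0 unfolding loc_rat_def by metis
  have q00: "q0 \<noteq> 0" using 0 by auto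
  define p where "p = p0 div gcd p0 q0"
  define q where "q = q0 div gcd p0 q0"
  have pq: "p0 = p * gcd p0 q0" "q0 = q * gcd p0 q0" by (auto simp: p_def q_def)
  have cop: "coprime p q" unfolding p_def q_def using q00 by (intro div_gcd_coprime) auto
  have g0: "gcd p0 q0 \<noteq> 0" using q00 by auto
  have q0': "q \<noteq> 0" using pq q00 by auto
  have key: "poly q t \<noteq> 0 \<and> f t = poly p t / poly q t" if t: "t \<in> S" for t
  proof -
    obtain p1 q1 where 1: "poly q1 t \<noteq> 0" "\<And>u. u\<in>S \<Longrightarrow> poly q1 u \<noteq> 0 \<Longrightarrow> f u = poly p1 u / poly q1 u"
      using f t unfolding loc_rat_def by metis
    have "p * q1 = p1 * q"
    proof (rule ccontr)
      assume "p * q1 \<noteq> p1 * q"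
      hence n: "(p * q1 - p1 * q) * q0 * q1 \<noteq> 0" using q00 1 by auto
      have "finite {u. poly ((p * q1 - p1 * q) * q0 * q1) u = 0}" using poly_roots_finite[OF n] .
      moreover have "S \<subseteq> {u. poly ((p * q1 - p1 * q) * q0 * q1) u = 0}"
      proof
        fix u assume u: "u \<in> S"
        { assume h: "poly q0 u \<noteq> 0" "poly q1 u \<noteq> 0"
          hence qu: "poly q u \<noteq> 0" "poly (gcd p0 q0) u \<noteq> 0" using pq(2) by (metis mult_eq_0_iff poly_mult)+
          have "poly p0 u / poly q0 u = poly p u / poly q u" using pq qu by (metis nonzero_mult_divide_mult_cancel_right poly_mult)
          hence "poly p u / poly q u = poly p1 u / poly q1 u" using 0(2) 1(2) u h by metis
          hence "poly p u * poly q1 u = poly p1 u * poly q u" using qu h by (simp add: field_simps) }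
        thus "u \<in> {u. poly ((p * q1 - p1 * q) * q0 * q1) u = 0}" by auto
      qed
      ultimately show False using \<open>infinite S\<close> finite_subset by blast
    qed
    hence e: "poly p t * poly q1 t = poly p1 t * poly q t" by (metis poly_mult)
    have "poly q t \<noteq> 0"
    proof
      assume z: "poly q t = 0"
      hence "poly p t = 0" using e 1 by auto
      with z cop show False using coprime_poly_0 by blast
    qed
    moreover have "f t = poly p t / poly q t"
      using 1 t e calculation by (metis frac_eq_eq)
    ultimately show ?thesis ..
  qed
  thus ?thesis by blast
qed

lemma poly_no_roots_const: "(\<And>t::complex. poly q t \<noteq> 0) \<Longrightarrow> \<exists>c. q = [:c:] \<and> c \<noteq> 0"
proof -
  assume q: "\<And>t::complex. poly q t \<noteq> 0"
  have "constant (poly q)" using q fundamental_theorem_of_algebra by blast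
  hence "degree q = 0" by (simp add: constant_degree)
  then obtain c where "q = [:c:]" by (rule degree_eq_zeroE)
  thus ?thesis using q by auto
qed

lemma loc_rat_UNIV: assumes "loc_rat UNIV f" shows "\<exists>p. \<forall>t. f t = poly p t"
proof -
  obtain p q where pq: "\<And>t. poly q t \<noteq> 0" "\<And>t. f t = poly p t / poly q t"
    using loc_rat_global[OF assms] by auto
  obtain c where "q = [:c:]" "c \<noteq> 0" using poly_no_roots_const pq(1) by blast
  hence "\<forall>t. f t = poly (smult (1/c) p) t" using pq by auto
  thus ?thesis ..
qed

text \<open>The global denominator can vanish only at 0, so it is a constant times a power of
  t.\<close>

lemma loc_rat_Cstar: assumes "loc_rat (-{0}) f" shows "\<exists>p N. \<forall>t. t \<noteq> 0 \<longrightarrow> f t = poly p t / t ^ N"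
proof -
  obtain p q where pq: "\<And>t. t \<noteq> 0 \<Longrightarrow> poly q t \<noteq> 0" "\<And>t. t \<noteq> 0 \<Longrightarrow> f t = poly p t / poly q t"
    using loc_rat_global[OF assms] by auto
  have q0: "q \<noteq> 0" using pq(1)[of 1] by auto
  obtain r where r: "q = [:-0,1:] ^ Polynomial.order 0 q * r" "\<not> [:-0,1:] dvd r"
    using order_decomp[OF q0, of 0] by auto
  have "poly r t \<noteq> 0" for t
  proof (cases "t = 0")
    case True thus ?thesis using r(2) poly_eq_0_iff_dvd by blast
  next
    case False thus ?thesis using pq(1) r(1) by (metis mult_not_zero poly_mult)
  qed
  then obtain c where c: "r = [:c:]" "c \<noteq> 0" using poly_no_roots_const by blast
  have "poly q t = t ^ Polynomial.order 0 q * c" for t by (subst r(1)) (simp add: c poly_power)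
  hence "\<forall>t. t \<noteq> 0 \<longrightarrow> f t = poly (smult (1/c) p) t / t ^ Polynomial.order 0 q" using pq(2) c by (auto simp: field_simps)
  thus ?thesis by blast
qed

lemma loc_rat_entry_polys:
  assumes "p \<in> entry_polys" "\<And>a b. loc_rat S (\<lambda>t. G t $ a $ b)"
  shows "loc_rat S (\<lambda>t. p (G t))"
  using assms(1) by induction (auto intro: loc_rat_const loc_rat_add loc_rat_mult assms(2))

text \<open>A regular function is a quotient only locally, so along a curve with rational
  coordinates it is at first only locally rational; \<open>loc_rat_global\<close> then makes the
  quotient global.\<close>

lemma loc_rat_regular:
  assumes "regular_on X f" "\<And>a b. loc_rat S (\<lambda>t. G t $ a $ b)" "\<And>t. t \<in> S \<Longrightarrow> G t \<in> X"
  shows "loc_rat S (\<lambda>t. f (G t))"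
proof (rule loc_rat_divide_local)
  fix t assume "t \<in> S"
  then obtain p q where "p\<in>entry_polys" "q\<in>entry_polys" "q (G t) \<noteq> 0" "\<forall>y\<in>X. q y \<noteq> 0 \<longrightarrow> f y = p y / q y"
    using assms(1,3) unfolding regular_on_def by metis
  thus "\<exists>g h. loc_rat S g \<and> loc_rat S h \<and> h t \<noteq> 0 \<and> (\<forall>u\<in>S. h u \<noteq> 0 \<longrightarrow> f (G u) = g u / h u)"
    by (intro exI[of _ "\<lambda>t. p (G t)"] exI[of _ "\<lambda>t. q (G t)"]) (auto intro: loc_rat_entry_polys assms)
qed

lemma loc_rat_matrix_mult:
  assumes "\<And>a b. loc_rat S (\<lambda>t. G t $ a $ b)" "\<And>a b. loc_rat S (\<lambda>t. G' t $ a $ b)"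
  shows "loc_rat S (\<lambda>t. (G t ** G' t) $ a $ b)"
  by (simp add: matrix_matrix_mult_def) (intro loc_rat_sum loc_rat_mult assms)

lemma loc_rat_2x2:
  assumes "loc_rat S a" "loc_rat S b" "loc_rat S c" "loc_rat S d"
  shows "loc_rat S (\<lambda>t. (vector [vector [a t, b t], vector [c t, d t]] :: complex^2^2) $ i $ j)"
proof -
  have "i = 1 \<or> i = 2" "j = 1 \<or> j = 2" using exhaust_2 by blast+
  thus ?thesis using assms by (auto simp: vector_2)
qed


section \<open>Laurent polynomials\<close>

definition laurent1 :: "(complex \<Rightarrow> complex) \<Rightarrow> bool" where
  "laurent1 f \<longleftrightarrow> (\<exists>p N. \<forall>t. t \<noteq> 0 \<longrightarrow> f t = poly p t / t ^ N)"

lemma laurent1_add: "laurent1 f \<Longrightarrow> laurent1 g \<Longrightarrow> laurent1 (\<lambda>t. f t + g t)"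
proof -
  assume "laurent1 f" "laurent1 g"
  then obtain p N q M where 1: "\<And>t. t \<noteq> 0 \<Longrightarrow> f t = poly p t / t ^ N" "\<And>t. t \<noteq> 0 \<Longrightarrow> g t = poly q t / t ^ M"
    unfolding laurent1_def by blast
  have "\<forall>t. t \<noteq> 0 \<longrightarrow> f t + g t = poly (p * monom 1 M + q * monom 1 N) t / t ^ (N + M)"
    by (auto simp: 1 poly_monom add_frac_eq power_add)
  thus ?thesis unfolding laurent1_def by blast
qed

lemma laurent1_cmult: "laurent1 f \<Longrightarrow> laurent1 (\<lambda>t. c * f t)"
  unfolding laurent1_def by (metis poly_smult times_divide_eq_right)

lemma laurent1_sum: "(\<And>a. a \<in> A \<Longrightarrow> laurent1 (f a)) \<Longrightarrow> laurent1 (\<lambda>t. \<Sum>a\<in>A. f a t)"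
proof (induction A rule: infinite_finite_induct)
  case (infinite A) thus ?case by (auto simp: laurent1_def intro!: exI[of _ 0])
next
  case empty thus ?case by (auto simp: laurent1_def intro!: exI[of _ 0])
next
  case (insert x F) thus ?case by (auto intro: laurent1_add)
qed

lemma laurent1_eq_0:
  assumes "laurent1 f" "infinite W" "\<And>w. w \<in> W \<Longrightarrow> w \<noteq> 0 \<and> f w = 0" "t \<noteq> 0"
  shows "f t = 0"
proof -
  obtain p N where p: "\<And>t. t \<noteq> 0 \<Longrightarrow> f t = poly p t / t ^ N" using assms(1) unfolding laurent1_def by blast
  have "poly p w = 0" if "w \<in> W" for w using p[of w] assms(3)[OF that] by simp
  hence "W \<subseteq> {t. poly p t = 0}" by blast
  hence "p = 0" using assms(2) poly_roots_finite finite_subset by blast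
  thus ?thesis using p assms(4) by simp
qed

lemma laurent1_expand:
  assumes "laurent1 f"
  shows "\<exists>K::nat. \<exists>c. \<forall>t. t \<noteq> 0 \<longrightarrow> f t = (\<Sum>k\<in>{-int K..int K}. c k * t powi k)"
proof -
  obtain p N where p: "\<And>t. t \<noteq> 0 \<Longrightarrow> f t = poly p t / t ^ N" using assms(1) unfolding laurent1_def by blast
  define K where "K = degree p + N"
  define c where "c k = (if k + int N \<ge> 0 then coeff p (nat (k + int N)) else 0)" for k :: int
  have "f t = (\<Sum>k\<in>{-int K..int K}. c k * t powi k)" if t: "t \<noteq> 0" for t
  proof -
    have "f t = (\<Sum>i\<le>degree p. coeff p i * t ^ i) / t ^ N" by (simp add: p t poly_altdef)
    also have "\<dots> = (\<Sum>i\<le>degree p. coeff p i * t powi (int i - int N))"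
      by (simp add: sum_divide_distrib power_int_diff t)
    also have "\<dots> = (\<Sum>i\<le>degree p. c (int i - int N) * t powi (int i - int N))" by (simp add: c_def)
    also have "\<dots> = (\<Sum>k\<in>(\<lambda>i. int i - int N) ` {..degree p}. c k * t powi k)"
      by (subst sum.reindex) (auto simp: inj_on_def)
    also have "\<dots> = (\<Sum>k\<in>{-int K..int K}. c k * t powi k)"
    proof (rule sum.mono_neutral_left)
      show "\<forall>i\<in>{- int K..int K} - (\<lambda>i. int i - int N) ` {..degree p}. c i * t powi i = 0"
      proof
        fix k assume k: "k \<in> {- int K..int K} - (\<lambda>i. int i - int N) ` {..degree p}"
        have "c k = 0"
        proof (cases "k + int N \<ge> 0")
          case True
          have "nat (k + int N) > degree p"
          proof (rule ccontr)
            assume "\<not> ?thesis"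
            hence "k \<in> (\<lambda>i. int i - int N) ` {..degree p}" using True by (intro image_eqI[of _ _ "nat (k + int N)"]) auto
            thus False using k by blast
          qed
          thus ?thesis by (simp add: c_def coeff_eq_0)
        qed (simp add: c_def)
        thus "c k * t powi k = 0" by simp
      qed
    qed (auto simp: K_def)
    finally show ?thesis .
  qed
  thus ?thesis by blast
qed

text \<open>Exponent vectors are functions on a whole type. Requiring them to vanish off V makes the
  box finite and gives each exponent vector on V exactly one representative.\<close>

definition exp_box :: "nat \<Rightarrow> 'v set \<Rightarrow> ('v \<Rightarrow> int) set" where
  "exp_box d V = {\<mu>. (\<forall>v\<in>V. \<bar>\<mu> v\<bar> \<le> int d) \<and> (\<forall>v. v \<notin> V \<longrightarrow> \<mu> v = 0)}"

lemma finite_exp_box: assumes "finite V" shows "finite (exp_box d V)"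
proof -
  have "exp_box d V = {f. (\<forall>x. (x \<in> V \<longrightarrow> f x \<in> {-int d..int d}) \<and> (x \<notin> V \<longrightarrow> f x = 0))}"
    by (auto simp: exp_box_def abs_le_iff)
  thus ?thesis using finite_set_of_finite_funs[OF assms, of "{-int d..int d}" 0] by simp
qed

text \<open>The order 2 d + 1 exceeds the largest difference 2 d of two exponents in [-d, d], so
  distinct exponents stay distinct modulo the order.\<close>

definition unity_root :: "nat \<Rightarrow> complex" where
  "unity_root d = cis (2 * pi / real (2 * d + 1))"

text \<open>Discrete Fourier inversion on a grid of roots of unity. What matters is that a
  coefficient is a finite linear combination of values of F, and so depends on any further parameter
  as well as F does.\<close>

definition laurent_coeff :: "nat \<Rightarrow> 'v set \<Rightarrow> (('v \<Rightarrow> complex) \<Rightarrow> complex) \<Rightarrow> ('v \<Rightarrow> int) \<Rightarrow> complex" where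
  "laurent_coeff d V F \<mu> = (\<Sum>g\<in>PiE V (\<lambda>_. {..<2 * d + 1}).
     (\<Prod>v\<in>V. (unity_root d ^ g v) powi (- \<mu> v) / of_nat (2 * d + 1)) * F (\<lambda>v. unity_root d ^ g v))"

lemma unity_root_sum:
  assumes "\<bar>k\<bar> \<le> 2 * int d"
  shows "(\<Sum>l<2 * d + 1. (unity_root d ^ l) powi k / of_nat (2 * d + 1)) = (if k = 0 then 1 else 0)"
proof (cases "k = 0")
  case True thus ?thesis by (simp del: of_nat_Suc of_nat_add)
next
  case False
  define w where "w = unity_root d powi k"
  have w: "w = cis (2 * pi * k / real (2 * d + 1))"
    by (simp add: w_def unity_root_def cis_power_int) (simp add: field_simps)
  have w1: "w \<noteq> 1"
  proof
    assume "w = 1"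
    hence "cos (2 * pi * k / real (2 * d + 1)) = 1" using w by (metis cis.sel(1) one_complex.sel(1))
    then obtain n :: int where "2 * pi * k / real (2 * d + 1) = of_int n * 2 * pi"
      using cos_one_2pi_int by blast
    hence "(2 * pi) * real_of_int k = (2 * pi) * (of_int n * real (2 * d + 1))" by (simp add: field_simps)
    hence "real_of_int k = of_int n * real (2 * d + 1)" by (subst (asm) mult_cancel_left) simp
    hence kn: "k = n * int (2 * d + 1)" by (metis of_int_eq_iff of_int_mult of_int_of_nat_eq)
    hence "n \<noteq> 0" using False by auto
    hence "\<bar>k\<bar> \<ge> int (2 * d + 1)" using kn by (simp add: abs_mult)
    thus False using assms by simp
  qed
  have "w ^ (2 * d + 1) = cis (real (2 * d + 1) * (2 * pi * k / real (2 * d + 1)))" using Complex.DeMoivre[of "2 * pi * k / real (2 * d + 1)" "2 * d + 1"] w by simp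
  also have "real (2 * d + 1) * (2 * pi * k / real (2 * d + 1)) = 2 * pi * real_of_int k" by (simp add: field_simps)
  also have "cis \<dots> = 1" by (rule cis_multiple_2pi) auto
  finally have wn: "w ^ (2 * d + 1) = 1" .
  have "(\<Sum>l<2 * d + 1. (unity_root d ^ l) powi k / of_nat (2 * d + 1)) = (\<Sum>l<2 * d + 1. w ^ l) / of_nat (2 * d + 1)"
  proof -
    have "(unity_root d ^ l) powi k = w ^ l" for l
      by (simp add: w_def power_int_power' power_int_power mult.commute)
    thus ?thesis by (simp only: sum_divide_distrib)
  qed
  also have "(\<Sum>l<2 * d + 1. w ^ l) = 0" using geometric_sum[OF w1, of "2 * d + 1"] wn by (simp only: diff_self div_0)
  finally show ?thesis using False by simp
qed

lemma unity_root_nz: "unity_root d \<noteq> 0" by (simp add: unity_root_def)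

text \<open>Orthogonality of characters (\<open>unity_root_sum\<close>), one factor for each
  variable. At coordinates outside V the grid point takes the value
  \<open>unity_root d ^ undefined\<close>, which is harmless: it is nonzero, and the monomials do
  not see it.\<close>

lemma laurent_coeff_eq:
  assumes "finite V" "\<mu> \<in> exp_box d V"
    and F: "\<And>z. (\<forall>v. z v \<noteq> 0) \<Longrightarrow> F z = (\<Sum>\<nu>\<in>exp_box d V. c \<nu> * (\<Prod>v\<in>V. z v powi \<nu> v))"
  shows "laurent_coeff d V F \<mu> = c \<mu>"
proof -
  let ?P = "PiE V (\<lambda>_. {..<2 * d + 1})"
  have "laurent_coeff d V F \<mu> = (\<Sum>g\<in>?P. \<Sum>\<nu>\<in>exp_box d V. c \<nu> * (\<Prod>v\<in>V. (unity_root d ^ g v) powi (\<nu> v - \<mu> v) / of_nat (2 * d + 1)))"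
    unfolding laurent_coeff_def
  proof (rule sum.cong[OF refl])
    fix g assume "g \<in> ?P"
    have "(\<Prod>v\<in>V. (unity_root d ^ g v) powi (- \<mu> v) / of_nat (2 * d + 1)) * F (\<lambda>v. unity_root d ^ g v)
      = (\<Sum>\<nu>\<in>exp_box d V. c \<nu> * ((\<Prod>v\<in>V. (unity_root d ^ g v) powi (- \<mu> v) / of_nat (2 * d + 1)) * (\<Prod>v\<in>V. (unity_root d ^ g v) powi \<nu> v)))"
      by (subst F) (simp_all add: unity_root_nz sum_distrib_left mult.left_commute)
    also have "\<dots> = (\<Sum>\<nu>\<in>exp_box d V. c \<nu> * (\<Prod>v\<in>V. (unity_root d ^ g v) powi (\<nu> v - \<mu> v) / of_nat (2 * d + 1)))"
      by (simp only: prod.distrib[symmetric]) (simp add: power_int_diff power_int_minus unity_root_nz field_simps)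
    finally show "(\<Prod>v\<in>V. (unity_root d ^ g v) powi (- \<mu> v) / of_nat (2 * d + 1)) * F (\<lambda>v. unity_root d ^ g v) = \<dots>" .
  qed
  also have "\<dots> = (\<Sum>\<nu>\<in>exp_box d V. c \<nu> * (\<Sum>g\<in>?P. \<Prod>v\<in>V. (unity_root d ^ g v) powi (\<nu> v - \<mu> v) / of_nat (2 * d + 1)))"
    by (subst sum.swap) (simp add: sum_distrib_left)
  also have "\<dots> = (\<Sum>\<nu>\<in>exp_box d V. c \<nu> * (\<Prod>v\<in>V. \<Sum>l<2 * d + 1. (unity_root d ^ l) powi (\<nu> v - \<mu> v) / of_nat (2 * d + 1)))"
    using assms(1) by (subst prod_sum_PiE) auto
  also have "\<dots> = (\<Sum>\<nu>\<in>exp_box d V. c \<nu> * (\<Prod>v\<in>V. if \<nu> v - \<mu> v = 0 then 1 else 0))"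
  proof (intro sum.cong refl arg_cong2[of _ _ _ _ times] prod.cong)
    fix \<nu> v assume "\<nu> \<in> exp_box d V" "v \<in> V"
    hence "\<bar>\<nu> v\<bar> \<le> int d" "\<bar>\<mu> v\<bar> \<le> int d" using assms(2) unfolding exp_box_def by blast+
    hence "\<bar>\<nu> v - \<mu> v\<bar> \<le> 2 * int d" by linarith
    from unity_root_sum[OF this] show "(\<Sum>l<2 * d + 1. (unity_root d ^ l) powi (\<nu> v - \<mu> v) / of_nat (2 * d + 1)) = (if \<nu> v - \<mu> v = 0 then 1 else 0)" .
  qed
  also have "\<dots> = (\<Sum>\<nu>\<in>exp_box d V. if \<nu> = \<mu> then c \<nu> else 0)"
  proof (rule sum.cong[OF refl])
    fix \<nu> assume n: "\<nu> \<in> exp_box d V"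
    show "c \<nu> * (\<Prod>v\<in>V. if \<nu> v - \<mu> v = 0 then 1 else 0) = (if \<nu> = \<mu> then c \<nu> else 0)"
    proof (cases "\<nu> = \<mu>")
      case False
      then obtain v where "\<nu> v \<noteq> \<mu> v" by blast
      moreover from this have "v \<in> V" using n assms(2) unfolding exp_box_def by force
      ultimately have "(\<Prod>v\<in>V. if \<nu> v - \<mu> v = 0 then 1 else 0::complex) = 0"
        using assms(1) by (intro prod_zero) auto
      thus ?thesis using False by simp
    qed simp
  qed
  also have "\<dots> = c \<mu>" using assms(2) finite_exp_box[OF assms(1)] by simp
  finally show ?thesis .
qed

lemma exp_box_mono: "d \<le> d' \<Longrightarrow> exp_box d V \<subseteq> exp_box d' V"
  unfolding exp_box_def by fastforce

text \<open>Uncountably many values of the last variable share a degree bound for the others; the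
  coefficients, being finite combinations of values, are then Laurent polynomials in it.\<close>

lemma separately_laurent:
  assumes "finite V"
    and "\<And>v z. v \<in> V \<Longrightarrow> \<forall>w. z w \<noteq> 0 \<Longrightarrow> laurent1 (\<lambda>t. F (z(v := t)))"
    and "\<forall>w. z0 w \<noteq> 0"
  shows "\<exists>d c. \<forall>z. (\<forall>w. z w \<noteq> 0) \<and> (\<forall>w. w \<notin> V \<longrightarrow> z w = z0 w) \<longrightarrow>
    F z = (\<Sum>\<nu>\<in>exp_box d V. c \<nu> * (\<Prod>v\<in>V. z v powi \<nu> v))"
  using assms
proof (induction V arbitrary: z0 rule: finite_induct)
  case empty
  have "exp_box 0 {} = {\<lambda>_. 0}" by (auto simp: exp_box_def)
  moreover have "z = z0" if "\<forall>w. w \<notin> {} \<longrightarrow> z w = z0 w" for z using that by auto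
  ultimately have "\<forall>z. (\<forall>w. z w \<noteq> 0) \<and> (\<forall>w. w \<notin> {} \<longrightarrow> z w = z0 w) \<longrightarrow>
    F z = (\<Sum>\<nu>\<in>exp_box 0 {}. F z0 * (\<Prod>v\<in>{}. z v powi \<nu> v))"
    by (metis (no_types, lifting) empty_iff mult.right_neutral prod.empty sum.empty finite.emptyI sum.insert add.right_neutral)
  thus ?case by (rule exI[of _ 0, OF exI[of _ "\<lambda>_. F z0"]])
next
  case (insert v V)
  let ?rep = "\<lambda>w d c. \<forall>z. (\<forall>x. z x \<noteq> 0) \<and> (\<forall>x. x \<notin> V \<longrightarrow> z x = (z0(v := w)) x) \<longrightarrow>
    F z = (\<Sum>\<nu>\<in>exp_box d V. c \<nu> * (\<Prod>x\<in>V. z x powi \<nu> x))"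
  define R where "R d w \<longleftrightarrow> (\<exists>c. ?rep w d c)" for d w
  have ex: "\<exists>d. R d w" if "w \<noteq> 0" for w
    unfolding R_def using insert.IH[of "z0(v := w)"] insert.prems that by auto
  have "\<exists>d. infinite {w. w \<noteq> 0 \<and> R d w}"
  proof (rule ccontr)
    assume "\<not> ?thesis"
    hence "countable (\<Union>d. {w. w \<noteq> 0 \<and> R d w})"
      by (intro countable_UN) (auto simp: countable_finite)
    moreover have "(\<Union>d. {w. w \<noteq> 0 \<and> R d w}) = UNIV - {0}" using ex by blast
    ultimately have "countable (UNIV :: complex set)" by (metis countable_insert_eq insert_Diff_single insert_UNIV)
    thus False using uncountable_UNIV_complex by blast
  qed
  then obtain d where W: "infinite {w. w \<noteq> 0 \<and> R d w}" by blast
  define W where "W = {w. w \<noteq> 0 \<and> R d w}"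
  define Z where "Z z w = (\<lambda>x. if x \<in> V then z x else (z0(v := w)) x)" for z w
  define C where "C \<mu> w = laurent_coeff d V (\<lambda>z. F (Z z w)) \<mu>" for \<mu> w
  have Znz: "\<forall>x. Z z w x \<noteq> 0" if "\<forall>x. z x \<noteq> 0" "w \<noteq> 0" for z w
    using that insert.prems by (auto simp: Z_def)
  have LZ: "laurent1 (\<lambda>w. F (Z z w))" if "\<forall>x. z x \<noteq> 0" for z
  proof -
    have "(\<lambda>w. F (Z z w)) = (\<lambda>w. F ((Z z 1)(v := w)))"
      using insert.hyps by (intro ext arg_cong[of _ _ F]) (auto simp: Z_def)
    thus ?thesis using insert.prems(1)[OF insertI1, of "Z z 1"] Znz[OF that, of 1] by (simp only: one_neq_zero not_False_eq_True simp_thms)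
  qed
  have C: "laurent1 (C \<mu>)" for \<mu>
    unfolding C_def laurent_coeff_def
    by (intro laurent1_sum laurent1_cmult LZ) (simp add: unity_root_nz)
  have Cexp: "F (Z z w) = (\<Sum>\<nu>\<in>exp_box d V. C \<nu> w * (\<Prod>x\<in>V. z x powi \<nu> x))"
    if z: "\<forall>x. z x \<noteq> 0" and w: "w \<in> W" for z w
  proof -
    obtain c where c: "?rep w d c" and w0: "w \<noteq> 0" using w unfolding W_def R_def by blast
    have rep: "F (Z z w) = (\<Sum>\<nu>\<in>exp_box d V. c \<nu> * (\<Prod>x\<in>V. z x powi \<nu> x))" if "\<forall>x. z x \<noteq> 0" for z
    proof -
      have "F (Z z w) = (\<Sum>\<nu>\<in>exp_box d V. c \<nu> * (\<Prod>x\<in>V. Z z w x powi \<nu> x))"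
        using c Znz[OF that w0] by (auto simp: Z_def)
      thus ?thesis by (simp add: Z_def cong: prod.cong)
    qed
    have "C \<nu> w = c \<nu>" if "\<nu> \<in> exp_box d V" for \<nu>
      unfolding C_def by (rule laurent_coeff_eq[OF insert.hyps(1) that]) (use rep in auto)
    thus ?thesis using rep[OF z] by (simp cong: sum.cong)
  qed
  have Call: "F (Z z w) = (\<Sum>\<nu>\<in>exp_box d V. C \<nu> w * (\<Prod>x\<in>V. z x powi \<nu> x))"
    if z: "\<forall>x. z x \<noteq> 0" and w: "w \<noteq> 0" for z w
  proof -
    \<comment> \<open>Both sides of the expansion are Laurent in w and agree for the infinitely many
      w in W; hence they agree for every nonzero w.\<close>
    have L: "laurent1 (\<lambda>w. F (Z z w) + (-1) * (\<Sum>\<nu>\<in>exp_box d V. (\<Prod>x\<in>V. z x powi \<nu> x) * C \<nu> w))"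
      by (intro laurent1_add laurent1_cmult laurent1_sum C LZ z)
    have "F (Z z w) + (-1) * (\<Sum>\<nu>\<in>exp_box d V. (\<Prod>x\<in>V. z x powi \<nu> x) * C \<nu> w) = 0"
      by (rule laurent1_eq_0[OF L W[folded W_def] _ w]) (use Cexp[OF z] in \<open>auto simp: W_def mult_ac\<close>)
    thus ?thesis by (simp add: mult_ac)
  qed
  have "\<forall>\<mu>. \<exists>K::nat. \<exists>c. \<forall>t. t \<noteq> 0 \<longrightarrow> C \<mu> t = (\<Sum>k\<in>{-int K..int K}. c k * t powi k)"
    using laurent1_expand[OF C] by blast
  then obtain K c where Kc: "\<And>\<mu> t. t \<noteq> 0 \<Longrightarrow> C \<mu> t = (\<Sum>k\<in>{-int (K \<mu>)..int (K \<mu>)}. c \<mu> k * t powi k)"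
    by metis
  \<comment> \<open>The new bound must dominate d at the old variables and every
    \<open>K \<mu>\<close> at v.\<close>
  define M where "M = d + (\<Sum>\<mu>\<in>exp_box d V. K \<mu>)"
  define e where "e \<nu> = (if \<nu>(v := 0) \<in> exp_box d V \<and> \<bar>\<nu> v\<bar> \<le> int (K (\<nu>(v := 0))) then c (\<nu>(v := 0)) (\<nu> v) else 0)" for \<nu>
  show ?case
  proof (intro exI allI impI)
    fix z assume z: "(\<forall>x. z x \<noteq> 0) \<and> (\<forall>x. x \<notin> insert v V \<longrightarrow> z x = z0 x)"
    have zZ: "Z z (z v) = z" using z by (auto simp: Z_def)
    let ?S = "SIGMA \<nu>:exp_box d V. {-int (K \<nu>)..int (K \<nu>)}"
    have "F z = (\<Sum>\<nu>\<in>exp_box d V. (\<Sum>k\<in>{-int (K \<nu>)..int (K \<nu>)}. c \<nu> k * z v powi k) * (\<Prod>x\<in>V. z x powi \<nu> x))"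
      using Call[of z "z v"] z by (simp add: zZ Kc)
    also have "\<dots> = (\<Sum>(\<nu>,k)\<in>?S. c \<nu> k * z v powi k * (\<Prod>x\<in>V. z x powi \<nu> x))"
      using finite_exp_box[OF insert.hyps(1)] by (subst sum.Sigma[symmetric]) (auto simp: sum_distrib_right)
    also have "\<dots> = (\<Sum>\<nu>\<in>(\<lambda>(\<nu>,k). \<nu>(v := k)) ` ?S. e \<nu> * (\<Prod>x\<in>insert v V. z x powi \<nu> x))"
    proof (subst sum.reindex)
      have v0: "\<nu> v = 0" if "\<nu> \<in> exp_box d V" for \<nu> using that insert.hyps by (auto simp: exp_box_def)
      show "inj_on (\<lambda>(\<nu>, k). \<nu>(v := k)) ?S"
        by (rule inj_onI) (use v0 in \<open>auto simp: fun_eq_iff split: if_splits, metis+\<close>)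
      show "(\<Sum>(\<nu>,k)\<in>?S. c \<nu> k * z v powi k * (\<Prod>x\<in>V. z x powi \<nu> x))
        = sum ((\<lambda>\<nu>. e \<nu> * (\<Prod>x\<in>insert v V. z x powi \<nu> x)) \<circ> (\<lambda>(\<nu>, k). \<nu>(v := k))) ?S"
      proof (rule sum.cong[OF refl], clarify, goal_cases)
        case (1 \<nu> k)
        have "\<nu>(v := 0) = \<nu>" using v0[OF 1(1)] by auto
        hence "e (\<nu>(v := k)) = c \<nu> k" using 1 by (auto simp: e_def)
        moreover have "(\<Prod>x\<in>V. z x powi (\<nu>(v := k)) x) = (\<Prod>x\<in>V. z x powi \<nu> x)"
          using insert.hyps by (intro prod.cong) auto
        ultimately show ?case using insert.hyps by simp
      qed
    qed
    also have "\<dots> = (\<Sum>\<nu>\<in>exp_box M (insert v V). e \<nu> * (\<Prod>x\<in>insert v V. z x powi \<nu> x))"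
    proof (rule sum.mono_neutral_left)
      show "finite (exp_box M (insert v V))" using insert.hyps by (simp add: finite_exp_box)
      have KM: "K \<nu> \<le> M" if "\<nu> \<in> exp_box d V" for \<nu>
        unfolding M_def using member_le_sum[OF that, of K] finite_exp_box[OF insert.hyps(1)] by auto
      show "(\<lambda>(\<nu>, k). \<nu>(v := k)) ` ?S \<subseteq> exp_box M (insert v V)"
      proof clarify
        fix \<nu> k assume a: "\<nu> \<in> exp_box d V" "k \<in> {- int (K \<nu>)..int (K \<nu>)}"
        have "\<nu> \<in> exp_box M V" using a exp_box_mono[of d M] by (auto simp: M_def)
        thus "\<nu>(v := k) \<in> exp_box M (insert v V)" using a KM[OF a(1)] by (auto simp: exp_box_def)
      qed
      show "\<forall>\<nu>\<in>exp_box M (insert v V) - (\<lambda>(\<nu>, k). \<nu>(v := k)) ` ?S. e \<nu> * (\<Prod>x\<in>insert v V. z x powi \<nu> x) = 0"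
      proof
        fix \<nu> assume n: "\<nu> \<in> exp_box M (insert v V) - (\<lambda>(\<nu>, k). \<nu>(v := k)) ` ?S"
        have "e \<nu> = 0"
        proof (rule ccontr)
          assume "e \<nu> \<noteq> 0"
          hence "(\<nu>(v := 0), \<nu> v) \<in> ?S" by (auto simp: e_def split: if_splits)
          hence "(\<lambda>(\<nu>, k). \<nu>(v := k)) (\<nu>(v := 0), \<nu> v) \<in> (\<lambda>(\<nu>, k). \<nu>(v := k)) ` ?S" by blast
          thus False using n by simp
        qed
        thus "e \<nu> * (\<Prod>x\<in>insert v V. z x powi \<nu> x) = 0" by simp
      qed
    qed
    finally show "F z = (\<Sum>\<nu>\<in>exp_box M (insert v V). e \<nu> * (\<Prod>x\<in>insert v V. z x powi \<nu> x))" .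
  qed
qed


section \<open>Contracted monoids of unipotent matrices are closed\<close>

lemma matrix_inv_works:
  assumes "invertible (A :: 'a::semiring_1^'n^'n)"
  shows "A ** matrix_inv A = mat 1" "matrix_inv A ** A = mat 1"
  using someI_ex[OF assms[unfolded invertible_def]] unfolding matrix_inv_def by blast+

lemma matrix_inv_unique:
  assumes "(A :: 'a::semiring_1^'n^'n) ** B = mat 1" "B ** A = mat 1"
  shows "matrix_inv A = B"
proof -
  have i: "invertible A" using assms unfolding invertible_def by blast
  have "matrix_inv A = (B ** A) ** matrix_inv A" using assms by (simp add: matrix_mul_lid)
  also have "\<dots> = B ** (A ** matrix_inv A)" by (simp add: matrix_mul_assoc)
  finally show ?thesis using matrix_inv_works[OF i] by (simp add: matrix_mul_rid)
qed

lemma matrix_inv_one: "matrix_inv (mat 1) = (mat 1 :: 'a::semiring_1^'n^'n)"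
  by (rule matrix_inv_unique) (simp_all add: matrix_mul_lid)

lemma tendsto_matrix_mult [tendsto_intros]:
  fixes f g :: "'b \<Rightarrow> complex^'m^'m"
  assumes "(f \<longlongrightarrow> A) F" "(g \<longlongrightarrow> B) F"
  shows "((\<lambda>x. f x ** g x) \<longlongrightarrow> A ** B) F"
proof (intro vec_tendstoI)
  fix i j
  show "((\<lambda>x. (f x ** g x) $ i $ j) \<longlongrightarrow> (A ** B) $ i $ j) F"
    unfolding matrix_matrix_mult_def by (simp, intro tendsto_intros assms)
qed

lemma continuous_on_matrix_mult [continuous_intros]:
  fixes f g :: "'b::topological_space \<Rightarrow> complex^'m^'m"
  assumes "continuous_on S f" "continuous_on S g"
  shows "continuous_on S (\<lambda>x. f x ** g x)"
  using assms unfolding continuous_on_def by (auto intro: tendsto_matrix_mult)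

lemma tendsto_matrix_iff:
  fixes f :: "'b \<Rightarrow> complex^'m^'n"
  shows "(f \<longlongrightarrow> A) F \<longleftrightarrow> (\<forall>a b. ((\<lambda>x. f x $ a $ b) \<longlongrightarrow> A $ a $ b) F)"
proof (intro iffI allI)
  fix a b assume "(f \<longlongrightarrow> A) F"
  thus "((\<lambda>x. f x $ a $ b) \<longlongrightarrow> A $ a $ b) F" by (intro tendsto_vec_nth)
qed (intro vec_tendstoI, blast)

text \<open>In each term of the matrix product the degrees of the two factors add up to at most 0,
  so one of the factors is a Kronecker delta.\<close>

lemma unip_entry_mult:
  fixes g h :: "complex^'m^'m" and e :: "'m \<Rightarrow> int"
  assumes g: "\<And>a b. e a - e b \<le> 0 \<Longrightarrow> g $ a $ b = (if a = b then 1 else 0)"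
    and h: "\<And>a b. e a - e b \<le> 0 \<Longrightarrow> h $ a $ b = (if a = b then 1 else 0)"
    and ab: "e a - e b \<le> 0"
  shows "(g ** h) $ a $ b = (if a = b then 1 else 0)"
proof -
  have "(g ** h) $ a $ b = (\<Sum>c\<in>UNIV. g $ a $ c * h $ c $ b)" by (simp add: matrix_matrix_mult_def)
  also have "\<dots> = (\<Sum>c\<in>UNIV. if c = a then (if a = b then 1 else 0) else 0)"
  proof (rule sum.cong[OF refl])
    fix c
    have "e a - e c \<le> 0 \<or> e c - e b \<le> 0" using ab by linarith
    thus "g $ a $ c * h $ c $ b = (if c = a then (if a = b then 1 else 0) else 0)"
      using ab g[of a c] h[of c b] g[of a a] h[of a b] by (cases "c = a"; cases "c = b") auto
  qed
  finally show ?thesis by simp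
qed

text \<open>The degree of the matrix entry \<open>(a,b)\<close> is \<open>e a - e b\<close>; conjugation by
  \<open>diag(\<tau>\<^sup>e)\<close> multiplies it by \<open>\<tau> powi (e a - e b)\<close>, contracting the entries of positive degree.\<close>

locale contracted_monoid =
  fixes e :: "'m::finite \<Rightarrow> int" and U :: "(complex^'m^'m) set"
  assumes one: "mat 1 \<in> U"
    and mult: "g \<in> U \<Longrightarrow> h \<in> U \<Longrightarrow> g ** h \<in> U"
    and scale0: "g \<in> U \<Longrightarrow> \<tau> \<noteq> 0 \<Longrightarrow> (\<chi> a b. \<tau> powi (e a - e b) * g $ a $ b) \<in> U"
    and unip: "g \<in> U \<Longrightarrow> e a - e b \<le> 0 \<Longrightarrow> g $ a $ b = (if a = b then 1 else 0)"
begin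

text \<open>Conjugation by a diagonal matrix, with the entries of nonpositive degree written as
  constants so that it extends to \<open>\<tau> = 0\<close>, where it gives the identity.\<close>

definition scale :: "complex \<Rightarrow> complex^'m^'m \<Rightarrow> complex^'m^'m" where
  "scale \<tau> g = (\<chi> a b. if e a - e b \<le> 0 then (if a = b then 1 else 0) else \<tau> ^ nat (e a - e b) * g $ a $ b)"

lemma scale_in: assumes "g \<in> U" shows "scale \<tau> g \<in> U"
proof (cases "\<tau> = 0")
  case True
  have "scale \<tau> g = mat 1" using True by (auto simp: scale_def mat_def vec_eq_iff)
  thus ?thesis by (simp add: one)
next
  case False
  have "scale \<tau> g = (\<chi> a b. \<tau> powi (e a - e b) * g $ a $ b)"
    using unip[OF assms] by (auto simp: scale_def vec_eq_iff power_int_def)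
  thus ?thesis using scale0[OF assms False] by simp
qed

lemma unip1: "g \<in> closure U \<Longrightarrow> e a - e b \<le> 0 \<Longrightarrow> g $ a $ b = (if a = b then 1 else 0)"
proof -
  assume g: "g \<in> closure U" and ab: "e a - e b \<le> 0"
  obtain h where h: "\<And>n::nat. h n \<in> U" "h \<longlonglongrightarrow> g" using g unfolding closure_sequential by blast
  have "(\<lambda>n. h n $ a $ b) \<longlonglongrightarrow> g $ a $ b" using h(2) by (intro tendsto_vec_nth)
  moreover have "(\<lambda>n. h n $ a $ b) = (\<lambda>n. if a = b then 1 else 0)" using unip h ab by auto
  ultimately show ?thesis by (simp add: LIMSEQ_const_iff)
qed

text \<open>The filtration of the unitriangular matrices by degree. On \<open>lev d\<close> the
  entries of degree d add up under multiplication (\<open>lead_mult\<close>), which linearises the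
  problem one degree at a time.\<close>

definition lev :: "int \<Rightarrow> (complex^'m^'m) set" where
  "lev d = {g. (\<forall>a b. e a - e b \<le> 0 \<longrightarrow> g $ a $ b = (if a = b then 1 else 0)) \<and>
     (\<forall>a b. 0 < e a - e b \<and> e a - e b < d \<longrightarrow> g $ a $ b = 0)}"

lemma lev_mult_entry:
  assumes "g \<in> lev d" "h \<in> lev d" "0 < e a - e b" "e a - e b \<le> d"
  shows "(g ** h) $ a $ b = g $ a $ b + h $ a $ b"
proof -
  have ab: "a \<noteq> b" using assms(3) by auto
  have "(g ** h) $ a $ b = (\<Sum>c\<in>UNIV. g $ a $ c * h $ c $ b)" by (simp add: matrix_matrix_mult_def)
  also have "\<dots> = (\<Sum>c\<in>UNIV. (if c = a then h $ a $ b else 0) + (if c = b then g $ a $ b else 0))"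
  proof (rule sum.cong[OF refl])
    fix c
    have G: "g $ a $ c = (if a = c then 1 else 0)" if "e a - e c < d" 
      using assms(1) that unfolding lev_def by (cases "e a - e c \<le> 0") auto
    have H: "h $ c $ b = (if c = b then 1 else 0)" if "e c - e b < d" 
      using assms(2) that unfolding lev_def by (cases "e c - e b \<le> 0") auto
    have Gaa: "g $ a $ a = 1" and Hbb: "h $ b $ b = 1" using assms(1,2) unfolding lev_def by auto
    consider "c = a" | "c = b" | "c \<noteq> a" "c \<noteq> b" by blast
    thus "g $ a $ c * h $ c $ b = (if c = a then h $ a $ b else 0) + (if c = b then g $ a $ b else 0)"
    proof cases
      case 3
      have "e a - e c < d \<or> e c - e b < d" using assms(3,4) by linarith
      thus ?thesis using 3 G H by auto
    qed (use ab Gaa Hbb in auto)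
  qed
  also have "\<dots> = g $ a $ b + h $ a $ b" by (simp add: sum.distrib)
  finally show ?thesis .
qed

lemma lev_mult: assumes "g \<in> lev d" "h \<in> lev d" shows "g ** h \<in> lev d"
proof -
  have low: "(g ** h) $ a $ b = (if a = b then 1 else 0)" if "e a - e b \<le> 0" for a b
    by (rule unip_entry_mult[of e g h]) (use assms that in \<open>auto simp: lev_def\<close>)
  moreover have "(g ** h) $ a $ b = 0" if "0 < e a - e b" "e a - e b < d" for a b
    using lev_mult_entry[OF assms that(1)] that assms unfolding lev_def by auto
  ultimately show ?thesis unfolding lev_def by auto
qed

definition lead :: "int \<Rightarrow> complex^'m^'m \<Rightarrow> complex^'m^'m" where
  "lead d g = (\<chi> a b. if e a - e b = d then g $ a $ b else 0)"

lemma lead_mult: "d > 0 \<Longrightarrow> g \<in> lev d \<Longrightarrow> h \<in> lev d \<Longrightarrow> lead d (g ** h) = lead d g + lead d h"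
  by (auto simp: lead_def vec_eq_iff lev_mult_entry)

lemma tendsto_lead: "(f \<longlongrightarrow> g) F \<Longrightarrow> ((\<lambda>x. lead d (f x)) \<longlongrightarrow> lead d g) F"
  unfolding tendsto_matrix_iff by (auto simp: lead_def)

lemma lead_one: "d > 0 \<Longrightarrow> lead d (mat 1) = 0" 
  by (auto simp: lead_def vec_eq_iff mat_def)

lemma one_lev: "mat 1 \<in> lev d" by (auto simp: lev_def mat_def)

lemma scale_lev: "g \<in> lev d \<Longrightarrow> scale \<tau> g \<in> lev d" 
  by (auto simp: lev_def scale_def)

lemma lead_scale: "d > 0 \<Longrightarrow> lead d (scale \<tau> g) = (\<chi> a b. \<tau> ^ nat d * lead d g $ a $ b)"
  by (auto simp: lead_def scale_def vec_eq_iff)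

text \<open>Scaling by \<open>\<tau>\<close> multiplies the part of degree d by the d-th power of
  \<open>\<tau>\<close>. A complex d-th root of \<open>c n\<close> therefore realises any real
  multiple inside U, also a negative one; when \<open>c n\<close> tends to 0 so does the root, and
  the scaled elements tend to the identity.\<close>

lemma small_multiple:
  fixes c :: "nat \<Rightarrow> real"
  assumes d: "d > 0" and g: "g \<in> U \<inter> lev d" and c: "c \<longlonglongrightarrow> 0"
  shows "\<exists>u. (\<forall>n. u n \<in> U \<inter> lev d \<and> lead d (u n) = c n *\<^sub>R lead d g) \<and> u \<longlonglongrightarrow> mat 1"
proof -
  have "\<exists>\<tau>::complex. \<tau> ^ nat d = of_real x \<and> norm \<tau> = root (nat d) \<bar>x\<bar>" for x :: real
  proof -
    define \<tau> where "\<tau> = (if x = 0 then 0 else exp (Ln (of_real x) / of_nat (nat d)))"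
    have t: "\<tau> ^ nat d = of_real x"
      using d by (auto simp: \<tau>_def exp_of_nat_mult[symmetric])
    have "norm \<tau> = root (nat d) (norm \<tau> ^ nat d)" using d by (simp add: real_root_power_cancel)
    also have "norm \<tau> ^ nat d = \<bar>x\<bar>" by (metis t norm_of_real norm_power)
    finally show ?thesis using t by blast
  qed
  then obtain \<tau> :: "real \<Rightarrow> complex" where \<tau>: "\<And>x. \<tau> x ^ nat d = of_real x" "\<And>x. norm (\<tau> x) = root (nat d) \<bar>x\<bar>" by metis
  have "(\<lambda>n. root (nat d) \<bar>c n\<bar>) \<longlonglongrightarrow> root (nat d) \<bar>0\<bar>" by (intro tendsto_intros c)
  hence "(\<lambda>n. norm (\<tau> (c n))) \<longlonglongrightarrow> 0" using \<tau>(2) by simp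
  hence t0: "(\<lambda>n. \<tau> (c n)) \<longlonglongrightarrow> 0" by (rule tendsto_norm_zero_cancel)
  define u where "u n = scale (\<tau> (c n)) g" for n
  have "u \<longlonglongrightarrow> mat 1" unfolding tendsto_matrix_iff
  proof (intro allI)
    fix a b
    show "(\<lambda>n. u n $ a $ b) \<longlonglongrightarrow> mat 1 $ a $ b"
    proof (cases "e a - e b \<le> 0")
      case True thus ?thesis by (simp add: u_def scale_def mat_def)
    next
      case False
      have "(\<lambda>n. \<tau> (c n) ^ nat (e a - e b) * g $ a $ b) \<longlonglongrightarrow> 0 ^ nat (e a - e b) * g $ a $ b"
        by (intro tendsto_intros t0)
      moreover have "a \<noteq> b" using False by auto
      ultimately show ?thesis using False by (simp add: u_def scale_def mat_def power_0_left)
    qed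
  qed
  moreover have "u n \<in> U \<inter> lev d" for n using g by (auto simp: u_def scale_in scale_lev)
  moreover have "lead d (u n) = c n *\<^sub>R lead d g" for n
    unfolding u_def lead_scale[OF d] by (simp add: \<tau> vec_eq_iff) (simp add: scaleR_conv_of_real)
  ultimately show ?thesis by blast
qed

lemma subspace_lead: assumes d: "d > 0" shows "subspace (lead d ` (U \<inter> lev d))"
proof (rule subspaceI)
  show "0 \<in> lead d ` (U \<inter> lev d)" using one one_lev lead_one[OF d] by (intro image_eqI[of _ _ "mat 1"]) auto
  fix x y assume "x \<in> lead d ` (U \<inter> lev d)" "y \<in> lead d ` (U \<inter> lev d)"
  then obtain g h where gh: "g \<in> U" "g \<in> lev d" "x = lead d g" "h \<in> U" "h \<in> lev d" "y = lead d h" by blast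
  show "x + y \<in> lead d ` (U \<inter> lev d)"
    using gh lead_mult[OF d gh(2,5)] mult[OF gh(1,4)] lev_mult[OF gh(2,5)] by (intro image_eqI[of _ _ "g ** h"]) auto
next
  fix r :: real and x assume "x \<in> lead d ` (U \<inter> lev d)"
  then obtain g where g: "g \<in> U \<inter> lev d" "x = lead d g" by blast
  \<comment> \<open>Any null sequence with value r at index 0 serves the purpose.\<close>
  have t: "(\<lambda>n::nat. r / real (Suc n)) \<longlonglongrightarrow> 0" using lim_const_over_n[of r] LIMSEQ_Suc by blast
  obtain u where "\<And>n. u n \<in> U \<inter> lev d \<and> lead d (u n) = (r / real (Suc n)) *\<^sub>R lead d g"
    using small_multiple[OF d g(1) t] by blast
  from this[of 0] have "u 0 \<in> U \<inter> lev d" "r *\<^sub>R x = lead d (u 0)" using g by auto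
  thus "r *\<^sub>R x \<in> lead d ` (U \<inter> lev d)" by blast
qed

text \<open>Multiply lifts of the components in an orthonormal basis, each obtained from
  \<open>small_multiple\<close>. The lifts must tend to the identity so that correcting an
  approximating sequence by them keeps its limit.\<close>

lemma small_section:
  assumes d: "d > 0" and v: "\<And>n. v n \<in> lead d ` (U \<inter> lev d)" "v \<longlonglongrightarrow> 0"
  shows "\<exists>u. (\<forall>n. u n \<in> U \<inter> lev d \<and> lead d (u n) = v n) \<and> u \<longlonglongrightarrow> mat 1"
proof -
  obtain B where B: "B \<subseteq> lead d ` (U \<inter> lev d)" "pairwise orthogonal B" "\<And>x. x \<in> B \<Longrightarrow> norm x = 1"
     "independent B" "span B = lead d ` (U \<inter> lev d)"
    using orthonormal_basis_subspace[OF subspace_lead[OF d]] by metis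
  have finB: "finite B" using B(4) by (rule finiteI_independent)
  have "\<exists>u. (\<forall>n. u n \<in> U \<inter> lev d \<and> lead d (u n) = (\<Sum>b\<in>C. (v n \<bullet> b) *\<^sub>R b)) \<and> u \<longlonglongrightarrow> mat 1"
    if "finite C" "C \<subseteq> B" for C using that
  proof (induction C)
    case empty
    show ?case by (rule exI[of _ "\<lambda>_. mat 1"]) (use one one_lev lead_one[OF d] in auto)
  next
    case (insert b C)
    then obtain u where u: "\<And>n. u n \<in> U \<inter> lev d \<and> lead d (u n) = (\<Sum>b\<in>C. (v n \<bullet> b) *\<^sub>R b)" "u \<longlonglongrightarrow> mat 1" by auto
    obtain g where g: "g \<in> U \<inter> lev d" "b = lead d g" using B(1) insert.prems by blast
    have "(\<lambda>n. v n \<bullet> b) \<longlonglongrightarrow> 0 \<bullet> b" by (intro tendsto_intros v)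
    hence "(\<lambda>n. v n \<bullet> b) \<longlonglongrightarrow> 0" by simp
    from small_multiple[OF d g(1) this] obtain w where w: "\<And>n. w n \<in> U \<inter> lev d \<and> lead d (w n) = (v n \<bullet> b) *\<^sub>R b" "w \<longlonglongrightarrow> mat 1"
      using g(2) by blast
    have "(\<lambda>n. w n ** u n) \<longlonglongrightarrow> mat 1 ** mat 1" by (intro tendsto_intros w u)
    thus ?case using u(1) w(1) insert.hyps
      by (intro exI[of _ "\<lambda>n. w n ** u n"]) (auto simp: lead_mult[OF d] lev_mult mult matrix_mul_rid)
  qed
  from this[OF finB subset_refl] orthonormal_basis_expand[OF B(2) B(3) _ finB] v(1) B(5)
  show ?thesis by simp
qed

text \<open>Let g in \<open>lev d\<close> be a limit of elements of U. The approximants can be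
  corrected, degree by degree, by elements of U tending to the identity until they lie in
  \<open>lev d\<close> too. The leading parts of such elements form a finite-dimensional real
  subspace, which is closed, so the leading part of g is that of an element of U. Hence a general
  limit g can be reduced to the identity by cancelling its leading parts successively, which yields
  an inverse of g in U.\<close>

theorem closed_U: "closed U"
proof -
  have lead_closure: "lead d g \<in> lead d ` (U \<inter> lev d)" if g: "g \<in> closure U" "g \<in> lev d" and d: "d > 0" for g d
  proof -
    have "\<exists>h. (\<forall>n. h n \<in> U \<inter> lev (int k)) \<and> h \<longlonglongrightarrow> g" if "k \<ge> 1" "int k \<le> d" for k using that
    proof (induction k rule: dec_induct)
      case base
      obtain h where "\<And>n::nat. h n \<in> U" "h \<longlonglongrightarrow> g" using g(1) unfolding closure_sequential by blast
      moreover have "h n \<in> lev 1" for n using unip[OF calculation(1)] by (auto simp: lev_def)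
      ultimately show ?case by (intro exI[of _ h]) auto
    next
      case (step k)
      then obtain h where h: "\<And>n. h n \<in> U \<inter> lev (int k)" "h \<longlonglongrightarrow> g" by auto
      have k: "int k > 0" using step by simp
      \<comment> \<open>As k < d, the limit g has no part of degree k. The parts of degree k of the
        approximants thus tend to 0 and can be cancelled by elements tending to the
        identity.\<close>
      have "lead (int k) g = 0" using g(2) step.prems k by (auto simp: lev_def lead_def vec_eq_iff)
      hence "(\<lambda>n. - lead (int k) (h n)) \<longlonglongrightarrow> - 0" using tendsto_lead[OF h(2), of "int k"] by (intro tendsto_intros) simp
      moreover have "- lead (int k) (h n) \<in> lead (int k) ` (U \<inter> lev (int k))" for n
        using subspace_neg[OF subspace_lead[OF k]] h(1) by blast
      ultimately obtain u where u: "\<And>n. u n \<in> U \<inter> lev (int k) \<and> lead (int k) (u n) = - lead (int k) (h n)" "u \<longlonglongrightarrow> mat 1"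
        using small_section[OF k, of "\<lambda>n. - lead (int k) (h n)"] by auto
      have "(\<lambda>n. u n ** h n) \<longlonglongrightarrow> mat 1 ** g" by (intro tendsto_intros u h)
      moreover have "u n ** h n \<in> U \<inter> lev (int (Suc k))" for n
      proof -
        have l: "u n ** h n \<in> lev (int k)" using u h by (auto intro: lev_mult)
        have "lead (int k) (u n ** h n) = 0" using lead_mult[OF k] u(1) h(1) by auto
        hence "(u n ** h n) $ a $ b = 0" if "e a - e b = int k" for a b
          using that by (auto simp: lead_def vec_eq_iff split: if_splits)
        hence "u n ** h n \<in> lev (int (Suc k))" using l unfolding lev_def
          by auto (metis linorder_neqE_linordered_idom not_less zless_add1_eq add.commute)
        thus ?thesis using u h mult by auto
      qed
      ultimately show ?case by (intro exI[of _ "\<lambda>n. u n ** h n"]) (auto simp: matrix_mul_lid)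
    qed
    moreover have "nat d \<ge> 1" "int (nat d) = d" using d by auto
    ultimately obtain h where h: "\<And>n. h n \<in> U \<inter> lev d" "h \<longlonglongrightarrow> g" by (metis order_refl)
    have c: "closed (lead d ` (U \<inter> lev d))" by (rule closed_subspace[OF subspace_lead[OF d]])
    show ?thesis by (rule closed_sequentially[OF c _ tendsto_lead[OF h(2)]]) (use h(1) in blast)
  qed
  have mul_closure: "u ** g \<in> closure U" if uU: "u \<in> U" and gU: "g \<in> closure U" for u g
  proof -
    obtain h where h: "\<And>n::nat. h n \<in> U" "h \<longlonglongrightarrow> g" using gU unfolding closure_sequential by blast
    have "(\<lambda>n. u ** h n) \<longlonglongrightarrow> u ** g" by (intro tendsto_intros h)
    thus ?thesis using h(1) uU mult unfolding closure_sequential by (intro exI[of _ "\<lambda>n. u ** h n"]) auto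
  qed
  have inv_in: "\<exists>w\<in>U. w ** g = mat 1" if g: "g \<in> closure U" for g
  proof -
    have ex: "\<exists>w\<in>U. w ** g \<in> lev (int k)" if "k \<ge> 1" for k using that
    proof (induction k rule: dec_induct)
      case base show ?case using one unip1[OF g] by (intro bexI[of _ "mat 1"]) (auto simp: lev_def matrix_mul_lid)
    next
      case (step k)
      then obtain w where w: "w \<in> U" "w ** g \<in> lev (int k)" by auto
      have k: "int k > 0" using step by simp
      have "lead (int k) (w ** g) \<in> lead (int k) ` (U \<inter> lev (int k))"
        by (rule lead_closure[OF mul_closure[OF w(1) g] w(2) k])
      hence "- lead (int k) (w ** g) \<in> lead (int k) ` (U \<inter> lev (int k))"
        using subspace_neg[OF subspace_lead[OF k]] by blast
      then obtain v where v: "v \<in> U \<inter> lev (int k)" "lead (int k) v = - lead (int k) (w ** g)" by auto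
      have l: "v ** (w ** g) \<in> lev (int k)" using v w by (auto intro: lev_mult)
      have "lead (int k) (v ** (w ** g)) = 0" using lead_mult[OF k] v w by auto
      hence "(v ** (w ** g)) $ a $ b = 0" if "e a - e b = int k" for a b
        using that by (auto simp: lead_def vec_eq_iff split: if_splits)
      hence "v ** (w ** g) \<in> lev (int (Suc k))" using l unfolding lev_def
        by auto (metis linorder_neqE_linordered_idom not_less zless_add1_eq add.commute)
      thus ?case using v w mult by (intro bexI[of _ "v ** w"]) (auto simp: matrix_mul_assoc)
    qed
    \<comment> \<open>K exceeds every degree, so \<open>lev (int K)\<close> contains only the
      identity and the cancellation ends.\<close>
    define K where "K = nat (Max (range (\<lambda>(a,b). e a - e b)) + 1) + 1"
    have "lev (int K) \<subseteq> {mat 1}"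
    proof
      fix g assume "g \<in> lev (int K)"
      moreover have "e a - e b < int K" for a b
      proof -
        have "e a - e b \<le> Max (range (\<lambda>(a,b). e a - e b))" by (intro Max_ge) (auto intro: image_eqI[of _ _ "(a,b)"])
        thus ?thesis by (simp add: K_def)
      qed
      ultimately have "g $ a $ b = (if a = b then 1 else 0)" for a b
        unfolding lev_def by (cases "e a - e b \<le> 0") auto
      thus "g \<in> {mat 1}" by (simp add: vec_eq_iff mat_def)
    qed
    moreover have "K \<ge> 1" by (simp add: K_def)
    ultimately show ?thesis using ex by blast
  qed
  have "g \<in> U" if g: "g \<in> closure U" for g
  proof -
    obtain w where w: "w \<in> U" "w ** g = mat 1" using inv_in[OF g] by blast
    \<comment> \<open>Being in U, w also lies in the closure and has a left inverse in U; that
      inverse must be g.\<close>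
    obtain w' where w': "w' \<in> U" "w' ** w = mat 1" using inv_in w(1) closure_subset by blast
    have "w' = w' ** (w ** g)" using w(2) by (simp add: matrix_mul_rid)
    also have "\<dots> = g" using w'(2) by (simp add: matrix_mul_assoc matrix_mul_lid)
    finally show ?thesis using w'(1) by simp
  qed
  thus ?thesis by (metis closure_subset closure_closed closure_eq subsetI subset_antisym)
qed

end


section \<open>Pinnings\<close>

definition m2 :: "complex \<Rightarrow> complex \<Rightarrow> complex \<Rightarrow> complex \<Rightarrow> complex^2^2" where
  "m2 a b c d = vector [vector [a, b], vector [c, d]]"

lemma m2_nth [simp]: "m2 a b c d $ 1 $ 1 = a" "m2 a b c d $ 1 $ 2 = b" "m2 a b c d $ 2 $ 1 = c" "m2 a b c d $ 2 $ 2 = d"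
  by (auto simp: m2_def vector_2)

lemma m2_eqI: "g $ 1 $ 1 = a \<Longrightarrow> g $ 1 $ 2 = b \<Longrightarrow> g $ 2 $ 1 = c \<Longrightarrow> g $ 2 $ 2 = d \<Longrightarrow> g = m2 a b c d"
  by (simp add: vec_eq_iff forall_2)

lemma m2_mult [simp]: "m2 a b c d ** m2 a' b' c' d' = m2 (a*a' + b*c') (a*b' + b*d') (c*a' + d*c') (c*b' + d*d')"
  by (rule m2_eqI) (simp_all add: matrix_matrix_mult_def sum_2)

lemma m2_one: "mat 1 = m2 1 0 0 1"
  by (rule m2_eqI) (simp_all add: mat_def)

lemma m2_SL2 [simp]: "m2 a b c d \<in> SL2 \<longleftrightarrow> a * d - b * c = 1"
  by (simp add: SL2_def det_2)

lemma SL2_cases: assumes "g \<in> SL2" obtains a b c d where "g = m2 a b c d" "a * d - b * c = 1"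
  using assms m2_eqI[of g] by (metis m2_SL2)

lemma wchar_add: "(\<And>i. fchar D i h \<noteq> 0) \<Longrightarrow> wchar D (\<gamma> + \<delta>) h = wchar D \<gamma> h * wchar D \<delta> h"
  by (simp add: wchar_def power_int_add prod.distrib)

lemma wchar_minus: "wchar D (- \<gamma>) h = inverse (wchar D \<gamma> h)"
  by (simp add: wchar_def power_int_minus prod_inversef[symmetric])

lemma simple_root_nth: "simple_root A j $ i = A $ i $ j"
  by (simp add: simple_root_def fund_weight_def axis_def if_distrib cong: if_cong)

lemma root_comb_nth: "root_comb A d $ l = (\<Sum>i\<in>UNIV. d $ i * A $ l $ i)"
  by (simp add: root_comb_def simple_root_nth)

lemma wchar_smult_root: "wchar D (n *s \<gamma>) h = wchar D \<gamma> h powi n"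
proof -
  have "(\<Prod>i\<in>I. f i) powi n = (\<Prod>i\<in>I. f i powi n)" for f :: "'a \<Rightarrow> complex" and I
    by (induction I rule: infinite_finite_induct) (auto simp: power_int_mult_distrib)
  thus ?thesis by (simp add: wchar_def power_int_mult mult.commute[of n])
qed

definition rot :: "complex^2^2" where "rot = m2 0 (-1) 1 0"
definition rot_inv :: "complex^2^2" where "rot_inv = m2 0 1 (-1) 0"

text \<open>The opposite pinning.  It turns a statement about upper unipotents and right multiplication into one about
  lower unipotents and left multiplication, with \<open>g \<mapsto> f (g\<^sup>-\<^sup>1)\<close> in place of a minor \<open>f\<close>.\<close>

definition swap_datum :: "('i::finite,'m::finite) group_datum \<Rightarrow> ('i,'m) group_datum" where
  "swap_datum D = D\<lparr>emb := (\<lambda>i g. emb D i (rot ** g ** rot_inv)), fchar := (\<lambda>i h. inverse (fchar D i h))\<rparr>"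

lemma swap_simps [simp]:
  "Grp (swap_datum D) = Grp D" "Tor (swap_datum D) = Tor D" "Cartan (swap_datum D) = Cartan D"
  "x_up (swap_datum D) i t = x_low D i (- t)"
  "x_low (swap_datum D) i t = x_up D i (- t)"
  "coroot (swap_datum D) i t = coroot D i (inverse t)"
  "s_bar (swap_datum D) i = s_bar D i"
  "fchar (swap_datum D) i h = inverse (fchar D i h)"
  "wchar (swap_datum D) \<gamma> h = inverse (wchar D \<gamma> h)"
  by (simp_all add: swap_datum_def x_up_def x_low_def coroot_def s_bar_def rot_def rot_inv_def m2_def[symmetric]
      wchar_def power_int_inverse prod_inversef[symmetric])

lemma w_bar_swap: "w_bar (swap_datum D) ws = w_bar D ws"
  by (simp add: w_bar_def)

text \<open>The properties are chosen so that the opposite pinning has them too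
  (\<open>pinning_swap\<close>): each result on upper unipotents then has a mirror image on lower
  ones. For the given group, \<open>commute\<close> is the property that takes real work
  (\<open>up_low_commute\<close>).\<close>

locale pinning =
  fixes D :: "('i::{finite,linorder},'m::finite) group_datum"
  assumes emb_mult: "u \<in> SL2 \<Longrightarrow> v \<in> SL2 \<Longrightarrow> emb D i (u ** v) = emb D i u ** emb D i v"
    and emb_one: "emb D i (mat 1) = mat 1"
    and emb_regular: "regular_on SL2 (\<lambda>g. emb D i g $ a $ b)"
    and Tor_one: "mat 1 \<in> Tor D"
    and Tor_mult: "h \<in> Tor D \<Longrightarrow> h' \<in> Tor D \<Longrightarrow> h ** h' \<in> Tor D"
    and Tor_inv: "h \<in> Tor D \<Longrightarrow> \<exists>h'\<in>Tor D. h ** h' = mat 1 \<and> h' ** h = mat 1"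
    and Tor_diag: "\<exists>(P::complex^'m^'m) (Q::complex^'m^'m). P ** Q = mat 1 \<and> Q ** P = mat 1 \<and> (\<forall>h\<in>Tor D. \<forall>a b. a \<noteq> b \<longrightarrow> (P ** h ** Q) $ a $ b = 0)"
    and coroot_Tor: "t \<noteq> 0 \<Longrightarrow> coroot D i t \<in> Tor D"
    and fchar_nz: "h \<in> Tor D \<Longrightarrow> fchar D i h \<noteq> 0"
    and fchar_mult: "h \<in> Tor D \<Longrightarrow> h' \<in> Tor D \<Longrightarrow> fchar D i (h ** h') = fchar D i h * fchar D i h'"
    and fchar_coroot: "t \<noteq> 0 \<Longrightarrow> fchar D i (coroot D j t) = (if i = j then t else 1)"
    and conj_up: "h \<in> Tor D \<Longrightarrow> h ** x_up D i t = x_up D i (wchar D (simple_root (Cartan D) i) h * t) ** h"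
    and conj_low: "h \<in> Tor D \<Longrightarrow> h ** x_low D i t = x_low D i (wchar D (- simple_root (Cartan D) i) h * t) ** h"
    and nonsing: "inj (root_comb (Cartan D))"
    and commute: "i \<noteq> j \<Longrightarrow> x_up D i s ** x_low D j t = x_low D j t ** x_up D i s"
begin

lemma Tor_cancel: "h \<in> Tor D \<Longrightarrow> matrix_inv h \<in> Tor D" "h \<in> Tor D \<Longrightarrow> h ** matrix_inv h = mat 1"
   "h \<in> Tor D \<Longrightarrow> matrix_inv h ** h = mat 1"
  using Tor_inv matrix_inv_unique by metis+

lemma wchar_nz: "h \<in> Tor D \<Longrightarrow> wchar D \<gamma> h \<noteq> 0"
  by (simp add: wchar_def fchar_nz)

lemma wchar_mult: "h \<in> Tor D \<Longrightarrow> h' \<in> Tor D \<Longrightarrow> wchar D \<gamma> (h ** h') = wchar D \<gamma> h * wchar D \<gamma> h'"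
  by (simp add: wchar_def fchar_mult power_int_mult_distrib prod.distrib)

lemma wchar_one: "wchar D \<gamma> (mat 1) = 1"
  using wchar_mult[OF Tor_one Tor_one, of \<gamma>] wchar_nz[OF Tor_one, of \<gamma>] by (simp add: matrix_mul_lid)

lemma wchar_inv: "h \<in> Tor D \<Longrightarrow> wchar D \<gamma> (matrix_inv h) = inverse (wchar D \<gamma> h)"
  using wchar_mult[of h "matrix_inv h" \<gamma>] Tor_cancel by (metis inverse_unique wchar_one)

lemma wchar_fund: "wchar D (fund_weight i) h = fchar D i h"
proof -
  have "wchar D (fund_weight i) h = (\<Prod>j\<in>UNIV. if j = i then fchar D i h else 1)"
    unfolding wchar_def fund_weight_def axis_def by (intro prod.cong) auto
  thus ?thesis by simp
qed

lemma wchar_coroot: "t \<noteq> 0 \<Longrightarrow> wchar D \<gamma> (coroot D j t) = t powi (\<gamma> $ j)"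
proof -
  assume t: "t \<noteq> 0"
  have "wchar D \<gamma> (coroot D j t) = (\<Prod>i\<in>UNIV. if i = j then t powi (\<gamma> $ j) else 1)"
    unfolding wchar_def fchar_coroot[OF t] by (intro prod.cong) auto
  thus ?thesis by simp
qed

lemma emb_m2: "x_up D i t = emb D i (m2 1 t 0 1)" "x_low D i t = emb D i (m2 1 0 t 1)"
   "coroot D i t = emb D i (m2 t 0 0 (inverse t))" "s_bar D i = emb D i (m2 0 (-1) 1 0)"
  by (auto simp: x_up_def x_low_def coroot_def s_bar_def m2_def)

lemma emb_m2_mult: "a * d - b * c = 1 \<Longrightarrow> a' * d' - b' * c' = 1 \<Longrightarrow>
   emb D i (m2 a b c d) ** emb D i (m2 a' b' c' d') = emb D i (m2 (a*a' + b*c') (a*b' + b*d') (c*a' + d*c') (c*b' + d*d'))"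
  by (subst emb_mult[symmetric]) auto

lemma x_up_0: "x_up D i 0 = mat 1" and x_low_0: "x_low D i 0 = mat 1" and coroot_1: "coroot D i 1 = mat 1"
  by (simp_all add: emb_m2 emb_one flip: m2_one)

lemma x_up_add: "x_up D i s ** x_up D i t = x_up D i (s + t)"
  and x_low_add: "x_low D i s ** x_low D i t = x_low D i (s + t)"
  by (simp_all add: emb_m2 emb_m2_mult add.commute)

lemma coroot_mult: "s \<noteq> 0 \<Longrightarrow> t \<noteq> 0 \<Longrightarrow> coroot D i s ** coroot D i t = coroot D i (s * t)"
  by (simp add: emb_m2 emb_m2_mult)

definition s_inv :: "'i \<Rightarrow> complex^'m^'m" where "s_inv i = emb D i rot_inv"

lemma s_inv_m2: "s_inv i = emb D i (m2 0 1 (-1) 0)" by (simp add: s_inv_def rot_inv_def)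

lemma s_inv: "s_bar D i ** s_inv i = mat 1" "s_inv i ** s_bar D i = mat 1"
  by (simp_all add: emb_m2 s_inv_m2 emb_m2_mult emb_one flip: m2_one)

text \<open>This and the next two lemmas are Gauss decompositions in SL_2. They bring a factor that
  threatens to leave the big cell back into the order lower, torus, upper.\<close>

lemma up_low: "1 + s * t \<noteq> 0 \<Longrightarrow> x_up D i s ** x_low D i t =
    x_low D i (t / (1 + s * t)) ** coroot D i (1 + s * t) ** x_up D i (s / (1 + s * t))"
  by (simp add: emb_m2 emb_m2_mult) (simp add: field_simps)

lemma up_s: "t \<noteq> 0 \<Longrightarrow> x_up D i t ** s_bar D i = x_low D i (1 / t) ** coroot D i t ** x_up D i (- 1 / t)"
  by (simp add: emb_m2 emb_m2_mult) (simp add: field_simps)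

lemma s_low: "t \<noteq> 0 \<Longrightarrow> s_inv i ** x_low D i t = x_low D i (- 1 / t) ** coroot D i t ** x_up D i (1 / t)"
  by (simp add: emb_m2 s_inv_m2 emb_m2_mult) (simp add: field_simps)

lemma s_conj_up: "s_inv i ** x_up D i t ** s_bar D i = x_low D i (- t)" "s_bar D i ** x_up D i t ** s_inv i = x_low D i (- t)"
  and s_conj_low: "s_inv i ** x_low D i t ** s_bar D i = x_up D i (- t)" "s_bar D i ** x_low D i t ** s_inv i = x_up D i (- t)"
  by (simp_all add: emb_m2 s_inv_m2 emb_m2_mult)

lemma s_word: "s_bar D i = x_up D i (-1) ** x_low D i 1 ** x_up D i (-1)"
  and s_inv_word: "s_inv i = x_up D i 1 ** x_low D i (-1) ** x_up D i 1"
  by (simp_all add: emb_m2 s_inv_m2 emb_m2_mult)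

subsection \<open>The torus and the Weyl group\<close>

text \<open>Writing s as a product of three root elements reduces the claim to the known action of h
  on these; what remains is an identity in SL_2.\<close>

lemma tor_s:
  assumes h: "h \<in> Tor D" and a_def: "a = wchar D (simple_root (Cartan D) i) h"
  shows "h ** s_bar D i = coroot D i a ** s_bar D i ** h"
proof -
  have a: "a \<noteq> 0" using wchar_nz[OF h] by (simp add: a_def)
  have "h ** s_bar D i = h ** x_up D i (-1) ** x_low D i 1 ** x_up D i (-1)"
    by (simp add: s_word matrix_mul_assoc)
  also have "h ** x_up D i (-1) = x_up D i (- a) ** h" using conj_up[OF h, of i "-1"] by (simp add: a_def)
  also have "x_up D i (- a) ** h ** x_low D i 1 = x_up D i (- a) ** (x_low D i (1 / a) ** h)"
    using conj_low[OF h, of i 1] by (simp add: a_def wchar_minus inverse_eq_divide flip: matrix_mul_assoc)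
  also have "x_up D i (- a) ** (x_low D i (1 / a) ** h) ** x_up D i (-1) = x_up D i (- a) ** x_low D i (1 / a) ** (h ** x_up D i (-1))"
    by (simp add: matrix_mul_assoc)
  also have "h ** x_up D i (-1) = x_up D i (- a) ** h" using conj_up[OF h, of i "-1"] by (simp add: a_def)
  also have "x_up D i (- a) ** x_low D i (1 / a) ** (x_up D i (- a) ** h) = (x_up D i (- a) ** x_low D i (1 / a) ** x_up D i (- a)) ** h"
    by (simp add: matrix_mul_assoc)
  also have "x_up D i (- a) ** x_low D i (1 / a) ** x_up D i (- a) = coroot D i a ** s_bar D i"
    using a by (simp add: emb_m2 emb_m2_mult inverse_eq_divide)
  finally show ?thesis .
qed

text \<open>This is s^-1 h s, written as a coroot value times h so that it visibly lies in the
  torus.\<close>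

definition stor :: "'i \<Rightarrow> complex^'m^'m \<Rightarrow> complex^'m^'m" where
  "stor i h = coroot D i (inverse (wchar D (simple_root (Cartan D) i) h)) ** h"

lemma stor:
  assumes h: "h \<in> Tor D"
  shows "stor i h \<in> Tor D" "h ** s_bar D i = s_bar D i ** stor i h"
    "wchar D \<gamma> (stor i h) = wchar D (simple_refl (Cartan D) i \<gamma>) h"
proof -
  define a where "a = wchar D (simple_root (Cartan D) i) h"
  have a: "a \<noteq> 0" using wchar_nz[OF h] by (simp add: a_def)
  show t: "stor i h \<in> Tor D" unfolding stor_def using h a by (intro Tor_mult coroot_Tor) (auto simp: a_def)
  have "coroot D i a ** s_bar D i = s_bar D i ** coroot D i (inverse a)"
    using a by (simp add: emb_m2 emb_m2_mult)
  thus "h ** s_bar D i = s_bar D i ** stor i h"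
    using tor_s[OF h refl, of i] by (simp add: stor_def a_def matrix_mul_assoc)
  have "wchar D \<gamma> (stor i h) = inverse a powi (\<gamma> $ i) * wchar D \<gamma> h"
    unfolding stor_def a_def[symmetric] using a h by (subst wchar_mult) (auto simp: wchar_coroot coroot_Tor)
  also have "inverse a powi (\<gamma> $ i) = wchar D (- ((\<gamma> $ i) *s simple_root (Cartan D) i)) h"
    by (simp add: wchar_minus wchar_smult_root a_def power_int_inverse)
  also have "\<dots> * wchar D \<gamma> h = wchar D (simple_refl (Cartan D) i \<gamma>) h"
    using wchar_add[of D h \<gamma> "- ((\<gamma> $ i) *s simple_root (Cartan D) i)"] fchar_nz[OF h]
    by (simp add: simple_refl_def mult.commute)
  finally show "wchar D \<gamma> (stor i h) = wchar D (simple_refl (Cartan D) i \<gamma>) h" .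
qed

lemma w_bar_Nil [simp]: "w_bar D [] = mat 1" and w_bar_Cons: "w_bar D (i # ws) = s_bar D i ** w_bar D ws"
  by (simp_all add: w_bar_def)

lemma w_bar_append: "w_bar D (us @ vs) = w_bar D us ** w_bar D vs"
  by (induction us) (simp_all add: w_bar_Cons matrix_mul_lid matrix_mul_assoc)

lemma tor_w_bar:
  assumes "h \<in> Tor D"
  shows "\<exists>h'\<in>Tor D. h ** w_bar D ws = w_bar D ws ** h' \<and> (\<forall>\<gamma>. wchar D \<gamma> h' = wchar D (word_act (Cartan D) ws \<gamma>) h)"
  using assms
proof (induction ws arbitrary: h)
  case Nil thus ?case by (auto simp: word_act_def matrix_mul_lid matrix_mul_rid)
next
  case (Cons i ws)
  obtain h' where h': "h' \<in> Tor D" "stor i h ** w_bar D ws = w_bar D ws ** h'"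
    "\<And>\<gamma>. wchar D \<gamma> h' = wchar D (word_act (Cartan D) ws \<gamma>) (stor i h)"
    using Cons.IH[OF stor(1)[OF Cons.prems, of i]] by blast
  have "h ** w_bar D (i # ws) = s_bar D i ** (stor i h ** w_bar D ws)"
    by (simp add: w_bar_Cons matrix_mul_assoc stor(2)[OF Cons.prems])
  also have "\<dots> = w_bar D (i # ws) ** h'" by (simp add: h' w_bar_Cons matrix_mul_assoc)
  finally show ?case using h' stor(3)[OF Cons.prems] by (auto simp: word_act_def)
qed

subsection \<open>The group generated by the torus and the root subgroups\<close>

text \<open>The minors are studied on this subgroup, which contains the double cell
  (\<open>LC_GG\<close>). Building it by right multiplication with generators is the form in which
  the density of the big cell is proved by induction (\<open>GG_closure\<close>).\<close>

inductive_set GG :: "(complex^'m^'m) set" where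
  GG_one: "mat 1 \<in> GG"
| GG_up_r: "g \<in> GG \<Longrightarrow> g ** x_up D i t \<in> GG"
| GG_low_r: "g \<in> GG \<Longrightarrow> g ** x_low D i t \<in> GG"
| GG_tor_r: "g \<in> GG \<Longrightarrow> h \<in> Tor D \<Longrightarrow> g ** h \<in> GG"

lemma GG_mult: "g \<in> GG \<Longrightarrow> g' \<in> GG \<Longrightarrow> g ** g' \<in> GG"
  by (rotate_tac 1, induction g' rule: GG.induct) (auto simp: matrix_mul_rid matrix_mul_assoc intro: GG.intros)

lemma GG_up: "x_up D i t \<in> GG" and GG_low: "x_low D i t \<in> GG" and GG_tor: "h \<in> Tor D \<Longrightarrow> h \<in> GG"
  using GG_up_r[OF GG_one, of i t] GG_low_r[OF GG_one, of i t] GG_tor_r[OF GG_one, of h] by (simp_all add: matrix_mul_lid)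

lemma GG_s: "s_bar D i \<in> GG" and GG_s_inv: "s_inv i \<in> GG"
  unfolding s_word s_inv_word by (intro GG_mult GG_up GG_low)+

lemma GG_w: "w_bar D ws \<in> GG"
  by (induction ws) (auto simp: w_bar_Cons GG_one GG_s GG_mult)

lemma GG_inv_ex: "g \<in> GG \<Longrightarrow> \<exists>g'\<in>GG. g ** g' = mat 1 \<and> g' ** g = mat 1"
proof (induction rule: GG.induct)
  case GG_one thus ?case using GG.GG_one by (auto simp: matrix_mul_lid)
next
  case (GG_up_r g i t)
  then obtain g' where g': "g'\<in>GG" "g ** g' = mat 1" "g' ** g = mat 1" by blast
  have u: "x_up D i t ** x_up D i (-t) = mat 1" "x_up D i (-t) ** x_up D i t = mat 1" by (simp_all add: x_up_add x_up_0)
  have "(g ** x_up D i t) ** (x_up D i (-t) ** g') = g ** (x_up D i t ** x_up D i (-t)) ** g'" by (simp add: matrix_mul_assoc)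
  moreover have "(x_up D i (-t) ** g') ** (g ** x_up D i t) = x_up D i (-t) ** (g' ** g) ** x_up D i t" by (simp add: matrix_mul_assoc)
  ultimately show ?case using g' u by (intro bexI[of _ "x_up D i (-t) ** g'"]) (auto simp: matrix_mul_rid GG_mult GG_up)
next
  case (GG_low_r g i t)
  then obtain g' where g': "g'\<in>GG" "g ** g' = mat 1" "g' ** g = mat 1" by blast
  have u: "x_low D i t ** x_low D i (-t) = mat 1" "x_low D i (-t) ** x_low D i t = mat 1" by (simp_all add: x_low_add x_low_0)
  have "(g ** x_low D i t) ** (x_low D i (-t) ** g') = g ** (x_low D i t ** x_low D i (-t)) ** g'" by (simp add: matrix_mul_assoc)
  moreover have "(x_low D i (-t) ** g') ** (g ** x_low D i t) = x_low D i (-t) ** (g' ** g) ** x_low D i t" by (simp add: matrix_mul_assoc)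
  ultimately show ?case using g' u by (intro bexI[of _ "x_low D i (-t) ** g'"]) (auto simp: matrix_mul_rid GG_mult GG_low)
next
  case (GG_tor_r g h)
  then obtain g' where g': "g'\<in>GG" "g ** g' = mat 1" "g' ** g = mat 1" by blast
  obtain h' where h': "h'\<in>Tor D" "h ** h' = mat 1" "h' ** h = mat 1" using Tor_inv GG_tor_r by blast
  have "(g ** h) ** (h' ** g') = g ** (h ** h') ** g'" by (simp add: matrix_mul_assoc)
  moreover have "(h' ** g') ** (g ** h) = h' ** (g' ** g) ** h" by (simp add: matrix_mul_assoc)
  ultimately show ?case using g' h' by (intro bexI[of _ "h' ** g'"]) (auto simp: matrix_mul_rid GG_mult GG_tor)
qed

lemma GG_cancel: assumes "g \<in> GG" 
  shows "matrix_inv g \<in> GG" "g ** matrix_inv g = mat 1" "matrix_inv g ** g = mat 1"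
  using GG_inv_ex[OF assms] matrix_inv_unique by metis+

lemma GG_cancel2: assumes "g \<in> GG" 
  shows "h ** g ** matrix_inv g = h" "h ** matrix_inv g ** g = h" 
  by (simp_all add: GG_cancel[OF assms] matrix_mul_rid flip: matrix_mul_assoc)

lemma GG_inv_mult: "g \<in> GG \<Longrightarrow> h \<in> GG \<Longrightarrow> matrix_inv (g ** h) = matrix_inv h ** matrix_inv g"
  by (rule matrix_inv_unique) (simp_all add: matrix_mul_assoc GG_cancel GG_cancel2)

lemma GG_inv_inv: "g \<in> GG \<Longrightarrow> matrix_inv (matrix_inv g) = g"
  by (rule matrix_inv_unique) (simp_all add: GG_cancel)

lemma s_bar_inv: "matrix_inv (s_bar D i) = s_inv i"
  by (rule matrix_inv_unique) (simp_all add: s_inv)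

lemma x_up_inv: "matrix_inv (x_up D i t) = x_up D i (- t)" and x_low_inv: "matrix_inv (x_low D i t) = x_low D i (- t)"
  by (rule matrix_inv_unique; simp add: x_up_add x_up_0 x_low_add x_low_0)+

subsection \<open>The unipotent subgroups\<close>

text \<open>The index set J is carried along because a lower root element with index outside J
  commutes with everything in \<open>NU J\<close> (\<open>low_NU_commute\<close>). Partial products
  along a Coxeter word, whose letters are distinct, are of this kind.\<close>

inductive_set NU :: "'i set \<Rightarrow> (complex^'m^'m) set" for J where
  NU_one: "mat 1 \<in> NU J"
| NU_up_l: "n \<in> NU J \<Longrightarrow> j \<in> J \<Longrightarrow> x_up D j t ** n \<in> NU J"

lemma NU_mult: "n \<in> NU J \<Longrightarrow> n' \<in> NU J \<Longrightarrow> n ** n' \<in> NU J"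
  by (induction n rule: NU.induct) (auto simp: matrix_mul_lid simp flip: matrix_mul_assoc intro: NU.intros)

lemma NU_up: "j \<in> J \<Longrightarrow> x_up D j t \<in> NU J"
  using NU_up_l[OF NU_one, of j J t] by (simp add: matrix_mul_rid)

lemma NU_GG: "n \<in> NU J \<Longrightarrow> n \<in> GG"
  by (induction n rule: NU.induct) (auto intro: GG_one GG_mult GG_up)

lemma NU_inv: "n \<in> NU J \<Longrightarrow> matrix_inv n \<in> NU J"
proof (induction rule: NU.induct)
  case NU_one
  have "matrix_inv (mat 1) = (mat 1 :: complex^'m^'m)" by (rule matrix_inv_one)
  thus ?case by (simp add: NU.NU_one)
next
  case (NU_up_l n j t)
  thus ?case by (auto simp: GG_inv_mult GG_up NU_GG x_up_inv intro: NU_mult NU_up)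
qed

lemma NU_mono: "n \<in> NU J \<Longrightarrow> J \<subseteq> K \<Longrightarrow> n \<in> NU K"
  by (induction rule: NU.induct) (auto intro: NU.intros)

lemma tor_NU: assumes "n \<in> NU J" "h \<in> Tor D" shows "\<exists>n'\<in>NU J. h ** n = n' ** h" "\<exists>n'\<in>NU J. n ** h = h ** n'"
proof -
  have A: "\<exists>n'\<in>NU J. h ** n = n' ** h" if "h \<in> Tor D" for h using assms(1)
  proof (induction rule: NU.induct)
    case NU_one show ?case by (rule bexI[of _ "mat 1"]) (simp_all add: matrix_mul_lid matrix_mul_rid NU.NU_one)
  next
    case (NU_up_l n j t)
    then obtain n' where n': "n' \<in> NU J" "h ** n = n' ** h" by blast
    have "h ** (x_up D j t ** n) = x_up D j (wchar D (simple_root (Cartan D) j) h * t) ** (h ** n)"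
      by (simp add: matrix_mul_assoc conj_up[OF that])
    also have "\<dots> = (x_up D j (wchar D (simple_root (Cartan D) j) h * t) ** n') ** h" by (simp add: n' matrix_mul_assoc)
    finally show ?case using n' NU_up_l by (auto intro: NU.intros)
  qed
  show "\<exists>n'\<in>NU J. h ** n = n' ** h" by (rule A) fact
  obtain n' where n': "n' \<in> NU J" "matrix_inv h ** n = n' ** matrix_inv h" using A Tor_cancel(1)[OF assms(2)] by blast
  have "n ** h = h ** (matrix_inv h ** n) ** h" using Tor_cancel[OF assms(2)] by (simp add: matrix_mul_assoc matrix_mul_lid)
  also have "\<dots> = h ** n' ** (matrix_inv h ** h)" by (simp add: n' matrix_mul_assoc)
  finally show "\<exists>n'\<in>NU J. n ** h = h ** n'" using n' Tor_cancel[OF assms(2)] by (auto simp: matrix_mul_rid)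
qed

lemma low_NU_commute: "n \<in> NU J \<Longrightarrow> i \<notin> J \<Longrightarrow> x_low D i t ** n = n ** x_low D i t"
proof (induction rule: NU.induct)
  case (NU_up_l n j s)
  have "j \<noteq> i" using NU_up_l by blast
  hence "x_low D i t ** (x_up D j s ** n) = x_up D j s ** (x_low D i t ** n)"
    using commute[of j i s t] by (simp add: matrix_mul_assoc)
  also have "x_low D i t ** n = n ** x_low D i t" using NU_up_l by simp
  finally show ?case by (simp add: matrix_mul_assoc)
qed (simp add: matrix_mul_lid matrix_mul_rid)

end


section \<open>Symmetry between a pinning and its opposite\<close>

lemma rot_conj: "rot ** m2 a b c d ** rot_inv = m2 d (- c) (- b) a"
  by (simp add: rot_def rot_inv_def)

lemma entry_polys_sum: "(\<And>a. a \<in> A \<Longrightarrow> f a \<in> entry_polys) \<Longrightarrow> (\<lambda>g. \<Sum>a\<in>A. f a g) \<in> entry_polys"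
  by (induction A rule: infinite_finite_induct) (auto intro: entry_polys.intros)

lemma entry_polys_compose:
  assumes "p \<in> entry_polys" "\<And>a b. (\<lambda>g. G g $ a $ b) \<in> entry_polys"
  shows "(\<lambda>g. p (G g)) \<in> entry_polys"
  using assms(1) by induction (auto intro: entry_polys.intros assms(2))

lemma regular_on_compose_poly:
  assumes f: "regular_on Y f" and G: "\<And>a b. (\<lambda>g. G g $ a $ b) \<in> entry_polys" "\<And>g. g \<in> X \<Longrightarrow> G g \<in> Y"
  shows "regular_on X (\<lambda>g. f (G g))"
  unfolding regular_on_def
proof
  fix x assume "x \<in> X"
  then obtain p q where pq: "p \<in> entry_polys" "q \<in> entry_polys" "q (G x) \<noteq> 0" "\<forall>y\<in>Y. q y \<noteq> 0 \<longrightarrow> f y = p y / q y"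
    using f G(2) unfolding regular_on_def by metis
  show "\<exists>p\<in>entry_polys. \<exists>q\<in>entry_polys. q x \<noteq> 0 \<and> (\<forall>y\<in>X. q y \<noteq> 0 \<longrightarrow> f (G y) = p y / q y)"
    by (rule bexI[of _ "\<lambda>g. p (G g)"], rule bexI[of _ "\<lambda>g. q (G g)"])
      (use pq G in \<open>auto intro: entry_polys_compose\<close>)
qed

lemma entry_polys_matrix_mult:
  assumes "\<And>a b. (\<lambda>g. G g $ a $ b) \<in> entry_polys" "\<And>a b. (\<lambda>g. H g $ a $ b) \<in> entry_polys"
  shows "(\<lambda>g. (G g ** H g) $ a $ b) \<in> entry_polys"
  by (simp add: matrix_matrix_mult_def) (intro entry_polys_sum entry_polys.mult assms)

lemma pinning_swap: assumes "pinning D" shows "pinning (swap_datum D)"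
proof -
  interpret pinning D by fact
  have rr: "rot_inv ** rot = mat 1" "rot ** rot_inv = mat 1" by (simp_all add: rot_def rot_inv_def m2_one)
  have SL: "rot ** u ** rot_inv \<in> SL2" if "u \<in> SL2" for u
    using that by (elim SL2_cases) (simp add: rot_conj mult.commute)
  show ?thesis
  proof
    fix u v :: "complex^2^2" and i assume uv: "u \<in> SL2" "v \<in> SL2"
    have "rot ** (u ** v) ** rot_inv = rot ** u ** (rot_inv ** rot) ** v ** rot_inv"
      by (simp add: rr matrix_mul_rid matrix_mul_assoc)
    also have "\<dots> = (rot ** u ** rot_inv) ** (rot ** v ** rot_inv)" by (simp add: matrix_mul_assoc)
    finally show "emb (swap_datum D) i (u ** v) = emb (swap_datum D) i u ** emb (swap_datum D) i v"
      using emb_mult SL uv by (simp add: swap_datum_def)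
  next
    fix i show "emb (swap_datum D) i (mat 1) = mat 1"
      by (simp add: swap_datum_def matrix_mul_rid rr emb_one)
  next
    fix i a b
    have "regular_on SL2 (\<lambda>g. emb D i (rot ** g ** rot_inv) $ a $ b)"
      by (rule regular_on_compose_poly[OF emb_regular])
        (auto intro!: entry_polys_matrix_mult SL entry_polys.entry entry_polys.const)
    thus "regular_on SL2 (\<lambda>g. emb (swap_datum D) i g $ a $ b)" by (simp add: swap_datum_def)
  next
    fix h i t assume "h \<in> Tor (swap_datum D)"
    thus "h ** x_up (swap_datum D) i t = x_up (swap_datum D) i (wchar (swap_datum D) (simple_root (Cartan (swap_datum D)) i) h * t) ** h"
      using conj_low[of h i "-t"] by (simp add: wchar_minus)
  next
    fix h i t assume "h \<in> Tor (swap_datum D)"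
    thus "h ** x_low (swap_datum D) i t = x_low (swap_datum D) i (wchar (swap_datum D) (- simple_root (Cartan (swap_datum D)) i) h * t) ** h"
      using conj_up[of h i "-t"] by (simp add: wchar_minus)
  next
    fix i j :: 'a and s t assume "i \<noteq> j"
    thus "x_up (swap_datum D) i s ** x_low (swap_datum D) j t = x_low (swap_datum D) j t ** x_up (swap_datum D) i s"
      using commute[of j i "-t" "-s"] by simp
  qed (use Tor_one Tor_mult Tor_inv Tor_diag coroot_Tor fchar_nz fchar_mult fchar_coroot nonsing in \<open>auto simp: fchar_coroot\<close>)
qed

lemma set_cox_word [simp]: "set (cox_word :: 'a::{finite,linorder} list) = UNIV"
  and distinct_cox_word [simp]: "distinct (cox_word :: 'a list)"
  by (simp_all add: cox_word_def)

section \<open>Rational curves and cocharacters in the group\<close>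

context pinning begin

lemma emb_curve_rat:
  assumes "loc_rat S a" "loc_rat S b" "loc_rat S c" "loc_rat S d" "\<And>t. t \<in> S \<Longrightarrow> a t * d t - b t * c t = 1"
  shows "loc_rat S (\<lambda>t. emb D i (m2 (a t) (b t) (c t) (d t)) $ x $ y)"
  by (rule loc_rat_regular[OF emb_regular]) (use assms loc_rat_2x2[of S a b c d] in \<open>auto simp: m2_def[symmetric]\<close>)

lemma x_up_rat: "loc_rat S f \<Longrightarrow> loc_rat S (\<lambda>t. x_up D i (f t) $ x $ y)"
  and x_low_rat: "loc_rat S f \<Longrightarrow> loc_rat S (\<lambda>t. x_low D i (f t) $ x $ y)"
  unfolding emb_m2 by (rule emb_curve_rat; auto intro: loc_rat_const)+

lemma coroot_rat: "loc_rat S f \<Longrightarrow> (\<And>t. t \<in> S \<Longrightarrow> f t \<noteq> 0) \<Longrightarrow> loc_rat S (\<lambda>t. coroot D i (f t) $ x $ y)"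
  unfolding emb_m2 by (rule emb_curve_rat) (auto intro: loc_rat_const loc_rat_inverse)

lemma x_up_poly: "\<exists>p. \<forall>t. x_up D i t $ x $ y = poly p t"
  and x_low_poly: "\<exists>p. \<forall>t. x_low D i t $ x $ y = poly p t"
  by (rule loc_rat_UNIV, rule x_up_rat[OF loc_rat_id])
     (rule loc_rat_UNIV, rule x_low_rat[OF loc_rat_id])

lemma tendsto_x_up [tendsto_intros]: 
  assumes "(f \<longlongrightarrow> l) F" shows "((\<lambda>x. x_up D i (f x)) \<longlongrightarrow> x_up D i l) F"
  unfolding tendsto_matrix_iff
proof (intro allI)
  fix a b obtain p where "\<And>t. x_up D i t $ a $ b = poly p t" using x_up_poly by blast
  thus "((\<lambda>x. x_up D i (f x) $ a $ b) \<longlongrightarrow> x_up D i l $ a $ b) F" using tendsto_poly[OF assms, of p] by simp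
qed

lemma tendsto_x_low [tendsto_intros]: 
  assumes "(f \<longlongrightarrow> l) F" shows "((\<lambda>x. x_low D i (f x)) \<longlongrightarrow> x_low D i l) F"
  unfolding tendsto_matrix_iff
proof (intro allI)
  fix a b obtain p where "\<And>t. x_low D i t $ a $ b = poly p t" using x_low_poly by blast
  thus "((\<lambda>x. x_low D i (f x) $ a $ b) \<longlongrightarrow> x_low D i l $ a $ b) F" using tendsto_poly[OF assms, of p] by simp
qed

subsection \<open>Cocharacters and gradings\<close>

text \<open>Here k lists the coordinates of a cocharacter in the basis of simple coroots.\<close>

definition pairing :: "'i weight \<Rightarrow> 'i weight \<Rightarrow> int" where
  "pairing k \<gamma> = (\<Sum>j\<in>UNIV. k $ j * \<gamma> $ j)"

lemma pairing_add: "pairing k (\<gamma> + \<delta>) = pairing k \<gamma> + pairing k \<delta>"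
  and pairing_minus: "pairing k (- \<gamma>) = - pairing k \<gamma>"
  and pairing_diff: "pairing k (\<gamma> - \<delta>) = pairing k \<gamma> - pairing k \<delta>"
  and pairing_smult: "pairing k (c *s \<gamma>) = c * pairing k \<gamma>"
  by (simp_all add: pairing_def sum.distrib algebra_simps sum_negf sum_subtractf sum_distrib_left)

lemma pairing_sum: "pairing k (\<Sum>x\<in>S. f x) = (\<Sum>x\<in>S. pairing k (f x))"
  by (induction S rule: infinite_finite_induct) (auto simp: pairing_add pairing_def[of k 0])

definition cochar :: "'i weight \<Rightarrow> complex \<Rightarrow> complex^'m^'m" where
  "cochar k \<tau> = foldr (\<lambda>j g. coroot D j (\<tau> powi (k $ j)) ** g) cox_word (mat 1)"

lemma foldr_coroot_Tor:
  assumes "\<And>j. j \<in> set ws \<Longrightarrow> f j \<noteq> 0"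
  shows "foldr (\<lambda>j g. coroot D j (f j) ** g) ws (mat 1) \<in> Tor D"
  using assms by (induction ws) (auto intro: Tor_one Tor_mult coroot_Tor)

lemma wchar_foldr_coroot:
  assumes "\<And>j. j \<in> set ws \<Longrightarrow> f j \<noteq> 0"
  shows "wchar D \<gamma> (foldr (\<lambda>j g. coroot D j (f j) ** g) ws (mat 1)) = (\<Prod>j\<leftarrow>ws. f j powi (\<gamma> $ j))"
  using assms by (induction ws) (auto simp: wchar_one wchar_mult coroot_Tor foldr_coroot_Tor wchar_coroot)

lemma cochar_Tor: "\<tau> \<noteq> 0 \<Longrightarrow> cochar k \<tau> \<in> Tor D"
  unfolding cochar_def by (rule foldr_coroot_Tor) auto

lemma prod_powi_sum: "finite S \<Longrightarrow> (x::complex) \<noteq> 0 \<Longrightarrow> (\<Prod>j\<in>S. x powi (f j)) = x powi (\<Sum>j\<in>S. f j)"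
  by (induction S rule: finite_induct) (auto simp: power_int_add)

lemma wchar_cochar: "\<tau> \<noteq> 0 \<Longrightarrow> wchar D \<gamma> (cochar k \<tau>) = \<tau> powi pairing k \<gamma>"
  unfolding cochar_def pairing_def
  by (subst wchar_foldr_coroot) (auto simp: prod_powi_sum power_int_mult prod.distinct_set_conv_list[symmetric] simp flip: power_int_mult)

text \<open>Injectivity of \<open>root_comb\<close> on integer vectors makes the Cartan matrix
  invertible over the rationals. A row of the inverse, cleared of denominators, is a positive
  multiple of a fundamental coweight. The multiple d is there because the coweight itself need not
  lie in the coroot lattice.\<close>

lemma fund_coweight_ex: "\<exists>k. \<exists>d>0. \<forall>l. pairing k (simple_root (Cartan D) l) = (if l = i then d else 0)"
proof -
  define M :: "((rat,'i) vec,'i) vec" where "M = (\<chi> a b. of_int (Cartan D $ a $ b))"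
  have common: "\<exists>d>0. \<forall>l. \<exists>z::int. of_int d * (v $ l) = of_int z" for v :: "(rat,'i) vec"
  proof -
    have "\<exists>d>0. \<forall>l\<in>S. \<exists>z::int. of_int d * (v $ l) = of_int z" if "finite S" for S using that
    proof induction
      case (insert x S)
      then obtain d where d: "d > 0" "\<And>l. l \<in> S \<Longrightarrow> \<exists>z::int. of_int d * (v $ l) = of_int z" by blast
      obtain a b where ab: "quotient_of (v $ x) = (a, b)" by fastforce
      have b: "b > 0" "v $ x = of_int a / of_int b" using quotient_of_denom_pos[OF ab] quotient_of_div[OF ab] by auto
      have "\<exists>z::int. of_int (d * b) * (v $ l) = of_int z" if "l \<in> insert x S" for l
      proof (cases "l = x")
        case True thus ?thesis using b by (intro exI[of _ "d * a"]) simp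
      next
        case False
        then obtain z where "of_int d * (v $ l) = of_int z" using d(2) \<open>l \<in> insert x S\<close> by blast
        thus ?thesis by (intro exI[of _ "b * z"]) (simp add: mult_ac)
      qed
      thus ?case using d(1) b(1) by (intro exI[of _ "d * b"]) auto
    qed (auto intro: exI[of _ 1])
    thus ?thesis using finite[of UNIV] by (metis UNIV_I)
  qed
  have "v = 0" if "M *v v = 0" for v
  proof -
    obtain d where d: "d > 0" "\<forall>l. \<exists>z::int. of_int d * (v $ l) = of_int z" using common by blast
    then obtain z :: "'i \<Rightarrow> int" where z: "\<And>l. of_int d * (v $ l) = of_int (z l)" by metis
    define w :: "'i weight" where "w = (\<chi> l. z l)"
    have "root_comb (Cartan D) w $ l = 0" for l
    proof -
      have "(of_int (root_comb (Cartan D) w $ l) :: rat) = (\<Sum>i\<in>UNIV. of_int (z i) * of_int (Cartan D $ l $ i))"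
        by (simp add: root_comb_nth w_def)
      also have "\<dots> = of_int d * ((M *v v) $ l)"
        by (simp add: z[symmetric] matrix_vector_mult_def M_def sum_distrib_left mult_ac)
      finally show ?thesis using that by simp
    qed
    hence "root_comb (Cartan D) w = root_comb (Cartan D) 0" by (simp add: vec_eq_iff root_comb_nth)
    hence "w = 0" using nonsing by (meson injD)
    hence "of_int d * (v $ l) = 0" for l using z by (simp add: w_def vec_eq_iff)
    thus ?thesis using d(1) by (simp add: vec_eq_iff)
  qed
  hence "\<exists>B. B ** M = mat 1" unfolding matrix_left_invertible_ker by simp
  then obtain B where B: "B ** M = mat 1" ..
  obtain d where d: "d > 0" "\<forall>l. \<exists>z::int. of_int d * (B $ i $ l) = of_int z" using common by blast
  then obtain z :: "'i \<Rightarrow> int" where z: "\<And>l. of_int d * (B $ i $ l) = of_int (z l)" by metis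
  have "pairing (\<chi> l. z l) (simple_root (Cartan D) l) = (if l = i then d else 0)" for l
  proof -
    have "(of_int (pairing (\<chi> l. z l) (simple_root (Cartan D) l)) :: rat) = (\<Sum>j\<in>UNIV. of_int (z j) * of_int (Cartan D $ j $ l))"
      by (simp add: pairing_def simple_root_nth)
    also have "\<dots> = of_int d * ((B ** M) $ i $ l)"
      by (simp add: z[symmetric] matrix_matrix_mult_def M_def sum_distrib_left mult_ac)
    also have "\<dots> = of_int (if l = i then d else 0)" by (simp add: B mat_def)
    finally show ?thesis by linarith
  qed
  thus ?thesis using d(1) by blast
qed

definition fcw :: "'i \<Rightarrow> 'i weight" where
  "fcw i = (SOME k. \<exists>d>0. \<forall>l. pairing k (simple_root (Cartan D) l) = (if l = i then d else 0))"

definition fcd :: "'i \<Rightarrow> int" where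
  "fcd i = pairing (fcw i) (simple_root (Cartan D) i)"

lemma fcw: "fcd i > 0" "pairing (fcw i) (simple_root (Cartan D) l) = (if l = i then fcd i else 0)"
  using someI_ex[OF fund_coweight_ex[of i]] unfolding fcw_def[symmetric] fcd_def by auto

lemma pairing_fcw_root_comb: "pairing (fcw i) (root_comb (Cartan D) q) = fcd i * q $ i"
  by (simp add: root_comb_def pairing_sum pairing_smult fcw if_distrib cong: if_cong)

text \<open>A coweight that is positive on every simple root, so that it contracts all of N to the
  identity.\<close>

definition pos_cow :: "'i weight" where "pos_cow = (\<Sum>i\<in>UNIV. fcw i)"

lemma pairing_pos_cow: "pairing pos_cow (simple_root (Cartan D) l) = fcd l"
proof -
  have "pairing pos_cow \<gamma> = (\<Sum>i\<in>UNIV. pairing (fcw i) \<gamma>)" for \<gamma>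
    by (simp add: pairing_def pos_cow_def sum_distrib_right) (rule sum.swap)
  thus ?thesis by (simp add: fcw)
qed

lemma cochar_up: "\<tau> \<noteq> 0 \<Longrightarrow> cochar k \<tau> ** x_up D i t = x_up D i (\<tau> powi pairing k (simple_root (Cartan D) i) * t) ** cochar k \<tau>"
  by (simp add: conj_up[OF cochar_Tor] wchar_cochar)

text \<open>A diagonal entry of a coroot is a Laurent polynomial ch with ch(s t) = ch(s) ch(t).
  Comparing the coefficients of t^k on both sides, for some k whose coefficient does not vanish,
  gives ch(s) = s^k.\<close>

lemma Tor_diag_exponents:
  "\<exists>(P::complex^'m^'m) (Q::complex^'m^'m) e. P ** Q = mat 1 \<and> Q ** P = mat 1 \<and> (\<forall>h\<in>Tor D. \<forall>a b. a \<noteq> b \<longrightarrow> (P ** h ** Q) $ a $ b = 0) \<and>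
     (\<forall>j a t. t \<noteq> 0 \<longrightarrow> (P ** coroot D j t ** Q) $ a $ a = t powi (e j a))"
proof -
  obtain P Q :: "complex^'m^'m" where PQ: "P ** Q = mat 1" "Q ** P = mat 1" "\<forall>h\<in>Tor D. \<forall>a b. a \<noteq> b \<longrightarrow> (P ** h ** Q) $ a $ b = 0"
    using Tor_diag by (elim exE conjE)
  have "\<exists>k::int. \<forall>t. t \<noteq> 0 \<longrightarrow> (P ** coroot D j t ** Q) $ a $ a = t powi k" for j a
  proof -
    define ch where "ch t = (P ** coroot D j t ** Q) $ a $ a" for t
    have mult: "ch (s * t) = ch s * ch t" if "s \<noteq> 0" "t \<noteq> 0" for s t
    proof -
      have "P ** coroot D j (s * t) ** Q = P ** coroot D j s ** (Q ** P) ** coroot D j t ** Q"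
        using that by (simp add: PQ matrix_mul_rid flip: coroot_mult) (simp add: matrix_mul_assoc)
      also have "\<dots> = (P ** coroot D j s ** Q) ** (P ** coroot D j t ** Q)" by (simp add: matrix_mul_assoc)
      finally have "ch (s * t) = (\<Sum>c\<in>UNIV. (P ** coroot D j s ** Q) $ a $ c * (P ** coroot D j t ** Q) $ c $ a)"
        by (simp add: ch_def matrix_matrix_mult_def)
      also have "\<dots> = (\<Sum>c\<in>UNIV. if c = a then ch s * ch t else 0)"
        using PQ(3) coroot_Tor that by (intro sum.cong) (auto simp: ch_def)
      finally show ?thesis by simp
    qed
    have one: "ch 1 = 1" by (simp add: ch_def coroot_1 PQ matrix_mul_rid) (simp add: mat_def)
    have "loc_rat (-{0}) ch" unfolding ch_def
      by (intro loc_rat_matrix_mult loc_rat_const coroot_rat loc_rat_id) auto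
    hence "laurent1 ch" using loc_rat_Cstar unfolding laurent1_def by blast
    then obtain K c where c: "\<And>t. t \<noteq> 0 \<Longrightarrow> ch t = (\<Sum>k\<in>{-int K..int K}. c k * t powi k)"
      using laurent1_expand by metis
    have "\<exists>k\<in>{-int K..int K}. c k \<noteq> 0" using c[of 1] one by (metis (no_types, lifting) mult_zero_left sum.neutral zero_neq_one)
    then obtain k where k: "k \<in> {-int K..int K}" "c k \<noteq> 0" by blast
    \<comment> \<open>Uniqueness of Laurent coefficients is taken from the case of several
      variables, with \<open>unit\<close> indexing the single one.\<close>
    have rep: "laurent_coeff K {()} F (\<lambda>_. k) = c' k" if "\<And>t. t \<noteq> 0 \<Longrightarrow> F (\<lambda>_. t) = (\<Sum>k\<in>{-int K..int K}. c' k * t powi k)" for F and c' :: "int \<Rightarrow> complex"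
    proof (rule laurent_coeff_eq[of "{()}" "\<lambda>_. k" K F "\<lambda>\<nu>. c' (\<nu> ())"])
      show "(\<lambda>_. k) \<in> exp_box K {()}" using k by (auto simp: exp_box_def)
      fix z :: "unit \<Rightarrow> complex" assume z: "\<forall>v. z v \<noteq> 0"
      have "F z = F (\<lambda>_. z ())" by (metis (full_types) old.unit.exhaust)
      also have "\<dots> = (\<Sum>k\<in>{-int K..int K}. c' k * z () powi k)" by (rule that) (rule spec[OF z])
      also have "\<dots> = (\<Sum>\<nu>\<in>exp_box K {()}. c' (\<nu> ()) * z () powi \<nu> ())"
        by (rule sum.reindex_bij_witness[of _ "\<lambda>\<nu>. \<nu> ()" "\<lambda>k _. k"]) (auto simp: exp_box_def)
      finally show "F z = (\<Sum>\<nu>\<in>exp_box K {()}. c' (\<nu> ()) * (\<Prod>v\<in>{()}. z v powi \<nu> v))" by simp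
    qed simp
    have "ch s = s powi k" if s: "s \<noteq> 0" for s
    proof -
      let ?F = "\<lambda>z::unit \<Rightarrow> complex. ch (s * z ())"
      have "laurent_coeff K {()} ?F (\<lambda>_. k) = c k * s powi k"
        by (rule rep[of ?F "\<lambda>k. c k * s powi k"]) (simp add: c s power_int_mult_distrib mult_ac)
      moreover have "laurent_coeff K {()} ?F (\<lambda>_. k) = ch s * c k"
      proof (rule rep[of ?F "\<lambda>k. ch s * c k"])
        fix t :: complex assume t: "t \<noteq> 0"
        show "ch (s * t) = (\<Sum>k\<in>{-int K..int K}. ch s * c k * t powi k)"
          unfolding mult[OF s t] c[OF t] sum_distrib_left mult.assoc ..
      qed
      ultimately show ?thesis using k by simp
    qed
    thus ?thesis unfolding ch_def by blast
  qed
  then obtain e where "\<forall>j a t. t \<noteq> 0 \<longrightarrow> (P ** coroot D j t ** Q) $ a $ a = t powi (e j a)" by metis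
  thus ?thesis using PQ by blast
qed

end


section \<open>Unipotent subgroups\<close>

lemma diag_mult:
  "(\<chi> a b. if a = b then f a else 0) ** (\<chi> a b. if a = b then g a else 0)
    = (\<chi> a b. if a = b then f a * g a else (0::complex))"
proof -
  have "(\<Sum>c\<in>UNIV. (if a = c then f a else 0) * (if c = b then g c else 0)) = (if a = b then f a * g a else 0)" for a b
  proof -
    have "(\<Sum>c\<in>UNIV. (if a = c then f a else 0) * (if c = b then g c else 0))
      = (\<Sum>c\<in>UNIV. if c = a then (if a = b then f a * g a else 0) else 0)" by (intro sum.cong) auto
    thus ?thesis by simp
  qed
  thus ?thesis by (simp add: vec_eq_iff matrix_matrix_mult_def)
qed

lemma diag_mult_left: "((\<chi> a b. if a = b then f a else (0::complex)) ** M) $ a $ b = f a * M $ a $ b"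
  and diag_mult_right: "(M ** (\<chi> a b. if a = b then f a else (0::complex))) $ a $ b = M $ a $ b * f b"
proof -
  have "(\<Sum>c\<in>UNIV. (if a = c then f a else 0) * M $ c $ b) = (\<Sum>c\<in>UNIV. if c = a then f a * M $ a $ b else 0)"
    by (intro sum.cong) auto
  thus "((\<chi> a b. if a = b then f a else (0::complex)) ** M) $ a $ b = f a * M $ a $ b"
    by (simp add: matrix_matrix_mult_def)
  have "(\<Sum>c\<in>UNIV. M $ a $ c * (if c = b then f c else 0)) = (\<Sum>c\<in>UNIV. if c = b then M $ a $ b * f b else 0)"
    by (intro sum.cong) auto
  thus "(M ** (\<chi> a b. if a = b then f a else (0::complex))) $ a $ b = M $ a $ b * f b"
    by (simp add: matrix_matrix_mult_def)
qed

context pinning begin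

definition diagonalizes :: "complex^'m^'m \<Rightarrow> complex^'m^'m \<Rightarrow> ('i \<Rightarrow> 'm \<Rightarrow> int) \<Rightarrow> bool" where
  "diagonalizes P Q e \<longleftrightarrow> P ** Q = mat 1 \<and> Q ** P = mat 1 \<and>
     (\<forall>h\<in>Tor D. \<forall>a b. a \<noteq> b \<longrightarrow> (P ** h ** Q) $ a $ b = 0) \<and>
     (\<forall>j a t. t \<noteq> 0 \<longrightarrow> (P ** coroot D j t ** Q) $ a $ a = t powi (e j a))"

text \<open>The weight of the a-th diagonalising coordinate under \<open>pos_cow\<close>. This is
  the grading handed to \<open>contracted_monoid\<close>.\<close>

definition deg :: "('i \<Rightarrow> 'm \<Rightarrow> int) \<Rightarrow> 'm \<Rightarrow> int" where
  "deg e a = (\<Sum>j\<in>UNIV. pos_cow $ j * e j a)"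

lemma cochar_diag:
  assumes d: "diagonalizes P Q e" and t: "\<tau> \<noteq> 0"
  shows "P ** cochar pos_cow \<tau> ** Q = (\<chi> a b. if a = b then \<tau> powi deg e a else 0)"
proof -
  let ?c = "\<lambda>ws. foldr (\<lambda>j g. coroot D j (\<tau> powi (pos_cow $ j)) ** g) ws (mat 1)"
  have "P ** ?c ws ** Q = (\<chi> a b. if a = b then \<tau> powi (\<Sum>j\<leftarrow>ws. pos_cow $ j * e j a) else 0)" for ws
  proof (induction ws)
    case Nil
    have "P ** Q = mat 1" using d by (simp add: diagonalizes_def)
    thus ?case by (simp add: matrix_mul_rid) (simp add: vec_eq_iff mat_def)
  next
    case (Cons j ws)
    let ?h = "coroot D j (\<tau> powi (pos_cow $ j))"
    have h: "?h \<in> Tor D" using t by (intro coroot_Tor) simp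
    have A: "(P ** ?h ** Q) $ a $ b = (if a = b then \<tau> powi (pos_cow $ j * e j a) else 0)" for a b
      using d t h unfolding diagonalizes_def by (auto simp: power_int_mult)
    have "P ** ?c (j # ws) ** Q = P ** ?h ** (Q ** P) ** ?c ws ** Q"
      using d by (simp add: diagonalizes_def matrix_mul_assoc matrix_mul_rid)
    also have "\<dots> = (P ** ?h ** Q) ** (P ** ?c ws ** Q)" by (simp add: matrix_mul_assoc)
    also have "\<dots> = (\<chi> a b. if a = b then \<tau> powi (\<Sum>j\<leftarrow>j # ws. pos_cow $ j * e j a) else 0)"
    proof -
      have "P ** ?h ** Q = (\<chi> a b. if a = b then \<tau> powi (pos_cow $ j * e j a) else 0)" by (simp add: vec_eq_iff A)
      hence "(P ** ?h ** Q) ** (P ** ?c ws ** Q) = (\<chi> a b. if a = b then \<tau> powi (pos_cow $ j * e j a) * \<tau> powi (\<Sum>j\<leftarrow>ws. pos_cow $ j * e j a) else 0)"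
        unfolding Cons.IH by (simp only: diag_mult)
      from this show ?thesis unfolding \<open>(P ** ?h ** Q) ** (P ** ?c ws ** Q) = _\<close> vec_eq_iff using t by (simp add: power_int_add)
    qed
    finally show ?case .
  qed
  thus ?thesis unfolding cochar_def deg_def by (simp add: sum_list_distinct_conv_sum_set cong: if_cong)
qed

lemma graded_conj_entry:
  assumes d: "diagonalizes P Q e" and t: "\<tau> \<noteq> 0"
    and c: "cochar pos_cow \<tau> ** g = g' ** cochar pos_cow \<tau>"
  shows "(P ** g' ** Q) $ a $ b = \<tau> powi (deg e a - deg e b) * (P ** g ** Q) $ a $ b"
proof -
  let ?h = "cochar pos_cow \<tau>"
  have QP: "Q ** P = mat 1" using d by (simp add: diagonalizes_def)
  have "(P ** ?h ** Q) ** (P ** g ** Q) = P ** ?h ** (Q ** P) ** g ** Q" by (simp add: matrix_mul_assoc)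
  also have "\<dots> = P ** (?h ** g) ** Q" by (simp add: QP matrix_mul_rid matrix_mul_assoc)
  also have "\<dots> = P ** g' ** (Q ** P) ** ?h ** Q" unfolding c by (simp add: QP matrix_mul_rid matrix_mul_assoc)
  also have "\<dots> = (P ** g' ** Q) ** (P ** ?h ** Q)" by (simp add: matrix_mul_assoc)
  finally have "((P ** ?h ** Q) ** (P ** g ** Q)) $ a $ b = ((P ** g' ** Q) ** (P ** ?h ** Q)) $ a $ b" by simp
  hence "\<tau> powi deg e a * (P ** g ** Q) $ a $ b = (P ** g' ** Q) $ a $ b * \<tau> powi deg e b"
    unfolding cochar_diag[OF d t] diag_mult_left diag_mult_right .
  thus ?thesis using t by (simp add: power_int_diff field_simps)
qed

text \<open>Conjugation by the cocharacter turns the entry at t into \<open>\<tau> ^ m\<close> times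
  the entry at \<open>\<tau> ^ nat (fcd i) * t\<close>, with m nonnegative because the degree is not
  positive. Letting \<open>\<tau>\<close> tend to 0 leaves the corresponding entry of the
  identity.\<close>

lemma x_up_graded:
  assumes d: "diagonalizes P Q e" and ab: "deg e a - deg e b \<le> 0"
  shows "(P ** x_up D i t ** Q) $ a $ b = (if a = b then 1 else 0)"
proof -
  define m where "m = nat (deg e b - deg e a)"
  have f: "fcd i > 0" by (rule fcw)
  have eq: "(P ** x_up D i t ** Q) $ a $ b = \<tau> ^ m * (P ** x_up D i (\<tau> ^ nat (fcd i) * t) ** Q) $ a $ b" if \<tau>: "\<tau> \<noteq> 0" for \<tau>
  proof -
    have "cochar pos_cow \<tau> ** x_up D i t = x_up D i (\<tau> ^ nat (fcd i) * t) ** cochar pos_cow \<tau>"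
      using cochar_up[OF \<tau>, of pos_cow i t] f by (simp add: pairing_pos_cow power_int_def)
    from graded_conj_entry[OF d \<tau> this, of a b] show ?thesis
      using ab \<tau> by (auto simp: m_def power_int_def field_simps)
  qed
  define T where "T n = complex_of_real (inverse (real (Suc n)))" for n
  have T0: "T \<longlonglongrightarrow> 0" unfolding T_def using tendsto_of_real[OF LIMSEQ_inverse_real_of_nat, where 'a=complex] by simp
  have Tn: "T n \<noteq> 0" for n by (simp add: T_def del: of_nat_Suc)
  have "(\<lambda>n. T n ^ m * (P ** x_up D i (T n ^ nat (fcd i) * t) ** Q) $ a $ b)
     \<longlonglongrightarrow> 0 ^ m * (P ** x_up D i (0 ^ nat (fcd i) * t) ** Q) $ a $ b"
    by (intro tendsto_intros T0 tendsto_vec_nth)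
  hence "(\<lambda>n. (P ** x_up D i t ** Q) $ a $ b) \<longlonglongrightarrow> 0 ^ m * (P ** x_up D i (0 ^ nat (fcd i) * t) ** Q) $ a $ b"
    using eq[OF Tn] by simp
  hence "(P ** x_up D i t ** Q) $ a $ b = 0 ^ m * (P ** x_up D i (0 ^ nat (fcd i) * t) ** Q) $ a $ b"
    by (simp add: LIMSEQ_const_iff)
  also have "P ** x_up D i (0 ^ nat (fcd i) * t) ** Q = mat 1"
    using f d by (simp add: power_0_left x_up_0 matrix_mul_rid diagonalizes_def)
  finally show ?thesis using ab by (auto simp: mat_def m_def power_0_left)
qed

lemma NU_graded:
  assumes d: "diagonalizes P Q e" and n: "n \<in> NU J" and ab: "deg e a - deg e b \<le> 0"
  shows "(P ** n ** Q) $ a $ b = (if a = b then 1 else 0)"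
  using n ab
proof (induction arbitrary: a b rule: NU.induct)
  case NU_one
  thus ?case using d by (simp add: matrix_mul_rid diagonalizes_def) (simp add: mat_def)
next
  case (NU_up_l n j t)
  have "P ** (x_up D j t ** n) ** Q = P ** x_up D j t ** (Q ** P) ** n ** Q"
    using d by (simp add: diagonalizes_def matrix_mul_assoc matrix_mul_rid)
  also have "\<dots> = (P ** x_up D j t ** Q) ** (P ** n ** Q)" by (simp add: matrix_mul_assoc)
  finally show ?case 
    using unip_entry_mult[of "deg e" "P ** x_up D j t ** Q" "P ** n ** Q"] x_up_graded[OF d] NU_up_l by simp
qed

lemma diagonalizes_ex: "\<exists>P Q e. diagonalizes P Q e"
  unfolding diagonalizes_def by (rule Tor_diag_exponents)

text \<open>In coordinates that diagonalise the torus, \<open>NU J\<close> is a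
  \<open>contracted_monoid\<close>. Closedness serves to reach the elements of SL_2 outside its big
  cell as limits (\<open>x_up_MU\<close>).\<close>

lemma NU_closed: "closed (NU J)"
proof -
  obtain P Q e where d: "diagonalizes P Q e" using diagonalizes_ex by blast
  have PQ: "P ** Q = mat 1" "Q ** P = mat 1" using d by (auto simp: diagonalizes_def)
  define U where "U = {g. Q ** g ** P \<in> NU J}"
  have mem: "(P ** n ** Q \<in> U) = (n \<in> NU J)" for n
  proof -
    have "Q ** (P ** n ** Q) ** P = (Q ** P) ** n ** (Q ** P)" by (simp add: matrix_mul_assoc)
    thus ?thesis by (simp add: U_def PQ matrix_mul_lid matrix_mul_rid)
  qed
  have bk: "g = P ** (Q ** g ** P) ** Q" for g
  proof -
    have "P ** (Q ** g ** P) ** Q = (P ** Q) ** g ** (P ** Q)" by (simp add: matrix_mul_assoc)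
    thus ?thesis by (simp add: PQ matrix_mul_lid matrix_mul_rid)
  qed
  have "contracted_monoid (deg e) U"
  proof
    show "mat 1 \<in> U" by (simp add: U_def matrix_mul_rid PQ NU_one)
    show "g ** h \<in> U" if "g \<in> U" "h \<in> U" for g h
    proof -
      have "Q ** (g ** h) ** P = Q ** g ** (P ** Q) ** h ** P" by (simp add: PQ matrix_mul_rid matrix_mul_assoc)
      also have "\<dots> = (Q ** g ** P) ** (Q ** h ** P)" by (simp add: matrix_mul_assoc)
      finally show ?thesis using that NU_mult by (simp add: U_def)
    qed
    show "(\<chi> a b. \<tau> powi (deg e a - deg e b) * g $ a $ b) \<in> U" if gU: "g \<in> U" and t0: "\<tau> \<noteq> 0" for g \<tau>
    proof -
      have "Q ** g ** P \<in> NU J" using gU by (simp add: U_def)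
      then obtain n' where n': "n' \<in> NU J" "cochar pos_cow \<tau> ** (Q ** g ** P) = n' ** cochar pos_cow \<tau>"
        using tor_NU(1) cochar_Tor[OF t0] by blast
      have "P ** n' ** Q = (\<chi> a b. \<tau> powi (deg e a - deg e b) * g $ a $ b)"
        using graded_conj_entry[OF d t0 n'(2)] bk[of g] by (simp add: vec_eq_iff)
      thus ?thesis using mem[of n'] n'(1) by metis
    qed
    show "g $ a $ b = (if a = b then 1 else 0)" if "g \<in> U" "deg e a - deg e b \<le> 0" for g a b
      using NU_graded[OF d _ that(2), of "Q ** g ** P" J] bk[of g] that(1) by (simp add: U_def)
  qed
  from contracted_monoid.closed_U[OF this] have cl: "closed U" .
  have "n \<in> NU J" if n: "\<And>k. x k \<in> NU J" "x \<longlonglongrightarrow> n" for x :: "nat \<Rightarrow> _" and n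
  proof -
    have lim: "(\<lambda>k. P ** x k ** Q) \<longlonglongrightarrow> P ** n ** Q" by (intro tendsto_intros n)
    have "P ** x k ** Q \<in> U" for k using n(1) mem by simp
    from closed_sequentially[OF cl this lim] have "P ** n ** Q \<in> U" .
    thus ?thesis by (simp add: mem)
  qed
  thus ?thesis by (auto simp: closed_sequential_limits)
qed

text \<open>The part of \<open>NU J\<close> that stays in \<open>NU J\<close> under conjugation by the \<open>SL\<^sub>2\<close> of \<open>i\<close>: the
  unipotent radical of the minimal parabolic of \<open>i\<close>.\<close>

definition MU :: "'i set \<Rightarrow> 'i \<Rightarrow> (complex^'m^'m) set" where
  "MU J i = {n. \<forall>a b c d. a * d - b * c = 1 \<longrightarrow> emb D i (m2 a b c d) ** n ** emb D i (m2 d (- b) (- c) a) \<in> NU J}"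

lemma emb_inv: "a * d - b * c = 1 \<Longrightarrow> emb D i (m2 a b c d) ** emb D i (m2 d (- b) (- c) a) = mat 1"
  "a * d - b * c = 1 \<Longrightarrow> emb D i (m2 d (- b) (- c) a) ** emb D i (m2 a b c d) = mat 1"
  by (subst emb_m2_mult; simp add: algebra_simps emb_one flip: m2_one)+

lemma MU_NU: "n \<in> MU J i \<Longrightarrow> n \<in> NU J"
  unfolding MU_def mem_Collect_eq by (drule spec[of _ 1], drule spec[of _ 0], drule spec[of _ 0], drule spec[of _ 1])
    (simp add: emb_one matrix_mul_lid matrix_mul_rid flip: m2_one)

lemma MU_conj: assumes n: "n \<in> MU J i" and e: "a * d - b * c = 1"
  shows "emb D i (m2 a b c d) ** n ** emb D i (m2 d (- b) (- c) a) \<in> MU J i"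
  unfolding MU_def
proof (intro CollectI allI impI)
  fix a' b' c' d' :: complex assume e': "a' * d' - b' * c' = 1"
  have "emb D i (m2 a' b' c' d') ** (emb D i (m2 a b c d) ** n ** emb D i (m2 d (- b) (- c) a)) ** emb D i (m2 d' (- b') (- c') a')
    = (emb D i (m2 a' b' c' d') ** emb D i (m2 a b c d)) ** n ** (emb D i (m2 d (- b) (- c) a) ** emb D i (m2 d' (- b') (- c') a'))"
    by (simp add: matrix_mul_assoc)
  also have "\<dots> = emb D i (m2 (a'*a + b'*c) (a'*b + b'*d) (c'*a + d'*c) (c'*b + d'*d)) ** n **
     emb D i (m2 (c'*b + d'*d) (- (a'*b + b'*d)) (- (c'*a + d'*c)) (a'*a + b'*c))"
    using e e' by (simp add: emb_m2_mult algebra_simps)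
  also have "\<dots> \<in> NU J"
  proof -
    have "(a'*a + b'*c) * (c'*b + d'*d) - (a'*b + b'*d) * (c'*a + d'*c) = (a' * d' - b' * c') * (a * d - b * c)"
      by (simp add: algebra_simps)
    hence "(a'*a + b'*c) * (c'*b + d'*d) - (a'*b + b'*d) * (c'*a + d'*c) = 1" using e e' by simp
    thus ?thesis using n unfolding MU_def by blast
  qed
  finally show "emb D i (m2 a' b' c' d') ** (emb D i (m2 a b c d) ** n ** emb D i (m2 d (- b) (- c) a)) ** emb D i (m2 d' (- b') (- c') a') \<in> NU J" .
qed

lemma MU_mult: assumes "n \<in> MU J i" "n' \<in> MU J i" shows "n ** n' \<in> MU J i"
  unfolding MU_def
proof (intro CollectI allI impI)
  fix a b c d :: complex assume e: "a * d - b * c = 1"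
  have "emb D i (m2 a b c d) ** (n ** n') ** emb D i (m2 d (- b) (- c) a)
    = emb D i (m2 a b c d) ** n ** (emb D i (m2 d (- b) (- c) a) ** emb D i (m2 a b c d)) ** n' ** emb D i (m2 d (- b) (- c) a)"
    by (simp add: emb_inv[OF e] matrix_mul_rid matrix_mul_assoc)
  also have "\<dots> = (emb D i (m2 a b c d) ** n ** emb D i (m2 d (- b) (- c) a)) ** (emb D i (m2 a b c d) ** n' ** emb D i (m2 d (- b) (- c) a))"
    by (simp add: matrix_mul_assoc)
  also have "\<dots> \<in> NU J" using assms e unfolding MU_def by (auto intro: NU_mult)
  finally show "emb D i (m2 a b c d) ** (n ** n') ** emb D i (m2 d (- b) (- c) a) \<in> NU J" .
qed

lemma MU_one: "mat 1 \<in> MU J i"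
  by (simp add: MU_def matrix_mul_rid emb_inv NU_one)

lemma tendsto_emb:
  assumes "(f \<longlongrightarrow> 0) F" and e: "a * d - b * c = 1"
  shows "((\<lambda>x. emb D i (m2 a (a * f x + b) c (c * f x + d))) \<longlongrightarrow> emb D i (m2 a b c d)) F"
proof -
  have "emb D i (m2 a (a * f x + b) c (c * f x + d)) = emb D i (m2 a b c d) ** x_up D i (f x)" for x
    using e by (simp add: emb_m2 emb_m2_mult)
  moreover have "((\<lambda>x. emb D i (m2 a b c d) ** x_up D i (f x)) \<longlongrightarrow> emb D i (m2 a b c d) ** x_up D i 0) F"
    by (intro tendsto_intros assms)
  ultimately show ?thesis by (simp add: x_up_0 matrix_mul_rid)
qed

text \<open>A matrix with nonzero lower right entry factors as upper times diagonal times lower. The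
  lower factor commutes with x_j(t) and cancels against its inverse; the remaining conjugation stays
  among upper and diagonal elements.\<close>

lemma x_up_conj_generic:
  assumes j: "j \<in> J" "j \<noteq> i" and i: "i \<in> J" and e: "a * d - b * c = 1" and dn: "d \<noteq> 0"
  shows "emb D i (m2 a b c d) ** x_up D j t ** emb D i (m2 d (- b) (- c) a) \<in> NU J"
proof -
  have a: "a = (1 + b * c) / d" using e dn by (simp add: field_simps)
  have dec: "emb D i (m2 a b c d) = x_up D i (b / d) ** coroot D i (1 / d) ** x_low D i (c / d)"
    "emb D i (m2 d (- b) (- c) a) = x_low D i (- c / d) ** coroot D i d ** x_up D i (- b / d)"
    unfolding a using dn by (simp_all add: emb_m2 emb_m2_mult field_simps)
  have "emb D i (m2 a b c d) ** x_up D j t ** emb D i (m2 d (- b) (- c) a)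
    = x_up D i (b / d) ** coroot D i (1 / d) ** (x_low D i (c / d) ** x_up D j t) ** x_low D i (- c / d) ** coroot D i d ** x_up D i (- b / d)"
    unfolding dec by (simp add: matrix_mul_assoc)
  also have "x_low D i (c / d) ** x_up D j t = x_up D j t ** x_low D i (c / d)" using commute[OF j(2)] by simp
  also have "x_up D i (b / d) ** coroot D i (1 / d) ** (x_up D j t ** x_low D i (c / d)) ** x_low D i (- c / d) ** coroot D i d ** x_up D i (- b / d)
    = x_up D i (b / d) ** (coroot D i (1 / d) ** x_up D j t) ** (x_low D i (c / d) ** x_low D i (- c / d)) ** coroot D i d ** x_up D i (- b / d)"
    by (simp add: matrix_mul_assoc)
  also have "x_low D i (c / d) ** x_low D i (- c / d) = mat 1" by (simp add: x_low_add x_low_0)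
  also have "coroot D i (1 / d) ** x_up D j t = x_up D j (wchar D (simple_root (Cartan D) j) (coroot D i (1 / d)) * t) ** coroot D i (1 / d)"
    using dn by (intro conj_up coroot_Tor) simp
  also have "x_up D i (b / d) ** (x_up D j (wchar D (simple_root (Cartan D) j) (coroot D i (1 / d)) * t) ** coroot D i (1 / d)) ** mat 1 ** coroot D i d ** x_up D i (- b / d)
    = x_up D i (b / d) ** x_up D j (wchar D (simple_root (Cartan D) j) (coroot D i (1 / d)) * t) ** (coroot D i (1 / d) ** coroot D i d) ** x_up D i (- b / d)"
    by (simp add: matrix_mul_assoc matrix_mul_rid)
  also have "coroot D i (1 / d) ** coroot D i d = mat 1" using dn by (simp add: coroot_mult coroot_1)
  finally show ?thesis using i j by (auto simp: matrix_mul_rid intro!: NU_mult NU_up)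
qed

text \<open>When d = 0, the matrix is a limit of matrices whose lower right entry is a nonzero
  multiple of c. The generic case applies to those, and closedness of \<open>NU J\<close> passes to
  the limit.\<close>

lemma x_up_MU: assumes j: "j \<in> J" "j \<noteq> i" and i: "i \<in> J" shows "x_up D j t \<in> MU J i"
  unfolding MU_def
proof (intro CollectI allI impI)
  fix a b c d :: complex assume e: "a * d - b * c = 1"
  show "emb D i (m2 a b c d) ** x_up D j t ** emb D i (m2 d (- b) (- c) a) \<in> NU J"
  proof (cases "d = 0")
    case False thus ?thesis using x_up_conj_generic j i e by blast
  next
    case True
    hence c: "c \<noteq> 0" using e by auto
    define T where "T n = complex_of_real (inverse (real (Suc n)))" for n
    have T0: "T \<longlonglongrightarrow> 0" unfolding T_def using tendsto_of_real[OF LIMSEQ_inverse_real_of_nat, where 'a=complex] by simp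
    have Tn: "T n \<noteq> 0" for n by (simp add: T_def del: of_nat_Suc)
    define G where "G n = emb D i (m2 a (a * T n + b) c (c * T n + d))" for n
    define G' where "G' n = x_up D i (- T n) ** emb D i (m2 d (- b) (- c) a)" for n
    have G'_eq: "G' n = emb D i (m2 (c * T n + d) (- (a * T n + b)) (- c) a)" for n
      using e by (simp add: G'_def emb_m2 emb_m2_mult algebra_simps)
    have lim: "(\<lambda>n. G n ** x_up D j t ** G' n) \<longlonglongrightarrow> emb D i (m2 a b c d) ** x_up D j t ** (x_up D i (- 0) ** emb D i (m2 d (- b) (- c) a))"
      unfolding G_def G'_def by (intro tendsto_intros tendsto_emb T0 e)
    have "G n ** x_up D j t ** G' n \<in> NU J" for n
      unfolding G_def G'_eq by (rule x_up_conj_generic[OF j i]) (use e c Tn True in \<open>auto simp: algebra_simps\<close>)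
    from closed_sequentially[OF NU_closed this lim]
    have "emb D i (m2 a b c d) ** x_up D j t ** (x_up D i (- 0) ** emb D i (m2 d (- b) (- c) a)) \<in> NU J" .
    thus ?thesis by (simp add: x_up_0 matrix_mul_lid)
  qed
qed

text \<open>Generators other than x_i lie in \<open>MU J i\<close>, and x_i normalises it, so all
  factors x_i can be collected on the right.\<close>

lemma NU_decomp: assumes "n \<in> NU J" "i \<in> J"
  obtains m s where "m \<in> MU J i" "n = m ** x_up D i s"
proof -
  have "\<exists>m s. m \<in> MU J i \<and> n = m ** x_up D i s" using assms(1)
  proof (induction rule: NU.induct)
    case NU_one thus ?case using MU_one by (intro exI[of _ "mat 1"] exI[of _ 0]) (simp add: x_up_0 matrix_mul_lid)
  next
    case (NU_up_l n j t)
    then obtain m s where m: "m \<in> MU J i" "n = m ** x_up D i s" by blast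
    show ?case
    proof (cases "j = i")
      case False
      hence "x_up D j t ** m \<in> MU J i" using MU_mult x_up_MU NU_up_l assms(2) m by blast
      thus ?thesis using m by (metis matrix_mul_assoc)
    next
      case True
      have "x_up D i t ** m ** x_up D i (- t) \<in> MU J i" using MU_conj[OF m(1), of 1 1 t 0] by (simp add: emb_m2)
      moreover have "x_up D i t ** n = (x_up D i t ** m ** x_up D i (- t)) ** x_up D i (t + s)"
        by (simp add: m x_up_add flip: matrix_mul_assoc)
      ultimately show ?thesis using True by blast
    qed
  qed
  thus thesis using that by blast
qed

lemma NU_MU: "n \<in> NU J \<Longrightarrow> i \<notin> J \<Longrightarrow> n \<in> MU (insert i J) i"
  by (induction rule: NU.induct) (auto intro!: MU_one MU_mult x_up_MU)

lemma MU_conj_s: "n \<in> MU J i \<Longrightarrow> s_bar D i ** n ** s_inv i \<in> MU J i" "n \<in> MU J i \<Longrightarrow> s_inv i ** n ** s_bar D i \<in> MU J i"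
  using MU_conj[of n J i 0 0 "-1" 1] MU_conj[of n J i 0 0 1 "-1"] by (simp_all add: emb_m2 s_inv_m2)

lemma MU_conj_low: "n \<in> MU J i \<Longrightarrow> x_low D i t ** n ** x_low D i (- t) \<in> MU J i"
  using MU_conj[of n J i 1 1 0 t] by (simp add: emb_m2)

lemma MU_conj_up: "n \<in> MU J i \<Longrightarrow> x_up D i t ** n ** x_up D i (- t) \<in> MU J i"
  using MU_conj[of n J i 1 1 t 0] by (simp add: emb_m2)

end


section \<open>Density of the big cell\<close>

lemma tendsto_det:
  fixes f :: "'b \<Rightarrow> complex^'m^'m"
  assumes "(f \<longlongrightarrow> A) F" shows "((\<lambda>x. det (f x)) \<longlongrightarrow> det A) F"
  unfolding det_def by (intro tendsto_intros assms)

lemma matrix_inv_entry: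
  fixes A :: "complex^'m^'m"
  assumes "invertible A"
  shows "matrix_inv A $ i $ j = det (\<chi> a b. if b = i then axis j 1 $ a else A $ a $ b) / det A"
proof -
  have d: "det A \<noteq> 0" using assms by (simp add: invertible_det_nz)
  have "A *v (column j (matrix_inv A)) = axis j 1"
  proof -
    have "(A *v column j (matrix_inv A)) $ k = (A ** matrix_inv A) $ k $ j" for k
      by (simp add: matrix_vector_mult_def column_def matrix_matrix_mult_def)
    thus ?thesis by (simp add: vec_eq_iff matrix_inv_works[OF assms]) (simp add: mat_def axis_def)
  qed
  hence "column j (matrix_inv A) = (\<chi> k. det(\<chi> i l. if l = k then axis j 1 $ i else A $ i $ l) / det A)"
    using cramer[OF d] by blast
  hence "column j (matrix_inv A) $ i = (\<chi> k. det(\<chi> i l. if l = k then axis j 1 $ i else A $ i $ l) / det A) $ i" by (rule arg_cong)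
  thus ?thesis unfolding column_def vec_lambda_beta .
qed

lemma tendsto_matrix_inv:
  fixes f :: "'b \<Rightarrow> complex^'m^'m"
  assumes f: "(f \<longlongrightarrow> A) F" and A: "invertible A" "\<And>x. invertible (f x)"
  shows "((\<lambda>x. matrix_inv (f x)) \<longlongrightarrow> matrix_inv A) F"
  unfolding tendsto_matrix_iff
proof (intro allI)
  fix i j
  have "((\<lambda>x. \<chi> a b. if b = i then axis j 1 $ a else f x $ a $ b) \<longlongrightarrow> (\<chi> a b. if b = i then axis j 1 $ a else A $ a $ b)) F"
    unfolding tendsto_matrix_iff using f by (auto intro: tendsto_vec_nth)
  hence "((\<lambda>x. det (\<chi> a b. if b = i then axis j 1 $ a else f x $ a $ b) / det (f x)) \<longlongrightarrow>
    det (\<chi> a b. if b = i then axis j 1 $ a else A $ a $ b) / det A) F"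
    using A(1) by (intro tendsto_divide tendsto_det f) (simp_all add: invertible_det_nz)
  thus "((\<lambda>x. matrix_inv (f x) $ i $ j) \<longlongrightarrow> matrix_inv A $ i $ j) F"
    by (simp add: matrix_inv_entry A)
qed

definition null_seq :: "nat \<Rightarrow> complex" where
  "null_seq n = complex_of_real (inverse (real (Suc n)))"

lemma null_seq: "null_seq n \<noteq> 0" "null_seq \<longlonglongrightarrow> 0"
  using tendsto_of_real[OF LIMSEQ_inverse_real_of_nat, where 'a=complex]
  by (simp_all add: null_seq_def[abs_def] del: of_nat_Suc)

lemma swap_swap [simp]: "swap_datum (swap_datum D) = D"
proof -
  have "rot ** (rot ** g ** rot_inv) ** rot_inv = g" for g
    using m2_eqI[OF refl refl refl refl, of g] by (metis add.inverse_inverse rot_conj)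
  thus ?thesis by (simp add: swap_datum_def)
qed

context pinning begin

interpretation sw: pinning "swap_datum D" by (rule pinning_swap) (rule pinning_axioms)

definition NL :: "'i set \<Rightarrow> (complex^'m^'m) set" where "NL J = sw.NU J"

lemma NL_low: "j \<in> J \<Longrightarrow> x_low D j t \<in> NL J"
  using sw.NU_up[of j J "- t"] by (simp add: NL_def)

lemma NL_one: "mat 1 \<in> NL J" and NL_mult: "n \<in> NL J \<Longrightarrow> n' \<in> NL J \<Longrightarrow> n ** n' \<in> NL J"
  by (simp_all add: NL_def sw.NU_one sw.NU_mult)

lemma sw_GG: "sw.GG = GG"
proof (intro subset_antisym subsetI)
  fix g assume "g \<in> sw.GG"
  thus "g \<in> GG" by (induction rule: sw.GG.induct) (auto intro: GG.intros)
next
  fix g assume "g \<in> GG"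
  thus "g \<in> sw.GG"
  proof (induction rule: GG.induct)
    case (GG_up_r g i t) thus ?case using sw.GG_low_r[of g i "-t"] by simp
  next
    case (GG_low_r g i t) thus ?case using sw.GG_up_r[of g i "-t"] by simp
  qed (auto intro: sw.GG.intros)
qed

lemma NL_GG: "n \<in> NL J \<Longrightarrow> n \<in> GG"
  using sw.NU_GG by (simp add: NL_def sw_GG)

lemma tor_NL: assumes "n \<in> NL J" "h \<in> Tor D" shows "\<exists>n'\<in>NL J. h ** n = n' ** h" "\<exists>n'\<in>NL J. n ** h = h ** n'"
  using sw.tor_NU assms by (simp_all add: NL_def)

definition Om :: "(complex^'m^'m) set" where
  "Om = {n' ** a ** n | n' a n. n' \<in> NL UNIV \<and> a \<in> Tor D \<and> n \<in> NU UNIV}"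

lemma Om_GG: "g \<in> Om \<Longrightarrow> g \<in> GG"
  unfolding Om_def by (auto intro!: GG_mult intro: NL_GG NU_GG GG_tor)

text \<open>The radical part m is normalised by the lower root subgroup of i. Hence only the SL_2
  product of x_i(s) with the lower element of parameter r has to be put into the order lower, torus,
  upper, which is possible when 1 + s r is nonzero.\<close>

lemma Om_low_generic:
  assumes "n' \<in> NL UNIV" "a \<in> Tor D" "m \<in> MU UNIV i" "1 + s * r \<noteq> 0"
  shows "n' ** a ** (m ** x_up D i s) ** x_low D i r \<in> Om"
proof -
  let ?r = "r / (1 + s * r)" let ?H = "coroot D i (1 + s * r)" let ?x = "x_up D i (s / (1 + s * r))"
  define m' where "m' = x_low D i (- ?r) ** m ** x_low D i ?r"
  have m': "m' \<in> NU UNIV" unfolding m'_def using MU_conj_low[OF assms(3), of "- ?r"] MU_NU by simp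
  have H: "?H \<in> Tor D" using assms(4) by (rule coroot_Tor)
  obtain m'' where m'': "m'' \<in> NU UNIV" "m' ** ?H = ?H ** m''" using tor_NU(2)[OF m' H] by blast
  have xx: "x_low D i ?r ** x_low D i (- ?r) = mat 1" by (simp add: x_low_add x_low_0)
  have "n' ** a ** (m ** x_up D i s) ** x_low D i r = n' ** a ** m ** (x_up D i s ** x_low D i r)" by (simp add: matrix_mul_assoc)
  also have "\<dots> = n' ** a ** m ** x_low D i ?r ** ?H ** ?x" by (simp add: up_low[OF assms(4)] matrix_mul_assoc)
  also have "\<dots> = n' ** a ** (x_low D i ?r ** x_low D i (- ?r)) ** m ** x_low D i ?r ** ?H ** ?x" by (simp add: xx matrix_mul_rid)
  also have "\<dots> = n' ** (a ** x_low D i ?r) ** m' ** ?H ** ?x" by (simp add: m'_def matrix_mul_assoc)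
  also have "\<dots> = n' ** (x_low D i (wchar D (- simple_root (Cartan D) i) a * ?r) ** a) ** (m' ** ?H) ** ?x"
    by (simp add: conj_low[OF assms(2)] matrix_mul_assoc)
  also have "\<dots> = (n' ** x_low D i (wchar D (- simple_root (Cartan D) i) a * ?r)) ** (a ** ?H) ** (m'' ** ?x)"
    by (simp add: m'' matrix_mul_assoc)
  also have "\<dots> \<in> Om" unfolding Om_def using assms H m'' by (blast intro: NL_mult NL_low Tor_mult NU_mult NU_up UNIV_I)
  finally show ?thesis .
qed

lemma Om_low: assumes "g \<in> Om" shows "g ** x_low D i r \<in> closure Om"
proof -
  obtain n' a n where g: "g = n' ** a ** n" "n' \<in> NL UNIV" "a \<in> Tor D" "n \<in> NU UNIV" using assms unfolding Om_def by blast
  obtain m s where m: "m \<in> MU UNIV i" "n = m ** x_up D i s" using NU_decomp[OF g(4), of i] by auto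
  show ?thesis
  proof (cases "1 + s * r = 0")
    case False
    thus ?thesis using Om_low_generic[OF g(2,3) m(1) False] g m closure_subset by blast
  next
    case True
    hence s: "s \<noteq> 0" by auto
    \<comment> \<open>Since s is nonzero here, moving r slightly makes 1 + s r nonzero.\<close>
    have "g ** x_low D i (r + null_seq k) \<in> Om" for k
    proof -
      have "1 + s * (r + null_seq k) = (1 + s * r) + s * null_seq k" by (simp add: algebra_simps)
      hence "1 + s * (r + null_seq k) \<noteq> 0" using True s null_seq(1) by simp
      from Om_low_generic[OF g(2,3) m(1) this] show ?thesis by (simp add: g m)
    qed
    moreover have "(\<lambda>k. g ** x_low D i (r + null_seq k)) \<longlonglongrightarrow> g ** x_low D i (r + 0)"
      by (intro tendsto_intros null_seq)
    ultimately show ?thesis unfolding closure_sequential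
      by (intro exI[of _ "\<lambda>k. g ** x_low D i (r + null_seq k)"]) simp
  qed
qed

lemma closure_right_mult:
  fixes A :: "(complex^'m^'m) set"
  assumes "\<And>g. g \<in> A \<Longrightarrow> g ** y \<in> closure A" "g \<in> closure A"
  shows "g ** y \<in> closure A"
proof -
  obtain x where x: "\<And>k::nat. x k \<in> A" "x \<longlonglongrightarrow> g" using assms(2) unfolding closure_sequential by blast
  have "(\<lambda>k. x k ** y) \<longlonglongrightarrow> g ** y" by (intro tendsto_intros x)
  from closed_sequentially[OF closed_closure assms(1)[OF x(1)] this] show ?thesis .
qed

text \<open>Right multiplication by a generator maps the big cell into its closure, hence, being
  continuous, the closure into itself.\<close>

lemma GG_closure: "g \<in> GG \<Longrightarrow> g \<in> closure Om"
proof (induction rule: GG.induct)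
  case GG_one
  have "mat 1 ** mat 1 ** mat 1 \<in> Om" unfolding Om_def using NL_one Tor_one NU_one by blast
  thus ?case using closure_subset by (auto simp: matrix_mul_rid)
next
  case (GG_up_r g i t)
  show ?case
  proof (rule closure_right_mult[OF _ GG_up_r.IH])
    fix g assume "g \<in> Om"
    then obtain n' a n where g: "g = n' ** a ** n" "n' \<in> NL UNIV" "a \<in> Tor D" "n \<in> NU UNIV" unfolding Om_def by blast
    hence "g ** x_up D i t = n' ** a ** (n ** x_up D i t)" by (simp add: matrix_mul_assoc)
    hence "g ** x_up D i t \<in> Om" unfolding Om_def using g NU_mult NU_up by blast
    thus "g ** x_up D i t \<in> closure Om" using closure_subset by blast
  qed
next
  case (GG_low_r g i t)
  show ?case by (rule closure_right_mult[OF Om_low GG_low_r.IH])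
next
  case (GG_tor_r g h)
  show ?case
  proof (rule closure_right_mult[OF _ GG_tor_r.IH])
    fix g assume "g \<in> Om"
    then obtain n' a n where g: "g = n' ** a ** n" "n' \<in> NL UNIV" "a \<in> Tor D" "n \<in> NU UNIV" unfolding Om_def by blast
    obtain n1 where n1: "n1 \<in> NU UNIV" "n ** h = h ** n1" using tor_NU(2)[OF g(4) GG_tor_r.hyps(2)] by blast
    have "g ** h = n' ** a ** (n ** h)" by (simp add: g matrix_mul_assoc)
    also have "\<dots> = n' ** (a ** h) ** n1" by (simp add: n1 matrix_mul_assoc)
    finally have "g ** h \<in> Om" unfolding Om_def using g n1 Tor_mult GG_tor_r.hyps(2) by blast
    thus "g ** h \<in> closure Om" using closure_subset by blast
  qed
qed

text \<open>The identity principle behind all statements on minors: continuous functions on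
  \<open>GG\<close> are compared on whichever translate of the big cell suits the
  computation.\<close>

lemma GG_ext:
  assumes "continuous_on GG \<phi>" "continuous_on GG \<psi>" and u: "u \<in> GG" "v \<in> GG"
    and eq: "\<And>n' a n. n' \<in> NL UNIV \<Longrightarrow> a \<in> Tor D \<Longrightarrow> n \<in> NU UNIV \<Longrightarrow> \<phi> (u ** (n' ** a ** n) ** v) = (\<psi> (u ** (n' ** a ** n) ** v) :: complex)"
    and g: "g \<in> GG"
  shows "\<phi> g = \<psi> g"
proof -
  define g' where "g' = matrix_inv u ** g ** matrix_inv v"
  have g': "g' \<in> GG" unfolding g'_def using u g by (intro GG_mult GG_cancel)
  have gg': "u ** g' ** v = g" by (simp add: g'_def u GG_cancel GG_cancel2 matrix_mul_assoc matrix_mul_lid)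
  obtain x where x: "\<And>k::nat. x k \<in> Om" "x \<longlonglongrightarrow> g'" using GG_closure[OF g'] unfolding closure_sequential by blast
  have lim: "(\<lambda>k. u ** x k ** v) \<longlonglongrightarrow> g" unfolding gg'[symmetric] by (intro tendsto_intros x)
  have GGx: "u ** x k ** v \<in> GG" for k using u Om_GG[OF x(1)] by (intro GG_mult)
  have "(\<lambda>k. \<phi> (u ** x k ** v)) \<longlonglongrightarrow> \<phi> g"
    by (rule continuous_on_tendsto_compose[OF assms(1) lim g]) (simp add: GGx)
  moreover have "(\<lambda>k. \<psi> (u ** x k ** v)) \<longlonglongrightarrow> \<psi> g"
    by (rule continuous_on_tendsto_compose[OF assms(2) lim g]) (simp add: GGx)
  moreover have "\<phi> (u ** x k ** v) = \<psi> (u ** x k ** v)" for k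
    using x(1)[of k] eq unfolding Om_def by auto
  ultimately show ?thesis using LIMSEQ_unique by auto
qed

lemma continuous_on_GG_inv: "continuous_on GG matrix_inv"
  unfolding continuous_on_sequentially
proof (intro allI ballI impI)
  fix x a assume a: "a \<in> GG" "(\<forall>n. x n \<in> GG) \<and> x \<longlonglongrightarrow> a"
  have inv: "invertible g" if "g \<in> GG" for g using GG_cancel[OF that] unfolding invertible_def by blast
  show "(matrix_inv \<circ> x) \<longlonglongrightarrow> matrix_inv a"
    unfolding comp_def by (rule tendsto_matrix_inv) (use a inv in auto)
qed

subsection \<open>Contraction by cocharacters\<close>

text \<open>When all exponents are nonnegative, the conjugates of n depend polynomially on
  \<open>\<tau>\<close> and so extend to \<open>\<tau> = 0\<close>. A single function
  \<open>N\<close> is provided so that \<open>N 0\<close> is the limit along every null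
  sequence.\<close>

lemma NU_contract:
  assumes n: "n \<in> NU J" and k: "\<And>j. pairing k (simple_root (Cartan D) j) \<ge> 0"
  shows "\<exists>N. (\<forall>\<tau>. N \<tau> \<in> NU J) \<and> (\<forall>x. x \<longlonglongrightarrow> 0 \<longrightarrow> (\<lambda>i::nat. N (x i)) \<longlonglongrightarrow> N 0) \<and>
    (\<forall>\<tau>. \<tau> \<noteq> 0 \<longrightarrow> cochar k \<tau> ** n = N \<tau> ** cochar k \<tau>) \<and>
    ((\<forall>j. pairing k (simple_root (Cartan D) j) > 0) \<longrightarrow> N 0 = mat 1)"
  using n
proof (induction rule: NU.induct)
  case NU_one thus ?case by (intro exI[of _ "\<lambda>_. mat 1"]) (auto simp: NU.NU_one matrix_mul_lid matrix_mul_rid)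
next
  case (NU_up_l n j t)
  then obtain N where N: "\<And>\<tau>. N \<tau> \<in> NU J" "\<And>x. x \<longlonglongrightarrow> 0 \<Longrightarrow> (\<lambda>i::nat. N (x i)) \<longlonglongrightarrow> N 0"
    "\<And>\<tau>. \<tau> \<noteq> 0 \<Longrightarrow> cochar k \<tau> ** n = N \<tau> ** cochar k \<tau>"
    "(\<forall>j. pairing k (simple_root (Cartan D) j) > 0) \<longrightarrow> N 0 = mat 1" by blast
  define e where "e = nat (pairing k (simple_root (Cartan D) j))"
  show ?case
  proof (intro exI[of _ "\<lambda>\<tau>. x_up D j (\<tau> ^ e * t) ** N \<tau>"] conjI allI impI)
    fix \<tau> show "x_up D j (\<tau> ^ e * t) ** N \<tau> \<in> NU J" using N(1) NU_up_l by (intro NU.NU_up_l)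
  next
    fix x :: "nat \<Rightarrow> complex" assume x: "x \<longlonglongrightarrow> 0"
    show "(\<lambda>i. x_up D j (x i ^ e * t) ** N (x i)) \<longlonglongrightarrow> x_up D j (0 ^ e * t) ** N 0"
      by (intro tendsto_intros x N(2))
  next
    fix \<tau> :: complex assume \<tau>: "\<tau> \<noteq> 0"
    have "cochar k \<tau> ** (x_up D j t ** n) = x_up D j (\<tau> ^ e * t) ** (cochar k \<tau> ** n)"
      using cochar_up[OF \<tau>, of k j t] k[of j] by (simp add: matrix_mul_assoc e_def power_int_def)
    thus "cochar k \<tau> ** (x_up D j t ** n) = x_up D j (\<tau> ^ e * t) ** N \<tau> ** cochar k \<tau>"
      by (simp add: N(3)[OF \<tau>] matrix_mul_assoc)
  next
    assume pos: "\<forall>j. pairing k (simple_root (Cartan D) j) > 0"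
    hence "e > 0" by (simp add: e_def)
    thus "x_up D j (0 ^ e * t) ** N 0 = mat 1" using N(4) pos by (simp add: x_up_0 matrix_mul_lid zero_power)
  qed
qed

lemma tor_w_bar_l:
  assumes "h \<in> Tor D"
  shows "\<exists>h'\<in>Tor D. w_bar D ws ** h = h' ** w_bar D ws \<and> (\<forall>\<gamma>. wchar D \<gamma> h' = wchar D (word_act (Cartan D) (rev ws) \<gamma>) h)"
proof (induction ws)
  case Nil thus ?case using assms by (auto simp: word_act_def matrix_mul_lid matrix_mul_rid)
next
  case (Cons i ws)
  then obtain h' where h': "h' \<in> Tor D" "w_bar D ws ** h = h' ** w_bar D ws"
    "\<And>\<gamma>. wchar D \<gamma> h' = wchar D (word_act (Cartan D) (rev ws) \<gamma>) h" by blast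
  define a where "a = wchar D (simple_root (Cartan D) i) h'"
  have a: "a \<noteq> 0" using wchar_nz h'(1) by (simp add: a_def)
  have "stor i h' ** s_bar D i = coroot D i (inverse a) ** (coroot D i a ** s_bar D i ** h')"
    using tor_s[OF h'(1) a_def] by (simp add: stor_def a_def flip: matrix_mul_assoc)
  also have "\<dots> = (coroot D i (inverse a) ** coroot D i a) ** s_bar D i ** h'" by (simp add: matrix_mul_assoc)
  finally have st: "stor i h' ** s_bar D i = s_bar D i ** h'" using a by (simp add: coroot_mult coroot_1 matrix_mul_lid)
  have "w_bar D (i # ws) ** h = s_bar D i ** (w_bar D ws ** h)" by (simp add: w_bar_Cons matrix_mul_assoc)
  also have "\<dots> = stor i h' ** w_bar D (i # ws)" by (simp add: h' w_bar_Cons matrix_mul_assoc st)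
  finally show ?case using stor(1)[OF h'(1), of i] stor(3)[OF h'(1), where i = i] h'(3) by (auto simp: word_act_def)
qed

end

section \<open>Principal minors on the group\<close>

locale minors = pinning +
  fixes f :: "'a \<Rightarrow> complex^'b^'b \<Rightarrow> complex"
  assumes f_cont: "continuous_on GG (f i)"
    and f_val: "n' \<in> NL UNIV \<Longrightarrow> a \<in> Tor D \<Longrightarrow> n \<in> NU UNIV \<Longrightarrow> f i (n' ** a ** n) = fchar D i a"
    and Cartan_diag: "Cartan D $ i $ i = 2"
    and Cartan_offdiag: "i \<noteq> j \<Longrightarrow> Cartan D $ i $ j \<le> 0"

lemma minors_swap: assumes "minors D f" shows "minors (swap_datum D) (\<lambda>i g. f i (matrix_inv g))"
proof -
  interpret minors D f by fact
  interpret sw: pinning "swap_datum D" by (rule pinning_swap) (rule pinning_axioms)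
  show ?thesis
  proof
    fix i show "continuous_on sw.GG (\<lambda>g. f i (matrix_inv g))"
      unfolding sw_GG by (rule continuous_on_compose2[OF f_cont continuous_on_GG_inv]) (auto intro: GG_cancel)
  next
    fix n' a n i assume n': "n' \<in> sw.NL UNIV" and a: "a \<in> Tor (swap_datum D)" and n: "n \<in> sw.NU UNIV"
    have n'1: "n' \<in> NU UNIV" using n' by (simp add: sw.NL_def)
    have n1: "n \<in> NL UNIV" using n by (simp add: NL_def)
    have a1: "a \<in> Tor D" using a by simp
    have G: "n' \<in> GG" "a \<in> GG" "n \<in> GG" using n'1 n1 a1 NU_GG NL_GG GG_tor by blast+
    have "matrix_inv (n' ** a ** n) = matrix_inv n ** matrix_inv a ** matrix_inv n'"
      using G by (simp add: GG_inv_mult GG_mult matrix_mul_assoc)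
    moreover have "matrix_inv n \<in> NL UNIV" using sw.NU_inv[OF n] by (simp add: NL_def)
    ultimately have "f i (matrix_inv (n' ** a ** n)) = fchar D i (matrix_inv a)"
      using f_val NU_inv[OF n'1] Tor_cancel(1)[OF a1] by simp
    also have "\<dots> = inverse (fchar D i a)" using wchar_inv[OF a1, of "fund_weight i"] by (simp add: wchar_fund)
    finally show "f i (matrix_inv (n' ** a ** n)) = fchar (swap_datum D) i a" by simp
  qed (use Cartan_diag Cartan_offdiag in auto)
qed


section \<open>Generalized minors\<close>

lemma word_act_Nil [simp]: "word_act A [] \<gamma> = \<gamma>" and word_act_Cons: "word_act A (i # ws) \<gamma> = simple_refl A i (word_act A ws \<gamma>)"
  and word_act_append: "word_act A (us @ vs) \<gamma> = word_act A us (word_act A vs \<gamma>)"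
  by (simp_all add: word_act_def)

lemma simple_refl_add: "simple_refl A i (\<gamma> + \<delta>) = simple_refl A i \<gamma> + simple_refl A i \<delta>"
  by (simp add: simple_refl_def vec_eq_iff algebra_simps)

lemma simple_refl_smult: "simple_refl A i (c *s \<gamma>) = c *s simple_refl A i \<gamma>"
  by (simp add: simple_refl_def vec_eq_iff algebra_simps)

lemma word_act_add: "word_act A ws (\<gamma> + \<delta>) = word_act A ws \<gamma> + word_act A ws \<delta>"
  by (induction ws) (simp_all add: word_act_Cons simple_refl_add)

lemma word_act_smult: "word_act A ws (c *s \<gamma>) = c *s word_act A ws \<gamma>"
  by (induction ws) (simp_all add: word_act_Cons simple_refl_smult)

lemma word_act_minus: "word_act A ws (- \<gamma>) = - word_act A ws \<gamma>"
proof -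
  have "- \<gamma> = (-1) *s \<gamma>" for \<gamma> :: "'a weight" by (simp add: vec_eq_iff)
  thus ?thesis by (metis word_act_smult)
qed

lemma word_act_diff: "word_act A ws (\<gamma> - \<delta>) = word_act A ws \<gamma> - word_act A ws \<delta>"
  using word_act_add[of A ws \<gamma> "- \<delta>"] by (simp add: word_act_minus)

lemma word_act_0 [simp]: "word_act A ws 0 = 0"
  using word_act_smult[of A ws 0 0] by simp

lemma word_act_sum: "word_act A ws (\<Sum>x\<in>S. g x) = (\<Sum>x\<in>S. word_act A ws (g x))"
  by (induction S rule: infinite_finite_induct) (auto simp: word_act_add)

lemma simple_refl_involution:
  assumes "A $ i $ i = 2" shows "simple_refl A i (simple_refl A i \<gamma>) = \<gamma>"
  using assms by (simp add: simple_refl_def vec_eq_iff simple_root_nth)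

lemma simple_refl_root: "A $ i $ i = 2 \<Longrightarrow> simple_refl A i (simple_root A i) = - simple_root A i"
  by (simp add: simple_refl_def vec_eq_iff simple_root_nth)

lemma word_act_rev:
  assumes "\<And>i. A $ i $ i = 2"
  shows "word_act A (rev ws) (word_act A ws \<gamma>) = \<gamma>" "word_act A ws (word_act A (rev ws) \<gamma>) = \<gamma>"
proof -
  show A: "word_act A (rev ws) (word_act A ws \<gamma>) = \<gamma>" for ws
    by (induction ws) (simp_all add: word_act_Cons word_act_append simple_refl_involution assms)
  show "word_act A ws (word_act A (rev ws) \<gamma>) = \<gamma>" using A[of "rev ws"] by simp
qed

lemma root_comb_add: "root_comb A (p + q) = root_comb A p + root_comb A q"
  and root_comb_minus: "root_comb A (- p) = - root_comb A p"
  and root_comb_diff: "root_comb A (p - q) = root_comb A p - root_comb A q"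
  and root_comb_smult: "root_comb A (c *s p) = c *s root_comb A p"
  and root_comb_0 [simp]: "root_comb A 0 = 0"
  by (simp_all add: vec_eq_iff root_comb_nth algebra_simps sum.distrib sum_negf sum_subtractf sum_distrib_left)

lemma root_comb_axis: "root_comb A (axis i 1) = simple_root A i"
proof -
  have "(\<Sum>j\<in>UNIV. axis i 1 $ j * A $ l $ j) = (\<Sum>j\<in>UNIV. if j = i then A $ l $ i else 0)" for l
    by (intro sum.cong) (auto simp: axis_def)
  thus ?thesis by (simp add: vec_eq_iff root_comb_nth simple_root_nth)
qed

lemma word_act_root_lattice: "\<exists>q. word_act A ws (root_comb A p) = root_comb A q"
proof (induction ws)
  case (Cons i ws)
  then obtain q where q: "word_act A ws (root_comb A p) = root_comb A q" by blast
  have "word_act A (i # ws) (root_comb A p) = root_comb A (q - (root_comb A q $ i) *s axis i 1)"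
    by (simp add: word_act_Cons q simple_refl_def root_comb_diff root_comb_smult root_comb_axis)
  thus ?case by blast
qed auto

context minors begin

lemma f_cont2: "continuous_on S \<phi> \<Longrightarrow> (\<And>x. x \<in> S \<Longrightarrow> \<phi> x \<in> GG) \<Longrightarrow> continuous_on S (\<lambda>x. f i (\<phi> x))"
  by (rule continuous_on_compose2[OF f_cont]) auto

lemma tendsto_f: "x \<longlonglongrightarrow> g \<Longrightarrow> g \<in> GG \<Longrightarrow> (\<And>n. x n \<in> GG) \<Longrightarrow> (\<lambda>n. f i (x n)) \<longlonglongrightarrow> f i g"
  by (rule continuous_on_tendsto_compose[OF f_cont]) auto

lemma GG_extf:
  assumes u: "u \<in> GG" "v \<in> GG" "u' \<in> GG" "v' \<in> GG"
    and eq: "\<And>n' a n. n' \<in> NL UNIV \<Longrightarrow> a \<in> Tor D \<Longrightarrow> n \<in> NU UNIV \<Longrightarrow> f i (u ** (n' ** a ** n) ** v) = c * f i (u' ** (n' ** a ** n) ** v')"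
    and g: "g \<in> GG"
  shows "f i (u ** g ** v) = c * f i (u' ** g ** v')"
proof (rule GG_ext[where u = "mat 1" and v = "mat 1", OF _ _ GG_one GG_one _ g])
  show "continuous_on GG (\<lambda>g. f i (u ** g ** v))"
    by (intro f_cont2 continuous_intros) (auto intro: GG_mult u)
  show "continuous_on GG (\<lambda>g. c * f i (u' ** g ** v'))"
    by (intro f_cont2 continuous_intros) (auto intro: GG_mult u)
qed (use eq in \<open>simp add: matrix_mul_lid matrix_mul_rid\<close>)

lemma f_right: assumes m: "m \<in> NU UNIV" and g: "g \<in> GG" shows "f i (g ** m) = f i g"
proof -
  have "f i (mat 1 ** g ** m) = 1 * f i (mat 1 ** g ** mat 1)"
  proof (rule GG_extf[OF GG_one NU_GG[OF m] GG_one GG_one _ g])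
    fix n' a n assume n: "n' \<in> NL UNIV" "a \<in> Tor D" "n \<in> NU UNIV"
    have "n' ** a ** n ** m = n' ** a ** (n ** m)" by (simp add: matrix_mul_assoc)
    thus "f i (mat 1 ** (n' ** a ** n) ** m) = 1 * f i (mat 1 ** (n' ** a ** n) ** mat 1)"
      using n m by (simp add: matrix_mul_lid matrix_mul_rid f_val NU_mult)
  qed
  thus ?thesis by (simp add: matrix_mul_lid matrix_mul_rid)
qed

lemma f_left: assumes m: "m \<in> NL UNIV" and g: "g \<in> GG" shows "f i (m ** g) = f i g"
proof -
  have "f i (m ** g ** mat 1) = 1 * f i (mat 1 ** g ** mat 1)"
  proof (rule GG_extf[OF NL_GG[OF m] GG_one GG_one GG_one _ g])
    fix n' a n assume n: "n' \<in> NL UNIV" "a \<in> Tor D" "n \<in> NU UNIV"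
    thus "f i (m ** (n' ** a ** n) ** mat 1) = 1 * f i (mat 1 ** (n' ** a ** n) ** mat 1)"
      using m by (simp add: matrix_mul_lid matrix_mul_rid f_val NL_mult matrix_mul_assoc)
  qed
  thus ?thesis by (simp add: matrix_mul_lid matrix_mul_rid)
qed

lemma f_tor_left: assumes h: "h \<in> Tor D" and g: "g \<in> GG" shows "f i (h ** g) = fchar D i h * f i g"
proof -
  have "f i (h ** g ** mat 1) = fchar D i h * f i (mat 1 ** g ** mat 1)"
  proof (rule GG_extf[OF GG_tor[OF h] GG_one GG_one GG_one _ g])
    fix n' a n assume n: "n' \<in> NL UNIV" "a \<in> Tor D" "n \<in> NU UNIV"
    obtain n1 where n1: "n1 \<in> NL UNIV" "h ** n' = n1 ** h" using tor_NL(1)[OF n(1) h] by blast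
    have "h ** (n' ** a ** n) = n1 ** (h ** a) ** n" by (simp add: matrix_mul_assoc n1)
    thus "f i (h ** (n' ** a ** n) ** mat 1) = fchar D i h * f i (mat 1 ** (n' ** a ** n) ** mat 1)"
      using n n1 h by (simp add: matrix_mul_lid matrix_mul_rid f_val Tor_mult fchar_mult)
  qed
  thus ?thesis by (simp add: matrix_mul_lid matrix_mul_rid)
qed

lemma f_tor_right: assumes h: "h \<in> Tor D" and g: "g \<in> GG" shows "f i (g ** h) = fchar D i h * f i g"
proof -
  have "f i (mat 1 ** g ** h) = fchar D i h * f i (mat 1 ** g ** mat 1)"
  proof (rule GG_extf[OF GG_one GG_tor[OF h] GG_one GG_one _ g])
    fix n' a n assume n: "n' \<in> NL UNIV" "a \<in> Tor D" "n \<in> NU UNIV"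
    obtain n1 where n1: "n1 \<in> NU UNIV" "n ** h = h ** n1" using tor_NU(2)[OF n(3) h] by blast
    have "n' ** a ** n ** h = n' ** a ** (n ** h)" by (simp add: matrix_mul_assoc)
    also have "\<dots> = n' ** (a ** h) ** n1" by (simp add: matrix_mul_assoc n1)
    finally show "f i (mat 1 ** (n' ** a ** n) ** h) = fchar D i h * f i (mat 1 ** (n' ** a ** n) ** mat 1)"
      using n n1 h by (simp add: matrix_mul_lid matrix_mul_rid f_val Tor_mult fchar_mult)
  qed
  thus ?thesis by (simp add: matrix_mul_lid matrix_mul_rid)
qed

lemma f_one: "f i (mat 1) = 1"
  using f_val[OF NL_one Tor_one NU_one, of i] wchar_one[of "fund_weight i"] by (simp add: matrix_mul_lid wchar_fund)

lemma f_w_tor: assumes h: "h \<in> Tor D" and g: "g \<in> GG"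
  shows "f i (g ** h ** w_bar D ws) = wchar D (word_act (Cartan D) ws (fund_weight i)) h * f i (g ** w_bar D ws)"
proof -
  obtain h' where h': "h' \<in> Tor D" "h ** w_bar D ws = w_bar D ws ** h'"
    "\<And>\<gamma>. wchar D \<gamma> h' = wchar D (word_act (Cartan D) ws \<gamma>) h" using tor_w_bar[OF h] by blast
  have "g ** h ** w_bar D ws = g ** w_bar D ws ** h'" by (simp add: h' flip: matrix_mul_assoc)
  hence "f i (g ** h ** w_bar D ws) = fchar D i h' * f i (g ** w_bar D ws)"
    using f_tor_right[OF h'(1) GG_mult[OF g GG_w]] by simp
  thus ?thesis using h'(3)[of "fund_weight i"] by (simp add: wchar_fund)
qed

subsection \<open>Extremality of the Weyl group orbit of a fundamental weight\<close>

text \<open>A vector of weight \<open>\<mu> = w \<omega>\<^sub>i\<close> is killed by raising along \<open>\<alpha>\<^sub>j\<close> when \<open>\<mu>(\<alpha>\<^sub>j\<^sup>\<or>) \<ge> 0\<close>.  In either case for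
  the sign of \<open>w\<^sup>-\<^sup>1\<alpha>\<^sub>j\<close>, conjugating by a cocharacter contracts the parameter \<open>t\<close> to \<open>0\<close>.\<close>

lemma f_up_w:
  assumes g: "g \<in> GG" and pos: "word_act (Cartan D) ws (fund_weight i) $ j \<ge> 0"
  shows "f i (g ** x_up D j t ** w_bar D ws) = f i (g ** w_bar D ws)"
proof -
  let ?A = "Cartan D" let ?w = "w_bar D ws"
  define \<mu> where "\<mu> = word_act ?A ws (fund_weight i)"
  define \<beta> where "\<beta> = word_act ?A (rev ws) (simple_root ?A j)"
  obtain b where b: "\<beta> = root_comb ?A b"
    using word_act_root_lattice[of ?A "rev ws" "axis j 1"] by (auto simp: \<beta>_def root_comb_axis)
  have "b \<noteq> 0"
  proof
    assume "b = 0"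
    hence "word_act ?A ws \<beta> = 0" by (simp add: b)
    hence "simple_root ?A j = 0" by (simp add: \<beta>_def word_act_rev Cartan_diag)
    hence "simple_root ?A j $ j = 0" by simp
    thus False by (simp add: simple_root_nth Cartan_diag)
  qed
  \<comment> \<open>Any coordinate in which w^-1 alpha_j is nonzero provides a contracting coweight;
    the sign of the coordinate decides between the two cases.\<close>
  then obtain l where l: "b $ l \<noteq> 0" by (auto simp: vec_eq_iff)
  define e where "e = nat \<bar>fcd l * b $ l\<bar>"
  have fl: "fcd l > 0" by (rule fcw)
  have e0: "e > 0" using l fl by (simp add: e_def)
  have k: "pairing (fcw l) (simple_root ?A j) \<ge> 0" for j using fcw[of l] by (auto simp: fcw(2) less_imp_le)
  have \<beta>h: "wchar D \<beta> (cochar (fcw l) \<tau>) = \<tau> powi (fcd l * b $ l)" if "\<tau> \<noteq> 0" for \<tau>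
    using that by (simp add: wchar_cochar b pairing_fcw_root_comb)
  \<comment> \<open>it suffices to find one right translate \<open>y\<close> for which the identity holds on \<open>NU UNIV\<close>\<close>
  have reduce: ?thesis
    if y: "y \<in> GG" and eq: "\<And>n. n \<in> NU UNIV \<Longrightarrow> f i (n ** y ** x_up D j t ** ?w) = f i (n ** y ** ?w)" for y
  proof (rule GG_ext[where u = "mat 1", OF _ _ GG_one y _ g])
    show "continuous_on GG (\<lambda>g. f i (g ** x_up D j t ** ?w))" "continuous_on GG (\<lambda>g. f i (g ** ?w))"
      by (intro f_cont2 continuous_intros; auto intro: GG_mult GG_up GG_w)+
    fix n' a n assume n: "n' \<in> NL UNIV" "a \<in> Tor D" "n \<in> NU UNIV"
    have G: "n ** y ** x_up D j t ** ?w \<in> GG" "n ** y ** ?w \<in> GG"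
      using n y by (auto intro!: GG_mult intro: NU_GG GG_up GG_w)
    have "f i (n' ** (a ** (n ** y ** x_up D j t ** ?w))) = fchar D i a * f i (n ** y ** x_up D j t ** ?w)"
      using f_left[OF n(1) GG_mult[OF GG_tor[OF n(2)] G(1)]] f_tor_left[OF n(2) G(1)] by simp
    moreover have "f i (n' ** (a ** (n ** y ** ?w))) = fchar D i a * f i (n ** y ** ?w)"
      using f_left[OF n(1) GG_mult[OF GG_tor[OF n(2)] G(2)]] f_tor_left[OF n(2) G(2)] by simp
    ultimately show "f i (mat 1 ** (n' ** a ** n) ** y ** x_up D j t ** ?w) = f i (mat 1 ** (n' ** a ** n) ** y ** ?w)"
      using eq[OF n(3)] by (simp add: matrix_mul_lid matrix_mul_assoc)
  qed
  have lim_const: "f i (n ** y ** x_up D j t ** ?w) = f i (n ** y ** ?w)"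
    if y: "y \<in> GG" and n: "n \<in> NU UNIV"
      and rel: "\<And>N \<tau> t. \<tau> \<noteq> 0 \<Longrightarrow> N \<in> NU UNIV \<Longrightarrow> cochar (fcw l) \<tau> ** n = N ** cochar (fcw l) \<tau> \<Longrightarrow>
         f i (n ** y ** x_up D j t ** ?w) = \<tau> ^ p * f i (N ** y ** x_up D j (\<tau> ^ e * t) ** ?w)" for y n p
  proof -
    obtain N where N: "\<And>\<tau>. N \<tau> \<in> NU UNIV" "\<And>x. x \<longlonglongrightarrow> 0 \<Longrightarrow> (\<lambda>i::nat. N (x i)) \<longlonglongrightarrow> N 0"
      "\<And>\<tau>. \<tau> \<noteq> 0 \<Longrightarrow> cochar (fcw l) \<tau> ** n = N \<tau> ** cochar (fcw l) \<tau>"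
      using NU_contract[OF n k] by blast
    \<comment> \<open>In the limit the parameter of x_j has become 0, so the value does not depend
      on that parameter; comparing with parameter 0 proves the claim, whatever p is.\<close>
    have "f i (n ** y ** x_up D j s ** ?w) = 0 ^ p * f i (N 0 ** y ** x_up D j 0 ** ?w)" for s
    proof -
      have "(\<lambda>m. null_seq m ^ p * f i (N (null_seq m) ** y ** x_up D j (null_seq m ^ e * s) ** ?w))
        \<longlonglongrightarrow> 0 ^ p * f i (N 0 ** y ** x_up D j (0 ^ e * s) ** ?w)"
        by (intro tendsto_intros null_seq tendsto_f N(2)) (auto intro!: GG_mult intro: NU_GG N(1) y GG_up GG_w)
      moreover have "null_seq m ^ p * f i (N (null_seq m) ** y ** x_up D j (null_seq m ^ e * s) ** ?w) = f i (n ** y ** x_up D j s ** ?w)" for m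
        using rel[OF null_seq(1)[of m] N(1) N(3)[OF null_seq(1)[of m]], of s] by simp
      ultimately show ?thesis using e0 by (simp add: LIMSEQ_const_iff zero_power)
    qed
    from this[of t] this[of 0] show ?thesis by (simp add: x_up_0 matrix_mul_rid)
  qed
  show ?thesis
  proof (cases "b $ l > 0")
    case True
    \<comment> \<open>With base point w^-1 the cocharacter acts on both sides through the same
      weight omega_i, and on alpha_j through w^-1 alpha_j, whose l-th coordinate is positive
      here.\<close>
    define y where "y = matrix_inv ?w"
    have y: "y \<in> GG" by (simp add: y_def GG_cancel GG_w)
    have yw: "y ** ?w = mat 1" "?w ** y = mat 1" by (simp_all add: y_def GG_cancel GG_w)
    have "f i (n ** y ** x_up D j t ** ?w) = f i (n ** y ** ?w)" if n: "n \<in> NU UNIV" for n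
    proof (rule lim_const[OF y n, of 0])
      fix N \<tau> t assume \<tau>: "\<tau> \<noteq> 0" and N: "N \<in> NU UNIV" "cochar (fcw l) \<tau> ** n = N ** cochar (fcw l) \<tau>"
      let ?h = "cochar (fcw l) \<tau>"
      have h: "?h \<in> Tor D" using cochar_Tor[OF \<tau>] .
      obtain h' where h': "h' \<in> Tor D" "?w ** ?h = h' ** ?w" "\<And>\<gamma>. wchar D \<gamma> h' = wchar D (word_act ?A (rev ws) \<gamma>) ?h"
        using tor_w_bar_l[OF h] by blast
      have "y ** (h' ** ?w) ** y = y ** (?w ** ?h) ** y" by (simp add: h')
      hence yh: "y ** h' = ?h ** y" by (metis matrix_mul_assoc matrix_mul_lid matrix_mul_rid yw)
      have "wchar D (simple_root ?A j) h' = \<tau> ^ e"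
        using h'(3)[of "simple_root ?A j"] \<beta>h[OF \<tau>] True fl by (simp add: \<beta>_def[symmetric] e_def power_int_def)
      hence x: "x_up D j (\<tau> ^ e * t) ** h' = h' ** x_up D j t" using conj_up[OF h'(1), of j t] by simp
      have "N ** y ** x_up D j (\<tau> ^ e * t) ** ?w ** ?h = N ** y ** (x_up D j (\<tau> ^ e * t) ** h') ** ?w"
        by (simp add: h'(2) flip: matrix_mul_assoc)
      also have "\<dots> = N ** (y ** h') ** x_up D j t ** ?w" by (simp add: x matrix_mul_assoc)
      also have "\<dots> = (N ** ?h) ** y ** x_up D j t ** ?w" by (simp add: yh matrix_mul_assoc)
      also have "\<dots> = ?h ** (n ** y ** x_up D j t ** ?w)" by (simp add: N(2)[symmetric] matrix_mul_assoc)
      finally have eq: "N ** y ** x_up D j (\<tau> ^ e * t) ** ?w ** ?h = ?h ** (n ** y ** x_up D j t ** ?w)" .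
      have G: "N ** y ** x_up D j (\<tau> ^ e * t) ** ?w \<in> GG" "n ** y ** x_up D j t ** ?w \<in> GG"
        using N(1) n y by (auto intro!: GG_mult intro: NU_GG GG_up GG_w)
      have "fchar D i ?h * f i (N ** y ** x_up D j (\<tau> ^ e * t) ** ?w) = fchar D i ?h * f i (n ** y ** x_up D j t ** ?w)"
        by (simp only: f_tor_right[OF h G(1), symmetric] f_tor_left[OF h G(2), symmetric] eq)
      thus "f i (n ** y ** x_up D j t ** ?w) = \<tau> ^ 0 * f i (N ** y ** x_up D j (\<tau> ^ e * t) ** ?w)"
        using fchar_nz[OF h] by simp
    qed
    thus ?thesis by (rule reduce[OF y])
  next
    case False
    define p where "p = nat (\<mu> $ j)"
    define z where "z = s_bar D j ** ?w"
    \<comment> \<open>The base point (s_j w)^-1 replaces beta by -beta. The weights on the two sides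
      now differ by mu_j times -beta, which produces the factor \<open>\<tau> ^ (e * p)\<close>; its
      exponent is nonnegative because mu_j is.\<close>
    define y where "y = matrix_inv z"
    have z: "z \<in> GG" by (simp add: z_def GG_mult GG_s GG_w)
    have y: "y \<in> GG" by (simp add: y_def GG_cancel z)
    have yw: "y ** z = mat 1" "z ** y = mat 1" by (simp_all add: y_def GG_cancel z)
    have "f i (n ** y ** x_up D j t ** ?w) = f i (n ** y ** ?w)" if n: "n \<in> NU UNIV" for n
    proof (rule lim_const[OF y n, of "e * p"])
      fix N \<tau> t assume \<tau>: "\<tau> \<noteq> 0" and N: "N \<in> NU UNIV" "cochar (fcw l) \<tau> ** n = N ** cochar (fcw l) \<tau>"
      let ?h = "cochar (fcw l) \<tau>"
      have h: "?h \<in> Tor D" using cochar_Tor[OF \<tau>] .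
      obtain h' where h': "h' \<in> Tor D" "z ** ?h = h' ** z"
        "\<And>\<gamma>. wchar D \<gamma> h' = wchar D (word_act ?A (rev (j # ws)) \<gamma>) ?h"
        using tor_w_bar_l[OF h, of "j # ws"] by (auto simp: z_def w_bar_Cons)
      have "y ** (h' ** z) ** y = y ** (z ** ?h) ** y" by (simp add: h')
      hence yh: "y ** h' = ?h ** y" by (metis matrix_mul_assoc matrix_mul_lid matrix_mul_rid yw)
      have wj: "wchar D (simple_root ?A j) h' = wchar D (- \<beta>) ?h"
        using h'(3)[of "simple_root ?A j"]
        by (simp add: word_act_append word_act_Cons simple_refl_root Cartan_diag word_act_minus \<beta>_def)
      have wb: "wchar D (- \<beta>) ?h = \<tau> ^ e" using False l fl \<beta>h[OF \<tau>]
        by (auto simp: wchar_minus e_def power_int_def abs_if mult_less_0_iff not_less le_less zero_less_mult_iff power_inverse)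
      have x: "x_up D j (\<tau> ^ e * t) ** h' = h' ** x_up D j t" using conj_up[OF h'(1), of j t] wj wb by simp
      obtain h4 where h4: "h4 \<in> Tor D" "h' ** ?w = ?w ** h4" "\<And>\<gamma>. wchar D \<gamma> h4 = wchar D (word_act ?A ws \<gamma>) h'"
        using tor_w_bar[OF h'(1)] by blast
      have "fchar D i h4 = wchar D \<mu> h'" using h4(3)[of "fund_weight i"] by (simp add: wchar_fund \<mu>_def)
      also have "\<dots> = wchar D (word_act ?A (rev ws) (\<mu> - (\<mu> $ j) *s simple_root ?A j)) ?h"
        unfolding h'(3) by (simp add: word_act_append word_act_Cons simple_refl_def)
      also have "word_act ?A (rev ws) (\<mu> - (\<mu> $ j) *s simple_root ?A j) = fund_weight i + (\<mu> $ j) *s (- \<beta>)"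
        by (simp add: word_act_diff word_act_smult \<mu>_def word_act_rev Cartan_diag \<beta>_def vec_eq_iff)
      also have "wchar D \<dots> ?h = fchar D i ?h * (\<tau> ^ e) powi (\<mu> $ j)"
        by (simp only: wchar_add[OF fchar_nz[OF h]] wchar_smult_root wchar_fund wb)
      also have "(\<tau> ^ e) powi (\<mu> $ j) = \<tau> ^ (e * p)" using pos by (simp add: p_def \<mu>_def power_int_def power_mult)
      finally have fh4: "fchar D i h4 = fchar D i ?h * \<tau> ^ (e * p)" .
      have "N ** y ** x_up D j (\<tau> ^ e * t) ** ?w ** h4 = N ** y ** (x_up D j (\<tau> ^ e * t) ** h') ** ?w"
        by (simp add: h4(2) flip: matrix_mul_assoc)
      also have "\<dots> = N ** (y ** h') ** x_up D j t ** ?w" by (simp add: x matrix_mul_assoc)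
      also have "\<dots> = (N ** ?h) ** y ** x_up D j t ** ?w" by (simp add: yh matrix_mul_assoc)
      also have "\<dots> = ?h ** (n ** y ** x_up D j t ** ?w)" by (simp add: N(2)[symmetric] matrix_mul_assoc)
      finally have eq: "N ** y ** x_up D j (\<tau> ^ e * t) ** ?w ** h4 = ?h ** (n ** y ** x_up D j t ** ?w)" .
      have G: "N ** y ** x_up D j (\<tau> ^ e * t) ** ?w \<in> GG" "n ** y ** x_up D j t ** ?w \<in> GG"
        using N(1) n y by (auto intro!: GG_mult intro: NU_GG GG_up GG_w)
      have "fchar D i h4 * f i (N ** y ** x_up D j (\<tau> ^ e * t) ** ?w) = fchar D i ?h * f i (n ** y ** x_up D j t ** ?w)"
        by (simp only: f_tor_right[OF h4(1) G(1), symmetric] f_tor_left[OF h G(2), symmetric] eq)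
      thus "f i (n ** y ** x_up D j t ** ?w) = \<tau> ^ (e * p) * f i (N ** y ** x_up D j (\<tau> ^ e * t) ** ?w)"
        using fchar_nz[OF h] by (simp add: fh4)
    qed
    thus ?thesis by (rule reduce[OF y])
  qed
qed

text \<open>Passing s_j across turns the lower root element into an upper one and w into s_j w, and
  the pairing with the coroot changes sign.\<close>

lemma f_low_w:
  assumes g: "g \<in> GG" and neg: "word_act (Cartan D) ws (fund_weight i) $ j \<le> 0"
  shows "f i (g ** x_low D j t ** w_bar D ws) = f i (g ** w_bar D ws)"
proof -
  have s: "x_low D j t = s_bar D j ** coroot D j (-1) ** x_up D j (- t) ** s_bar D j"
    by (simp add: emb_m2 emb_m2_mult)
  have s1: "mat 1 = s_bar D j ** coroot D j (-1) ** s_bar D j"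
    by (simp add: emb_m2 emb_m2_mult emb_one flip: m2_one)
  have G: "g ** (s_bar D j ** coroot D j (-1)) \<in> GG" using g by (intro GG_mult GG_s GG_tor[OF coroot_Tor]) auto
  have p: "word_act (Cartan D) (j # ws) (fund_weight i) $ j \<ge> 0"
    using neg by (simp add: word_act_Cons simple_refl_def simple_root_nth Cartan_diag)
  have "g ** x_low D j t ** w_bar D ws = g ** (s_bar D j ** coroot D j (-1)) ** x_up D j (- t) ** w_bar D (j # ws)"
    by (simp add: s w_bar_Cons matrix_mul_assoc)
  also have "f i \<dots> = f i (g ** (s_bar D j ** coroot D j (-1)) ** w_bar D (j # ws))" by (rule f_up_w[OF G p])
  also have "g ** (s_bar D j ** coroot D j (-1)) ** w_bar D (j # ws) = g ** (s_bar D j ** coroot D j (-1) ** s_bar D j) ** w_bar D ws"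
    by (simp add: w_bar_Cons matrix_mul_assoc)
  finally show ?thesis by (simp add: s1[symmetric] matrix_mul_rid)
qed

text \<open>When the weight is orthogonal to the coroot of j, both root subgroups of j leave the
  minor unchanged, and s_j is a product of three of their elements.\<close>

lemma f_s_w:
  assumes g: "g \<in> GG" and z: "word_act (Cartan D) ws (fund_weight i) $ j = 0"
  shows "f i (g ** w_bar D (j # ws)) = f i (g ** w_bar D ws)"
proof -
  have "g ** w_bar D (j # ws) = g ** x_up D j (-1) ** x_low D j 1 ** x_up D j (-1) ** w_bar D ws"
    by (simp add: w_bar_Cons s_word matrix_mul_assoc)
  also have "f i \<dots> = f i (g ** x_up D j (-1) ** x_low D j 1 ** w_bar D ws)"
    using z g by (intro f_up_w GG_mult GG_up GG_low) auto
  also have "\<dots> = f i (g ** x_up D j (-1) ** w_bar D ws)"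
    using z g by (intro f_low_w GG_mult GG_up GG_low) auto
  also have "\<dots> = f i (g ** w_bar D ws)" using z g by (intro f_up_w) auto
  finally show ?thesis .
qed

text \<open>Conjugating n by a cocharacter that is positive on all simple roots does not change the
  value, and it contracts n to the identity.\<close>

lemma f_w_conj_NU: assumes n: "n \<in> NU UNIV" shows "f i (matrix_inv (w_bar D ws) ** n ** w_bar D ws) = 1"
proof -
  let ?w = "w_bar D ws" let ?v = "matrix_inv ?w"
  have v: "?v \<in> GG" "?w ** ?v = mat 1" "?v ** ?w = mat 1" by (simp_all add: GG_cancel GG_w)
  have pc: "pairing pos_cow (simple_root (Cartan D) j) \<ge> 0" "\<forall>j. pairing pos_cow (simple_root (Cartan D) j) > 0" for j
    using fcw(1) by (simp_all add: pairing_pos_cow less_imp_le)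
  obtain N where N: "\<And>\<tau>. N \<tau> \<in> NU UNIV" "\<And>x. x \<longlonglongrightarrow> 0 \<Longrightarrow> (\<lambda>i::nat. N (x i)) \<longlonglongrightarrow> N 0"
      "\<And>\<tau>. \<tau> \<noteq> 0 \<Longrightarrow> cochar pos_cow \<tau> ** n = N \<tau> ** cochar pos_cow \<tau>" "N 0 = mat 1"
    using NU_contract[OF n pc(1)] pc(2) by blast
  have eq: "f i (?v ** N \<tau> ** ?w) = f i (?v ** n ** ?w)" if \<tau>: "\<tau> \<noteq> 0" for \<tau>
  proof -
    let ?h = "cochar pos_cow \<tau>"
    have h: "?h \<in> Tor D" using cochar_Tor[OF \<tau>] .
    obtain h1 where h1: "h1 \<in> Tor D" "?h ** ?w = ?w ** h1" using tor_w_bar[OF h] by blast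
    have "?v ** (?h ** ?w) ** ?v = ?v ** (?w ** h1) ** ?v" by (simp add: h1)
    hence vh: "?v ** ?h = h1 ** ?v" by (metis matrix_mul_assoc matrix_mul_lid matrix_mul_rid v(2,3))
    have "?v ** N \<tau> ** ?w ** h1 = ?v ** (N \<tau> ** ?h) ** ?w" by (simp add: h1(2)[symmetric] flip: matrix_mul_assoc)
    also have "\<dots> = (?v ** ?h) ** n ** ?w" by (simp add: N(3)[OF \<tau>, symmetric] matrix_mul_assoc)
    also have "\<dots> = h1 ** (?v ** n ** ?w)" by (simp add: vh matrix_mul_assoc)
    finally have e: "?v ** N \<tau> ** ?w ** h1 = h1 ** (?v ** n ** ?w)" .
    have G: "?v ** N \<tau> ** ?w \<in> GG" "?v ** n ** ?w \<in> GG" using v(1) N(1) n by (auto intro!: GG_mult intro: NU_GG GG_w)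
    show ?thesis using f_tor_right[OF h1(1) G(1), of i] f_tor_left[OF h1(1) G(2), of i] e fchar_nz[OF h1(1)] by simp
  qed
  have "(\<lambda>m. f i (?v ** N (null_seq m) ** ?w)) \<longlonglongrightarrow> f i (?v ** N 0 ** ?w)"
    by (intro tendsto_f tendsto_intros null_seq N(2)) (auto intro!: GG_mult intro: v(1) N(1) NU_GG GG_w)
  hence "f i (?v ** n ** ?w) = f i (?v ** N 0 ** ?w)" by (simp add: eq null_seq(1) LIMSEQ_const_iff)
  thus ?thesis by (simp add: N(4) matrix_mul_rid v f_one)
qed

interpretation sw: minors "swap_datum D" "\<lambda>i g. f i (matrix_inv g)"
  by (rule minors_swap) (rule minors_axioms)

lemma f_low_w_left:
  assumes g: "g \<in> GG" and pos: "word_act (Cartan D) ws (fund_weight i) $ j \<ge> 0"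
  shows "f i (matrix_inv (w_bar D ws) ** x_low D j t ** g) = f i (matrix_inv (w_bar D ws) ** g)"
proof -
  have g': "matrix_inv g \<in> sw.GG" using g by (simp add: sw_GG GG_cancel)
  have "f i (matrix_inv (matrix_inv g ** x_low D j (- t) ** w_bar D ws)) = f i (matrix_inv (matrix_inv g ** w_bar D ws))"
    using sw.f_up_w[OF g', of ws i j t] pos by (simp add: w_bar_swap)
  moreover have "matrix_inv (matrix_inv g ** x_low D j (- t) ** w_bar D ws) = matrix_inv (w_bar D ws) ** x_low D j t ** g"
    using g by (simp add: GG_inv_mult GG_mult GG_low GG_w GG_cancel GG_inv_inv x_low_inv matrix_mul_assoc)
  moreover have "matrix_inv (matrix_inv g ** w_bar D ws) = matrix_inv (w_bar D ws) ** g"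
    using g by (simp add: GG_inv_mult GG_w GG_cancel GG_inv_inv)
  ultimately show ?thesis by simp
qed

lemma f_s_w_left:
  assumes g: "g \<in> GG" and z: "word_act (Cartan D) ws (fund_weight i) $ j = 0"
  shows "f i (matrix_inv (w_bar D (j # ws)) ** g) = f i (matrix_inv (w_bar D ws) ** g)"
proof -
  have g': "matrix_inv g \<in> sw.GG" using g by (simp add: sw_GG GG_cancel)
  have "f i (matrix_inv (matrix_inv g ** w_bar D (j # ws))) = f i (matrix_inv (matrix_inv g ** w_bar D ws))"
    using sw.f_s_w[OF g', of ws i j] z by (simp add: w_bar_swap)
  thus ?thesis using g by (simp add: GG_inv_mult GG_w GG_cancel GG_inv_inv)
qed

lemma f_w_conj_NL: assumes n: "n \<in> NL UNIV" shows "f i (matrix_inv (w_bar D ws) ** n ** w_bar D ws) = 1"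
proof -
  have "matrix_inv n \<in> sw.NU UNIV" using sw.NU_inv n by (simp add: NL_def)
  from sw.f_w_conj_NU[OF this, of i ws] show ?thesis
    using NL_GG[OF n] by (simp add: w_bar_swap GG_inv_mult GG_mult GG_w GG_cancel GG_inv_inv matrix_mul_assoc)
qed

subsection \<open>The determinantal identity\<close>

lemma f_up_low: assumes s: "s \<noteq> 0" shows "f i (x_up D i s ** x_low D i t) = 1 + s * t"
proof -
  have gen: "f i (x_up D i s ** x_low D i t) = 1 + s * t" if "1 + s * t \<noteq> 0" for t
    unfolding up_low[OF that] using that
    by (subst f_val) (auto intro: NL_low NU_up coroot_Tor simp: fchar_coroot)
  show ?thesis
  proof (cases "1 + s * t = 0")
    case False thus ?thesis by (rule gen)
  next
    case True
    have "(\<lambda>m. f i (x_up D i s ** x_low D i (t + null_seq m))) \<longlonglongrightarrow> f i (x_up D i s ** x_low D i (t + 0))"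
      by (intro tendsto_f tendsto_intros null_seq) (auto intro!: GG_mult GG_up GG_low)
    moreover have "f i (x_up D i s ** x_low D i (t + null_seq m)) = s * null_seq m" for m
    proof -
      have "1 + s * (t + null_seq m) = (1 + s * t) + s * null_seq m" by (simp add: algebra_simps)
      thus ?thesis using gen[of "t + null_seq m"] True s null_seq(1) by simp
    qed
    moreover have "(\<lambda>m. s * null_seq m) \<longlonglongrightarrow> s * 0" by (intro tendsto_intros null_seq)
    ultimately have "f i (x_up D i s ** x_low D i t) = 0" using LIMSEQ_unique by fastforce
    thus ?thesis using True by simp
  qed
qed

text \<open>On the big cell write g as m' y(q) a x(r) m, with x and y the root subgroups of k and
  with m' and m in the radicals that s_k normalises. The radicals drop out of the minors of g, g s,
  s^-1 g and s^-1 g s, which are A, A r, q A and A (q r + 1/alpha) for A = a^(omega_k) and alpha =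
  a^(alpha_k). The term A^2/alpha is the product over the other indices, since 2 omega_k - alpha_k
  is minus the sum of a_{i,k} omega_i over i different from k.\<close>

theorem minor_identity:
  assumes g: "g \<in> GG"
  shows "f k g * f k (s_inv k ** g ** s_bar D k) = f k (s_inv k ** g) * f k (g ** s_bar D k)
    + (\<Prod>i\<in>UNIV - {k}. f i g ^ nat (- Cartan D $ i $ k))"
proof (rule GG_ext[where u = "mat 1" and v = "mat 1", OF _ _ GG_one GG_one _ g])
  show "continuous_on GG (\<lambda>g. f k g * f k (s_inv k ** g ** s_bar D k))"
    by (intro continuous_intros f_cont2) (auto intro: GG_mult GG_s GG_s_inv)
  show "continuous_on GG (\<lambda>g. f k (s_inv k ** g) * f k (g ** s_bar D k)
    + (\<Prod>i\<in>UNIV - {k}. f i g ^ nat (- Cartan D $ i $ k)))"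
    by (intro continuous_intros f_cont2) (auto intro: GG_mult GG_s GG_s_inv)
  fix n' a n assume n: "n' \<in> NL UNIV" and a: "a \<in> Tor D" and "n \<in> NU UNIV"
  then obtain m r0 where m: "m \<in> MU UNIV k" "n = m ** x_up D k r0" using NU_decomp[of n UNIV k] by auto
  define m2 where "m2 = x_up D k (- r0) ** m ** x_up D k r0"
  have m2: "m2 \<in> MU UNIV k" using MU_conj_up[OF m(1), of "- r0"] by (simp add: m2_def)
  have n_eq: "n = x_up D k r0 ** m2" by (simp add: m2_def m(2) matrix_mul_assoc x_up_add x_up_0 matrix_mul_lid)
  obtain m' q where m': "m' \<in> sw.MU UNIV k" "n' = m' ** x_up (swap_datum D) k q"
    using sw.NU_decomp[of n' UNIV k] n by (auto simp: NL_def)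
  define q0 where "q0 = - q"
  have n'_eq: "n' = m' ** x_low D k q0" by (simp add: m' q0_def)
  have sws: "sw.s_inv k = s_inv k" using sw.s_bar_inv[of k] s_bar_inv[of k] by simp
  define m1 where "m1 = s_inv k ** m' ** s_bar D k"
  have m1: "m1 \<in> NL UNIV" using sw.MU_conj_s(2)[OF m'(1)] sw.MU_NU by (simp add: NL_def m1_def sws)
  have m'L: "m' \<in> NL UNIV" using m'(1) sw.MU_NU by (simp add: NL_def)
  define m3 where "m3 = s_inv k ** m2 ** s_bar D k"
  have m3: "m3 \<in> NU UNIV" using MU_conj_s(2)[OF m2] MU_NU by (simp add: m3_def)
  have m2U: "m2 \<in> NU UNIV" using m2 MU_NU by blast
  have sm': "s_inv k ** m' = m1 ** s_inv k" by (simp add: m1_def s_inv matrix_mul_rid flip: matrix_mul_assoc)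
  have m2s: "m2 ** s_bar D k = s_bar D k ** m3" by (simp add: m3_def matrix_mul_assoc s_inv matrix_mul_lid)
  define G where "G q r = m' ** x_low D k q ** a ** x_up D k r ** m2" for q r
  define \<alpha> where "\<alpha> = wchar D (simple_root (Cartan D) k) a"
  have \<alpha>: "\<alpha> \<noteq> 0" using wchar_nz[OF a] by (simp add: \<alpha>_def)
  have GG: "G q r \<in> GG" for q r
    unfolding G_def using m'L a m2U by (auto intro!: GG_mult intro: NL_GG NU_GG GG_low GG_up GG_tor)
  have F1: "f i (G q r) = fchar D i a" for i q r
  proof -
    have "G q r = (m' ** x_low D k q) ** a ** (x_up D k r ** m2)" by (simp add: G_def matrix_mul_assoc)
    thus ?thesis using m'L a m2U by (simp add: f_val NL_mult NL_low NU_mult NU_up)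
  qed
  have prod: "(\<Prod>i\<in>UNIV - {k}. fchar D i a ^ nat (- Cartan D $ i $ k)) = fchar D k a ^ 2 / \<alpha>"
  proof -
    have "\<alpha> = fchar D k a powi 2 * (\<Prod>i\<in>UNIV - {k}. fchar D i a powi (Cartan D $ i $ k))"
      unfolding \<alpha>_def wchar_def simple_root_nth by (subst prod.remove[of UNIV k]) (auto simp: Cartan_diag)
    also have "(\<Prod>i\<in>UNIV - {k}. fchar D i a powi (Cartan D $ i $ k)) = inverse (\<Prod>i\<in>UNIV - {k}. fchar D i a ^ nat (- Cartan D $ i $ k))"
      unfolding prod_inversef[symmetric] comp_def
    proof (rule prod.cong[OF refl])
      fix i assume "i \<in> UNIV - {k}"
      hence "Cartan D $ i $ k \<le> 0" using Cartan_offdiag by simp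
      thus "fchar D i a powi (Cartan D $ i $ k) = inverse (fchar D i a ^ nat (- Cartan D $ i $ k))"
        by (cases "Cartan D $ i $ k = 0") (auto simp: power_int_def power_inverse)
    qed
    finally have "\<alpha> = fchar D k a ^ 2 * inverse (\<Prod>i\<in>UNIV - {k}. fchar D i a ^ nat (- Cartan D $ i $ k))" by simp
    moreover have "(\<Prod>i\<in>UNIV - {k}. fchar D i a ^ nat (- Cartan D $ i $ k)) \<noteq> 0" by (simp add: fchar_nz[OF a])
    ultimately have "(\<Prod>i\<in>UNIV - {k}. fchar D i a ^ nat (- Cartan D $ i $ k)) * \<alpha> = fchar D k a ^ 2"
      by (simp add: field_simps)
    thus ?thesis using \<alpha> by (simp add: eq_divide_eq)
  qed
  have gen: "f k (G q r) * f k (s_inv k ** G q r ** s_bar D k) = f k (s_inv k ** G q r) * f k (G q r ** s_bar D k)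
    + (\<Prod>i\<in>UNIV - {k}. f i (G q r) ^ nat (- Cartan D $ i $ k))" if q: "q \<noteq> 0" and r: "r \<noteq> 0" for q r
  proof -
    let ?H = "coroot D k"
    have H: "?H q \<in> Tor D" "?H r \<in> Tor D" using q r coroot_Tor by auto
    define c where "c = wchar D (- simple_root (Cartan D) k) a * (1 / r)"
    define c' where "c' = 1 / (q * \<alpha>)"
    have aY: "a ** x_low D k (1 / r) = x_low D k c ** a" by (simp add: c_def conj_low[OF a])
    have Xa: "x_up D k (1 / q) ** a = a ** x_up D k c'" using \<alpha> by (simp add: c'_def conj_up[OF a] \<alpha>_def[symmetric])
    have "G q r ** s_bar D k = m' ** x_low D k q ** a ** x_up D k r ** (m2 ** s_bar D k)" by (simp add: G_def matrix_mul_assoc)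
    also have "\<dots> = m' ** x_low D k q ** a ** (x_up D k r ** s_bar D k) ** m3" by (simp add: m2s matrix_mul_assoc)
    also have "\<dots> = m' ** x_low D k q ** (a ** x_low D k (1 / r)) ** ?H r ** x_up D k (- 1 / r) ** m3" by (simp add: up_s[OF r] matrix_mul_assoc)
    also have "\<dots> = (m' ** x_low D k q ** x_low D k c) ** (a ** ?H r) ** (x_up D k (- 1 / r) ** m3)" by (simp add: aY matrix_mul_assoc)
    finally have "f k (G q r ** s_bar D k) = fchar D k (a ** ?H r)"
      using m'L a H m3 by (simp add: f_val NL_mult NL_low NU_mult NU_up Tor_mult)
    hence F2: "f k (G q r ** s_bar D k) = fchar D k a * r" using a H r by (simp add: fchar_mult fchar_coroot)
    have sG: "s_inv k ** G q r = m1 ** (x_low D k (- 1 / q) ** ?H q ** (x_up D k (1 / q) ** a) ** x_up D k r) ** m2"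
    proof -
      have "s_inv k ** G q r = (s_inv k ** m') ** x_low D k q ** a ** x_up D k r ** m2" by (simp add: G_def matrix_mul_assoc)
      also have "\<dots> = m1 ** (s_inv k ** x_low D k q) ** a ** x_up D k r ** m2" by (simp add: sm' matrix_mul_assoc)
      finally show ?thesis by (simp add: s_low[OF q] matrix_mul_assoc)
    qed
    have "s_inv k ** G q r = (m1 ** x_low D k (- 1 / q)) ** (?H q ** a) ** (x_up D k c' ** x_up D k r ** m2)"
      unfolding sG Xa by (simp add: matrix_mul_assoc)
    hence "f k (s_inv k ** G q r) = fchar D k (?H q ** a)"
      using m1 a H m2U by (simp add: f_val NL_mult NL_low NU_mult NU_up Tor_mult)
    hence F3: "f k (s_inv k ** G q r) = q * fchar D k a" using a H q by (simp add: fchar_mult fchar_coroot)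
    have "s_inv k ** G q r ** s_bar D k = m1 ** x_low D k (- 1 / q) ** ?H q ** (x_up D k (1 / q) ** a) ** x_up D k r ** (m2 ** s_bar D k)"
      unfolding sG by (simp add: matrix_mul_assoc)
    also have "\<dots> = m1 ** x_low D k (- 1 / q) ** ?H q ** (a ** x_up D k c') ** (x_up D k r ** s_bar D k) ** m3"
      by (simp add: Xa m2s matrix_mul_assoc)
    also have "\<dots> = (m1 ** x_low D k (- 1 / q)) ** ((?H q ** a) ** (x_up D k c' ** x_low D k (1 / r) ** ?H r ** (x_up D k (- 1 / r) ** m3)))"
      by (simp add: up_s[OF r] matrix_mul_assoc)
    finally have eq: "s_inv k ** G q r ** s_bar D k = \<dots>" .
    have G4: "x_up D k c' ** x_low D k (1 / r) ** ?H r \<in> GG" "x_up D k c' ** x_low D k (1 / r) \<in> GG"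
      using H by (auto intro!: GG_mult intro: GG_up GG_low GG_tor)
    have n3: "x_up D k (- 1 / r) ** m3 \<in> NU UNIV" using m3 by (intro NU_mult NU_up) auto
    have "f k (s_inv k ** G q r ** s_bar D k) = f k ((?H q ** a) ** (x_up D k c' ** x_low D k (1 / r) ** ?H r ** (x_up D k (- 1 / r) ** m3)))"
      unfolding eq by (rule f_left) (use m1 G4(1) n3 H a in \<open>auto intro!: NL_mult NL_low GG_mult[OF GG_mult] GG_mult[OF G4(1)] intro: GG_tor NU_GG\<close>)
    also have "\<dots> = fchar D k (?H q ** a) * f k (x_up D k c' ** x_low D k (1 / r) ** ?H r ** (x_up D k (- 1 / r) ** m3))"
      by (rule f_tor_left) (use H a n3 G4(1) in \<open>auto intro: Tor_mult GG_mult NU_GG\<close>)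
    also have "f k (x_up D k c' ** x_low D k (1 / r) ** ?H r ** (x_up D k (- 1 / r) ** m3)) = f k (x_up D k c' ** x_low D k (1 / r) ** ?H r)"
      by (rule f_right[OF n3 G4(1)])
    also have "\<dots> = r * f k (x_up D k c' ** x_low D k (1 / r))"
      using f_tor_right[OF H(2) G4(2)] r by (simp add: fchar_coroot)
    also have "f k (x_up D k c' ** x_low D k (1 / r)) = 1 + c' * (1 / r)" by (rule f_up_low) (use q \<alpha> in \<open>simp add: c'_def\<close>)
    finally have F4: "f k (s_inv k ** G q r ** s_bar D k) = q * fchar D k a * (r * (1 + c' * (1 / r)))"
      using a H q by (simp add: fchar_mult fchar_coroot)
    have alg: "A * (q * A * (r * (1 + 1 / (q * \<alpha>) * (1 / r)))) = q * A * (A * r) + A ^ 2 / \<alpha>" for A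
    proof -
      have "r * (1 + 1 / (q * \<alpha>) * (1 / r)) = r + 1 / (q * \<alpha>)" using r by (simp add: distrib_left)
      moreover have "q * A * (r + 1 / (q * \<alpha>)) = q * A * r + A / \<alpha>" using q by (simp add: distrib_left)
      ultimately show ?thesis by (simp add: distrib_left power2_eq_square mult_ac)
    qed
    show ?thesis unfolding F1 F2 F3 F4 prod c'_def by (rule alg)
  qed
  \<comment> \<open>The Gauss decompositions require q and r to be nonzero; zero parameters are
    approached by \<open>null_seq\<close>.\<close>
  define qs where "qs i = (if q0 = 0 then null_seq i else q0)" for i
  define rs where "rs i = (if r0 = 0 then null_seq i else r0)" for i
  have qs: "qs i \<noteq> 0" "qs \<longlonglongrightarrow> q0" and rs: "rs i \<noteq> 0" "rs \<longlonglongrightarrow> r0" for i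
    using null_seq by (cases "q0 = 0"; cases "r0 = 0"; simp add: qs_def[abs_def] rs_def[abs_def])+
  have Gl: "(\<lambda>i. G (qs i) (rs i)) \<longlonglongrightarrow> G q0 r0" unfolding G_def by (intro tendsto_intros qs rs)
  have "(\<lambda>i. f k (G (qs i) (rs i)) * f k (s_inv k ** G (qs i) (rs i) ** s_bar D k))
    \<longlonglongrightarrow> f k (G q0 r0) * f k (s_inv k ** G q0 r0 ** s_bar D k)"
    by (intro tendsto_mult tendsto_f tendsto_matrix_mult tendsto_const Gl) (auto intro!: GG_mult intro: GG GG_s GG_s_inv)
  moreover have "(\<lambda>i. f k (s_inv k ** G (qs i) (rs i)) * f k (G (qs i) (rs i) ** s_bar D k)
      + (\<Prod>j\<in>UNIV - {k}. f j (G (qs i) (rs i)) ^ nat (- Cartan D $ j $ k)))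
    \<longlonglongrightarrow> f k (s_inv k ** G q0 r0) * f k (G q0 r0 ** s_bar D k) + (\<Prod>j\<in>UNIV - {k}. f j (G q0 r0) ^ nat (- Cartan D $ j $ k))"
    by (intro tendsto_add tendsto_prod tendsto_power tendsto_mult tendsto_f tendsto_matrix_mult tendsto_const Gl) (auto intro!: GG_mult intro: GG GG_s GG_s_inv)
  ultimately have "f k (G q0 r0) * f k (s_inv k ** G q0 r0 ** s_bar D k) = f k (s_inv k ** G q0 r0) * f k (G q0 r0 ** s_bar D k)
    + (\<Prod>j\<in>UNIV - {k}. f j (G q0 r0) ^ nat (- Cartan D $ j $ k))"
    unfolding gen[OF qs(1) rs(1)] by (rule LIMSEQ_unique)
  moreover have "G q0 r0 = n' ** a ** n" by (simp add: G_def n'_eq n_eq matrix_mul_assoc)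
  ultimately show "f k (mat 1 ** (n' ** a ** n) ** mat 1) * f k (s_inv k ** (mat 1 ** (n' ** a ** n) ** mat 1) ** s_bar D k) =
    f k (s_inv k ** (mat 1 ** (n' ** a ** n) ** mat 1)) * f k (mat 1 ** (n' ** a ** n) ** mat 1 ** s_bar D k) +
    (\<Prod>i\<in>UNIV - {k}. f i (mat 1 ** (n' ** a ** n) ** mat 1) ^ nat (- Cartan D $ i $ k))"
    by (simp add: matrix_mul_lid matrix_mul_rid)
qed

end


section \<open>Powers of a Coxeter element\<close>

text \<open>A word acts letter by letter from its right end, and no letter may raise the weight. The
  strict variant \<open>sdesc\<close> is kept apart because it forces the word to be reduced
  (\<open>sdesc_reduced\<close>).\<close>

primrec desc :: "'i int_mat \<Rightarrow> 'i list \<Rightarrow> 'i::finite weight \<Rightarrow> bool" where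
  "desc A [] \<gamma> = True"
| "desc A (j # ws) \<gamma> = (word_act A ws \<gamma> $ j \<ge> 0 \<and> desc A ws \<gamma>)"

primrec sdesc :: "'i int_mat \<Rightarrow> 'i list \<Rightarrow> 'i::finite weight \<Rightarrow> bool" where
  "sdesc A [] \<gamma> = True"
| "sdesc A (j # ws) \<gamma> = (word_act A ws \<gamma> $ j > 0 \<and> sdesc A ws \<gamma>)"

text \<open>Omitting the letters that fix the weight turns a weakly descending word into a strictly
  descending one with the same effect on this weight, hence into a reduced word.\<close>

primrec filt :: "'i int_mat \<Rightarrow> 'i list \<Rightarrow> 'i::finite weight \<Rightarrow> 'i list" where
  "filt A [] \<gamma> = []"
| "filt A (j # ws) \<gamma> = (if word_act A ws \<gamma> $ j = 0 then filt A ws \<gamma> else j # filt A ws \<gamma>)"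

lemma desc_append: "desc A (us @ vs) \<gamma> \<longleftrightarrow> desc A us (word_act A vs \<gamma>) \<and> desc A vs \<gamma>"
  by (induction us) (auto simp: word_act_append)

lemma simple_refl_fix: "\<gamma> $ j = 0 \<Longrightarrow> simple_refl A j \<gamma> = \<gamma>"
  by (simp add: simple_refl_def)

lemma filt_act: "word_act A (filt A ws \<gamma>) \<gamma> = word_act A ws \<gamma>"
  by (induction ws) (auto simp: word_act_Cons simple_refl_fix)

lemma filt_sdesc: "desc A ws \<gamma> \<Longrightarrow> sdesc A (filt A ws \<gamma>) \<gamma>"
  by (induction ws) (auto simp: filt_act)

lemma fund_weight_nth: "fund_weight i $ j = (if i = j then 1 else 0)"
  by (simp add: fund_weight_def axis_def)

lemma word_act_fund_fix: "i \<notin> set ws \<Longrightarrow> word_act A ws (fund_weight i) = fund_weight i"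
  by (induction ws) (auto simp: word_act_Cons simple_refl_fix fund_weight_nth)

lemma cox_word_split: 
  obtains us vs where "(cox_word :: 'i::{finite,linorder} list) = us @ k # vs" "set us = {..<k}" "set vs = {k<..}"
proof -
  have s: "sorted (cox_word :: 'i list)" "distinct (cox_word :: 'i list)" "set (cox_word :: 'i list) = UNIV"
    by (simp_all add: cox_word_def)
  obtain us vs where uv: "(cox_word :: 'i list) = us @ k # vs" using s(3) by (metis UNIV_I split_list)
  have "set us \<subseteq> {..<k}" "set vs \<subseteq> {k<..}"
    using s(1,2) unfolding uv by (fastforce simp: sorted_append less_le)+
  moreover have "set us \<union> {k} \<union> set vs = UNIV" using s(3) unfolding uv by auto
  ultimately have "set us = {..<k}" "set vs = {k<..}" by (force)+
  thus thesis using that uv by blast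
qed

definition good :: "'i::{finite,linorder} int_mat \<Rightarrow> nat \<Rightarrow> 'i \<Rightarrow> bool" where
  "good A m k \<longleftrightarrow> (\<forall>p<m. weight_ge A ((cox A ^^ p) (fund_weight k)) ((cox A ^^ Suc p) (fund_weight k)))"

definition cox_pow_word :: "nat \<Rightarrow> 'i::{finite,linorder} list" where
  "cox_pow_word m = concat (replicate m cox_word)"

lemma cox_pow_word_0 [simp]: "cox_pow_word 0 = []" and cox_pow_word_Suc: "cox_pow_word (Suc m) = cox_word @ cox_pow_word m"
  by (simp_all add: cox_pow_word_def)

lemma cox_pow_word_act: "word_act A (cox_pow_word m) \<gamma> = (cox A ^^ m) \<gamma>"
  by (induction m) (simp_all add: cox_pow_word_Suc word_act_append cox_def)

text \<open>The last two conditions carry what the group contributes: real roots have coordinates of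
  one sign, and omega_i is the highest weight of its orbit. They are established on the group in
  \<open>word_act_root_dich\<close> and \<open>weyl_dominance\<close>.\<close>

locale weyl =
  fixes A :: "'i::{finite,linorder} int_mat"
  assumes A_diag: "A $ i $ i = 2"
    and A_off: "i \<noteq> j \<Longrightarrow> A $ i $ j \<le> 0"
    and A_inj: "inj (root_comb A)"
    and dich: "word_act A ws (simple_root A j) = root_comb A q \<Longrightarrow> (\<forall>l. q $ l \<ge> 0) \<or> (\<forall>l. q $ l \<le> 0)"
    and dom: "fund_weight i - word_act A ws (fund_weight i) = root_comb A q \<Longrightarrow> q $ l \<ge> 0"
begin

lemma root_comb_eq_iff: "root_comb A p = root_comb A q \<longleftrightarrow> p = q"
  using A_inj by (auto dest: injD)

lemma act_rev: "word_act A (rev ws) (word_act A ws \<gamma>) = \<gamma>" "word_act A ws (word_act A (rev ws) \<gamma>) = \<gamma>"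
  using word_act_rev[of A] A_diag by blast+

lemma refl_root_comb: "simple_refl A j (root_comb A q) = root_comb A (q - (root_comb A q $ j) *s axis j 1)"
  by (simp add: simple_refl_def root_comb_diff root_comb_smult root_comb_axis)

text \<open>In a word with distinct letters each simple root is subtracted once, so its coefficient
  in the difference is the pairing met at that letter. Descent can thus be read off from the
  difference alone.\<close>

lemma telescope:
  assumes "distinct ws"
  shows "\<exists>q. \<gamma> - word_act A ws \<gamma> = root_comb A q \<and> (\<forall>l. l \<notin> set ws \<longrightarrow> q $ l = 0) \<and> (desc A ws \<gamma> \<longleftrightarrow> (\<forall>l. q $ l \<ge> 0))"
  using assms
proof (induction ws)
  case Nil show ?case by (intro exI[of _ 0]) simp
next
  case (Cons j ws)
  then obtain q where q: "\<gamma> - word_act A ws \<gamma> = root_comb A q" "\<And>l. l \<notin> set ws \<Longrightarrow> q $ l = 0"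
    "desc A ws \<gamma> \<longleftrightarrow> (\<forall>l. q $ l \<ge> 0)" by auto
  have qj: "q $ j = 0" using q(2) Cons.prems by simp
  define p where "p = q + (word_act A ws \<gamma> $ j) *s axis j 1"
  have "\<gamma> - word_act A (j # ws) \<gamma> = root_comb A p"
    using q(1) by (simp add: word_act_Cons simple_refl_def p_def root_comb_add root_comb_smult root_comb_axis)
  moreover have "p $ l = 0" if "l \<notin> set (j # ws)" for l using that q(2) by (simp add: p_def axis_def)
  moreover have "desc A (j # ws) \<gamma> \<longleftrightarrow> (\<forall>l. p $ l \<ge> 0)"
  proof -
    have "p $ l = (if l = j then word_act A ws \<gamma> $ j else q $ l)" for l using qj by (simp add: p_def axis_def)
    thus ?thesis using q(3) qj by auto
  qed
  ultimately show ?case by blast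
qed

text \<open>By linear independence of the simple roots every coefficient of the telescoped
  difference is 0, so each letter already fixes the weight. For a Coxeter word this leaves only the
  weight 0.\<close>

lemma fixed_by_distinct:
  assumes "distinct ws" "word_act A ws \<nu> = \<nu>" "j \<in> set ws" shows "\<nu> $ j = 0"
  using assms
proof (induction ws)
  case (Cons i ws)
  obtain q where q: "\<nu> - word_act A ws \<nu> = root_comb A q" "\<And>l. l \<notin> set ws \<Longrightarrow> q $ l = 0"
    using telescope[of ws \<nu>] Cons.prems by auto
  have "\<nu> - word_act A (i # ws) \<nu> = root_comb A (q + (word_act A ws \<nu> $ i) *s axis i 1)"
    using q(1) by (simp add: word_act_Cons simple_refl_def root_comb_add root_comb_smult root_comb_axis)
  hence z: "q + (word_act A ws \<nu> $ i) *s axis i 1 = 0" using Cons.prems(2) root_comb_eq_iff[of _ 0] by simp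
  have "q $ l = 0" for l
  proof (cases "l = i")
    case True thus ?thesis using q(2) Cons.prems(1) by simp
  next
    case False
    have "(q + (word_act A ws \<nu> $ i) *s axis i 1) $ l = 0" by (simp add: z)
    thus ?thesis using False by (simp add: axis_def)
  qed
  hence q0: "q = 0" by (simp add: vec_eq_iff)
  hence fx: "word_act A ws \<nu> = \<nu>" using q(1) by simp
  have "(q + (word_act A ws \<nu> $ i) *s axis i 1) $ i = 0" by (simp add: z)
  hence "\<nu> $ i = 0" by (simp add: q0 fx)
  thus ?case using Cons fx by auto
qed simp

lemma desc_iff_weight_ge: "desc A cox_word \<gamma> \<longleftrightarrow> weight_ge A \<gamma> (cox A \<gamma>)"
proof -
  obtain q where q: "\<gamma> - word_act A cox_word \<gamma> = root_comb A q" "desc A cox_word \<gamma> \<longleftrightarrow> (\<forall>l. q $ l \<ge> 0)"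
    using telescope[of cox_word \<gamma>] by (auto simp: cox_word_def)
  thus ?thesis unfolding weight_ge_def cox_def q(1) root_comb_eq_iff by auto
qed

lemma good_desc: "good A m k \<Longrightarrow> p < m \<Longrightarrow> desc A cox_word ((cox A ^^ p) (fund_weight k))"
  by (simp add: good_def desc_iff_weight_ge)

lemma good_desc_pow: "good A m k \<Longrightarrow> desc A (cox_pow_word m) (fund_weight k)"
proof (induction m)
  case (Suc m)
  have "good A m k" using Suc.prems by (simp add: good_def)
  thus ?case using Suc good_desc[OF Suc.prems, of m] by (simp add: cox_pow_word_Suc desc_append cox_pow_word_act)
qed simp

text \<open>A reflection at an index absent so far adds a nonnegative multiple of its simple root,
  since all off-diagonal Cartan entries are at most 0.\<close>

lemma fresh:
  assumes "distinct ws" "\<And>l. q $ l \<ge> 0" "\<And>l. l \<in> set ws \<Longrightarrow> q $ l = 0"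
  shows "\<exists>r. word_act A ws (root_comb A q) = root_comb A r \<and> (\<forall>l. r $ l \<ge> 0) \<and> (\<forall>l. l \<notin> set ws \<longrightarrow> r $ l = q $ l)"
  using assms(1,3)
proof (induction ws)
  case Nil thus ?case using assms(2) by auto
next
  case (Cons j ws)
  then obtain r where r: "word_act A ws (root_comb A q) = root_comb A r" "\<And>l. r $ l \<ge> 0" "\<And>l. l \<notin> set ws \<Longrightarrow> r $ l = q $ l"
    by auto
  have rj: "r $ j = 0" using r(3) Cons.prems by simp
  have "root_comb A r $ j \<le> 0" unfolding root_comb_nth
  proof (rule sum_nonpos)
    fix l show "r $ l * A $ j $ l \<le> 0"
    proof (cases "l = j")
      case False thus ?thesis using r(2) A_off[of j l] by (simp add: mult_nonneg_nonpos)
    qed (simp add: rj)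
  qed
  thus ?case using r rj
    by (intro exI[of _ "r - (root_comb A r $ j) *s axis j 1"])
      (auto simp: word_act_Cons refl_root_comb axis_def)
qed

lemma fresh_axis:
  assumes "distinct ws" "i \<notin> set ws"
  obtains r where "word_act A ws (simple_root A i) = root_comb A r" "\<And>l. r $ l \<ge> 0" "r $ i = 1"
    "\<And>l. l \<notin> set ws \<Longrightarrow> l \<noteq> i \<Longrightarrow> r $ l = 0"
proof -
  have "(axis i 1 :: 'i weight) $ l \<ge> 0" "l \<in> set ws \<Longrightarrow> (axis i 1 :: 'i weight) $ l = 0" for l
    using assms(2) by (auto simp: axis_def)
  from fresh[OF assms(1) this] obtain r where r: "word_act A ws (root_comb A (axis i 1)) = root_comb A r"
    "\<forall>l. r $ l \<ge> 0" "\<forall>l. l \<notin> set ws \<longrightarrow> r $ l = axis i 1 $ l" by blast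
  show thesis by (rule that[of r]) (use r(2,3) r(1)[unfolded root_comb_axis] assms(2) in \<open>auto simp: axis_def\<close>)
qed

definition real_root :: "'i weight \<Rightarrow> bool" where
  "real_root \<delta> \<longleftrightarrow> (\<exists>ws j. \<delta> = word_act A ws (simple_root A j))"

lemma real_root_act: "real_root \<delta> \<Longrightarrow> real_root (word_act A ws \<delta>)"
  unfolding real_root_def by (metis word_act_append)

lemma real_root_simple: "real_root (simple_root A j)"
  unfolding real_root_def by (metis word_act_Nil)

lemma real_root_minus: "real_root \<delta> \<Longrightarrow> real_root (- \<delta>)"
proof -
  assume "real_root \<delta>"
  then obtain ws j where "\<delta> = word_act A ws (simple_root A j)" unfolding real_root_def by blast
  hence "- \<delta> = word_act A (ws @ [j]) (simple_root A j)"
    by (simp add: word_act_append word_act_Cons simple_refl_root A_diag word_act_minus)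
  thus ?thesis unfolding real_root_def by blast
qed

definition posr :: "'i weight \<Rightarrow> bool" where "posr \<delta> \<longleftrightarrow> weight_ge A \<delta> 0"

lemma posr_root_comb: "posr (root_comb A q) \<longleftrightarrow> (\<forall>l. q $ l \<ge> 0)"
  unfolding posr_def weight_ge_def by (auto simp: root_comb_eq_iff)

lemma real_root_comb: "real_root \<delta> \<Longrightarrow> \<exists>q. \<delta> = root_comb A q \<and> q \<noteq> 0"
proof -
  assume "real_root \<delta>"
  then obtain ws j where d: "\<delta> = word_act A ws (simple_root A j)" unfolding real_root_def by blast
  then obtain q where q: "\<delta> = root_comb A q"
    using word_act_root_lattice[of A ws "axis j 1"] by (auto simp: root_comb_axis)
  have "q \<noteq> 0"
  proof
    assume "q = 0"
    hence "word_act A (rev ws) (word_act A ws (simple_root A j)) = 0" using d q by simp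
    hence "simple_root A j = 0" by (simp add: act_rev)
    hence "simple_root A j $ j = 0" by simp
    thus False by (simp add: simple_root_nth A_diag)
  qed
  thus ?thesis using q by blast
qed

lemma posr_minus: assumes "real_root \<delta>" shows "posr (- \<delta>) \<longleftrightarrow> \<not> posr \<delta>"
proof -
  obtain q where q: "\<delta> = root_comb A q" "q \<noteq> 0" using real_root_comb[OF assms] by blast
  have d: "(\<forall>l. q $ l \<ge> 0) \<or> (\<forall>l. q $ l \<le> 0)" using assms dich q unfolding real_root_def by metis
  have m: "- \<delta> = root_comb A (- q)" by (simp add: q root_comb_minus)
  show ?thesis unfolding m unfolding q(1) posr_root_comb
  proof
    assume "\<forall>l. (- q) $ l \<ge> 0"
    show "\<not> (\<forall>l. 0 \<le> q $ l)"
    proof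
      assume "\<forall>l. 0 \<le> q $ l"
      with \<open>\<forall>l. (- q) $ l \<ge> 0\<close> have "q $ l = 0" for l by (metis dual_order.antisym neg_0_le_iff_le vector_uminus_component)
      thus False using q(2) by (simp add: vec_eq_iff)
    qed
  next
    assume "\<not> (\<forall>l. 0 \<le> q $ l)" thus "\<forall>l. (- q) $ l \<ge> 0" using d by auto
  qed
qed

text \<open>The reflection changes only the coordinate of alpha_j, so a positive root that it makes
  negative is a multiple of alpha_j. The multiple is 1: after moving the root back to the simple
  root it came from, the multiple divides a coordinate equal to 1.\<close>

lemma simple_flip:
  assumes "real_root \<delta>" "posr \<delta>" "\<not> posr (simple_refl A j \<delta>)"
  shows "\<delta> = simple_root A j"
proof -
  obtain ws k where d: "\<delta> = word_act A ws (simple_root A k)" using assms(1) unfolding real_root_def by blast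
  obtain q where q: "\<delta> = root_comb A q" using real_root_comb[OF assms(1)] by blast
  define c where "c = root_comb A q $ j"
  have sd: "simple_refl A j \<delta> = root_comb A (q - c *s axis j 1)" by (simp add: q refl_root_comb c_def)
  have rr: "real_root (simple_refl A j \<delta>)" using real_root_act[OF assms(1), of "[j]"] by (simp add: word_act_Cons)
  have "posr (- simple_refl A j \<delta>)" using posr_minus[OF rr] assms(3) by simp
  hence neg: "\<And>l. (q - c *s axis j 1) $ l \<le> 0"
    unfolding sd root_comb_minus[symmetric] posr_root_comb by simp
  have pos: "\<And>l. q $ l \<ge> 0" using assms(2) unfolding q posr_root_comb by simp
  have "q $ l = 0" if "l \<noteq> j" for l using neg[of l] pos[of l] that by (simp add: axis_def)
  hence q': "q = (q $ j) *s axis j 1" by (auto simp: vec_eq_iff axis_def)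
  have "\<delta> = (q $ j) *s simple_root A j" by (subst q, subst q') (simp add: root_comb_smult root_comb_axis)
  moreover obtain r where r: "word_act A (rev ws) (simple_root A j) = root_comb A r"
    using word_act_root_lattice[of A "rev ws" "axis j 1"] by (auto simp: root_comb_axis)
  ultimately have "simple_root A k = (q $ j) *s root_comb A r"
    using act_rev(1)[of ws "simple_root A k"] by (simp add: d[symmetric] word_act_smult)
  hence "root_comb A (axis k 1) = root_comb A ((q $ j) *s r)" by (simp add: root_comb_axis root_comb_smult)
  hence "axis k 1 = (q $ j) *s r" by (simp add: root_comb_eq_iff)
  hence "(axis k 1 :: 'i weight) $ k = (q $ j) * r $ k" by simp
  hence "q $ j * r $ k = 1" by simp
  hence "q $ j = 1" using pos[of j] by (metis pos_zmult_eq_1_iff mult_zero_left order_le_less zero_neq_one)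
  thus ?thesis using \<open>\<delta> = (q $ j) *s simple_root A j\<close> by simp
qed

text \<open>Reading the word, the root changes sign at some letter l, and by
  \<open>simple_flip\<close> it is then alpha_l.\<close>

lemma inversion:
  assumes "real_root \<delta>" "posr \<delta>" "\<not> posr (word_act A (rev ws) \<delta>)"
  shows "\<exists>us l vs. ws = us @ l # vs \<and> \<delta> = word_act A us (simple_root A l)"
  using assms
proof (induction ws arbitrary: \<delta>)
  case (Cons j ws)
  have rr: "real_root (simple_refl A j \<delta>)" using real_root_act[OF Cons.prems(1), of "[j]"] by (simp add: word_act_Cons)
  show ?case
  proof (cases "posr (simple_refl A j \<delta>)")
    case True
    have "\<not> posr (word_act A (rev ws) (simple_refl A j \<delta>))" using Cons.prems(3) by (simp add: word_act_append word_act_Cons)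
    then obtain us l vs where "ws = us @ l # vs" "simple_refl A j \<delta> = word_act A us (simple_root A l)"
      using Cons.IH[OF rr True] by blast
    moreover have "\<delta> = simple_refl A j (simple_refl A j \<delta>)" by (simp add: simple_refl_involution A_diag)
    ultimately have "j # ws = (j # us) @ l # vs \<and> \<delta> = word_act A (j # us) (simple_root A l)" by (simp add: word_act_Cons)
    thus ?thesis by blast
  next
    case False
    hence "\<delta> = simple_root A j" using simple_flip Cons.prems by blast
    thus ?thesis by (intro exI[of _ "[]"]) auto
  qed
qed simp

definition inv_set :: "'i list \<Rightarrow> 'i weight set" where
  "inv_set ws = {\<beta>. real_root \<beta> \<and> posr \<beta> \<and> \<not> posr (word_act A ws \<beta>)}"

lemma inv_set_Cons: "inv_set (j # ws) \<subseteq> insert (word_act A (rev ws) (simple_root A j)) (inv_set ws)"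
proof
  fix \<beta> assume b: "\<beta> \<in> inv_set (j # ws)"
  have "\<beta> = word_act A (rev ws) (simple_root A j)" if "posr (word_act A ws \<beta>)"
  proof -
    have "word_act A ws \<beta> = simple_root A j"
      using b that by (intro simple_flip real_root_act) (auto simp: inv_set_def word_act_Cons)
    thus ?thesis using act_rev(1)[of ws \<beta>] by simp
  qed
  thus "\<beta> \<in> insert (word_act A (rev ws) (simple_root A j)) (inv_set ws)" using b by (auto simp: inv_set_def)
qed

lemma inv_set_card: "finite (inv_set ws) \<and> card (inv_set ws) \<le> length ws"
proof (induction ws)
  case Nil show ?case by (auto simp: inv_set_def)
next
  case (Cons j ws)
  have f: "finite (insert (word_act A (rev ws) (simple_root A j)) (inv_set ws))" using Cons by simp
  have "card (inv_set (j # ws)) \<le> card (insert (word_act A (rev ws) (simple_root A j)) (inv_set ws))"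
    by (rule card_mono[OF f inv_set_Cons])
  also have "\<dots> \<le> Suc (card (inv_set ws))" using Cons by (simp add: card_insert_if)
  finally show ?case using Cons finite_subset[OF inv_set_Cons f] by simp
qed

text \<open>With beta = w^-1 alpha_j, reflecting omega_i in beta subtracts a positive multiple of
  beta. The result lies in the orbit of omega_i, hence below omega_i by \<open>dom\<close>.\<close>

lemma pos_pairing_posr:
  assumes "word_act A ws (fund_weight i) $ j > 0"
  shows "posr (word_act A (rev ws) (simple_root A j))"
proof -
  define c where "c = word_act A ws (fund_weight i) $ j"
  obtain q where q: "word_act A (rev ws) (simple_root A j) = root_comb A q"
    using word_act_root_lattice[of A "rev ws" "axis j 1"] by (auto simp: root_comb_axis)
  have "word_act A (rev ws @ j # ws) (fund_weight i) = fund_weight i - c *s root_comb A q"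
    by (simp add: word_act_append word_act_Cons simple_refl_def word_act_diff word_act_smult act_rev q c_def)
  hence "fund_weight i - word_act A (rev ws @ j # ws) (fund_weight i) = root_comb A (c *s q)"
    by (simp add: root_comb_smult)
  from dom[OF this] have "\<And>l. c * q $ l \<ge> 0" by simp
  hence "\<And>l. q $ l \<ge> 0" using assms by (simp add: c_def zero_le_mult_iff)
  thus ?thesis by (simp add: q posr_root_comb)
qed

text \<open>Each strictly descending letter j contributes the new inversion w^-1 alpha_j, positive
  by \<open>pos_pairing_posr\<close>. No old inversion is lost: by \<open>simple_flip\<close> it
  would have to be the negative of the new one.\<close>

lemma sdesc_card: "sdesc A ws (fund_weight i) \<Longrightarrow> card (inv_set ws) = length ws"
proof (induction ws)
  case Nil show ?case by (auto simp: inv_set_def)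
next
  case (Cons j ws)
  define \<beta> where "\<beta> = word_act A (rev ws) (simple_root A j)"
  have b: "real_root \<beta>" "posr \<beta>" "word_act A ws \<beta> = simple_root A j"
    using pos_pairing_posr[of ws i j] Cons.prems by (auto simp: \<beta>_def act_rev intro: real_root_act real_root_simple)
  have ps: "posr (simple_root A j)" using posr_root_comb[of "axis j 1"] by (simp add: root_comb_axis) (simp add: axis_def)
  have nb: "\<beta> \<notin> inv_set ws" using b ps by (simp add: inv_set_def)
  have "inv_set (j # ws) = insert \<beta> (inv_set ws)"
  proof
    show "inv_set (j # ws) \<subseteq> insert \<beta> (inv_set ws)" using inv_set_Cons by (simp add: \<beta>_def)
    have "\<beta> \<in> inv_set (j # ws)"
      using b ps posr_minus[OF real_root_simple, of j] by (simp add: inv_set_def word_act_Cons simple_refl_root A_diag)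
    moreover have "x \<in> inv_set (j # ws)" if x: "x \<in> inv_set ws" for x
    proof (rule ccontr)
      assume "x \<notin> inv_set (j # ws)"
      hence p: "posr (simple_refl A j (word_act A ws x))" using x by (simp add: inv_set_def word_act_Cons)
      have rx: "real_root (word_act A ws x)" using x by (auto simp: inv_set_def intro: real_root_act)
      have rsx: "real_root (simple_refl A j (word_act A ws x))" using real_root_act[OF rx, of "[j]"] by (simp add: word_act_Cons)
      have "- word_act A ws x = simple_root A j"
      proof (rule simple_flip)
        show "real_root (- word_act A ws x)" by (rule real_root_minus[OF rx])
        show "posr (- word_act A ws x)" using x posr_minus[OF rx] by (simp add: inv_set_def)
        have "simple_refl A j (- word_act A ws x) = - simple_refl A j (word_act A ws x)"
          using word_act_minus[of A "[j]"] by (simp add: word_act_Cons)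
        thus "\<not> posr (simple_refl A j (- word_act A ws x))" using p posr_minus[OF rsx] by simp
      qed
      hence "word_act A (rev ws) (- word_act A ws x) = \<beta>" by (simp add: \<beta>_def)
      hence "x = - \<beta>" by (simp add: word_act_minus act_rev) (metis add.inverse_inverse)
      moreover have "posr x" using x by (simp add: inv_set_def)
      ultimately show False using b posr_minus[OF b(1)] by simp
    qed
    ultimately show "insert \<beta> (inv_set ws) \<subseteq> inv_set (j # ws)" by blast
  qed
  thus ?case using Cons nb inv_set_card[of ws] by simp
qed

text \<open>The number of inversions depends only on the action and is at most the length of any
  word for it; here it equals the length.\<close>

lemma sdesc_reduced: assumes "sdesc A ws (fund_weight i)" shows "reduced_word A ws"
  unfolding reduced_word_def
proof (intro allI impI)
  fix vs assume "word_act A vs = word_act A ws"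
  hence "inv_set vs = inv_set ws" by (simp add: inv_set_def)
  thus "length ws \<le> length vs" using sdesc_card[OF assms] inv_set_card[of vs] by simp
qed

text \<open>If a_{k,i} were 0, then s_k s_i alpha_k would be - alpha_k - a_{i,k} alpha_i, a real
  root with coordinates of both signs.\<close>

lemma A_zero_sym: assumes "A $ i $ k \<noteq> 0" shows "A $ k $ i \<noteq> 0"
proof
  assume z: "A $ k $ i = 0"
  have ik: "i \<noteq> k" using z A_diag by auto
  have neg: "A $ i $ k < 0" using A_off[OF ik] assms by simp
  have "word_act A [k, i] (simple_root A k) = root_comb A (- axis k 1 - (A $ i $ k) *s axis i 1)"
    using z ik by (simp add: word_act_Cons vec_eq_iff simple_refl_def simple_root_nth root_comb_diff root_comb_minus
        root_comb_smult root_comb_axis A_diag algebra_simps)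
  from dich[OF this] show False
  proof
    assume "\<forall>l. (- axis k 1 - (A $ i $ k) *s axis i 1) $ l \<ge> 0"
    from this[rule_format, of k] show False using ik by (simp add: axis_def)
  next
    assume "\<forall>l. (- axis k 1 - (A $ i $ k) *s axis i 1) $ l \<le> 0"
    from this[rule_format, of i] show False using ik neg by (simp add: axis_def)
  qed
qed

lemma cox_pow_add: "(cox A ^^ m) (\<gamma> + \<delta>) = (cox A ^^ m) \<gamma> + (cox A ^^ m) \<delta>"
  and cox_pow_diff: "(cox A ^^ m) (\<gamma> - \<delta>) = (cox A ^^ m) \<gamma> - (cox A ^^ m) \<delta>"
  and cox_pow_smult: "(cox A ^^ m) (c *s \<gamma>) = c *s (cox A ^^ m) \<gamma>"
  and cox_pow_minus: "(cox A ^^ m) (- \<gamma>) = - (cox A ^^ m) \<gamma>"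
  unfolding cox_pow_word_act[symmetric] by (rule word_act_add word_act_diff word_act_smult word_act_minus)+

lemma cox_fund:
  assumes "cox_word = us @ k # vs" "set us = {..<k}" "set vs = {k<..}"
  shows "fund_weight k - cox A (fund_weight k) = word_act A us (simple_root A k)"
proof -
  have "cox A (fund_weight k) = word_act A us (simple_refl A k (word_act A vs (fund_weight k)))"
    by (simp add: cox_def assms(1) word_act_append word_act_Cons)
  also have "word_act A vs (fund_weight k) = fund_weight k" using assms(3) by (intro word_act_fund_fix) auto
  also have "simple_refl A k (fund_weight k) = fund_weight k - simple_root A k" by (simp add: simple_refl_def fund_weight_nth)
  also have "word_act A us \<dots> = fund_weight k - word_act A us (simple_root A k)"
    using assms(2) by (simp add: word_act_diff word_act_fund_fix)
  finally show ?thesis by simp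
qed

lemma cox_beta:
  assumes "cox_word = us @ k # vs" "set us = {..<k}" "set vs = {k<..}"
  shows "(cox A ^^ p) (fund_weight k) - (cox A ^^ Suc p) (fund_weight k) = (cox A ^^ p) (word_act A us (simple_root A k))"
  using cox_fund[OF assms] by (simp only: funpow_Suc_right o_apply cox_pow_diff[symmetric])

lemma weight_ge_posr: "weight_ge A \<gamma> \<delta> \<longleftrightarrow> posr (\<gamma> - \<delta>)"
  by (simp add: posr_def weight_ge_def)

lemma good_1: "good A 1 k"
proof -
  obtain us vs where c: "cox_word = us @ k # vs" "set us = {..<k}" "set vs = {k<..}" using cox_word_split[of k] by blast
  have d: "distinct us" using distinct_cox_word[where 'a = 'i] unfolding c(1) by simp
  have "k \<notin> set us" using c(2) by simp
  from fresh_axis[OF d this] obtain r where "word_act A us (simple_root A k) = root_comb A r" "\<And>l. r $ l \<ge> 0"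
    by metis
  hence "posr (word_act A us (simple_root A k))" by (simp add: posr_root_comb)
  thus ?thesis using cox_fund[OF c] by (simp add: good_def weight_ge_posr)
qed

text \<open>At the first failure p the root delta = c^(p+1) omega_i - c^p omega_i is positive while
  c^-1 delta is negative, so delta is an inversion and equals omega_l - c omega_l for some l. Adding
  up, c fixes c^p omega_i + omega_l, and c has no nonzero fixed weight.\<close>

lemma first_bad:
  assumes "\<not> good A m i"
  shows "\<exists>p l. p < m \<and> (cox A ^^ p) (fund_weight i) = - fund_weight l"
proof -
  define P where "P p \<longleftrightarrow> weight_ge A ((cox A ^^ p) (fund_weight i)) ((cox A ^^ Suc p) (fund_weight i))" for p
  have "\<exists>p. p < m \<and> \<not> P p" using assms by (auto simp: good_def P_def)
  define p where "p = (LEAST p. \<not> P p)"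
  have np: "\<not> P p" unfolding p_def using \<open>\<exists>p. p < m \<and> \<not> P p\<close> by (metis LeastI)
  have pm: "p < m" using \<open>\<exists>p. p < m \<and> \<not> P p\<close> unfolding p_def by (metis Least_le le_less_trans)
  have P0: "P 0" using good_1[of i] by (simp add: good_def P_def)
  obtain p' where p': "p = Suc p'" using np P0 by (cases p) auto
  have Pp': "P p'" using p' not_less_Least[of p' "\<lambda>p. \<not> P p"] by (simp add: p_def)
  obtain us vs where c: "cox_word = us @ i # vs" "set us = {..<i}" "set vs = {i<..}" using cox_word_split[of i] by blast
  define \<beta> where "\<beta> = word_act A us (simple_root A i)"
  have rb: "real_root ((cox A ^^ q) \<beta>)" for q
    unfolding \<beta>_def cox_pow_word_act[symmetric] by (intro real_root_act real_root_simple)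
  define \<delta> where "\<delta> = - (cox A ^^ p) \<beta>"
  have d: "real_root \<delta>" unfolding \<delta>_def by (rule real_root_minus[OF rb])
  have pd: "posr \<delta>" using np posr_minus[OF rb] by (simp add: P_def weight_ge_posr cox_beta[OF c, folded \<beta>_def] \<delta>_def del: funpow.simps)
  have "word_act A (rev cox_word) \<delta> = - (cox A ^^ p') \<beta>"
    by (simp add: \<delta>_def p' word_act_minus cox_def act_rev)
  moreover have "posr ((cox A ^^ p') \<beta>)" using Pp' by (simp add: P_def weight_ge_posr cox_beta[OF c, folded \<beta>_def] del: funpow.simps)
  ultimately have "\<not> posr (word_act A (rev cox_word) \<delta>)" using posr_minus[OF rb] by simp
  then obtain us' l vs' where c': "cox_word = us' @ l # vs'" "\<delta> = word_act A us' (simple_root A l)"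
    using inversion[OF d pd] by blast
  obtain us2 vs2 where c2: "(cox_word :: 'i list) = us2 @ l # vs2" "set us2 = {..<l}" "set vs2 = {l<..}" using cox_word_split[of l] by blast
  have "distinct (cox_word :: 'i list)" by (simp add: cox_word_def)
  hence "l \<notin> set us2" "l \<notin> set vs2" "l \<notin> set us'" "l \<notin> set vs'" using c'(1) c2(1) by (metis distinct.simps(2) distinct_append not_distinct_conv_prefix disjoint_iff list.set_intros(1))+
  hence "us2 = us'" using c'(1) c2(1) by (metis append_Cons_eq_iff)
  hence "fund_weight l - cox A (fund_weight l) = \<delta>" using cox_fund[OF c2] c'(2) by simp
  hence c1: "cox A (fund_weight l) = fund_weight l - \<delta>" by (simp add: algebra_simps)
  have "(cox A ^^ p) (fund_weight i) - (cox A ^^ Suc p) (fund_weight i) = - \<delta>"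
    by (simp add: cox_beta[OF c, folded \<beta>_def] \<delta>_def del: funpow.simps)
  hence c2: "cox A ((cox A ^^ p) (fund_weight i)) = (cox A ^^ p) (fund_weight i) + \<delta>" by (simp add: algebra_simps)
  have "cox A ((cox A ^^ p) (fund_weight i) + fund_weight l) = cox A ((cox A ^^ p) (fund_weight i)) + cox A (fund_weight l)"
    by (simp add: cox_def word_act_add)
  hence "cox A ((cox A ^^ p) (fund_weight i) + fund_weight l) = (cox A ^^ p) (fund_weight i) + fund_weight l"
    by (simp add: c1 c2)
  hence "((cox A ^^ p) (fund_weight i) + fund_weight l) $ j = 0" for j
    by (intro fixed_by_distinct[of cox_word]) (auto simp: cox_def cox_word_def)
  hence "(cox A ^^ p) (fund_weight i) + fund_weight l = 0" by (simp add: vec_eq_iff)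
  thus ?thesis using pm by (metis eq_neg_iff_add_eq_0)
qed

text \<open>The root beta pairs positively with c^p omega_i, so the reflection in a positive beta
  would lower that weight. But - omega_l is the lowest weight of its orbit, by \<open>dom\<close>
  applied to omega_l.\<close>

lemma antidominant_contra:
  assumes "(cox A ^^ p) (fund_weight i) = - fund_weight l"
    and "(word_act A us (fund_weight i)) $ k > 0"
    and \<beta>: "\<beta> = (cox A ^^ p) (word_act A (rev us) (simple_root A k))"
  shows "\<not> posr \<beta>"
proof
  assume pos: "posr \<beta>"
  have rr: "real_root \<beta>" unfolding \<beta> cox_pow_word_act[symmetric] by (intro real_root_act real_root_simple)
  define c where "c = word_act A us (fund_weight i) $ k"
  \<comment> \<open>W acts on omega_i as c^p followed by the reflection in beta.\<close>
  define W where "W = cox_pow_word p @ rev us @ k # us"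
  have "word_act A W (fund_weight i) = (cox A ^^ p) (fund_weight i) - c *s \<beta>"
    by (simp add: W_def word_act_append word_act_Cons simple_refl_def word_act_diff word_act_smult act_rev \<beta>
        cox_pow_word_act cox_pow_diff cox_pow_smult c_def)
  also have "\<dots> = - fund_weight l - c *s \<beta>" by (simp add: assms(1))
  finally have e: "word_act A W (fund_weight i) = - fund_weight l - c *s \<beta>" .
  have "fund_weight i = word_act A (rev (cox_pow_word p)) (- fund_weight l)"
    using act_rev(1)[of "cox_pow_word p" "fund_weight i"] assms(1) by (simp add: cox_pow_word_act)
  hence "word_act A W (fund_weight i) = - word_act A (W @ rev (cox_pow_word p)) (fund_weight l)"
    by (simp add: word_act_append word_act_minus)
  hence l: "fund_weight l - word_act A (W @ rev (cox_pow_word p)) (fund_weight l) = - (c *s \<beta>)" using e by (simp add: algebra_simps)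
  obtain q where q: "\<beta> = root_comb A q" "q \<noteq> 0" using real_root_comb[OF rr] by blast
  have "- (c *s \<beta>) = root_comb A (- (c *s q))" by (simp add: q root_comb_minus root_comb_smult)
  from dom[OF l[unfolded this]] have "\<And>l. c * q $ l \<le> 0" by simp
  moreover have "\<And>l. q $ l \<ge> 0" using pos by (simp add: q posr_root_comb)
  moreover have "c > 0" using assms(2) by (simp add: c_def)
  ultimately have "q $ l = 0" for l by (metis mult_le_0_iff order_antisym not_le)
  thus False using q(2) by (simp add: vec_eq_iff)
qed

lemma pairing_pos:
  assumes r: "\<And>l. r $ l \<ge> 0" "r $ i \<ge> 1" "r $ k = 0" and ki: "A $ k $ i < 0" "i \<noteq> k"
  shows "(fund_weight i - root_comb A r) $ k > 0"
proof -
  have "root_comb A r $ k = r $ i * A $ k $ i + (\<Sum>l\<in>UNIV - {i}. r $ l * A $ k $ l)"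
    unfolding root_comb_nth by (subst sum.remove[of UNIV i]) auto
  moreover have "(\<Sum>l\<in>UNIV - {i}. r $ l * A $ k $ l) \<le> 0"
  proof (rule sum_nonpos)
    fix l show "r $ l * A $ k $ l \<le> 0"
      using r A_off[of k l] by (cases "l = k") (auto simp: mult_nonneg_nonpos)
  qed
  moreover have "r $ i * A $ k $ i < 0" using r(2) ki(1) by (simp add: mult_pos_neg)
  ultimately show ?thesis using ki(2) by (simp add: fund_weight_nth)
qed

text \<open>If the chain of i ended at some p < m, then \<open>antidominant_contra\<close> with u =
  (s_1 ... s_{k-1})^-1 would make c^p omega_k - c^(p+1) omega_k negative. The pairing of u omega_i
  with the coroot of k is positive, because i is a neighbour of k and u contains the letter i but
  not k.\<close>

lemma good_neighbour_less:
  assumes "good A m k" "i < k" "A $ i $ k \<noteq> 0"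
  shows "good A m i"
proof (rule ccontr)
  assume "\<not> good A m i"
  then obtain p l where p: "p < m" "(cox A ^^ p) (fund_weight i) = - fund_weight l" using first_bad by blast
  obtain us vs where c: "cox_word = us @ k # vs" "set us = {..<k}" "set vs = {k<..}" using cox_word_split[of k] by blast
  have du: "distinct us" using distinct_cox_word[where 'a = 'i] unfolding c(1) by simp
  obtain u1 u2 where u: "us = u1 @ i # u2" using c(2) assms(2) by (metis lessThan_iff split_list)
  have d2: "distinct (rev u2)" "i \<notin> set u1" "i \<notin> set u2" using du by (auto simp: u)
  have "i \<notin> set (rev u2)" using d2(3) by simp
  from fresh_axis[OF d2(1) this] obtain r where r: "word_act A (rev u2) (simple_root A i) = root_comb A r"
    "\<And>l. r $ l \<ge> 0" "r $ i = 1" "\<And>l. l \<notin> set u2 \<Longrightarrow> l \<noteq> i \<Longrightarrow> r $ l = 0"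
    by (metis set_rev)
  have "word_act A (rev us) (fund_weight i) = word_act A (rev u2) (fund_weight i - simple_root A i)"
    using d2(2) by (simp add: u word_act_append word_act_Cons word_act_fund_fix simple_refl_def fund_weight_nth)
  also have "\<dots> = fund_weight i - root_comb A r"
    using r(1) d2(3) by (simp add: word_act_diff word_act_fund_fix)
  finally have e: "word_act A (rev us) (fund_weight i) = fund_weight i - root_comb A r" .
  have "k \<notin> set us" using c(2) by auto
  hence "r $ k = 0" "r $ i \<ge> 1" using r(3,4) assms(2) by (auto simp: u)
  moreover have "A $ k $ i < 0" using A_zero_sym[OF assms(3)] A_off[of k i] assms(2) by (cases "k = i") auto
  ultimately have "word_act A (rev us) (fund_weight i) $ k > 0"
    unfolding e using r(2) assms(2) by (intro pairing_pos) auto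
  from antidominant_contra[OF p(2) this refl] have "\<not> posr ((cox A ^^ p) (word_act A us (simple_root A k)))" by simp
  thus False using assms(1) p(1) by (simp add: good_def weight_ge_posr cox_beta[OF c] del: funpow.simps)
qed

text \<open>As for smaller neighbours, with an extra c^-1 in u to bring in the letter i. This raises
  p by one in the contradiction, hence the bound m - 1, which suits the recursion: it meets larger
  neighbours one step earlier.\<close>

lemma good_neighbour_greater:
  assumes "good A m k" "k < i" "A $ i $ k \<noteq> 0"
  shows "good A (m - 1) i"
proof (rule ccontr)
  assume "\<not> good A (m - 1) i"
  then obtain p l where p: "p < m - 1" "(cox A ^^ p) (fund_weight i) = - fund_weight l" using first_bad by blast
  obtain us vs where c: "cox_word = us @ k # vs" "set us = {..<k}" "set vs = {k<..}" using cox_word_split[of k] by blast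
  have du: "distinct (rev us)" using distinct_cox_word[where 'a = 'i] unfolding c(1) by simp
  obtain u1 v1 where u: "cox_word = u1 @ i # v1" "set u1 = {..<i}" "set v1 = {i<..}" using cox_word_split[of i] by blast
  have dv: "distinct (rev v1)" using distinct_cox_word[where 'a = 'i] unfolding u(1) by simp
  have "i \<notin> set (rev v1)" using u(3) by simp
  from fresh_axis[OF dv this] obtain r where r: "word_act A (rev v1) (simple_root A i) = root_comb A r"
    "\<And>l. r $ l \<ge> 0" "r $ i = 1" "\<And>l. l \<notin> set v1 \<Longrightarrow> l \<noteq> i \<Longrightarrow> r $ l = 0"
    by (metis set_rev)
  have r0: "r $ l = 0" if "l \<in> set (rev us)" for l using that c(2) r(4) u(3) assms(2) by auto
  obtain r' where r': "word_act A (rev us) (root_comb A r) = root_comb A r'" "\<forall>l. r' $ l \<ge> 0" "\<forall>l. l \<notin> set us \<longrightarrow> r' $ l = r $ l"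
    using fresh[OF du, of r] r0 r(2) by auto
  define U where "U = rev us @ rev (cox_word :: 'i list)"
  have "word_act A (rev (cox_word :: 'i list)) (fund_weight i) = word_act A (rev v1) (fund_weight i - simple_root A i)"
    using u(2) by (simp add: u(1) word_act_append word_act_Cons word_act_fund_fix simple_refl_def fund_weight_nth)
  also have "\<dots> = fund_weight i - root_comb A r"
    using r(1) u(3) by (simp add: word_act_diff word_act_fund_fix)
  finally have "word_act A U (fund_weight i) = fund_weight i - root_comb A r'"
    using c(2) assms(2) by (simp add: U_def word_act_append word_act_diff word_act_fund_fix r'(1))
  moreover have "r' $ k = 0" "r' $ i \<ge> 1" using r'(3) r(3,4) c(2) u(3) assms(2) by auto
  moreover have "A $ k $ i < 0" using A_zero_sym[OF assms(3)] A_off[of k i] assms(2) by (cases "k = i") auto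
  ultimately have "word_act A U (fund_weight i) $ k > 0"
    using r'(2) assms(2) by (simp del: vector_minus_component add: pairing_pos)
  from antidominant_contra[OF p(2) this refl] have "\<not> posr ((cox A ^^ p) (word_act A (rev U) (simple_root A k)))" .
  also have "(cox A ^^ p) (word_act A (rev U) (simple_root A k)) = (cox A ^^ Suc p) (word_act A us (simple_root A k))"
    by (simp only: U_def rev_append rev_rev_ident word_act_append funpow_Suc_right o_apply cox_def)
  finally show False using assms(1) p(1) by (simp add: good_def weight_ge_posr cox_beta[OF c] del: funpow.simps)
qed

end


section \<open>A chart of the reduced double cell\<close>

text \<open>With \<open>T i = \<Delta>\<^bsub>\<omega>\<^sub>i,c\<omega>\<^sub>i\<^esub>\<close> and \<open>ws = cox_word\<close> this is the coefficient \<open>y\<^bsub>i;c\<^esub>\<close>, cf. \<open>y_coef_chart\<close>.\<close>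

primrec EE :: "'i int_mat \<Rightarrow> 'i list \<Rightarrow> ('i \<Rightarrow> complex) \<Rightarrow> 'i::finite \<Rightarrow> complex" where
  "EE A [] T i = 1"
| "EE A (j # ws) T i = (if i = j then T j else T j powi (A $ j $ i) * EE A ws T i)"

lemma EE_nz: "(\<And>i. T i \<noteq> 0) \<Longrightarrow> EE A ws T i \<noteq> 0"
  by (induction ws) auto

lemma EE_divide: "EE A ws (\<lambda>i. T i / T' i) i = EE A ws T i / EE A ws T' i"
  by (induction ws) (auto simp: power_int_divide_distrib)

lemma EE_cong: "(\<And>j. j \<in> set ws \<Longrightarrow> T j = T' j) \<Longrightarrow> EE A ws T i = EE A ws T' i"
  by (induction ws) auto

lemma EE_split: "distinct (us @ i # vs) \<Longrightarrow> EE A (us @ i # vs) T i = (\<Prod>l\<leftarrow>us. T l powi (A $ l $ i)) * T i"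
  by (induction us) (auto simp: mult.assoc)

definition posR :: "complex \<Rightarrow> bool" where "posR z \<longleftrightarrow> (\<exists>r>0. z = complex_of_real r)"

lemma posR_mult: "posR a \<Longrightarrow> posR b \<Longrightarrow> posR (a * b)" 
  unfolding posR_def by (metis mult_pos_pos of_real_mult)
lemma posR_add: "posR a \<Longrightarrow> posR b \<Longrightarrow> posR (a + b)" 
  unfolding posR_def by (metis add_pos_pos of_real_add)
lemma posR_powi: "posR a \<Longrightarrow> posR (a powi n)" 
  unfolding posR_def by (metis of_real_power_int zero_less_power_int)
lemma posR_1: "posR 1" unfolding posR_def by (metis of_real_1 zero_less_one)
lemma posR_nz: "posR a \<Longrightarrow> a \<noteq> 0" unfolding posR_def by auto
lemma posR_prod: "(\<And>x. x \<in> S \<Longrightarrow> posR (g x)) \<Longrightarrow> posR (\<Prod>x\<in>S. g x)"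
  by (induction S rule: infinite_finite_induct) (auto intro: posR_1 posR_mult)
lemma posR_divide: "posR a \<Longrightarrow> posR b \<Longrightarrow> posR (a / b)" 
  unfolding posR_def by (metis divide_pos_pos of_real_divide)

text \<open>A triangular system, solved from the left end of the word by monomials; positive data
  therefore have a positive solution.\<close>

lemma EE_surj:
  assumes "distinct ws" "\<And>i. y i \<noteq> 0"
  shows "\<exists>T. (\<forall>i. T i \<noteq> 0) \<and> (\<forall>i\<in>set ws. EE A ws T i = y i) \<and> ((\<forall>i. posR (y i)) \<longrightarrow> (\<forall>i. posR (T i)))"
  using assms
proof (induction ws arbitrary: y)
  case Nil show ?case by (intro exI[of _ "\<lambda>_. 1"]) (simp add: posR_1)
next
  case (Cons j ws)
  define y' where "y' i = y i * y j powi (- A $ j $ i)" for i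
  have nz: "\<And>i. y' i \<noteq> 0" using Cons.prems by (simp add: y'_def)
  have "distinct ws" using Cons.prems by simp
  from Cons.IH[of y', OF this nz] obtain T where T: "\<And>i. T i \<noteq> 0" "\<And>i. i\<in>set ws \<Longrightarrow> EE A ws T i = y' i" "(\<forall>i. posR (y' i)) \<longrightarrow> (\<forall>i. posR (T i))"
    by blast
  define T' where "T' = T(j := y j)"
  have "EE A ws T' i = EE A ws T i" for i using Cons.prems(1) by (intro EE_cong) (auto simp: T'_def)
  hence "EE A (j # ws) T' i = y i" if "i \<in> set (j # ws)" for i
    using T(2)[of i] that Cons.prems(2)[of j] by (auto simp: T'_def y'_def power_int_minus)
  moreover have "(\<forall>i. posR (y i)) \<longrightarrow> (\<forall>i. posR (T' i))"
    using T(3) by (auto simp: T'_def y'_def intro: posR_mult posR_powi)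
  moreover have "\<forall>i. T' i \<noteq> 0" using T(1) Cons.prems(2) by (simp add: T'_def)
  ultimately show ?case by blast
qed

context pinning begin

interpretation sw: pinning "swap_datum D" by (rule pinning_swap) (rule pinning_axioms)

definition lowp :: "'i list \<Rightarrow> ('i \<Rightarrow> complex) \<Rightarrow> complex^'m^'m" where
  "lowp ws u = foldr (\<lambda>i g. x_low D i (u i) ** g) ws (mat 1)"
definition upp :: "'i list \<Rightarrow> ('i \<Rightarrow> complex) \<Rightarrow> complex^'m^'m" where
  "upp ws u = foldr (\<lambda>i g. x_up D i (u i) ** g) ws (mat 1)"
definition torp :: "'i list \<Rightarrow> ('i \<Rightarrow> complex) \<Rightarrow> complex^'m^'m" where
  "torp ws u = foldr (\<lambda>i g. coroot D i (u i) ** g) ws (mat 1)"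
text \<open>These products parametrise N w N modulo N on the right (\<open>NwN_form\<close>,
  \<open>pprod_NwN\<close>). For the Coxeter word the parameters are the principal minors
  (\<open>f_pprod\<close>).\<close>

definition pprod :: "'i list \<Rightarrow> ('i \<Rightarrow> complex) \<Rightarrow> complex^'m^'m" where
  "pprod ws u = foldr (\<lambda>i g. x_up D i (u i) ** s_bar D i ** g) ws (mat 1)"

lemma lowp_simps: "lowp [] u = mat 1" "lowp (i # ws) u = x_low D i (u i) ** lowp ws u"
  and upp_simps: "upp [] u = mat 1" "upp (i # ws) u = x_up D i (u i) ** upp ws u"
  and torp_simps: "torp [] u = mat 1" "torp (i # ws) u = coroot D i (u i) ** torp ws u"
  and pprod_simps: "pprod [] u = mat 1" "pprod (i # ws) u = x_up D i (u i) ** s_bar D i ** pprod ws u"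
  by (simp_all add: lowp_def upp_def torp_def pprod_def)

lemma upp_append: "upp (us @ vs) u = upp us u ** upp vs u"
  by (induction us) (simp_all add: upp_simps matrix_mul_lid matrix_mul_assoc)

lemma lowp_cong: "(\<And>i. i \<in> set ws \<Longrightarrow> u i = u' i) \<Longrightarrow> lowp ws u = lowp ws u'"
  and upp_cong: "(\<And>i. i \<in> set ws \<Longrightarrow> u i = u' i) \<Longrightarrow> upp ws u = upp ws u'"
  and pprod_cong: "(\<And>i. i \<in> set ws \<Longrightarrow> u i = u' i) \<Longrightarrow> pprod ws u = pprod ws u'"
  by (induction ws) (auto simp: lowp_simps upp_simps pprod_simps)

lemma lowp_NL: "lowp ws u \<in> NL (set ws)"
proof -
  have "set us \<subseteq> J \<Longrightarrow> lowp us u \<in> NL J" for us J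
    by (induction us) (auto simp: lowp_simps intro: NL_one NL_mult NL_low)
  thus ?thesis by blast
qed

lemma upp_NU: "upp ws u \<in> NU (set ws)"
proof -
  have "set us \<subseteq> J \<Longrightarrow> upp us u \<in> NU J" for us J
    by (induction us) (auto simp: upp_simps intro: NU_one NU_mult NU_up)
  thus ?thesis by blast
qed

lemma NL_mono: "n \<in> NL J \<Longrightarrow> J \<subseteq> K \<Longrightarrow> n \<in> NL K"
  using sw.NU_mono by (simp add: NL_def)

lemma lowp_NL': "lowp ws u \<in> NL UNIV" and upp_NU': "upp ws u \<in> NU UNIV"
  using lowp_NL NL_mono upp_NU NU_mono by blast+

lemma torp_Tor: "(\<And>i. i \<in> set ws \<Longrightarrow> u i \<noteq> 0) \<Longrightarrow> torp ws u \<in> Tor D"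
  unfolding torp_def by (rule foldr_coroot_Tor)

lemma wchar_torp: "(\<And>i. i \<in> set ws \<Longrightarrow> u i \<noteq> 0) \<Longrightarrow> wchar D \<gamma> (torp ws u) = (\<Prod>j\<leftarrow>ws. u j powi (\<gamma> $ j))"
  unfolding torp_def by (rule wchar_foldr_coroot)

lemma wchar_torp_cox: "(\<And>i. u i \<noteq> 0) \<Longrightarrow> wchar D \<gamma> (torp cox_word u) = (\<Prod>j\<in>UNIV. u j powi (\<gamma> $ j))"
  by (subst wchar_torp) (auto simp: prod.distinct_set_conv_list[symmetric])

lemma up_NL_commute: "n \<in> NL J \<Longrightarrow> i \<notin> J \<Longrightarrow> x_up D i t ** n = n ** x_up D i t"
  using sw.low_NU_commute[of n J i "- t"] by (simp add: NL_def)

lemma coroot_lowp: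
  assumes "t \<noteq> 0" shows "coroot D j t ** lowp ws u = lowp ws (\<lambda>l. t powi (- Cartan D $ j $ l) * u l) ** coroot D j t"
proof (induction ws)
  case (Cons i ws)
  have "coroot D j t ** lowp (i # ws) u = (coroot D j t ** x_low D i (u i)) ** lowp ws u"
    by (simp add: lowp_simps matrix_mul_assoc)
  also have "\<dots> = x_low D i (t powi (- Cartan D $ j $ i) * u i) ** (coroot D j t ** lowp ws u)"
    using assms by (simp add: conj_low[OF coroot_Tor] wchar_coroot simple_root_nth flip: matrix_mul_assoc)
  finally show ?case by (simp add: Cons lowp_simps matrix_mul_assoc)
qed (simp add: lowp_simps matrix_mul_lid matrix_mul_rid)

lemma upp_coroot:
  assumes "t \<noteq> 0" shows "upp ws u ** coroot D j t = coroot D j t ** upp ws (\<lambda>l. t powi (- Cartan D $ j $ l) * u l)"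
proof (induction ws)
  case (Cons i ws)
  have "coroot D j t ** x_up D i (t powi (- Cartan D $ j $ i) * u i) = x_up D i (u i) ** coroot D j t"
  proof -
    have "t powi (Cartan D $ j $ i) * (t powi (- Cartan D $ j $ i) * u i) = u i" using assms by (simp add: power_int_minus)
    thus ?thesis by (simp only: conj_up[OF coroot_Tor[OF assms]] wchar_coroot[OF assms] simple_root_nth)
  qed
  thus ?case using Cons by (simp add: upp_simps matrix_mul_assoc) (simp flip: matrix_mul_assoc)
qed (simp add: upp_simps matrix_mul_lid matrix_mul_rid)

text \<open>In each step the part of n in the radical for i passes through s_i and stays in N, which
  leaves one parameter.\<close>

lemma NwN_form:
  assumes "distinct ws" "n \<in> NU UNIV"
  shows "\<exists>\<tau>. \<exists>n'\<in>NU UNIV. n ** w_bar D ws = pprod ws \<tau> ** n'"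
  using assms
proof (induction ws arbitrary: n)
  case Nil thus ?case by (auto simp: pprod_simps matrix_mul_lid matrix_mul_rid)
next
  case (Cons i ws)
  obtain m r where m: "m \<in> MU UNIV i" "n = m ** x_up D i r" using NU_decomp[OF Cons.prems(2), of i] by auto
  define m2 where "m2 = x_up D i (- r) ** m ** x_up D i r"
  have m2: "m2 \<in> MU UNIV i" using MU_conj_up[OF m(1), of "- r"] by (simp add: m2_def)
  have n_eq: "n = x_up D i r ** m2" by (simp add: m2_def m(2) matrix_mul_assoc x_up_add x_up_0 matrix_mul_lid)
  define m3 where "m3 = s_inv i ** m2 ** s_bar D i"
  have m3: "m3 \<in> NU UNIV" using MU_conj_s(2)[OF m2] MU_NU by (simp add: m3_def)
  have m2s: "m2 ** s_bar D i = s_bar D i ** m3" by (simp add: m3_def matrix_mul_assoc s_inv matrix_mul_lid)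
  obtain \<tau> n' where t: "n' \<in> NU UNIV" "m3 ** w_bar D ws = pprod ws \<tau> ** n'" using Cons.IH[OF _ m3] Cons.prems by auto
  have "n ** w_bar D (i # ws) = x_up D i r ** (m2 ** s_bar D i) ** w_bar D ws" by (simp add: n_eq w_bar_Cons matrix_mul_assoc)
  also have "\<dots> = x_up D i r ** s_bar D i ** (m3 ** w_bar D ws)" by (simp add: m2s matrix_mul_assoc)
  also have "\<dots> = x_up D i r ** s_bar D i ** pprod ws (\<tau>(i := r)) ** n'"
  proof -
    have "pprod ws \<tau> = pprod ws (\<tau>(i := r))" using Cons.prems by (intro pprod_cong) auto
    thus ?thesis by (simp only: t matrix_mul_assoc)
  qed
  also have "\<dots> = pprod (i # ws) (\<tau>(i := r)) ** n'" by (simp add: pprod_simps)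
  finally show ?case using t(1) by blast
qed

lemma pprod_NwN:
  assumes "distinct ws" shows "\<exists>n\<in>NU (set ws). pprod ws \<tau> = n ** w_bar D ws"
  using assms
proof (induction ws)
  case Nil show ?case using NU_one by (auto simp: pprod_simps matrix_mul_lid)
next
  case (Cons i ws)
  then obtain n where n: "n \<in> NU (set ws)" "pprod ws \<tau> = n ** w_bar D ws" by auto
  have "n \<in> MU (insert i (set ws)) i" using NU_MU[OF n(1)] Cons.prems by simp
  hence n1: "s_bar D i ** n ** s_inv i \<in> NU (insert i (set ws))" using MU_conj_s(1) MU_NU by blast
  have "pprod (i # ws) \<tau> = x_up D i (\<tau> i) ** (s_bar D i ** n ** (s_inv i ** s_bar D i)) ** w_bar D ws"
    by (simp add: pprod_simps n s_inv matrix_mul_rid matrix_mul_assoc)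
  also have "\<dots> = (x_up D i (\<tau> i) ** (s_bar D i ** n ** s_inv i)) ** w_bar D (i # ws)" by (simp add: w_bar_Cons matrix_mul_assoc)
  finally show ?case using n1 by (auto intro: NU_mult NU_up)
qed

text \<open>Decompose each x_j(tau_j) s_j in SL_2. Its upper part commutes with the lower elements
  of the later letters, which differ from j, and moving its coroot through them produces the factors
  collected in \<open>EE\<close>.\<close>

lemma pprod_gauss:
  assumes "distinct ws" "\<And>i. \<tau> i \<noteq> 0"
  shows "\<exists>n\<in>NU UNIV. pprod ws \<tau> = lowp ws (\<lambda>i. 1 / EE (Cartan D) ws \<tau> i) ** torp ws \<tau> ** n"
  using assms(1)
proof (induction ws)
  case Nil show ?case by (rule bexI[OF _ NU_one]) (simp add: pprod_simps lowp_simps torp_simps matrix_mul_lid)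
next
  case (Cons j ws)
  let ?A = "Cartan D"
  obtain n where n: "n \<in> NU UNIV" "pprod ws \<tau> = lowp ws (\<lambda>i. 1 / EE ?A ws \<tau> i) ** torp ws \<tau> ** n" using Cons by auto
  have T: "torp ws \<tau> \<in> Tor D" using assms(2) by (intro torp_Tor)
  obtain n1 where n1: "n1 \<in> NU UNIV" "x_up D j (- 1 / \<tau> j) ** torp ws \<tau> = torp ws \<tau> ** n1"
    using tor_NU(2)[OF NU_up[of j UNIV] T] by blast
  have jw: "j \<notin> set ws" using Cons.prems by simp
  have u: "lowp ws (\<lambda>l. \<tau> j powi (- ?A $ j $ l) * (1 / EE ?A ws \<tau> l)) = lowp ws (\<lambda>i. 1 / EE ?A (j # ws) \<tau> i)"
    using jw by (intro lowp_cong) (auto simp: power_int_minus field_simps)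
  have "pprod (j # ws) \<tau> = x_low D j (1 / \<tau> j) ** coroot D j (\<tau> j) ** x_up D j (- 1 / \<tau> j) ** (lowp ws (\<lambda>i. 1 / EE ?A ws \<tau> i) ** torp ws \<tau> ** n)"
    by (simp add: pprod_simps n up_s assms(2))
  also have "\<dots> = x_low D j (1 / \<tau> j) ** coroot D j (\<tau> j) ** (x_up D j (- 1 / \<tau> j) ** lowp ws (\<lambda>i. 1 / EE ?A ws \<tau> i)) ** torp ws \<tau> ** n"
    by (simp add: matrix_mul_assoc)
  also have "x_up D j (- 1 / \<tau> j) ** lowp ws (\<lambda>i. 1 / EE ?A ws \<tau> i) = lowp ws (\<lambda>i. 1 / EE ?A ws \<tau> i) ** x_up D j (- 1 / \<tau> j)"
    by (rule up_NL_commute[OF lowp_NL jw])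
  also have "x_low D j (1 / \<tau> j) ** coroot D j (\<tau> j) ** (lowp ws (\<lambda>i. 1 / EE ?A ws \<tau> i) ** x_up D j (- 1 / \<tau> j)) ** torp ws \<tau> ** n
    = x_low D j (1 / \<tau> j) ** (coroot D j (\<tau> j) ** lowp ws (\<lambda>i. 1 / EE ?A ws \<tau> i)) ** (x_up D j (- 1 / \<tau> j) ** torp ws \<tau>) ** n"
    by (simp add: matrix_mul_assoc)
  also have "\<dots> = x_low D j (1 / \<tau> j) ** lowp ws (\<lambda>i. 1 / EE ?A (j # ws) \<tau> i) ** (coroot D j (\<tau> j) ** torp ws \<tau>) ** (n1 ** n)"
    unfolding coroot_lowp[OF assms(2)] u n1(2) by (simp add: matrix_mul_assoc)
  also have "\<dots> = lowp (j # ws) (\<lambda>i. 1 / EE ?A (j # ws) \<tau> i) ** torp (j # ws) \<tau> ** (n1 ** n)"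
    by (simp add: lowp_simps torp_simps)
  finally show ?case using n1 n NU_mult by blast
qed

text \<open>The first two factors come from \<open>pprod_gauss\<close>, which places the point in N
  c N with principal minors tau. The last factor has the reversed order because of B_- c^-1 B_-, and
  its parameters are normalised so that the coefficients become y
  (\<open>y_coef_chart\<close>).\<close>

definition chart :: "('i \<Rightarrow> complex) \<Rightarrow> ('i \<Rightarrow> complex) \<Rightarrow> complex^'m^'m" where
  "chart \<tau> y = lowp cox_word (\<lambda>i. 1 / EE (Cartan D) cox_word \<tau> i) ** torp cox_word \<tau> **
     upp (rev cox_word) (\<lambda>i. y i / EE (Cartan D) cox_word \<tau> i)"

lemma chart_GG: "(\<And>i. \<tau> i \<noteq> 0) \<Longrightarrow> chart \<tau> y \<in> GG"
  unfolding chart_def by (intro GG_mult GG_tor torp_Tor NL_GG[OF lowp_NL'] NU_GG[OF upp_NU']) auto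

end

section \<open>Twisted minors on the chart and their recursion\<close>

context minors begin

text \<open>Suppose the l-th coordinate is negative. The function f_i(n w) of n in N is not
  identically 0, by density and its value at n = w^-1 in the group. But conjugation by the coweight
  of l writes each value as a positive power of \<open>\<tau>\<close> times a convergent factor, so
  all values vanish.\<close>

lemma weyl_dominance:
  assumes q: "fund_weight i - word_act (Cartan D) ws (fund_weight i) = root_comb (Cartan D) q"
  shows "q $ l \<ge> 0"
proof (rule ccontr)
  assume neg: "\<not> q $ l \<ge> 0"
  let ?w = "w_bar D ws"
  have "\<exists>n\<in>NU UNIV. f i (n ** ?w) \<noteq> 0"
  proof (rule ccontr)
    assume z: "\<not> ?thesis"
    have "f i (matrix_inv ?w ** ?w) = (\<lambda>_. 0) (matrix_inv ?w)"
    proof (rule GG_ext[where u = "mat 1" and v = "mat 1" and \<phi> = "\<lambda>g. f i (g ** ?w)", OF _ _ GG_one GG_one])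
      show "continuous_on GG (\<lambda>g. f i (g ** ?w))" by (intro f_cont2 continuous_intros) (auto intro: GG_mult GG_w)
      fix n' a n assume n: "n' \<in> NL UNIV" "a \<in> Tor D" "n \<in> NU UNIV"
      have G: "n ** ?w \<in> GG" "a ** (n ** ?w) \<in> GG" using n by (auto intro!: GG_mult intro: NU_GG GG_w GG_tor)
      have "f i (n' ** (a ** (n ** ?w))) = fchar D i a * f i (n ** ?w)"
        using f_left[OF n(1) G(2)] f_tor_left[OF n(2) G(1)] by simp
      thus "f i (mat 1 ** (n' ** a ** n) ** mat 1 ** ?w) = 0"
        using z n(3) by (simp add: matrix_mul_lid matrix_mul_rid matrix_mul_assoc)
    qed (auto simp: GG_cancel GG_w)
    thus False by (simp add: GG_cancel GG_w f_one)
  qed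
  then obtain n where n: "n \<in> NU UNIV" "f i (n ** ?w) \<noteq> 0" by blast
  have k: "pairing (fcw l) (simple_root (Cartan D) j) \<ge> 0" for j using fcw[of l] by (auto simp: fcw(2) less_imp_le)
  obtain N where N: "\<And>\<tau>. N \<tau> \<in> NU UNIV" "\<And>x. x \<longlonglongrightarrow> 0 \<Longrightarrow> (\<lambda>i::nat. N (x i)) \<longlonglongrightarrow> N 0"
      "\<And>\<tau>. \<tau> \<noteq> 0 \<Longrightarrow> cochar (fcw l) \<tau> ** n = N \<tau> ** cochar (fcw l) \<tau>"
    using NU_contract[OF n(1) k] by blast
  define e where "e = nat (- (fcd l * q $ l))"
  have ql: "fcd l * q $ l < 0" using neg fcw(1)[of l] by (simp add: mult_pos_neg)
  hence e: "e > 0" by (simp add: e_def)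
  have eq: "f i (n ** ?w) = \<tau> ^ e * f i (N \<tau> ** ?w)" if \<tau>: "\<tau> \<noteq> 0" for \<tau>
  proof -
    let ?h = "cochar (fcw l) \<tau>"
    have h: "?h \<in> Tor D" using cochar_Tor[OF \<tau>] .
    have G: "n ** ?w \<in> GG" using n by (auto intro!: GG_mult intro: NU_GG GG_w)
    have "fchar D i ?h * f i (n ** ?w) = f i (?h ** (n ** ?w))" by (rule f_tor_left[OF h G, symmetric])
    also have "?h ** (n ** ?w) = N \<tau> ** ?h ** ?w" by (simp add: N(3)[OF \<tau>, symmetric] matrix_mul_assoc)
    also have "f i \<dots> = wchar D (word_act (Cartan D) ws (fund_weight i)) ?h * f i (N \<tau> ** ?w)"
      by (rule f_w_tor[OF h NU_GG[OF N(1)]])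
    also have "word_act (Cartan D) ws (fund_weight i) = fund_weight i + - root_comb (Cartan D) q" using q by (simp add: algebra_simps)
    also have "wchar D \<dots> ?h = fchar D i ?h * \<tau> powi (- (fcd l * q $ l))"
      unfolding wchar_add[OF fchar_nz[OF h]]
      by (simp only: wchar_fund wchar_cochar[OF \<tau>, of "- root_comb (Cartan D) q"] pairing_minus pairing_fcw_root_comb)
    also have "\<tau> powi (- (fcd l * q $ l)) = \<tau> ^ e"
    proof -
      have "int e = - (fcd l * q $ l)" using ql by (simp add: e_def)
      thus ?thesis by (metis power_int_of_nat)
    qed
    finally show ?thesis using fchar_nz[OF h] by simp
  qed
  have "(\<lambda>m. null_seq m ^ e * f i (N (null_seq m) ** ?w)) \<longlonglongrightarrow> 0 ^ e * f i (N 0 ** ?w)"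
    by (intro tendsto_intros tendsto_f null_seq N(2)) (auto intro!: GG_mult intro: NU_GG N(1) GG_w)
  hence "f i (n ** ?w) = 0 ^ e * f i (N 0 ** ?w)" unfolding eq[OF null_seq(1), symmetric] by (simp add: LIMSEQ_const_iff)
  thus False using n e by simp
qed

lemma f_drop_right: "k \<notin> set us \<Longrightarrow> g \<in> GG \<Longrightarrow> f k (g ** w_bar D us) = f k g"
proof (induction us)
  case (Cons j us)
  have "word_act (Cartan D) us (fund_weight k) $ j = 0" using Cons.prems by (simp add: word_act_fund_fix fund_weight_nth)
  from f_s_w[OF Cons.prems(2) this] show ?case using Cons by simp
qed (simp add: matrix_mul_rid)

lemma f_drop_left: "k \<notin> set us \<Longrightarrow> g \<in> GG \<Longrightarrow> f k (matrix_inv (w_bar D us) ** g) = f k g"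
proof (induction us)
  case Nil
  have "matrix_inv (mat 1) = (mat 1 :: complex^'b^'b)" by (rule matrix_inv_one)
  thus ?case by (simp add: matrix_mul_lid)
next
  case (Cons j us)
  have "word_act (Cartan D) us (fund_weight k) $ j = 0" using Cons.prems by (simp add: word_act_fund_fix fund_weight_nth)
  from f_s_w_left[OF Cons.prems(2) this] show ?case using Cons by simp
qed

lemma f_filt: "g \<in> GG \<Longrightarrow> f k (g ** w_bar D (filt (Cartan D) ws (fund_weight k))) = f k (g ** w_bar D ws)"
proof (induction ws arbitrary: g)
  case (Cons j ws)
  show ?case
  proof (cases "word_act (Cartan D) ws (fund_weight k) $ j = 0")
    case True thus ?thesis using Cons.IH[OF Cons.prems] f_s_w[OF Cons.prems True] by simp
  next
    case False
    have "f k (g ** s_bar D j ** w_bar D (filt (Cartan D) ws (fund_weight k))) = f k (g ** s_bar D j ** w_bar D ws)"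
      by (intro Cons.IH GG_mult GG_s Cons.prems)
    thus ?thesis using False by (simp add: w_bar_Cons matrix_mul_assoc)
  qed
qed simp

lemma f_filt_left: "g \<in> GG \<Longrightarrow> f k (matrix_inv (w_bar D (filt (Cartan D) ws (fund_weight k))) ** g) = f k (matrix_inv (w_bar D ws) ** g)"
proof (induction ws arbitrary: g)
  case (Cons j ws)
  show ?case
  proof (cases "word_act (Cartan D) ws (fund_weight k) $ j = 0")
    case True thus ?thesis using Cons.IH[OF Cons.prems] f_s_w_left[OF Cons.prems True] by simp
  next
    case False
    have "f k (matrix_inv (w_bar D (filt (Cartan D) ws (fund_weight k))) ** (s_inv j ** g)) = f k (matrix_inv (w_bar D ws) ** (s_inv j ** g))"
      by (intro Cons.IH GG_mult GG_s_inv Cons.prems)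
    thus ?thesis using False by (simp add: w_bar_Cons GG_inv_mult GG_s GG_w s_bar_inv matrix_mul_assoc)
  qed
qed simp

text \<open>Replace the inner product x_j(T_j) s_j by lower times torus times upper. The upper part
  is absorbed by \<open>f_up_w\<close>, which is where descent enters; the lower part commutes past
  the other upper elements, whose letters differ from j.\<close>

lemma right_factor:
  assumes "distinct ws" "\<And>i. T i \<noteq> 0"
  shows "\<exists>n\<in>NL UNIV. \<forall>B\<in>GG. \<forall>k v. desc (Cartan D) ws (word_act (Cartan D) v (fund_weight k)) \<longrightarrow>
    f k (B ** upp (rev ws) (EE (Cartan D) ws T) ** w_bar D ws ** w_bar D v) = f k (B ** n ** torp ws T ** w_bar D v)"
  using assms(1)
proof (induction ws)
  case Nil show ?case by (rule bexI[OF _ NL_one]) (simp add: upp_simps torp_simps matrix_mul_rid)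
next
  case (Cons j ws)
  let ?A = "Cartan D"
  obtain n where n: "n \<in> NL UNIV" "\<And>B k v. B \<in> GG \<Longrightarrow> desc ?A ws (word_act ?A v (fund_weight k)) \<Longrightarrow>
    f k (B ** upp (rev ws) (EE ?A ws T) ** w_bar D ws ** w_bar D v) = f k (B ** n ** torp ws T ** w_bar D v)"
    using Cons by auto
  have jw: "j \<notin> set ws" "j \<notin> set (rev ws)" using Cons.prems by auto
  let ?H = "coroot D j (T j)" let ?Y = "x_low D j (1 / T j)"
  have H: "?H \<in> Tor D" using assms(2) by (rule coroot_Tor)
  obtain n' where n': "n' \<in> NL UNIV" "?H ** n = n' ** ?H" using tor_NL(1)[OF n(1) H] by blast
  have u: "upp (rev ws) (\<lambda>l. T j powi (- ?A $ j $ l) * EE ?A (j # ws) T l) = upp (rev ws) (EE ?A ws T)"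
    using jw assms(2)[of j] by (intro upp_cong) (auto simp: power_int_minus)
  show ?case
  proof (rule bexI[of _ "?Y ** n'"], intro ballI allI impI)
    fix B k v assume B: "B \<in> GG" and d: "desc ?A (j # ws) (word_act ?A v (fund_weight k))"
    let ?U = "upp (rev ws) (EE ?A (j # ws) T)"
    have UG: "?U \<in> GG" by (rule NU_GG[OF upp_NU'])
    have "B ** upp (rev (j # ws)) (EE ?A (j # ws) T) ** w_bar D (j # ws) ** w_bar D v
      = B ** ?U ** (x_up D j (T j) ** s_bar D j) ** w_bar D (ws @ v)"
      by (simp add: upp_append upp_simps matrix_mul_rid w_bar_Cons w_bar_append matrix_mul_assoc)
    also have "\<dots> = (B ** ?U ** ?Y ** ?H) ** x_up D j (- 1 / T j) ** w_bar D (ws @ v)"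
      by (simp add: up_s[OF assms(2)] matrix_mul_assoc)
    also have "f k \<dots> = f k ((B ** ?U ** ?Y ** ?H) ** w_bar D (ws @ v))"
      by (rule f_up_w) (use d B UG H in \<open>auto simp: word_act_append intro!: GG_mult intro: GG_low GG_tor\<close>)
    also have "(B ** ?U ** ?Y ** ?H) ** w_bar D (ws @ v) = B ** (?Y ** ?U) ** ?H ** w_bar D ws ** w_bar D v"
      using low_NU_commute[OF upp_NU jw(2), of "1 / T j" "EE ?A (j # ws) T"] by (simp add: w_bar_append matrix_mul_assoc)
    also have "\<dots> = B ** ?Y ** (?U ** ?H) ** w_bar D ws ** w_bar D v" by (simp add: matrix_mul_assoc)
    also have "\<dots> = (B ** ?Y ** ?H) ** upp (rev ws) (EE ?A ws T) ** w_bar D ws ** w_bar D v"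
      unfolding upp_coroot[OF assms(2)] u by (simp add: matrix_mul_assoc)
    also have "f k \<dots> = f k ((B ** ?Y ** ?H) ** n ** torp ws T ** w_bar D v)"
      by (rule n(2)) (use B H d in \<open>auto intro!: GG_mult intro: GG_low GG_tor\<close>)
    also have "(B ** ?Y ** ?H) ** n ** torp ws T ** w_bar D v = B ** ?Y ** (?H ** n) ** torp ws T ** w_bar D v" by (simp add: matrix_mul_assoc)
    also have "\<dots> = B ** (?Y ** n') ** torp (j # ws) T ** w_bar D v" by (simp add: n' torp_simps matrix_mul_assoc)
    finally show "f k (B ** upp (rev (j # ws)) (EE ?A (j # ws) T) ** w_bar D (j # ws) ** w_bar D v)
      = f k (B ** (?Y ** n') ** torp (j # ws) T ** w_bar D v)" .
  qed (use n' in \<open>auto intro: NL_mult NL_low\<close>)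
qed

text \<open>The mirror computation for c^-1 on the left. Here the torus factor is consumed as well:
  s_j^-1 turns the coroot of j into its inverse, which cancels the corresponding factor of
  \<open>torp\<close>.\<close>

lemma left_factor:
  assumes "distinct ws" "\<And>i. \<tau> i \<noteq> 0"
  shows "\<exists>n\<in>NU UNIV. \<forall>g\<in>GG. \<forall>k v. desc (Cartan D) ws (word_act (Cartan D) v (fund_weight k)) \<longrightarrow>
    f k (matrix_inv (w_bar D v) ** matrix_inv (w_bar D ws) ** lowp ws (\<lambda>i. 1 / EE (Cartan D) ws \<tau> i) ** torp ws \<tau> ** g)
      = f k (matrix_inv (w_bar D v) ** n ** g)"
  using assms(1)
proof (induction ws)
  case Nil
  have "matrix_inv (mat 1) = (mat 1 :: complex^'b^'b)" by (rule matrix_inv_one)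
  thus ?case by (intro bexI[OF _ NU_one]) (simp add: lowp_simps torp_simps matrix_mul_rid)
next
  case (Cons j ws)
  let ?A = "Cartan D"
  obtain n where n: "n \<in> NU UNIV" "\<And>g k v. g \<in> GG \<Longrightarrow> desc ?A ws (word_act ?A v (fund_weight k)) \<Longrightarrow>
    f k (matrix_inv (w_bar D v) ** matrix_inv (w_bar D ws) ** lowp ws (\<lambda>i. 1 / EE ?A ws \<tau> i) ** torp ws \<tau> ** g) = f k (matrix_inv (w_bar D v) ** n ** g)"
    using Cons by auto
  have jw: "j \<notin> set ws" using Cons.prems by auto
  let ?t = "\<tau> j" let ?Hi = "coroot D j (1 / ?t)" let ?H = "coroot D j ?t"
  have t: "?t \<noteq> 0" "1 / ?t \<noteq> 0" using assms(2) by auto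
  have H: "?H \<in> Tor D" "?Hi \<in> Tor D" using t by (auto intro: coroot_Tor)
  define c where "c = wchar D (simple_root ?A j) ?Hi * ?t"
  have Hc: "?Hi ** x_up D j ?t ** ?H = x_up D j c"
  proof -
    have "?Hi ** x_up D j ?t ** ?H = x_up D j c ** (?Hi ** ?H)" by (simp add: c_def conj_up[OF H(2)] matrix_mul_assoc)
    thus ?thesis using t by (simp add: coroot_mult coroot_1 matrix_mul_rid)
  qed
  have T: "torp ws \<tau> \<in> Tor D" using assms(2) by (intro torp_Tor)
  obtain n1 where n1: "n1 \<in> NU UNIV" "x_up D j c ** torp ws \<tau> = torp ws \<tau> ** n1"
    using tor_NU(2)[OF NU_up[of j UNIV] T] by blast
  let ?L = "lowp ws (\<lambda>i. 1 / EE ?A (j # ws) \<tau> i)"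
  have u: "lowp ws (\<lambda>l. (1 / ?t) powi (- ?A $ j $ l) * (1 / EE ?A (j # ws) \<tau> l)) = lowp ws (\<lambda>i. 1 / EE ?A ws \<tau> i)"
    using jw t by (intro lowp_cong) (auto simp: power_int_minus power_int_divide_distrib)
  show ?case
  proof (rule bexI[of _ "n ** n1"], intro ballI allI impI)
    fix g k v assume g: "g \<in> GG" and d: "desc ?A (j # ws) (word_act ?A v (fund_weight k))"
    let ?V = "matrix_inv (w_bar D v)" let ?W = "matrix_inv (w_bar D ws)"
    have VW: "?V ** ?W = matrix_inv (w_bar D (ws @ v))" by (simp add: w_bar_append GG_inv_mult GG_w)
    have LG: "?L \<in> GG" by (rule NL_GG[OF lowp_NL'])
    define g1 where "g1 = ?Hi ** x_up D j ?t ** ?L ** ?H ** torp ws \<tau> ** g"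
    have g1: "g1 \<in> GG" unfolding g1_def using g H T LG by (auto intro!: GG_mult intro: GG_tor GG_up)
    have "?V ** matrix_inv (w_bar D (j # ws)) ** lowp (j # ws) (\<lambda>i. 1 / EE ?A (j # ws) \<tau> i) ** torp (j # ws) \<tau> ** g
      = ?V ** ?W ** (s_inv j ** x_low D j (1 / ?t)) ** ?L ** ?H ** torp ws \<tau> ** g"
      by (simp add: w_bar_Cons GG_inv_mult GG_s GG_w s_bar_inv lowp_simps torp_simps matrix_mul_assoc)
    also have "\<dots> = matrix_inv (w_bar D (ws @ v)) ** x_low D j (- ?t) ** g1"
      using s_low[OF t(2), of j] by (simp add: VW g1_def matrix_mul_assoc)
    also have "f k \<dots> = f k (matrix_inv (w_bar D (ws @ v)) ** g1)"
      by (rule f_low_w_left[OF g1]) (use d in \<open>simp add: word_act_append\<close>)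
    also have "g1 = ?Hi ** (x_up D j ?t ** ?L) ** ?H ** torp ws \<tau> ** g" by (simp add: g1_def matrix_mul_assoc)
    also have "\<dots> = (?Hi ** ?L) ** x_up D j ?t ** ?H ** torp ws \<tau> ** g"
      by (simp add: up_NL_commute[OF lowp_NL jw] matrix_mul_assoc)
    also have "\<dots> = lowp ws (\<lambda>i. 1 / EE ?A ws \<tau> i) ** (?Hi ** x_up D j ?t ** ?H) ** torp ws \<tau> ** g"
      unfolding coroot_lowp[OF t(2)] u by (simp add: matrix_mul_assoc)
    also have "\<dots> = lowp ws (\<lambda>i. 1 / EE ?A ws \<tau> i) ** (x_up D j c ** torp ws \<tau>) ** g" by (simp add: Hc matrix_mul_assoc)
    also have "\<dots> = lowp ws (\<lambda>i. 1 / EE ?A ws \<tau> i) ** torp ws \<tau> ** (n1 ** g)" by (simp add: n1 matrix_mul_assoc)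
    also have "f k (matrix_inv (w_bar D (ws @ v)) ** (lowp ws (\<lambda>i. 1 / EE ?A ws \<tau> i) ** torp ws \<tau> ** (n1 ** g)))
      = f k (?V ** ?W ** lowp ws (\<lambda>i. 1 / EE ?A ws \<tau> i) ** torp ws \<tau> ** (n1 ** g))"
      by (simp add: VW[symmetric] matrix_mul_assoc)
    also have "\<dots> = f k (?V ** n ** (n1 ** g))" by (rule n(2)) (use n1 g d in \<open>auto intro: GG_mult NU_GG\<close>)
    finally show "f k (?V ** matrix_inv (w_bar D (j # ws)) ** lowp (j # ws) (\<lambda>i. 1 / EE ?A (j # ws) \<tau> i) ** torp (j # ws) \<tau> ** g)
      = f k (?V ** (n ** n1) ** g)" by (simp add: matrix_mul_assoc)
  qed (use n n1 NU_mult in blast)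
qed

lemma f_chart: "(\<And>i. \<tau> i \<noteq> 0) \<Longrightarrow> f i (chart \<tau> y) = \<tau> i"
proof -
  assume t: "\<And>i. \<tau> i \<noteq> 0"
  have "f i (chart \<tau> y) = wchar D (fund_weight i) (torp cox_word \<tau>)"
    unfolding chart_def wchar_fund by (rule f_val[OF lowp_NL' torp_Tor upp_NU']) (rule t)
  also have "\<dots> = (\<Prod>j\<in>UNIV. if j = i then \<tau> i else 1)"
    unfolding wchar_torp_cox[OF t] by (intro prod.cong) (auto simp: fund_weight_nth)
  finally show ?thesis by simp
qed

text \<open>As \<open>EE\<close> is multiplicative in its parameters, the right factor contributes
  the torus parameter M / tau. Multiplied by the torus part tau of the chart this leaves M, and the
  minor no longer depends on tau.\<close>

lemma chart_right:
  assumes t: "\<And>i. \<tau> i \<noteq> 0" and M: "\<And>i. M i \<noteq> 0" "\<And>i. EE (Cartan D) cox_word M i = y i"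
    and d: "desc (Cartan D) cox_word (word_act (Cartan D) v (fund_weight k))"
  shows "f k (matrix_inv (w_bar D v) ** chart \<tau> y ** w_bar D cox_word ** w_bar D v)
    = (\<Prod>j\<in>UNIV. M j powi (word_act (Cartan D) v (fund_weight k) $ j))"
proof -
  let ?A = "Cartan D" let ?V = "matrix_inv (w_bar D v)"
  define T where "T i = M i / \<tau> i" for i
  have T: "T i \<noteq> 0" for i using t M(1) by (simp add: T_def)
  have ET: "EE ?A cox_word T = (\<lambda>i. y i / EE ?A cox_word \<tau> i)"
    unfolding T_def by (rule ext) (simp add: EE_divide M(2))
  obtain n where n: "n \<in> NL UNIV" "\<And>B. B \<in> GG \<Longrightarrow> f k (B ** upp (rev cox_word) (EE ?A cox_word T) ** w_bar D cox_word ** w_bar D v)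
     = f k (B ** n ** torp cox_word T ** w_bar D v)"
    using right_factor[of cox_word T] T d by (auto simp: cox_word_def)
  let ?L = "lowp cox_word (\<lambda>i. 1 / EE ?A cox_word \<tau> i)"
  have TT: "torp cox_word \<tau> \<in> Tor D" "torp cox_word T \<in> Tor D" using t T by (auto intro: torp_Tor)
  obtain n' where n': "n' \<in> NL UNIV" "torp cox_word \<tau> ** n = n' ** torp cox_word \<tau>" using tor_NL(1)[OF n(1) TT(1)] by blast
  have V: "?V \<in> GG" by (simp add: GG_cancel GG_w)
  have B: "?V ** ?L ** torp cox_word \<tau> \<in> GG" using V TT by (auto intro!: GG_mult intro: GG_tor NL_GG lowp_NL')
  have Ln: "?L ** n' \<in> NL UNIV" using n' lowp_NL' NL_mult by blast
  have "?V ** chart \<tau> y ** w_bar D cox_word ** w_bar D v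
    = (?V ** ?L ** torp cox_word \<tau>) ** upp (rev cox_word) (EE ?A cox_word T) ** w_bar D cox_word ** w_bar D v"
    by (simp add: chart_def ET matrix_mul_assoc)
  also have "f k \<dots> = f k ((?V ** ?L ** torp cox_word \<tau>) ** n ** torp cox_word T ** w_bar D v)" by (rule n(2)[OF B])
  also have "(?V ** ?L ** torp cox_word \<tau>) ** n ** torp cox_word T ** w_bar D v
    = ?V ** ?L ** (torp cox_word \<tau> ** n) ** torp cox_word T ** w_bar D v" by (simp add: matrix_mul_assoc)
  also have "\<dots> = (?V ** (?L ** n')) ** (torp cox_word \<tau> ** torp cox_word T) ** w_bar D v" by (simp add: n' matrix_mul_assoc)
  also have "f k \<dots> = wchar D (word_act ?A v (fund_weight k)) (torp cox_word \<tau> ** torp cox_word T) * f k (?V ** (?L ** n') ** w_bar D v)"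
    by (rule f_w_tor[OF Tor_mult[OF TT]]) (use V NL_GG[OF Ln] in \<open>auto intro: GG_mult\<close>)
  also have "f k (?V ** (?L ** n') ** w_bar D v) = 1" by (rule f_w_conj_NL[OF Ln])
  also have "wchar D (word_act ?A v (fund_weight k)) (torp cox_word \<tau> ** torp cox_word T) = (\<Prod>j\<in>UNIV. M j powi (word_act ?A v (fund_weight k) $ j))"
    using t by (simp add: wchar_mult[OF TT] wchar_torp_cox[OF t] wchar_torp_cox[OF T] T_def flip: prod.distrib power_int_mult_distrib)
  finally show ?thesis by simp
qed

lemma chart_left:
  assumes t: "\<And>i. \<tau> i \<noteq> 0" and d: "desc (Cartan D) cox_word (word_act (Cartan D) v (fund_weight k))"
  shows "f k (matrix_inv (w_bar D v) ** matrix_inv (w_bar D cox_word) ** chart \<tau> y ** w_bar D v) = 1"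
proof -
  let ?A = "Cartan D" let ?V = "matrix_inv (w_bar D v)" let ?U = "upp (rev cox_word) (\<lambda>i. y i / EE ?A cox_word \<tau> i)"
  obtain n where n: "n \<in> NU UNIV" "\<And>g. g \<in> GG \<Longrightarrow>
    f k (?V ** matrix_inv (w_bar D cox_word) ** lowp cox_word (\<lambda>i. 1 / EE ?A cox_word \<tau> i) ** torp cox_word \<tau> ** g) = f k (?V ** n ** g)"
    using left_factor[of cox_word \<tau>] t d by (auto simp: cox_word_def)
  have G: "?U ** w_bar D v \<in> GG" by (intro GG_mult GG_w NU_GG[OF upp_NU'])
  have "?V ** matrix_inv (w_bar D cox_word) ** chart \<tau> y ** w_bar D v
    = ?V ** matrix_inv (w_bar D cox_word) ** lowp cox_word (\<lambda>i. 1 / EE ?A cox_word \<tau> i) ** torp cox_word \<tau> ** (?U ** w_bar D v)"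
    by (simp add: chart_def matrix_mul_assoc)
  also have "f k \<dots> = f k (?V ** n ** (?U ** w_bar D v))" by (rule n(2)[OF G])
  also have "?V ** n ** (?U ** w_bar D v) = ?V ** (n ** ?U) ** w_bar D v" by (simp add: matrix_mul_assoc)
  also have "f k \<dots> = 1" by (intro f_w_conj_NU NU_mult n(1) upp_NU')
  finally show ?thesis .
qed

text \<open>For \<open>\<gamma> = c\<^sup>p \<omega>\<^sub>k\<close> this is the minor \<open>\<Delta>\<^bsub>\<gamma>,\<gamma>\<^esub>\<close>; no reduced word for \<open>c\<^sup>p\<close> is needed, since letters that fix the weight can be
  dropped (\<open>f_filt\<close>).\<close>

definition XX :: "nat \<Rightarrow> 'a \<Rightarrow> complex^'b^'b \<Rightarrow> complex" where
  "XX p k x = f k (matrix_inv (w_bar D (cox_pow_word p)) ** x ** w_bar D (cox_pow_word p))"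

lemma cox_pow_word_Suc2: "cox_pow_word (Suc p) = cox_pow_word p @ cox_word"
  by (induction p) (simp_all add: cox_pow_word_Suc)

theorem chart_recursion:
  assumes t: "\<And>i. \<tau> i \<noteq> 0" and M: "\<And>i. M i \<noteq> 0" "\<And>i. EE (Cartan D) cox_word M i = y i"
    and d: "desc (Cartan D) cox_word ((cox (Cartan D) ^^ p) (fund_weight k))"
  shows "XX p k (chart \<tau> y) * XX (Suc p) k (chart \<tau> y) =
    (\<Prod>j\<in>UNIV. M j powi ((cox (Cartan D) ^^ p) (fund_weight k) $ j)) +
    (\<Prod>i\<in>UNIV - {k}. XX (if i < k then Suc p else p) i (chart \<tau> y) ^ nat (- Cartan D $ i $ k))"
proof -
  let ?A = "Cartan D" let ?x = "chart \<tau> y" let ?P = "cox_pow_word p :: 'a list"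
  have x: "?x \<in> GG" by (rule chart_GG[OF t])
  obtain us vs where c: "cox_word = us @ k # vs" "set us = {..<k}" "set vs = {k<..}" using cox_word_split[of k] by blast
  define W where "W ws = w_bar D (?P @ ws)" for ws
  have WG: "W ws \<in> GG" "matrix_inv (W ws) \<in> GG" for ws by (simp_all add: W_def GG_w GG_cancel)
  have W_app: "W (us @ vs) = W us ** w_bar D vs" for us vs by (simp add: W_def w_bar_append matrix_mul_assoc)
  have Wi_app: "matrix_inv (W (us @ vs)) = matrix_inv (w_bar D vs) ** matrix_inv (W us)" for us vs
    by (simp add: W_app GG_inv_mult WG GG_w)
  have dropr: "f i (matrix_inv (W l) ** ?x ** W (us @ vs)) = f i (matrix_inv (W l) ** ?x ** W us)" if "i \<notin> set vs" for i l us vs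
    using f_drop_right[OF that, of "matrix_inv (W l) ** ?x ** W us"] WG x by (simp add: W_app GG_mult matrix_mul_assoc)
  have dropl: "f i (matrix_inv (W (us @ vs)) ** ?x ** W l) = f i (matrix_inv (W us) ** ?x ** W l)" if "i \<notin> set vs" for i l us vs
    using f_drop_left[OF that, of "matrix_inv (W us) ** ?x ** W l"] WG x by (simp add: Wi_app GG_mult matrix_mul_assoc)
  have W0: "W [] = w_bar D ?P" by (simp add: W_def)
  have W1: "W cox_word = w_bar D (cox_pow_word (Suc p))" by (simp add: W_def cox_pow_word_Suc2)
  define g where "g = matrix_inv (W us) ** ?x ** W us"
  have g: "g \<in> GG" unfolding g_def using WG x by (intro GG_mult)
  have kus: "k \<notin> set us" "k \<notin> set vs" using c by auto
  have ck: "cox_word = (us @ [k]) @ vs" using c(1) by simp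
  have F1: "f k g = XX p k ?x"
    using dropr[OF kus(1), of us "[]"] dropl[OF kus(1), of "[]" "[]"] by (simp add: g_def XX_def W0)
  have Wk: "W (us @ [k]) = W us ** s_bar D k" "matrix_inv (W (us @ [k])) = s_inv k ** matrix_inv (W us)"
    using W_app[of us "[k]"] Wi_app[of us "[k]"] by (simp_all add: w_bar_Cons matrix_mul_rid s_bar_inv)
  have F2: "f k (s_inv k ** g ** s_bar D k) = XX (Suc p) k ?x"
  proof -
    have "s_inv k ** g ** s_bar D k = matrix_inv (W (us @ [k])) ** ?x ** W (us @ [k])"
      unfolding Wk(2) unfolding Wk(1) by (simp add: g_def matrix_mul_assoc)
    thus ?thesis using dropr[OF kus(2), of "us @ [k]" "us @ [k]"] dropl[OF kus(2), of "us @ [k]" cox_word]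
      unfolding XX_def W1[symmetric] ck by simp
  qed
  have F3: "f k (s_inv k ** g) = 1"
  proof -
    have "s_inv k ** g = matrix_inv (W (us @ [k])) ** ?x ** W us"
      unfolding Wk(2) by (simp add: g_def matrix_mul_assoc)
    hence "f k (s_inv k ** g) = f k (matrix_inv (W cox_word) ** ?x ** W [])"
      using dropr[OF kus(1), of "us @ [k]" "[]"] dropl[OF kus(2), of "us @ [k]" "[]"] unfolding ck by simp
    also have "matrix_inv (W cox_word) = matrix_inv (w_bar D ?P) ** matrix_inv (w_bar D cox_word)"
      unfolding W1 cox_pow_word_Suc w_bar_append by (simp add: GG_inv_mult GG_w)
    finally show ?thesis using chart_left[OF t, where v = ?P and k = k and y = y] d by (simp add: W0 cox_pow_word_act)
  qed
  have F4: "f k (g ** s_bar D k) = (\<Prod>j\<in>UNIV. M j powi ((cox ?A ^^ p) (fund_weight k) $ j))"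
  proof -
    have "g ** s_bar D k = matrix_inv (W us) ** ?x ** W (us @ [k])" by (simp add: Wk g_def matrix_mul_assoc)
    hence "f k (g ** s_bar D k) = f k (matrix_inv (W []) ** ?x ** W cox_word)"
      using dropl[OF kus(1), of "[]" "us @ [k]"] dropr[OF kus(2), of "[]" "us @ [k]"] unfolding ck by simp
    also have "W cox_word = w_bar D cox_word ** w_bar D ?P"
      unfolding W1 cox_pow_word_Suc w_bar_append ..
    finally show ?thesis using chart_right[OF t M, where v = ?P and k = k] d by (simp add: W0 cox_pow_word_act matrix_mul_assoc)
  qed
  have F5: "f i g = XX (if i < k then Suc p else p) i ?x" if "i \<noteq> k" for i
  proof (cases "i < k")
    case True
    hence n: "i \<notin> set (k # vs)" using that c(3) by (metis greaterThan_iff less_asym set_ConsD)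
    have "f i g = f i (matrix_inv (W us) ** ?x ** W (us @ k # vs))" unfolding g_def by (rule dropr[OF n, symmetric])
    also have "\<dots> = f i (matrix_inv (W (us @ k # vs)) ** ?x ** W (us @ k # vs))" by (rule dropl[OF n, symmetric])
    also have "\<dots> = XX (Suc p) i ?x" by (simp only: XX_def W1 c(1)[symmetric])
    finally show ?thesis using True by simp
  next
    case False
    hence n: "i \<notin> set us" by (simp add: c(2))
    have "f i g = f i (matrix_inv (W us) ** ?x ** W [])" unfolding g_def using dropr[OF n, of us "[]"] by simp
    also have "\<dots> = f i (matrix_inv (W []) ** ?x ** W [])" using dropl[OF n, of "[]" "[]"] by simp
    finally show ?thesis using False by (simp add: XX_def W0)
  qed
  have "(\<Prod>i\<in>UNIV - {k}. f i g ^ nat (- ?A $ i $ k)) = (\<Prod>i\<in>UNIV - {k}. XX (if i < k then Suc p else p) i ?x ^ nat (- ?A $ i $ k))"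
    by (intro prod.cong) (auto simp: F5)
  thus ?thesis using minor_identity[OF g, of k] by (simp add: F1 F2 F3 F4)
qed

end


section \<open>The reduced double cell and the image of the chart\<close>

context pinning begin

interpretation sw: pinning "swap_datum D" by (rule pinning_swap) (rule pinning_axioms)

definition BL :: "(complex^'m^'m) set" where "BL = {a ** n | a n. a \<in> Tor D \<and> n \<in> NL UNIV}"

lemma BL_GG: "b \<in> BL \<Longrightarrow> b \<in> GG"
  unfolding BL_def by (auto intro!: GG_mult intro: GG_tor NL_GG)

lemma BL_tor: "a \<in> Tor D \<Longrightarrow> a \<in> BL" and BL_NL: "n \<in> NL UNIV \<Longrightarrow> n \<in> BL"
  unfolding BL_def using NL_one Tor_one by (force simp: matrix_mul_rid matrix_mul_lid)+

lemma BL_mult: assumes "b \<in> BL" "b' \<in> BL" shows "b ** b' \<in> BL"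
proof -
  obtain a n a' n' where b: "b = a ** n" "a \<in> Tor D" "n \<in> NL UNIV" "b' = a' ** n'" "a' \<in> Tor D" "n' \<in> NL UNIV"
    using assms unfolding BL_def by blast
  obtain n1 where n1: "n1 \<in> NL UNIV" "n ** a' = a' ** n1" using tor_NL(2)[OF b(3,5)] by blast
  have "b ** b' = a ** (n ** a') ** n'" by (simp add: b matrix_mul_assoc)
  also have "\<dots> = (a ** a') ** (n1 ** n')" by (simp add: n1 matrix_mul_assoc)
  finally show ?thesis unfolding BL_def using b n1 Tor_mult NL_mult by blast
qed

lemma NL_inv: "n \<in> NL J \<Longrightarrow> matrix_inv n \<in> NL J"
  using sw.NU_inv by (simp add: NL_def)

lemma BL_inv: assumes "b \<in> BL" shows "matrix_inv b \<in> BL"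
proof -
  obtain a n where b: "b = a ** n" "a \<in> Tor D" "n \<in> NL UNIV" using assms unfolding BL_def by blast
  have "matrix_inv b = matrix_inv n ** matrix_inv a" using b by (simp add: GG_inv_mult GG_tor NL_GG)
  thus ?thesis using b by (simp add: BL_mult BL_NL BL_tor NL_inv Tor_cancel)
qed

text \<open>In coordinates graded by \<open>pos_cow\<close>, an element of N is unitriangular in one
  direction and an element of B_- triangular in the other.\<close>

lemma NU_Int_BL: assumes "n \<in> NU UNIV" "n \<in> BL" shows "n = mat 1"
proof -
  obtain a n' where n: "n = a ** n'" "a \<in> Tor D" "n' \<in> NL UNIV" using assms unfolding BL_def by blast
  obtain P Q e where d: "diagonalizes P Q e" using diagonalizes_ex by blast
  have PQ: "P ** Q = mat 1" "Q ** P = mat 1" using d by (auto simp: diagonalizes_def)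
  \<comment> \<open>The opposite pinning inverts the coroots, so its exponents and degrees change
    sign.\<close>
  define e' where "e' j a = - e j a" for j a
  have d': "sw.diagonalizes P Q e'"
    using d unfolding diagonalizes_def sw.diagonalizes_def
    by (auto simp: e'_def power_int_minus power_int_inverse)
  have pc: "sw.pos_cow = pos_cow" by (simp add: sw.pos_cow_def pos_cow_def sw.fcw_def fcw_def)
  have deg': "sw.deg e' a = - deg e a" for a by (simp add: sw.deg_def deg_def pc e'_def sum_negf)
  have U: "(P ** n ** Q) $ a $ b = (if a = b then 1 else 0)" if "deg e a - deg e b \<le> 0" for a b
    by (rule NU_graded[OF d assms(1) that])
  have L: "(P ** n' ** Q) $ a $ b = (if a = b then 1 else 0)" if "deg e b - deg e a \<le> 0" for a b
    using sw.NU_graded[OF d', of n' UNIV a b] n(3) that by (simp add: NL_def deg')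
  have "P ** n ** Q = P ** a ** (Q ** P) ** n' ** Q" by (simp add: n PQ matrix_mul_rid matrix_mul_assoc)
  also have "\<dots> = (P ** a ** Q) ** (P ** n' ** Q)" by (simp add: matrix_mul_assoc)
  finally have prod: "P ** n ** Q = (P ** a ** Q) ** (P ** n' ** Q)" .
  have "(P ** n ** Q) $ a' $ b = (if a' = b then 1 else 0)" for a' b
  proof (cases "deg e a' - deg e b \<le> 0")
    case True thus ?thesis by (rule U)
  next
    case False
    have "(P ** n ** Q) $ a' $ b = (\<Sum>c\<in>UNIV. (P ** a ** Q) $ a' $ c * (P ** n' ** Q) $ c $ b)"
      unfolding prod by (simp add: matrix_matrix_mult_def[of "P ** a ** Q"])
    also have "\<dots> = 0"
    proof (rule sum.neutral, rule ballI)
      fix c show "(P ** a ** Q) $ a' $ c * (P ** n' ** Q) $ c $ b = 0"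
        using d n(2) L[of b a'] False unfolding diagonalizes_def by (cases "c = a'") auto
    qed
    finally show ?thesis using False by auto
  qed
  hence "P ** n ** Q = mat 1" by (simp add: vec_eq_iff mat_def)
  hence "Q ** (P ** n ** Q) ** P = Q ** P" by (simp add: matrix_mul_rid)
  moreover have "Q ** (P ** n ** Q) ** P = (Q ** P) ** n ** (Q ** P)" by (simp add: matrix_mul_assoc)
  ultimately show ?thesis by (simp add: PQ matrix_mul_lid matrix_mul_rid)
qed

lemma w_bar_rev_inv: "\<exists>h\<in>Tor D. matrix_inv (w_bar D (rev ws)) = h ** w_bar D ws"
proof (induction ws)
  case Nil
  have "matrix_inv (mat 1) = (mat 1 :: complex^'m^'m)" by (rule matrix_inv_one)
  thus ?case using Tor_one by (intro bexI[of _ "mat 1"]) (simp_all add: matrix_mul_lid)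
next
  case (Cons j ws)
  then obtain h where h: "h \<in> Tor D" "matrix_inv (w_bar D (rev ws)) = h ** w_bar D ws" by blast
  obtain h' where h': "h' \<in> Tor D" "w_bar D [j] ** h = h' ** w_bar D [j]" using tor_w_bar_l[OF h(1)] by blast
  have sj: "s_bar D j ** h = h' ** s_bar D j" using h'(2) by (simp add: w_bar_Cons matrix_mul_rid)
  have si: "s_inv j = coroot D j (-1) ** s_bar D j" by (simp add: emb_m2 s_inv_m2 emb_m2_mult)
  have "matrix_inv (w_bar D (rev (j # ws))) = s_inv j ** (h ** w_bar D ws)"
    by (simp add: w_bar_append w_bar_Cons matrix_mul_rid GG_inv_mult GG_w GG_s s_bar_inv h)
  also have "\<dots> = coroot D j (-1) ** (s_bar D j ** h) ** w_bar D ws" by (simp add: si matrix_mul_assoc)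
  also have "\<dots> = (coroot D j (-1) ** h') ** w_bar D (j # ws)" by (simp add: sj w_bar_Cons matrix_mul_assoc)
  finally have "matrix_inv (w_bar D (rev (j # ws))) = (coroot D j (-1) ** h') ** w_bar D (j # ws)" .
  moreover have "coroot D j (-1) ** h' \<in> Tor D" using h'(1) by (intro Tor_mult coroot_Tor) simp
  ultimately show ?case by blast
qed

lemma sw_lowp: "sw.lowp ws u = upp ws (\<lambda>i. - u i)"
  by (induction ws) (simp_all add: sw.lowp_simps upp_simps)

lemma tor_upp: assumes "h \<in> Tor D" 
  shows "h ** upp ws t = upp ws (\<lambda>l. wchar D (simple_root (Cartan D) l) h * t l) ** h"
proof (induction ws)
  case (Cons i ws)
  have "h ** upp (i # ws) t = (h ** x_up D i (t i)) ** upp ws t" by (simp add: upp_simps matrix_mul_assoc)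
  also have "\<dots> = x_up D i (wchar D (simple_root (Cartan D) i) h * t i) ** (h ** upp ws t)"
    by (simp add: conj_up[OF assms] matrix_mul_assoc)
  finally show ?case by (simp add: Cons upp_simps matrix_mul_assoc)
qed (simp add: upp_simps matrix_mul_lid matrix_mul_rid)

lemma upp_inv: "matrix_inv (upp ws t) = upp (rev ws) (\<lambda>i. - t i)"
proof (induction ws)
  case Nil show ?case by (simp add: upp_simps) (rule matrix_inv_unique, simp_all add: matrix_mul_lid)
next
  case (Cons i ws)
  thus ?case using NU_GG[OF upp_NU'] by (simp add: upp_simps upp_append GG_inv_mult GG_up x_up_inv matrix_mul_rid)
qed

text \<open>The inverse of an element of \<open>B\<^sub>- c\<^sup>-\<^sup>1 B\<^sub>-\<close> is put into normal form by \<open>NwN_form\<close> for the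
  opposite pinning.\<close>

lemma BwB_form:
  assumes "distinct ws" "b \<in> BL" "b' \<in> BL"
  shows "\<exists>\<sigma>. \<exists>a\<in>Tor D. \<exists>n\<in>NL UNIV. matrix_inv (b ** w_bar D (rev ws) ** b') = a ** sw.pprod ws \<sigma> ** n"
proof -
  obtain h where h: "h \<in> Tor D" "matrix_inv (w_bar D (rev ws)) = h ** w_bar D ws" using w_bar_rev_inv by blast
  have "matrix_inv b' ** h \<in> BL" by (rule BL_mult[OF BL_inv[OF assms(3)] BL_tor[OF h(1)]])
  then obtain a1 n1 where 1: "matrix_inv b' ** h = a1 ** n1" "a1 \<in> Tor D" "n1 \<in> NL UNIV" unfolding BL_def by blast
  obtain a2 n2 where 2: "matrix_inv b = a2 ** n2" "a2 \<in> Tor D" "n2 \<in> NL UNIV" using BL_inv[OF assms(2)] unfolding BL_def by blast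
  obtain a3 where a3: "a3 \<in> Tor D" "w_bar D ws ** a2 = a3 ** w_bar D ws" using tor_w_bar_l[OF 2(2)] by blast
  obtain n3 where n3: "n3 \<in> NL UNIV" "n1 ** a3 = a3 ** n3" using tor_NL(2)[OF 1(3) a3(1)] by blast
  obtain \<sigma> n4 where s: "n4 \<in> NL UNIV" "n3 ** w_bar D ws = sw.pprod ws \<sigma> ** n4"
    using sw.NwN_form[OF assms(1), of n3] n3(1) by (auto simp: NL_def w_bar_swap)
  have "matrix_inv (b ** w_bar D (rev ws) ** b') = (matrix_inv b' ** h) ** w_bar D ws ** matrix_inv b"
    using BL_GG[OF assms(2)] BL_GG[OF assms(3)] by (simp add: GG_inv_mult GG_mult GG_w h matrix_mul_assoc)
  also have "\<dots> = a1 ** n1 ** (w_bar D ws ** a2) ** n2" by (simp add: 1 2 matrix_mul_assoc)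
  also have "\<dots> = a1 ** (n1 ** a3) ** w_bar D ws ** n2" by (simp add: a3 matrix_mul_assoc)
  also have "\<dots> = (a1 ** a3) ** (n3 ** w_bar D ws) ** n2" by (simp add: n3 matrix_mul_assoc)
  also have "\<dots> = (a1 ** a3) ** sw.pprod ws \<sigma> ** (n4 ** n2)" by (simp add: s matrix_mul_assoc)
  finally show ?thesis using 1 2 a3 s Tor_mult NL_mult by blast
qed

definition LC :: "(complex^'m^'m) set" where
  "LC = {n ** w_bar D cox_word ** n' | n n'. n \<in> NU UNIV \<and> n' \<in> NU UNIV} \<inter>
     {b ** w_bar D (rev cox_word) ** b' | b b'. b \<in> BL \<and> b' \<in> BL}"

lemma LC_GG: "x \<in> LC \<Longrightarrow> x \<in> GG"
  unfolding LC_def by (auto intro!: GG_mult intro: NU_GG GG_w)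

lemma tendsto_pprod:
  assumes "\<And>i. (\<lambda>m. u m i) \<longlonglongrightarrow> \<tau> i" shows "(\<lambda>m. pprod ws (u m)) \<longlonglongrightarrow> pprod ws \<tau>"
  by (induction ws) (auto simp: pprod_simps intro!: tendsto_intros assms)

lemma pprod_GG: "pprod ws \<tau> \<in> GG"
  by (induction ws) (auto simp: pprod_simps intro!: GG_mult intro: GG_one GG_up GG_s)

text \<open>For N c N, the lower and torus factors form a product \<open>pprod\<close> up to a
  factor in N, by \<open>pprod_gauss\<close>. For B_- c^-1 B_-, the inverse of the upper factor is
  the lower factor in \<open>pprod_gauss\<close> for the opposite pinning, with parameters
  \<open>\<sigma>\<close> that solve another triangular system.\<close>

lemma chart_in_LC:
  assumes t: "\<And>i. \<tau> i \<noteq> 0" and y: "\<And>i. y i \<noteq> 0" shows "chart \<tau> y \<in> LC"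
proof -
  let ?A = "Cartan D" let ?L = "lowp cox_word (\<lambda>i. 1 / EE ?A cox_word \<tau> i)" let ?T = "torp cox_word \<tau>"
  define s where "s i = y i / EE ?A cox_word \<tau> i" for i
  have s: "s i \<noteq> 0" for i using y EE_nz[OF t] by (simp add: s_def)
  let ?U = "upp (rev cox_word) s"
  have ch: "chart \<tau> y = ?L ** ?T ** ?U" by (simp add: chart_def s_def[abs_def])
  have T: "?T \<in> Tor D" using t by (intro torp_Tor)
  have dc: "distinct (cox_word :: 'i list)" by simp
  obtain n where n: "n \<in> NU UNIV" "pprod cox_word \<tau> = ?L ** ?T ** n" using pprod_gauss[where ws = cox_word and \<tau> = \<tau>, OF dc t] by (rule bexE)
  obtain n1 where n1: "n1 \<in> NU UNIV" "pprod cox_word \<tau> = n1 ** w_bar D cox_word" using pprod_NwN[OF dc] by auto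
  have "chart \<tau> y = (?L ** ?T ** n) ** matrix_inv n ** ?U"
    by (simp add: ch GG_cancel2 NU_GG[OF n(1)])
  also have "\<dots> = n1 ** w_bar D cox_word ** (matrix_inv n ** ?U)" by (simp add: n(2)[symmetric] n1 matrix_mul_assoc)
  finally have A: "\<exists>n n'. chart \<tau> y = n ** w_bar D cox_word ** n' \<and> n \<in> NU UNIV \<and> n' \<in> NU UNIV"
    using n1 n upp_NU' by (blast intro: NU_mult NU_inv)
  have "\<exists>T. (\<forall>i. T i \<noteq> 0) \<and> (\<forall>i\<in>set cox_word. EE ?A cox_word T i = 1 / s i) \<and> ((\<forall>i. posR (1 / s i)) \<longrightarrow> (\<forall>i. posR (T i)))"
    by (rule EE_surj[OF dc]) (simp add: s)
  then obtain \<sigma> where \<sigma>: "\<And>i. \<sigma> i \<noteq> 0" "\<And>i. EE ?A cox_word \<sigma> i = 1 / s i" by (auto simp del: divide_eq_0_iff)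
  have Us: "upp cox_word (\<lambda>i. - s i) = sw.lowp cox_word (\<lambda>i. 1 / EE ?A cox_word \<sigma> i)"
    by (simp add: sw_lowp \<sigma>)
  let ?T' = "sw.torp cox_word \<sigma>"
  have T': "?T' \<in> Tor D" using sw.torp_Tor[of cox_word \<sigma>] \<sigma>(1) by simp
  obtain m where m: "m \<in> NL UNIV" "sw.pprod cox_word \<sigma> = upp cox_word (\<lambda>i. - s i) ** ?T' ** m"
    using sw.pprod_gauss[where ws = cox_word and \<tau> = \<sigma>, OF dc \<sigma>(1)] unfolding swap_simps Us NL_def[symmetric] by (rule bexE)
  obtain m1 where m1: "m1 \<in> NL UNIV" "sw.pprod cox_word \<sigma> = m1 ** w_bar D cox_word"
    using sw.pprod_NwN[OF dc] by (auto simp: NL_def w_bar_swap)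
  obtain h where h: "h \<in> Tor D" "matrix_inv (w_bar D cox_word) = h ** w_bar D (rev cox_word)"
    using w_bar_rev_inv[of "rev cox_word"] by auto
  have "upp cox_word (\<lambda>i. - s i) = m1 ** w_bar D cox_word ** matrix_inv m ** matrix_inv ?T'"
    unfolding m1(2)[symmetric] m(2) by (simp add: GG_cancel2 NL_GG[OF m(1)] GG_tor[OF T'])
  hence "matrix_inv (upp cox_word (\<lambda>i. - s i)) = ?T' ** m ** matrix_inv (w_bar D cox_word) ** matrix_inv m1"
    using NL_GG[OF m(1)] NL_GG[OF m1(1)] GG_tor[OF T'] by (simp add: GG_inv_mult GG_mult GG_w GG_cancel GG_inv_inv matrix_mul_assoc)
  hence "?U = (?T' ** m ** h) ** w_bar D (rev cox_word) ** matrix_inv m1" by (simp add: upp_inv h matrix_mul_assoc)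
  hence "chart \<tau> y = (?L ** ?T ** (?T' ** m ** h)) ** w_bar D (rev cox_word) ** matrix_inv m1"
    by (simp add: ch matrix_mul_assoc)
  moreover have "?L ** ?T ** (?T' ** m ** h) \<in> BL" using T T' m h lowp_NL' by (auto intro!: BL_mult intro: BL_tor BL_NL)
  moreover have "matrix_inv m1 \<in> BL" using m1 by (intro BL_NL NL_inv)
  ultimately show ?thesis unfolding LC_def using A by blast
qed

end

context minors begin

lemma f_pprod: "f i (pprod cox_word \<tau>) = \<tau> i"
proof -
  have gen: "f i (pprod cox_word \<tau>) = \<tau> i" if t: "\<And>i. \<tau> i \<noteq> 0" for \<tau>
  proof -
    obtain n where n: "n \<in> NU UNIV" "pprod cox_word \<tau> = lowp cox_word (\<lambda>i. 1 / EE (Cartan D) cox_word \<tau> i) ** torp cox_word \<tau> ** n"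
      using pprod_gauss[of cox_word \<tau>] t by (auto simp: cox_word_def)
    have T: "torp cox_word \<tau> \<in> Tor D" using t by (intro torp_Tor)
    have "f i (pprod cox_word \<tau>) = fchar D i (torp cox_word \<tau>)" unfolding n(2) by (rule f_val[OF lowp_NL' T n(1)])
    also have "\<dots> = f i (chart \<tau> \<tau>)" unfolding chart_def by (rule f_val[OF lowp_NL' T upp_NU', symmetric])
    finally show ?thesis by (simp add: f_chart t)
  qed
  define u where "u m j = (if \<tau> j = 0 then null_seq m else \<tau> j)" for m j
  have u: "(\<lambda>m. u m j) \<longlonglongrightarrow> \<tau> j" "u m j \<noteq> 0" for m j
    using null_seq by (cases "\<tau> j = 0"; simp add: u_def)+
  have "(\<lambda>m. f i (pprod cox_word (u m))) \<longlonglongrightarrow> f i (pprod cox_word \<tau>)"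
    by (intro tendsto_f tendsto_pprod u(1) pprod_GG)
  moreover have "(\<lambda>m. f i (pprod cox_word (u m))) \<longlonglongrightarrow> \<tau> i" using gen[of "u _"] u by simp
  ultimately show ?thesis using LIMSEQ_unique by blast
qed

end

context minors begin

interpretation sw: minors "swap_datum D" "\<lambda>i g. f i (matrix_inv g)"
  by (rule minors_swap) (rule minors_axioms)

text \<open>Membership in N c N determines tau and leaves an upper unipotent factor m. Membership in
  B_- c^-1 B_- writes m^-1 as a product of simple root elements times an element of B_-. That
  element also lies in N and is therefore trivial.\<close>

theorem LC_generic:
  assumes x: "x \<in> LC" and nz: "\<And>i. f i x \<noteq> 0"
  shows "\<exists>\<tau> y. (\<forall>i. \<tau> i \<noteq> 0) \<and> (\<forall>i. y i \<noteq> 0) \<and> x = chart \<tau> y"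
proof -
  let ?A = "Cartan D"
  have dc: "distinct (cox_word :: 'a list)" by simp
  obtain n n' where n: "x = n ** w_bar D cox_word ** n'" "n \<in> NU UNIV" "n' \<in> NU UNIV" using x unfolding LC_def by blast
  obtain \<tau> n1 where n1: "n1 \<in> NU UNIV" "n ** w_bar D cox_word = pprod cox_word \<tau> ** n1" using NwN_form[OF dc n(2)] by blast
  have "f i x = \<tau> i" for i
  proof -
    have "x = pprod cox_word \<tau> ** (n1 ** n')" by (simp add: n n1 matrix_mul_assoc)
    thus ?thesis using f_right[OF NU_mult[OF n1(1) n(3)] pprod_GG] f_pprod by simp
  qed
  hence t: "\<And>i. \<tau> i \<noteq> 0" using nz by metis
  note \<tau>nz = t
  let ?L = "lowp cox_word (\<lambda>i. 1 / EE ?A cox_word \<tau> i)" let ?T = "torp cox_word \<tau>"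
  have T: "?T \<in> Tor D" using t by (intro torp_Tor)
  obtain n2 where n2: "n2 \<in> NU UNIV" "pprod cox_word \<tau> = ?L ** ?T ** n2" using pprod_gauss[where ws = cox_word and \<tau> = \<tau>, OF dc t] by (rule bexE)
  define m where "m = n2 ** n1 ** n'"
  have m: "m \<in> NU UNIV" unfolding m_def using n n1 n2 by (intro NU_mult)
  have xm: "x = ?L ** ?T ** m" by (simp add: n n1 n2 m_def matrix_mul_assoc)
  have LT: "?L ** ?T \<in> BL" using lowp_NL' T by (auto intro!: BL_mult intro: BL_NL BL_tor)
  obtain b b' where b: "x = b ** w_bar D (rev cox_word) ** b'" "b \<in> BL" "b' \<in> BL" using x unfolding LC_def by blast
  have "matrix_inv (?L ** ?T) ** x = (matrix_inv (?L ** ?T) ** (?L ** ?T)) ** m" unfolding xm by (simp only: matrix_mul_assoc)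
  hence "m = matrix_inv (?L ** ?T) ** x" by (simp only: GG_cancel(3)[OF BL_GG[OF LT]] matrix_mul_lid)
  hence mb: "m = (matrix_inv (?L ** ?T) ** b) ** w_bar D (rev cox_word) ** b'" by (simp add: b matrix_mul_assoc)
  have "matrix_inv (?L ** ?T) ** b \<in> BL" by (rule BL_mult[OF BL_inv[OF LT] b(2)])
  from BwB_form[OF dc this b(3)] obtain \<sigma> a n3 where s: "a \<in> Tor D" "n3 \<in> NL UNIV" "matrix_inv m = a ** sw.pprod cox_word \<sigma> ** n3"
    unfolding mb by blast
  have aS: "a \<in> Tor (swap_datum D)" "n3 \<in> sw.NU UNIV" using s by (simp_all add: NL_def)
  \<comment> \<open>Since m is upper unipotent, its principal minors are 1; computed from the other
    form they are a torus character times \<open>\<sigma> i\<close>.\<close>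
  have "\<sigma> i \<noteq> 0" for i
  proof -
    have "f i (matrix_inv (matrix_inv m)) = f i (mat 1 ** mat 1 ** m)" using NU_GG[OF m] by (simp add: GG_inv_inv matrix_mul_lid)
    also have "\<dots> = 1" using f_right[OF m GG_one, of i] f_one by (simp add: matrix_mul_lid)
    finally have 1: "f i (matrix_inv (matrix_inv m)) = 1" .
    have "f i (matrix_inv (matrix_inv m)) = f i (matrix_inv (a ** sw.pprod cox_word \<sigma>))"
      unfolding s(3) by (rule sw.f_right[OF aS(2)]) (intro sw.GG_mult sw.GG_tor aS sw.pprod_GG)
    also have "\<dots> = fchar (swap_datum D) i a * \<sigma> i"
      unfolding sw.f_tor_left[OF aS(1) sw.pprod_GG] sw.f_pprod ..
    finally show ?thesis using 1 by auto
  qed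
  from sw.pprod_gauss[where ws = cox_word and \<tau> = \<sigma>, OF dc this] obtain n4 where n4: "n4 \<in> NL UNIV"
    "sw.pprod cox_word \<sigma> = sw.lowp cox_word (\<lambda>i. 1 / EE ?A cox_word \<sigma> i) ** sw.torp cox_word \<sigma> ** n4"
    unfolding swap_simps NL_def[symmetric] by (rule bexE)
  define t where "t l = wchar D (simple_root ?A l) a * (- (1 / EE ?A cox_word \<sigma> l))" for l
  have tnz: "t l \<noteq> 0" for l unfolding t_def using wchar_nz[OF s(1)] EE_nz[where T = \<sigma>, OF \<open>\<And>i. \<sigma> i \<noteq> 0\<close>] by simp
  let ?T' = "sw.torp cox_word \<sigma>"
  have T': "?T' \<in> Tor D" using sw.torp_Tor[of cox_word \<sigma>] \<open>\<And>i. \<sigma> i \<noteq> 0\<close> by simp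
  have "matrix_inv m = (a ** upp cox_word (\<lambda>i. - (1 / EE ?A cox_word \<sigma> i))) ** ?T' ** n4 ** n3"
    by (simp add: s n4 sw_lowp matrix_mul_assoc)
  also have "\<dots> = upp cox_word t ** (a ** ?T' ** n4 ** n3)"
    unfolding tor_upp[OF s(1)] by (simp add: t_def[abs_def] matrix_mul_assoc)
  finally have mi: "matrix_inv m = upp cox_word t ** (a ** ?T' ** n4 ** n3)" .
  let ?r = "a ** ?T' ** n4 ** n3"
  have rB: "?r \<in> BL" using s T' n4 by (auto intro!: BL_mult intro: BL_NL BL_tor)
  have "?r = matrix_inv (upp cox_word t) ** matrix_inv m"
    using NU_GG[OF upp_NU'] by (simp add: mi matrix_mul_assoc GG_cancel matrix_mul_lid)
  hence "?r \<in> NU UNIV" using m upp_NU' by (simp add: NU_mult NU_inv)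
  hence "?r = mat 1" using rB by (rule NU_Int_BL)
  hence "matrix_inv m = upp cox_word t" by (simp add: mi matrix_mul_rid)
  hence "m = upp (rev cox_word) (\<lambda>i. - t i)" using GG_inv_inv[OF NU_GG[OF m]] by (simp add: upp_inv)
  hence "x = chart \<tau> (\<lambda>i. - t i * EE ?A cox_word \<tau> i)"
    using EE_nz[where T = \<tau>, OF \<tau>nz] by (simp add: xm chart_def)
  moreover have "\<forall>i. - t i * EE ?A cox_word \<tau> i \<noteq> 0" using tnz EE_nz[where T = \<tau>, OF \<tau>nz] by simp
  ultimately show ?thesis using \<tau>nz
    by (intro exI[of _ \<tau>] exI[of _ "\<lambda>i. - t i * EE ?A cox_word \<tau> i"] conjI) simp_all
qed

lemma f_pprod_cancel:
  assumes "desc (Cartan D) ws (fund_weight j)" "g \<in> GG"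
  shows "f j (g ** matrix_inv (sw.pprod ws \<sigma>) ** w_bar D ws) = f j g"
  using assms
proof (induction ws)
  case Nil
  have "matrix_inv (mat 1) = (mat 1 :: complex^'b^'b)" by (rule matrix_inv_one)
  thus ?case by (simp add: sw.pprod_simps matrix_mul_rid)
next
  case (Cons i ws)
  have PG: "sw.pprod ws \<sigma> \<in> GG" "x_low D i (- \<sigma> i) ** s_bar D i \<in> GG"
    using sw.pprod_GG[of ws \<sigma>] by (auto simp: sw_GG intro: GG_mult GG_low GG_s)
  have "matrix_inv (sw.pprod (i # ws) \<sigma>) = matrix_inv (sw.pprod ws \<sigma>) ** s_inv i ** x_low D i (\<sigma> i)"
    using PG by (simp add: sw.pprod_simps GG_inv_mult GG_low GG_s s_bar_inv x_low_inv matrix_mul_assoc)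
  hence "g ** matrix_inv (sw.pprod (i # ws) \<sigma>) ** w_bar D (i # ws)
    = g ** matrix_inv (sw.pprod ws \<sigma>) ** (s_inv i ** x_low D i (\<sigma> i) ** s_bar D i) ** w_bar D ws"
    by (simp add: w_bar_Cons matrix_mul_assoc)
  also have "\<dots> = (g ** matrix_inv (sw.pprod ws \<sigma>)) ** x_up D i (- \<sigma> i) ** w_bar D ws" by (simp add: s_conj_low matrix_mul_assoc)
  also have "f j \<dots> = f j (g ** matrix_inv (sw.pprod ws \<sigma>) ** w_bar D ws)"
    by (rule f_up_w) (use Cons.prems PG in \<open>auto intro: GG_mult GG_cancel\<close>)
  also have "\<dots> = f j g" using Cons by simp
  finally show ?case .
qed

text \<open>By \<open>BwB_form\<close> the inverse of x is a torus element times a product for the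
  opposite pinning times a lower unipotent. When x is multiplied by c, the factors of that product
  become upper root elements, absorbed one by one by \<open>f_up_w\<close>, and a torus character
  remains.\<close>

lemma LC_nonvanishing:
  assumes x: "x \<in> LC" and d: "desc (Cartan D) cox_word (fund_weight j)"
  shows "f j (x ** w_bar D cox_word) \<noteq> 0"
proof -
  have dc: "distinct (cox_word :: 'a list)" by simp
  obtain b b' where b: "x = b ** w_bar D (rev cox_word) ** b'" "b \<in> BL" "b' \<in> BL" using x unfolding LC_def by blast
  from BwB_form[OF dc b(2,3)] obtain \<sigma> a n where s: "a \<in> Tor D" "n \<in> NL UNIV" "matrix_inv x = a ** sw.pprod cox_word \<sigma> ** n"
    unfolding b by blast
  have PG: "sw.pprod cox_word \<sigma> \<in> GG" using sw.pprod_GG[of cox_word \<sigma>] by (simp add: sw_GG)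
  have ai: "matrix_inv a \<in> Tor D" using Tor_cancel s by blast
  have "x = matrix_inv (a ** sw.pprod cox_word \<sigma> ** n)" using GG_inv_inv[OF LC_GG[OF x]] s(3) by simp
  also have "\<dots> = matrix_inv n ** matrix_inv (sw.pprod cox_word \<sigma>) ** matrix_inv a"
    using PG GG_tor[OF s(1)] NL_GG[OF s(2)] by (simp add: GG_inv_mult GG_mult matrix_mul_assoc)
  finally have xe: "x = matrix_inv n ** matrix_inv (sw.pprod cox_word \<sigma>) ** matrix_inv a" .
  have G: "matrix_inv n ** matrix_inv (sw.pprod cox_word \<sigma>) \<in> GG" by (rule GG_mult[OF GG_cancel(1)[OF NL_GG[OF s(2)]] GG_cancel(1)[OF PG]])
  have "f j (x ** w_bar D cox_word) = wchar D (word_act (Cartan D) cox_word (fund_weight j)) (matrix_inv a)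
     * f j (matrix_inv n ** matrix_inv (sw.pprod cox_word \<sigma>) ** w_bar D cox_word)"
    unfolding xe by (rule f_w_tor[OF ai G])
  also have "f j (matrix_inv n ** matrix_inv (sw.pprod cox_word \<sigma>) ** w_bar D cox_word) = f j (matrix_inv n)"
    by (rule f_pprod_cancel[OF d GG_cancel(1)[OF NL_GG[OF s(2)]]])
  also have "f j (matrix_inv n) = 1" using f_left[OF NL_inv[OF s(2)] GG_one, of j] f_one by (simp add: matrix_mul_rid)
  finally show ?thesis using wchar_nz[OF ai] by simp
qed

end


section \<open>Asymptotics\<close>

text \<open>Growth like epsilon^-d with a positive leading constant, through positive values.
  Positivity is what lets \<open>asym_add\<close> hold with \<open>max\<close>: leading terms cannot
  cancel.\<close>

definition asym :: "(real \<Rightarrow> complex) \<Rightarrow> int \<Rightarrow> bool" where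
  "asym g d \<longleftrightarrow> (\<forall>\<epsilon>>0. posR (g \<epsilon>)) \<and>
     (\<exists>C. posR C \<and> ((\<lambda>\<epsilon>. complex_of_real \<epsilon> powi d * g \<epsilon>) \<longlongrightarrow> C) (at_right 0))"

lemma asym_cong: "asym g d \<Longrightarrow> (\<And>\<epsilon>. \<epsilon> > 0 \<Longrightarrow> g \<epsilon> = h \<epsilon>) \<Longrightarrow> asym h d"
proof -
  assume a: "asym g d" and e: "\<And>\<epsilon>. \<epsilon> > 0 \<Longrightarrow> g \<epsilon> = h \<epsilon>"
  from a obtain C where C: "posR C" "((\<lambda>\<epsilon>. complex_of_real \<epsilon> powi d * g \<epsilon>) \<longlongrightarrow> C) (at_right 0)" unfolding asym_def by blast
  have "((\<lambda>\<epsilon>. complex_of_real \<epsilon> powi d * h \<epsilon>) \<longlongrightarrow> C) (at_right 0)"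
    by (rule Lim_transform_eventually[OF C(2)]) (auto simp: e eventually_at_filter)
  thus ?thesis using a C(1) e unfolding asym_def by auto
qed

lemma asym_const: "posR c \<Longrightarrow> asym (\<lambda>_. c) 0"
  unfolding asym_def by auto

lemma asym_var: "asym (\<lambda>\<epsilon>. complex_of_real \<epsilon>) (-1)"
  unfolding asym_def
proof (intro conjI exI[of _ 1])
  show "((\<lambda>\<epsilon>. complex_of_real \<epsilon> powi - 1 * complex_of_real \<epsilon>) \<longlongrightarrow> 1) (at_right 0)"
    by (rule Lim_transform_eventually[OF tendsto_const[of 1]]) (auto simp: eventually_at_filter power_int_minus)
qed (auto simp: posR_def intro: posR_1)

lemma asym_mult: assumes "asym g d" "asym h e" shows "asym (\<lambda>\<epsilon>. g \<epsilon> * h \<epsilon>) (d + e)"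
proof -
  obtain C where C: "posR C" "((\<lambda>\<epsilon>. complex_of_real \<epsilon> powi d * g \<epsilon>) \<longlongrightarrow> C) (at_right 0)" using assms(1) unfolding asym_def by blast
  obtain C' where C': "posR C'" "((\<lambda>\<epsilon>. complex_of_real \<epsilon> powi e * h \<epsilon>) \<longlongrightarrow> C') (at_right 0)" using assms(2) unfolding asym_def by blast
  have "((\<lambda>\<epsilon>. complex_of_real \<epsilon> powi (d + e) * (g \<epsilon> * h \<epsilon>)) \<longlongrightarrow> C * C') (at_right 0)"
    by (rule Lim_transform_eventually[OF tendsto_mult[OF C(2) C'(2)]]) (auto simp: eventually_at_filter power_int_add)
  thus ?thesis using assms posR_mult[OF C(1) C'(1)] unfolding asym_def by (auto intro: posR_mult)
qed

lemma asym_power: "asym g d \<Longrightarrow> asym (\<lambda>\<epsilon>. g \<epsilon> ^ n) (int n * d)"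
proof (induction n)
  case 0 show ?case using asym_const[OF posR_1] by simp
next
  case (Suc n)
  from asym_mult[OF Suc(2) Suc.IH[OF Suc(2)]] show ?case by (simp add: algebra_simps)
qed

lemma asym_prod: "finite S \<Longrightarrow> (\<And>x. x \<in> S \<Longrightarrow> asym (g x) (d x)) \<Longrightarrow> asym (\<lambda>\<epsilon>. \<Prod>x\<in>S. g x \<epsilon>) (\<Sum>x\<in>S. d x)"
proof (induction S rule: finite_induct)
  case empty show ?case using asym_const[OF posR_1] by simp
next
  case (insert x S) thus ?case using asym_mult[of "g x" "d x"] by simp
qed

lemma posR_inverse: "posR a \<Longrightarrow> posR (inverse a)"
  using posR_divide[OF posR_1, of a] by (simp add: divide_inverse)

lemma asym_inverse: assumes "asym g d" shows "asym (\<lambda>\<epsilon>. inverse (g \<epsilon>)) (- d)"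
proof -
  obtain C where C: "posR C" "((\<lambda>\<epsilon>. complex_of_real \<epsilon> powi d * g \<epsilon>) \<longlongrightarrow> C) (at_right 0)" using assms(1) unfolding asym_def by blast
  have "((\<lambda>\<epsilon>. complex_of_real \<epsilon> powi (- d) * inverse (g \<epsilon>)) \<longlongrightarrow> inverse C) (at_right 0)"
    by (rule Lim_transform_eventually[OF tendsto_inverse[OF C(2) posR_nz[OF C(1)]]]) (simp add: power_int_minus)
  thus ?thesis using assms posR_inverse[OF C(1)] unfolding asym_def by (auto intro: posR_inverse)
qed

lemma tendsto_eps_powi: assumes "n \<ge> 0" 
  shows "((\<lambda>\<epsilon>. complex_of_real \<epsilon> powi n) \<longlongrightarrow> (if n = 0 then 1 else 0)) (at_right 0)"
proof -
  have "((\<lambda>\<epsilon>. complex_of_real \<epsilon> ^ nat n) \<longlongrightarrow> complex_of_real 0 ^ nat n) (at_right 0)"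
    by (intro tendsto_intros)
  thus ?thesis using assms by (cases "n = 0") (auto simp: power_int_def zero_power)
qed

lemma asym_add: assumes "asym g d" "asym h e" shows "asym (\<lambda>\<epsilon>. g \<epsilon> + h \<epsilon>) (max d e)"
proof -
  have *: "asym (\<lambda>\<epsilon>. g \<epsilon> + h \<epsilon>) d" if "asym g d" "asym h e" "e \<le> d" for g h d e
  proof -
    obtain C where C: "posR C" "((\<lambda>\<epsilon>. complex_of_real \<epsilon> powi d * g \<epsilon>) \<longlongrightarrow> C) (at_right 0)" using \<open>asym g d\<close> unfolding asym_def by blast
    obtain C' where C': "posR C'" "((\<lambda>\<epsilon>. complex_of_real \<epsilon> powi e * h \<epsilon>) \<longlongrightarrow> C') (at_right 0)" using \<open>asym h e\<close> unfolding asym_def by blast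
    define c where "c = (if d - e = 0 then 1 else 0 :: complex)"
    have t: "((\<lambda>\<epsilon>. complex_of_real \<epsilon> powi (d - e)) \<longlongrightarrow> c) (at_right 0)"
      unfolding c_def by (rule tendsto_eps_powi) (use that in simp)
    have "((\<lambda>\<epsilon>. complex_of_real \<epsilon> powi d * g \<epsilon> + complex_of_real \<epsilon> powi (d - e) * (complex_of_real \<epsilon> powi e * h \<epsilon>)) \<longlongrightarrow> C + c * C') (at_right 0)"
      by (intro tendsto_intros C C' t)
    hence "((\<lambda>\<epsilon>. complex_of_real \<epsilon> powi d * (g \<epsilon> + h \<epsilon>)) \<longlongrightarrow> C + c * C') (at_right 0)"
      by (rule Lim_transform_eventually) (auto simp: eventually_at_filter power_int_diff algebra_simps)
    moreover have "posR (C + c * C')" using C(1) C'(1) by (auto simp: c_def intro: posR_add)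
    ultimately show ?thesis using that unfolding asym_def by (auto intro: posR_add)
  qed
  show ?thesis
  proof (cases "e \<le> d")
    case True thus ?thesis using *[OF assms] by simp
  next
    case False thus ?thesis using *[OF assms(2,1)] by (simp add: add.commute)
  qed
qed

lemma asym_leading:
  assumes g: "asym g d" and lim: "((\<lambda>\<epsilon>. complex_of_real \<epsilon> powi e * g \<epsilon>) \<longlongrightarrow> C) (at_right 0)" "C \<noteq> 0"
  shows "e = d"
proof -
  obtain C' where C': "posR C'" "((\<lambda>\<epsilon>. complex_of_real \<epsilon> powi d * g \<epsilon>) \<longlongrightarrow> C') (at_right 0)" using g unfolding asym_def by blast
  have zero: False if "m < n" "((\<lambda>\<epsilon>. complex_of_real \<epsilon> powi n * g \<epsilon>) \<longlongrightarrow> c) (at_right 0)" "c \<noteq> 0"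
    "((\<lambda>\<epsilon>. complex_of_real \<epsilon> powi m * g \<epsilon>) \<longlongrightarrow> c') (at_right 0)" for m n c c'
  proof -
    have "((\<lambda>\<epsilon>. complex_of_real \<epsilon> powi (n - m) * (complex_of_real \<epsilon> powi m * g \<epsilon>)) \<longlongrightarrow> 0 * c') (at_right 0)"
      using tendsto_eps_powi[of "n - m"] that by (intro tendsto_intros) auto
    hence "((\<lambda>\<epsilon>. complex_of_real \<epsilon> powi n * g \<epsilon>) \<longlongrightarrow> 0 * c') (at_right 0)"
      by (rule Lim_transform_eventually) (auto simp: eventually_at_filter power_int_diff)
    thus False using tendsto_unique[OF _ that(2)] that(3) by force
  qed
  have "C' \<noteq> 0" using C'(1) by (rule posR_nz)
  thus ?thesis using zero[OF _ lim C'(2)] zero[OF _ C'(2) _ lim(1)] by (cases e d rule: linorder_cases) auto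
qed

lemma asym_laurent:
  assumes g: "asym g d" and e: "\<And>\<epsilon>. \<epsilon> > 0 \<Longrightarrow> g \<epsilon> = (\<Sum>n\<in>{-int N..int N}. a n * complex_of_real \<epsilon> powi n)"
  shows "(\<forall>n\<in>{-int N..int N}. n < - d \<longrightarrow> a n = 0) \<and> - d \<in> {-int N..int N} \<and> a (- d) \<noteq> 0"
proof -
  have ex: "\<exists>n\<in>{-int N..int N}. a n \<noteq> 0"
  proof (rule ccontr)
    assume "\<not> ?thesis"
    hence "g 1 = 0" using e[of 1] by simp
    thus False using g unfolding asym_def by (auto dest!: spec[of _ 1] posR_nz)
  qed
  define S where "S = {n\<in>{-int N..int N}. a n \<noteq> 0}"
  have "S \<subseteq> {-int N..int N}" by (auto simp: S_def)
  hence S: "finite S" "S \<noteq> {}" using ex finite_subset by (auto simp: S_def)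
  define n0 where "n0 = Min S"
  have n0: "n0 \<in> S" "\<And>n. n \<in> S \<Longrightarrow> n0 \<le> n" using S by (auto simp: n0_def)
  have "((\<lambda>\<epsilon>. \<Sum>n\<in>S. a n * complex_of_real \<epsilon> powi (n - n0)) \<longlongrightarrow> (\<Sum>n\<in>S. a n * (if n - n0 = 0 then 1 else 0))) (at_right 0)"
    by (intro tendsto_sum tendsto_mult tendsto_const tendsto_eps_powi) (use n0 in simp)
  also have "(\<Sum>n\<in>S. a n * (if n - n0 = 0 then 1 else 0)) = (\<Sum>n\<in>S. if n = n0 then a n else 0)" by (intro sum.cong) auto
  also have "\<dots> = a n0" using S n0 by simp
  finally have L: "((\<lambda>\<epsilon>. \<Sum>n\<in>S. a n * complex_of_real \<epsilon> powi (n - n0)) \<longlongrightarrow> a n0) (at_right 0)" .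
  have "(\<Sum>n\<in>S. a n * complex_of_real \<epsilon> powi (n - n0)) = complex_of_real \<epsilon> powi (- n0) * g \<epsilon>" if "\<epsilon> > 0" for \<epsilon>
  proof -
    have "g \<epsilon> = (\<Sum>n\<in>S. a n * complex_of_real \<epsilon> powi n)"
      unfolding e[OF that] S_def by (rule sum.mono_neutral_right) auto
    thus ?thesis using that by (simp add: sum_distrib_left power_int_diff power_int_minus divide_inverse mult_ac)
  qed
  hence "((\<lambda>\<epsilon>. complex_of_real \<epsilon> powi (- n0) * g \<epsilon>) \<longlongrightarrow> a n0) (at_right 0)"
    by (intro Lim_transform_eventually[OF L]) (auto simp: eventually_at_filter)
  from asym_leading[OF g this] n0(1) have "- n0 = d" by (auto simp: S_def)
  thus ?thesis using n0 by (force simp: S_def)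
qed

definition lsum :: "nat \<Rightarrow> ('v::finite \<Rightarrow> int) set \<Rightarrow> (('v \<Rightarrow> int) \<Rightarrow> complex) \<Rightarrow> ('v \<Rightarrow> complex) \<Rightarrow> complex" where
  "lsum N S c z = (\<Sum>\<nu>\<in>exp_box N UNIV \<inter> S. c \<nu> * (\<Prod>v\<in>UNIV. z v powi \<nu> v))"

lemma laurent1_powi: "laurent1 (\<lambda>t. t powi n)"
proof (cases "n \<ge> 0")
  case True
  thus ?thesis unfolding laurent1_def
    by (intro exI[of _ "monom 1 (nat n)"] exI[of _ 0]) (simp add: poly_monom power_int_def)
next
  case False
  thus ?thesis unfolding laurent1_def
    by (intro exI[of _ 1] exI[of _ "nat (- n)"]) (simp add: power_int_def divide_inverse power_inverse)
qed

lemma prod_fun_upd: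
  fixes z :: "'v::finite \<Rightarrow> complex"
  shows "(\<Prod>v\<in>UNIV. (z(w := t)) v powi \<nu> v) = (\<Prod>v\<in>UNIV - {w}. z v powi \<nu> v) * t powi \<nu> w"
proof -
  have "(\<Prod>v\<in>UNIV - {w}. (z(w := t)) v powi \<nu> v) = (\<Prod>v\<in>UNIV - {w}. z v powi \<nu> v)" by (intro prod.cong) auto
  thus ?thesis using prod.remove[of UNIV w "\<lambda>v. (z(w := t)) v powi \<nu> v"] by (simp add: mult_ac)
qed

lemma laurent1_lsum: "laurent1 (\<lambda>t. lsum N S c (z(w := t)))"
  unfolding lsum_def prod_fun_upd mult.assoc[symmetric] by (intro laurent1_sum laurent1_cmult laurent1_powi)

text \<open>Vanishing is extended from positive reals to nonzero complex numbers one variable at a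
  time, as infinitely many values determine a Laurent polynomial in one variable. Then the
  coefficients can be read off.\<close>

lemma lsum_positive_eq_0:
  assumes "\<And>z. (\<And>v. posR (z v)) \<Longrightarrow> lsum N S c z = 0" "\<nu> \<in> exp_box N UNIV" "\<nu> \<in> S"
  shows "c \<nu> = 0"
proof -
  have ext: "\<forall>z. (\<forall>v\<in>W. z v \<noteq> 0) \<longrightarrow> (\<forall>v. v \<notin> W \<longrightarrow> posR (z v)) \<longrightarrow> lsum N S c z = 0" for W :: "'a set"
  proof (induction W rule: finite_induct[OF finite])
    case 1 show ?case using assms(1) by auto
  next
    case (2 w W)
    have inf: "infinite (complex_of_real ` {0<..})" by (simp add: finite_image_iff inj_on_def infinite_Ioi)
    have zero: "w' \<noteq> 0 \<and> lsum N S c (z(w := w')) = 0" if z: "\<forall>v\<in>insert w W. z v \<noteq> 0" "\<forall>v. v \<notin> insert w W \<longrightarrow> posR (z v)"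
      and w': "w' \<in> complex_of_real ` {0<..}" for z w'
    proof -
      have p: "posR w'" using w' by (auto simp: posR_def)
      have "\<forall>v\<in>W. (z(w := w')) v \<noteq> 0" "\<forall>v. v \<notin> W \<longrightarrow> posR ((z(w := w')) v)" using z p \<open>w \<notin> W\<close> by auto
      thus ?thesis using 2(3) posR_nz[OF p] by blast
    qed
    show ?case
    proof (intro allI impI)
      fix z assume z: "\<forall>v\<in>insert w W. z v \<noteq> 0" "\<forall>v. v \<notin> insert w W \<longrightarrow> posR (z v)"
      have "lsum N S c (z(w := z w)) = 0"
        by (rule laurent1_eq_0[OF laurent1_lsum inf zero[OF z]]) (use z in auto)
      thus "lsum N S c z = 0" by simp
    qed
  qed
  have 0: "lsum N S c z = 0" if "\<forall>v. z v \<noteq> 0" for z using ext[of UNIV] that by auto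
  define c' where "c' \<nu> = (if \<nu> \<in> S then c \<nu> else 0)" for \<nu>
  have "laurent_coeff N UNIV (\<lambda>_. 0) \<nu> = c' \<nu>"
  proof (rule laurent_coeff_eq)
    fix z :: "'a \<Rightarrow> complex" assume "\<forall>v. z v \<noteq> 0"
    hence "0 = lsum N S c z" using 0 by simp
    also have "\<dots> = (\<Sum>\<nu>\<in>exp_box N UNIV. c' \<nu> * (\<Prod>v\<in>UNIV. z v powi \<nu> v))"
      unfolding lsum_def by (rule sum.mono_neutral_cong_left) (auto simp: c'_def finite_exp_box)
    finally show "0 = (\<Sum>\<nu>\<in>exp_box N UNIV. c' \<nu> * (\<Prod>v\<in>UNIV. z v powi \<nu> v))" .
  qed (use assms in auto)
  thus ?thesis using assms(3) by (simp add: laurent_coeff_def c'_def)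
qed

text \<open>Sorted by powers of the variable w, F has coefficients \<open>a z n\<close> that are
  Laurent in the other variables. For positive z the growth order says that they vanish for n < -d
  and that the one for n = -d does not. By \<open>lsum_positive_eq_0\<close> the vanishing passes to
  the individual coefficients of F.\<close>

lemma laurent_support:
  fixes F :: "('v::finite \<Rightarrow> complex) \<Rightarrow> complex"
  assumes F: "\<And>z. \<forall>v. z v \<noteq> 0 \<Longrightarrow> F z = (\<Sum>\<nu>\<in>exp_box N UNIV. c \<nu> * (\<Prod>v\<in>UNIV. z v powi \<nu> v))"
    and asym: "\<And>z. (\<And>v. posR (z v)) \<Longrightarrow> asym (\<lambda>\<epsilon>. F (z(w := complex_of_real \<epsilon>))) d"
  shows "(\<forall>\<nu>\<in>exp_box N UNIV. c \<nu> \<noteq> 0 \<longrightarrow> \<nu> w \<ge> - d) \<and> (\<exists>\<nu>\<in>exp_box N UNIV. c \<nu> \<noteq> 0 \<and> \<nu> w = - d)"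
proof -
  define a where "a z n = (\<Sum>\<nu>\<in>exp_box N UNIV \<inter> {\<nu>. \<nu> w = n}. c \<nu> * (\<Prod>v\<in>UNIV - {w}. z v powi \<nu> v))" for z n
  have a: "lsum N {\<nu>. \<nu> w = n} c z = a z n * z w powi n" for z n
    unfolding lsum_def a_def sum_distrib_right
    by (intro sum.cong refl) (subst prod.remove[of UNIV w], auto)
  have key: "(\<forall>n\<in>{-int N..int N}. n < - d \<longrightarrow> a z n = 0) \<and> - d \<in> {-int N..int N} \<and> a z (- d) \<noteq> 0" if z: "\<And>v. posR (z v)" for z
  proof (rule asym_laurent[OF asym[OF z]])
    fix \<epsilon> :: real assume e: "\<epsilon> > 0"
    have nz: "\<forall>v. (z(w := complex_of_real \<epsilon>)) v \<noteq> 0" using e z by (auto dest: posR_nz)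
    have "F (z(w := complex_of_real \<epsilon>)) = (\<Sum>\<nu>\<in>exp_box N UNIV. c \<nu> * ((\<Prod>v\<in>UNIV - {w}. z v powi \<nu> v) * complex_of_real \<epsilon> powi \<nu> w))"
      unfolding F[OF nz] prod_fun_upd ..
    also have "\<dots> = (\<Sum>n\<in>{-int N..int N}. \<Sum>\<nu>\<in>{\<nu>\<in>exp_box N UNIV. \<nu> w = n}. c \<nu> * ((\<Prod>v\<in>UNIV - {w}. z v powi \<nu> v) * complex_of_real \<epsilon> powi \<nu> w))"
      by (rule sum.group[symmetric, OF finite_exp_box[OF finite] finite_atLeastAtMost_int])
        (auto simp: exp_box_def abs_le_iff minus_le_iff)
    also have "\<dots> = (\<Sum>n\<in>{-int N..int N}. a z n * complex_of_real \<epsilon> powi n)"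
      unfolding a_def sum_distrib_right by (intro sum.cong refl) auto
    finally show "F (z(w := complex_of_real \<epsilon>)) = \<dots>" .
  qed
  have "c \<nu> = 0" if "\<nu> \<in> exp_box N UNIV" "\<nu> w < - d" for \<nu>
  proof (rule lsum_positive_eq_0[OF _ that(1)])
    fix z :: "'v \<Rightarrow> complex" assume "\<And>v. posR (z v)"
    from key[where z = z, OF this] have k: "\<forall>n\<in>{-int N..int N}. n < - d \<longrightarrow> a z n = 0" by simp
    have "\<bar>\<nu> w\<bar> \<le> int N" using that(1) by (simp add: exp_box_def)
    hence "a z (\<nu> w) = 0" using that(2) by (intro k[rule_format]) auto
    thus "lsum N {\<nu>'. \<nu>' w = \<nu> w} c z = 0" by (simp add: a)
  qed simp
  moreover have "\<exists>\<nu>\<in>exp_box N UNIV. c \<nu> \<noteq> 0 \<and> \<nu> w = - d"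
  proof (rule ccontr)
    assume "\<not> ?thesis"
    hence "a (\<lambda>_. 1) (- d) = 0" unfolding a_def by (intro sum.neutral) auto
    thus False using key[of "\<lambda>_. 1"] posR_1 by blast
  qed
  ultimately show ?thesis by (meson not_le)
qed


section \<open>Exponents of the Laurent expansions\<close>

context weyl begin

text \<open>The value \<open>-\<alpha>\<^sub>k\<close> at \<open>m = 0\<close> is the usual denominator of an initial variable; it makes \<open>dv_recursion\<close> hold from
  the start.\<close>

definition dv :: "nat \<Rightarrow> 'i \<Rightarrow> 'i weight" where
  "dv m k = (if m = 0 then - axis k 1
     else SOME q. root_comb A q = (cox A ^^ (m - 1)) (fund_weight k) - (cox A ^^ m) (fund_weight k))"

lemma root_comb_dv:
  "root_comb A (dv (Suc m) k) = (cox A ^^ m) (fund_weight k) - (cox A ^^ Suc m) (fund_weight k)"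
proof -
  define P where "P q \<longleftrightarrow> root_comb A q = (cox A ^^ m) (fund_weight k) - (cox A ^^ Suc m) (fund_weight k)" for q
  obtain q where "(cox A ^^ m) (fund_weight k) - cox A ((cox A ^^ m) (fund_weight k)) = root_comb A q"
    using telescope[OF distinct_cox_word, of "(cox A ^^ m) (fund_weight k)"] unfolding cox_def by metis
  hence "P q" unfolding P_def by (simp only: funpow.simps(2) o_apply)
  hence "P (SOME q. P q)" by (rule someI)
  moreover have "dv (Suc m) k = (SOME q. P q)"
    unfolding dv_def P_def by (simp only: diff_Suc_1 nat.distinct if_False)
  ultimately show ?thesis by (simp only: P_def)
qed

lemma dv_nonneg: assumes "good A (Suc m) k" shows "dv (Suc m) k $ l \<ge> 0"
proof -
  have "weight_ge A ((cox A ^^ m) (fund_weight k)) ((cox A ^^ Suc m) (fund_weight k))"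
    using assms by (simp add: good_def del: funpow.simps)
  thus ?thesis unfolding weight_ge_def root_comb_dv[symmetric] root_comb_eq_iff by auto
qed

lemma root_comb_sum: "root_comb A (\<Sum>x\<in>S. g x) = (\<Sum>x\<in>S. root_comb A (g x))"
  by (induction S rule: infinite_finite_induct) (simp_all add: root_comb_add)

text \<open>Apply s_1 ... s_{k-1} to alpha_k, the sum of a_{i,k} omega_i. This product sends omega_i
  to c omega_i for i < k and fixes the other fundamental weights, and it sends alpha_k to omega_k -
  c omega_k.\<close>

lemma cox_exchange:
  "fund_weight k + cox A (fund_weight k) =
    (\<Sum>i\<in>UNIV - {k}. (- A $ i $ k) *s (if i < k then cox A (fund_weight i) else fund_weight i))"
proof -
  obtain us vs where c: "cox_word = us @ k # vs" "set us = {..<k}" "set vs = {k<..}" using cox_word_split[of k] by blast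
  have u: "word_act A us (fund_weight i) = (if i < k then cox A (fund_weight i) else fund_weight i)" if "i \<noteq> k" for i
  proof (cases "i < k")
    case True
    hence "i \<notin> set (k # vs)" using c(3) that by auto
    hence "word_act A (k # vs) (fund_weight i) = fund_weight i" by (rule word_act_fund_fix)
    thus ?thesis using True by (simp only: cox_def c(1) word_act_append if_True)
  next
    case False thus ?thesis using word_act_fund_fix[of i us] c(2) by simp
  qed
  have uk: "word_act A us (fund_weight k) = fund_weight k" using c(2) by (intro word_act_fund_fix) auto
  have "simple_root A k = (\<Sum>i\<in>UNIV - {k}. A $ i $ k *s fund_weight i) + 2 *s fund_weight k"
    unfolding simple_root_def by (subst sum.remove[of UNIV k]) (simp_all add: A_diag)
  hence "word_act A us (simple_root A k) = (\<Sum>i\<in>UNIV - {k}. A $ i $ k *s word_act A us (fund_weight i)) + 2 *s fund_weight k"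
    by (simp add: word_act_add word_act_sum word_act_smult uk)
  also have "(\<Sum>i\<in>UNIV - {k}. A $ i $ k *s word_act A us (fund_weight i))
    = (\<Sum>i\<in>UNIV - {k}. A $ i $ k *s (if i < k then cox A (fund_weight i) else fund_weight i))" (is "_ = ?S")
    by (intro sum.cong refl) (simp add: u)
  finally have e: "fund_weight k - cox A (fund_weight k) = ?S + 2 *s fund_weight k" using cox_fund[OF c] by simp
  have two: "2 *s fund_weight k = fund_weight k + (fund_weight k :: 'i weight)" by (simp add: vec_eq_iff)
  have gen: "a + b = - S" if "a - b = S + t" "t = a + a" for a b S t :: "'i weight"
  proof -
    have "a + b = (a + a) - (a - b)" by simp
    also have "\<dots> = - S" unfolding that(1) using that(2) by simp
    finally show ?thesis .
  qed
  have "fund_weight k + cox A (fund_weight k) = - ?S" by (rule gen[OF e two])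
  also have "\<dots> = (\<Sum>i\<in>UNIV - {k}. (- A $ i $ k) *s (if i < k then cox A (fund_weight i) else fund_weight i))"
    unfolding sum_negf[symmetric] vector_smult_lneg ..
  finally show ?thesis .
qed

lemma dv_1_axis: "dv 1 k = axis k 1 + (\<Sum>i\<in>{..<k}. (- A $ i $ k) *s dv 1 i)"
proof -
  have 1: "root_comb A (dv 1 i) = fund_weight i - cox A (fund_weight i)" for i using root_comb_dv[of 0 i] by simp
  have "root_comb A (axis k 1 + (\<Sum>i\<in>{..<k}. (- A $ i $ k) *s dv 1 i)) =
    simple_root A k + (\<Sum>i\<in>{..<k}. (- A $ i $ k) *s fund_weight i) - (\<Sum>i\<in>{..<k}. (- A $ i $ k) *s cox A (fund_weight i))"
    by (simp add: root_comb_add root_comb_sum root_comb_smult root_comb_axis 1 vector_ssub_ldistrib sum_subtractf del: One_nat_def)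
  also have "(\<Sum>i\<in>{..<k}. (- A $ i $ k) *s cox A (fund_weight i)) =
     fund_weight k + cox A (fund_weight k) - (\<Sum>i\<in>{k<..}. (- A $ i $ k) *s fund_weight i)"
  proof -
    have "UNIV - {k} = {..<k} \<union> {k<..}" by auto
    hence "fund_weight k + cox A (fund_weight k) = (\<Sum>i\<in>{..<k} \<union> {k<..}. (- A $ i $ k) *s (if i < k then cox A (fund_weight i) else fund_weight i))"
      by (simp add: cox_exchange)
    also have "\<dots> = (\<Sum>i\<in>{..<k}. (- A $ i $ k) *s (if i < k then cox A (fund_weight i) else fund_weight i)) +
       (\<Sum>i\<in>{k<..}. (- A $ i $ k) *s (if i < k then cox A (fund_weight i) else fund_weight i))"
      by (rule sum.union_disjoint) auto
    also have "\<dots> = (\<Sum>i\<in>{..<k}. (- A $ i $ k) *s cox A (fund_weight i)) + (\<Sum>i\<in>{k<..}. (- A $ i $ k) *s fund_weight i)"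
      by (intro arg_cong2[of _ _ _ _ "(+)"] sum.cong) auto
    finally show ?thesis by (simp add: algebra_simps)
  qed
  also have "simple_root A k + (\<Sum>i\<in>{..<k}. (- A $ i $ k) *s fund_weight i) - (fund_weight k + cox A (fund_weight k) - (\<Sum>i\<in>{k<..}. (- A $ i $ k) *s fund_weight i))
     = fund_weight k - cox A (fund_weight k)"
  proof -
    have "UNIV = {..<k} \<union> ({k} \<union> {k<..})" by auto
    hence "simple_root A k = (\<Sum>i\<in>{..<k} \<union> ({k} \<union> {k<..}). A $ i $ k *s fund_weight i)" by (simp add: simple_root_def)
    also have "\<dots> = (\<Sum>i\<in>{..<k}. A $ i $ k *s fund_weight i) + (2 *s fund_weight k + (\<Sum>i\<in>{k<..}. A $ i $ k *s fund_weight i))"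
      by (subst sum.union_disjoint, auto)+ (simp add: A_diag)
    finally have "simple_root A k = (\<Sum>i\<in>{..<k}. A $ i $ k *s fund_weight i) + (2 *s fund_weight k + (\<Sum>i\<in>{k<..}. A $ i $ k *s fund_weight i))" .
    moreover have "2 *s fund_weight k = fund_weight k + (fund_weight k :: 'i weight)" by (simp add: vec_eq_iff)
    ultimately show ?thesis by (simp add: sum_negf vector_smult_lneg)
  qed
  finally show ?thesis unfolding 1[symmetric] root_comb_eq_iff by simp
qed

lemma dv_1_support: "k < j \<Longrightarrow> dv 1 k $ j = 0"
proof (induction "card {..<k}" arbitrary: k rule: less_induct)
  case less
  have "dv 1 i $ j = 0" if "i < k" for i
    using that less.prems by (intro less.hyps psubset_card_mono) auto
  thus ?case using less.prems by (subst dv_1_axis) (simp add: axis_def)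
qed

text \<open>For m > 0 the relation holds even without \<open>max\<close>, by applying c^(m-1) - c^m
  to \<open>cox_exchange\<close>, and its left side is nonnegative because the chain of k descends.
  For m = 0 the vectors - alpha_i of the larger indices make the sum at a coordinate j > k equal to
  a_{j,k}, which is at most 0, while the left side is 0 there; the other coordinates agree.\<close>

lemma dv_recursion:
  assumes g: "good A (Suc m) k"
  shows "dv m k $ j + dv (Suc m) k $ j =
    max 0 (\<Sum>i\<in>UNIV - {k}. - A $ i $ k * dv (if i < k then Suc m else m) i $ j)"
proof (cases m)
  case 0
  have "(\<Sum>i\<in>UNIV - {k}. - A $ i $ k * dv (if i < k then Suc m else m) i $ j)
    = (\<Sum>i\<in>{..<k} \<union> {k<..}. - A $ i $ k * dv (if i < k then Suc m else m) i $ j)"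
    by (intro sum.cong) auto
  also have "\<dots> = (\<Sum>i\<in>{..<k}. - A $ i $ k * dv (if i < k then Suc m else m) i $ j) + (\<Sum>i\<in>{k<..}. - A $ i $ k * dv (if i < k then Suc m else m) i $ j)"
    by (rule sum.union_disjoint) auto
  also have "(\<Sum>i\<in>{..<k}. - A $ i $ k * dv (if i < k then Suc m else m) i $ j) = (\<Sum>i\<in>{..<k}. - A $ i $ k * dv 1 i $ j)"
    by (intro sum.cong) (auto simp: 0)
  also have "(\<Sum>i\<in>{k<..}. - A $ i $ k * dv (if i < k then Suc m else m) i $ j) = (\<Sum>i\<in>{k<..}. if i = j then A $ j $ k else 0)"
    by (intro sum.cong) (auto simp: 0 dv_def axis_def)
  also have "\<dots> = (if k < j then A $ j $ k else 0)" by simp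
  finally have S: "(\<Sum>i\<in>UNIV - {k}. - A $ i $ k * dv (if i < k then Suc m else m) i $ j)
    = (\<Sum>i\<in>{..<k}. - A $ i $ k * dv 1 i $ j) + (if k < j then A $ j $ k else 0)" .
  have L: "dv m k $ j + dv (Suc m) k $ j = (\<Sum>i\<in>{..<k}. - A $ i $ k * dv 1 i $ j)"
    using dv_1_axis[of k] by (simp add: 0 dv_def[of 0])
  have nn: "(\<Sum>i\<in>{..<k}. - A $ i $ k * dv 1 i $ j) \<ge> 0"
    using A_off dv_nonneg[of 0] good_1 by (intro sum_nonneg mult_nonneg_nonneg) (auto simp: less_imp_neq)
  show ?thesis
  proof (cases "k < j")
    case True
    hence "(\<Sum>i\<in>{..<k}. - A $ i $ k * dv 1 i $ j) = 0" by (intro sum.neutral ballI) (simp add: dv_1_support del: One_nat_def)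
    thus ?thesis unfolding L S using True A_off[of j k] by simp
  next
    case False thus ?thesis unfolding L S using nn by simp
  qed
next
  case (Suc p)
  have pow: "(cox A ^^ m) v = (cox A ^^ p) (cox A v)" "(cox A ^^ Suc m) v = (cox A ^^ m) (cox A v)" for v
    by (simp_all only: Suc funpow_Suc_right o_apply)
  have "root_comb A (dv m k + dv (Suc m) k) = (cox A ^^ p) (fund_weight k + cox A (fund_weight k)) - (cox A ^^ m) (fund_weight k + cox A (fund_weight k))"
    unfolding root_comb_add Suc root_comb_dv unfolding Suc[symmetric] cox_pow_add pow by (simp add: algebra_simps)
  also have "\<dots> = (\<Sum>i\<in>UNIV - {k}. (- A $ i $ k) *s root_comb A (dv (if i < k then Suc m else m) i))"
  proof -
    have lin: "(cox A ^^ n) (\<Sum>i\<in>S. g i) = (\<Sum>i\<in>S. (cox A ^^ n) (g i))" for n S and g :: "'i \<Rightarrow> 'i weight"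
      unfolding cox_pow_word_act[symmetric] by (rule word_act_sum)
    show ?thesis unfolding cox_exchange lin cox_pow_smult sum_subtractf[symmetric]
    proof (intro sum.cong refl)
      fix i
      have "root_comb A (dv (if i < k then Suc m else m) i) = (cox A ^^ p) (if i < k then cox A (fund_weight i) else fund_weight i)
         - (cox A ^^ m) (if i < k then cox A (fund_weight i) else fund_weight i)"
      proof (cases "i < k")
        case True show ?thesis unfolding if_P[OF True] root_comb_dv pow ..
      next
        case False show ?thesis unfolding if_not_P[OF False] Suc root_comb_dv ..
      qed
      thus "- A $ i $ k *s (cox A ^^ p) (if i < k then cox A (fund_weight i) else fund_weight i) - - A $ i $ k *s (cox A ^^ m) (if i < k then cox A (fund_weight i) else fund_weight i)
         = - A $ i $ k *s root_comb A (dv (if i < k then Suc m else m) i)"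
        by (simp only: vector_ssub_ldistrib)
    qed
  qed
  also have "\<dots> = root_comb A (\<Sum>i\<in>UNIV - {k}. (- A $ i $ k) *s dv (if i < k then Suc m else m) i)"
    by (simp only: root_comb_sum root_comb_smult)
  finally have e: "dv m k + dv (Suc m) k = (\<Sum>i\<in>UNIV - {k}. (- A $ i $ k) *s dv (if i < k then Suc m else m) i)"
    unfolding root_comb_eq_iff .
  have "good A m k" using g by (simp add: good_def)
  hence "dv m k $ j + dv (Suc m) k $ j \<ge> 0" using dv_nonneg[OF g] dv_nonneg[of p k j] by (simp add: Suc)
  moreover have "dv m k $ j + dv (Suc m) k $ j = (\<Sum>i\<in>UNIV - {k}. - A $ i $ k * dv (if i < k then Suc m else m) i $ j)"
    using arg_cong[OF e, of "\<lambda>v. v $ j"] by (simp only: vector_add_component sum_component vector_smult_component)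
  ultimately show ?thesis by simp
qed

end

section \<open>Growth orders and Laurent expansions of the variables\<close>

lemma loc_rat_EE:
  assumes "\<And>i. loc_rat S (\<lambda>t. T t i)" "\<And>i t. t \<in> S \<Longrightarrow> T t i \<noteq> 0"
  shows "loc_rat S (\<lambda>t. EE A ws (T t) i)"
proof (induction ws)
  case (Cons j ws)
  have "loc_rat S (\<lambda>t. T t j powi (A $ j $ i) * EE A ws (T t) i)"
    by (intro loc_rat_mult loc_rat_powi Cons assms)
  thus ?case using assms(1) by (cases "i = j") simp_all
qed (simp add: loc_rat_const)

locale cox_minors = minors D f for D :: "('a::{finite,linorder},'b::finite) group_datum" and f +
  assumes f_reg: "regular_on GG (f i)"
    and roots_dich: "word_act (Cartan D) ws (simple_root (Cartan D) j) = root_comb (Cartan D) q \<Longrightarrow>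
       (\<forall>l. q $ l \<ge> 0) \<or> (\<forall>l. q $ l \<le> 0)"
    and Cartan_inj: "inj (root_comb (Cartan D))"

sublocale cox_minors \<subseteq> weyl "Cartan D"
  by unfold_locales (use Cartan_diag Cartan_offdiag Cartan_inj roots_dich weyl_dominance in auto)

context cox_minors begin

text \<open>Induction on m and, inside it, on the position of k: step m + 1 of k is expressed
  through step m of k and of larger neighbours and through step m + 1 of smaller ones. These are
  still in range by \<open>good_neighbour_greater\<close> and
  \<open>good_neighbour_less\<close>.\<close>

lemma XX_asym:
  assumes "good (Cartan D) m k" "\<And>i. posR (\<tau> i)" "\<And>i. posR (y i)"
  shows "asym (\<lambda>\<epsilon>. XX m k (chart (\<tau>(j := complex_of_real \<epsilon>)) y)) (dv m k $ j)"
  using assms(1)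
proof (induction m arbitrary: k)
  case 0
  have nz: "\<epsilon> > 0 \<Longrightarrow> (\<tau>(j := complex_of_real \<epsilon>)) i \<noteq> 0" for \<epsilon> i using assms(2) posR_nz by auto
  have one: "matrix_inv (mat 1) = (mat 1 :: complex^'b^'b)" by (rule matrix_inv_one)
  have "asym (\<lambda>\<epsilon>. (\<tau>(j := complex_of_real \<epsilon>)) k) (dv 0 k $ j)"
    using asym_var asym_const[OF assms(2)] by (cases "k = j") (auto simp: dv_def axis_def)
  thus ?case
  proof (rule asym_cong)
    fix \<epsilon> :: real assume "\<epsilon> > 0"
    from f_chart[where \<tau> = "\<tau>(j := complex_of_real \<epsilon>)", OF nz[OF this]]
    show "(\<tau>(j := complex_of_real \<epsilon>)) k = XX 0 k (chart (\<tau>(j := complex_of_real \<epsilon>)) y)"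
      by (simp only: XX_def cox_pow_word_0 w_bar_Nil one matrix_mul_lid matrix_mul_rid)
  qed
next
  case (Suc m)
  note outer = Suc.IH
  from Suc.prems show ?case
  proof (induction "card {..<k}" arbitrary: k rule: less_induct)
    case less
    have gm: "good (Cartan D) m k" using less.prems by (simp add: good_def)
    define g where "g i \<epsilon> = XX (if i < k then Suc m else m) i (chart (\<tau>(j := complex_of_real \<epsilon>)) y)" for i \<epsilon>
    define e where "e i = dv (if i < k then Suc m else m) i $ j" for i
    have ngb: "asym (g i) (e i)" if "i \<noteq> k" "Cartan D $ i $ k \<noteq> 0" for i
    proof (cases "i < k")
      case True
      have "card {..<i} < card {..<k}" using True by (intro psubset_card_mono) auto
      from less.hyps[OF this good_neighbour_less[OF less.prems True that(2)]] True show ?thesis by (simp add: g_def[abs_def] e_def del: fun_upd_apply)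
    next
      case False
      hence "k < i" using that(1) by simp
      have "good (Cartan D) m i" using good_neighbour_greater[of "Suc m" k i] less.prems \<open>k < i\<close> that(2) by simp
      from outer[OF this] False show ?thesis by (simp add: g_def[abs_def] e_def del: fun_upd_apply)
    qed
    have "asym (\<lambda>\<epsilon>. g i \<epsilon> ^ nat (- Cartan D $ i $ k)) (- Cartan D $ i $ k * e i)" if "i \<in> UNIV - {k}" for i
    proof (cases "Cartan D $ i $ k = 0")
      \<comment> \<open>A zero Cartan entry gives exponent 0, so the chain of that index may have
        ended already.\<close>
      case True thus ?thesis using asym_const[OF posR_1] by simp
    next
      case False
      thus ?thesis using asym_power[OF ngb[of i], of "nat (- Cartan D $ i $ k)"] that A_off[of i k] by simp
    qed
    hence P: "asym (\<lambda>\<epsilon>. \<Prod>i\<in>UNIV - {k}. g i \<epsilon> ^ nat (- Cartan D $ i $ k)) (\<Sum>i\<in>UNIV - {k}. - Cartan D $ i $ k * e i)"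
      by (intro asym_prod) auto
    have "\<exists>T. (\<forall>i. T i \<noteq> 0) \<and> (\<forall>i\<in>set cox_word. EE (Cartan D) cox_word T i = y i) \<and> ((\<forall>i. posR (y i)) \<longrightarrow> (\<forall>i. posR (T i)))"
      by (rule EE_surj[OF distinct_cox_word]) (rule posR_nz[OF assms(3)])
    then obtain M where M: "\<And>i. M i \<noteq> 0" "\<And>i. EE (Cartan D) cox_word M i = y i" "\<And>i. posR (M i)"
      using assms(3) by auto
    define Mm where "Mm = (\<Prod>l\<in>UNIV. M l powi ((cox (Cartan D) ^^ m) (fund_weight k) $ l))"
    have "posR Mm" unfolding Mm_def by (intro posR_prod posR_powi M)
    from asym_mult[OF asym_add[OF asym_const[OF this] P] asym_inverse[OF outer[OF gm]]]
    have "asym (\<lambda>\<epsilon>. (Mm + (\<Prod>i\<in>UNIV - {k}. g i \<epsilon> ^ nat (- Cartan D $ i $ k))) *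
      inverse (XX m k (chart (\<tau>(j := complex_of_real \<epsilon>)) y)))
      (max 0 (\<Sum>i\<in>UNIV - {k}. - Cartan D $ i $ k * e i) + - dv m k $ j)" .
    also have "max 0 (\<Sum>i\<in>UNIV - {k}. - Cartan D $ i $ k * e i) + - dv m k $ j = dv (Suc m) k $ j"
      using dv_recursion[OF less.prems, of j] by (simp add: e_def)
    finally show ?case
    proof (rule asym_cong)
      fix \<epsilon> :: real assume \<epsilon>: "\<epsilon> > 0"
      have nz: "(\<tau>(j := complex_of_real \<epsilon>)) i \<noteq> 0" for i using \<epsilon> assms(2) posR_nz by auto
      have "XX m k (chart (\<tau>(j := complex_of_real \<epsilon>)) y) \<noteq> 0" using outer[OF gm] \<epsilon> unfolding asym_def by (auto dest: posR_nz)
      moreover have "XX m k (chart (\<tau>(j := complex_of_real \<epsilon>)) y) * XX (Suc m) k (chart (\<tau>(j := complex_of_real \<epsilon>)) y)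
        = Mm + (\<Prod>i\<in>UNIV - {k}. g i \<epsilon> ^ nat (- Cartan D $ i $ k))"
        unfolding Mm_def g_def by (rule chart_recursion[OF nz M(1,2) good_desc[OF less.prems]]) simp
      ultimately show "(Mm + (\<Prod>i\<in>UNIV - {k}. g i \<epsilon> ^ nat (- Cartan D $ i $ k))) *
        inverse (XX m k (chart (\<tau>(j := complex_of_real \<epsilon>)) y)) = XX (Suc m) k (chart (\<tau>(j := complex_of_real \<epsilon>)) y)"
        by (simp add: field_simps)
    qed
  qed
qed

lemma chart_rat:
  assumes "\<And>i. loc_rat S (\<lambda>t. \<tau> t i)" "\<And>i. loc_rat S (\<lambda>t. y t i)" "\<And>i t. t \<in> S \<Longrightarrow> \<tau> t i \<noteq> 0"
  shows "loc_rat S (\<lambda>t. chart (\<tau> t) (y t) $ a $ b)"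
proof -
  have E: "loc_rat S (\<lambda>t. EE (Cartan D) cox_word (\<tau> t) i)" for i by (rule loc_rat_EE[OF assms(1,3)])
  have En: "t \<in> S \<Longrightarrow> EE (Cartan D) cox_word (\<tau> t) i \<noteq> 0" for t i by (rule EE_nz[OF assms(3)])
  have L: "loc_rat S (\<lambda>t. lowp ws (u t) $ a $ b)" if "\<And>i. loc_rat S (\<lambda>t. u t i)" for u ws a b
    by (induction ws arbitrary: a b) (auto simp: lowp_simps intro!: loc_rat_const loc_rat_matrix_mult x_low_rat that)
  have U: "loc_rat S (\<lambda>t. upp ws (u t) $ a $ b)" if "\<And>i. loc_rat S (\<lambda>t. u t i)" for u ws a b
    by (induction ws arbitrary: a b) (auto simp: upp_simps intro!: loc_rat_const loc_rat_matrix_mult x_up_rat that)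
  have T: "loc_rat S (\<lambda>t. torp ws (\<tau> t) $ a $ b)" for ws a b
    by (induction ws arbitrary: a b) (auto simp: torp_simps intro!: loc_rat_const loc_rat_matrix_mult coroot_rat assms(1,3))
  show ?thesis unfolding chart_def
    by (intro loc_rat_matrix_mult L U T loc_rat_divide loc_rat_const E En assms)
qed

text \<open>In each single coordinate the chart is rational without poles on the nonzero numbers,
  and the minor is regular, so the composite is separately Laurent;
  \<open>separately_laurent\<close> joins the variables, with \<open>Inl\<close> for tau and
  \<open>Inr\<close> for y. The growth orders then fix the exponents of tau.\<close>

theorem XX_laurent:
  assumes g: "good (Cartan D) m k"
  shows "\<exists>N c. (\<forall>z. (\<forall>v. z v \<noteq> 0) \<longrightarrow> XX m k (chart (\<lambda>i. z (Inl i)) (\<lambda>i. z (Inr i))) =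
      (\<Sum>\<nu>\<in>exp_box N UNIV. c \<nu> * (\<Prod>v\<in>UNIV. z v powi \<nu> v))) \<and>
    (\<forall>j. (\<forall>\<nu>\<in>exp_box N UNIV. c \<nu> \<noteq> 0 \<longrightarrow> \<nu> (Inl j) \<ge> - dv m k $ j) \<and>
      (\<exists>\<nu>\<in>exp_box N UNIV. c \<nu> \<noteq> 0 \<and> \<nu> (Inl j) = - dv m k $ j))"
proof -
  define F where "F z = XX m k (chart (\<lambda>i. z (Inl i)) (\<lambda>i. z (Inr i)))" for z
  have l: "laurent1 (\<lambda>t. F (z(v := t)))" if z: "\<forall>w. z w \<noteq> 0" for z v
  proof -
    have c: "loc_rat (-{0}) (\<lambda>t. (z(v := t)) w)" for w
      by (cases "w = v") (simp_all add: loc_rat_const loc_rat_id)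
    have nz: "t \<in> -{0} \<Longrightarrow> (z(v := t)) w \<noteq> 0" for t w using z by auto
    have "loc_rat (-{0}) (\<lambda>t. F (z(v := t)))"
      unfolding F_def XX_def
    proof (rule loc_rat_regular[OF f_reg])
      fix a b
      show "loc_rat (-{0}) (\<lambda>t. (matrix_inv (w_bar D (cox_pow_word m)) ** chart (\<lambda>i. (z(v := t)) (Inl i)) (\<lambda>i. (z(v := t)) (Inr i)) ** w_bar D (cox_pow_word m)) $ a $ b)"
        by (intro loc_rat_matrix_mult loc_rat_const chart_rat c nz)
    next
      fix t assume "t \<in> -{0::complex}"
      thus "matrix_inv (w_bar D (cox_pow_word m)) ** chart (\<lambda>i. (z(v := t)) (Inl i)) (\<lambda>i. (z(v := t)) (Inr i)) ** w_bar D (cox_pow_word m) \<in> GG"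
        by (intro GG_mult GG_cancel(1) GG_w chart_GG nz)
    qed
    from loc_rat_Cstar[OF this] show ?thesis by (simp add: laurent1_def)
  qed
  have "\<exists>d c. \<forall>z. (\<forall>w. z w \<noteq> 0) \<and> (\<forall>w. w \<notin> UNIV \<longrightarrow> z w = 1) \<longrightarrow>
    F z = (\<Sum>\<nu>\<in>exp_box d UNIV. c \<nu> * (\<Prod>v\<in>UNIV. z v powi \<nu> v))"
    by (rule separately_laurent[where ?z0.0 = "\<lambda>_. 1"]) (use l in auto)
  then obtain N c where F: "\<And>z. \<forall>v. z v \<noteq> 0 \<Longrightarrow> F z = (\<Sum>\<nu>\<in>exp_box N UNIV. c \<nu> * (\<Prod>v\<in>UNIV. z v powi \<nu> v))" by auto
  have "(\<forall>\<nu>\<in>exp_box N UNIV. c \<nu> \<noteq> 0 \<longrightarrow> \<nu> (Inl j) \<ge> - dv m k $ j) \<and> (\<exists>\<nu>\<in>exp_box N UNIV. c \<nu> \<noteq> 0 \<and> \<nu> (Inl j) = - dv m k $ j)" for j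
  proof (rule laurent_support[OF F])
    fix z :: "'a + 'a \<Rightarrow> complex" assume z: "\<And>v. posR (z v)"
    have "(\<lambda>i. (z(Inl j := t)) (Inl i)) = (\<lambda>i. z (Inl i))(j := t)" "(\<lambda>i. (z(Inl j := t)) (Inr i)) = (\<lambda>i. z (Inr i))" for t by auto
    thus "asym (\<lambda>\<epsilon>. F (z(Inl j := complex_of_real \<epsilon>))) (dv m k $ j)"
      unfolding F_def using XX_asym[where \<tau> = "\<lambda>i. z (Inl i)" and y = "\<lambda>i. z (Inr i)", OF g z z] by simp
  qed
  thus ?thesis using F unfolding F_def by blast
qed

end


section \<open>Limits of conjugated one-parameter subgroups\<close>

lemma matrix_sandwich_sum:
  fixes X U V :: "complex^'m^'m"
  assumes "\<And>a b. X $ a $ b = (\<Sum>l\<in>S. k l * M l $ a $ b)"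
  shows "(U ** X ** V) $ r $ c = (\<Sum>l\<in>S. k l * (U ** M l ** V) $ r $ c)"
proof -
  have "(U ** X ** V) $ r $ c = (\<Sum>j\<in>UNIV. \<Sum>i\<in>UNIV. \<Sum>l\<in>S. k l * (U $ r $ i * M l $ i $ j * V $ j $ c))"
    by (simp add: matrix_matrix_mult_def assms sum_distrib_left sum_distrib_right mult_ac)
  also have "\<dots> = (\<Sum>j\<in>UNIV. \<Sum>l\<in>S. \<Sum>i\<in>UNIV. k l * (U $ r $ i * M l $ i $ j * V $ j $ c))"
    by (intro sum.cong refl sum.swap)
  also have "\<dots> = (\<Sum>l\<in>S. \<Sum>j\<in>UNIV. \<Sum>i\<in>UNIV. k l * (U $ r $ i * M l $ i $ j * V $ j $ c))"
    by (rule sum.swap)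
  also have "\<dots> = (\<Sum>l\<in>S. k l * (U ** M l ** V) $ r $ c)"
    by (simp add: matrix_matrix_mult_def sum_distrib_left sum_distrib_right mult_ac)
  finally show ?thesis .
qed

text \<open>Differentiate x(t + u) = x(t) x(u) at t = 0: the coefficient matrices are those of an
  exponential series.\<close>

lemma one_parameter_coeffs:
  fixes x :: "complex \<Rightarrow> complex^'m^'m"
  assumes hom: "\<And>s t. x (s + t) = x s ** x t" and p: "\<And>t a b. x t $ a $ b = poly (p a b) t"
  shows "of_nat (Suc l) * coeff (p a b) (Suc l) = (\<Sum>k\<in>UNIV. coeff (p a k) 1 * coeff (p k b) l)"
proof -
  have "poly (pderiv (p a b)) u = poly (\<Sum>k\<in>UNIV. smult (coeff (p a k) 1) (p k b)) u" for u
  proof -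
    have "pcompose (p a b) [:u, 1:] = (\<Sum>k\<in>UNIV. smult (poly (p k b) u) (p a k))" (is "?l = ?r")
    proof -
      have "poly ?l t = poly ?r t" for t
        using hom[of t u] by (simp add: poly_pcompose poly_sum p[symmetric] matrix_matrix_mult_def add.commute mult.commute)
      thus ?thesis by (simp add: poly_eq_poly_eq_iff[symmetric] fun_eq_iff)
    qed
    hence "poly (pderiv ?l) 0 = poly (pderiv ?r) 0" by simp
    moreover have "pderiv (\<Sum>k\<in>S. g k) = (\<Sum>k\<in>S. pderiv (g k))" for S and g :: "'m \<Rightarrow> complex poly"
      by (induction S rule: infinite_finite_induct) (simp_all add: pderiv_add)
    ultimately show ?thesis by (simp add: pderiv_pcompose poly_pcompose pderiv_smult poly_sum pderiv_pCons poly_0_coeff_0 coeff_pderiv coeff_sum mult.commute)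
  qed
  hence "pderiv (p a b) = (\<Sum>k\<in>UNIV. smult (coeff (p a k) 1) (p k b))" by (simp add: poly_eq_poly_eq_iff[symmetric] fun_eq_iff)
  from arg_cong[OF this, of "\<lambda>q. coeff q l"] show ?thesis by (simp add: coeff_pderiv coeff_sum)
qed

lemma poly_altdef_le:
  assumes "degree (q :: 'a::comm_semiring_1 poly) \<le> n" shows "poly q s = (\<Sum>k\<le>n. coeff q k * s ^ k)"
  unfolding poly_altdef using assms by (intro sum.mono_neutral_left) (auto simp: coeff_eq_0)

lemma poly_leading_limit:
  fixes q :: "complex poly"
  assumes "degree q \<le> n"
  shows "((\<lambda>s. poly q s / s ^ n) \<longlongrightarrow> coeff q n) at_infinity"
proof -
  have "((\<lambda>s. \<Sum>k\<le>n. coeff q k * inverse s ^ (n - k)) \<longlongrightarrow> (\<Sum>k\<le>n. coeff q k * 0 ^ (n - k))) at_infinity"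
    by (intro tendsto_intros tendsto_inverse_0)
  also have "(\<Sum>k\<le>n. coeff q k * 0 ^ (n - k)) = (\<Sum>k\<le>n. if k = n then coeff q k else 0)"
    by (intro sum.cong) (auto simp: zero_power)
  also have "\<dots> = coeff q n" by simp
  finally have L: "((\<lambda>s. \<Sum>k\<le>n. coeff q k * inverse s ^ (n - k)) \<longlongrightarrow> coeff q n) at_infinity" .
  have "eventually (\<lambda>s. (\<Sum>k\<le>n. coeff q k * inverse s ^ (n - k)) = poly q s / s ^ n) at_infinity"
  proof (rule eventually_mono[OF eventually_not_equal_at_infinity[of 0]])
    fix s :: complex assume s: "s \<noteq> 0"
    have "poly q s = (\<Sum>k\<le>n. coeff q k * s ^ k)" by (rule poly_altdef_le[OF assms])
    moreover have "s ^ k / s ^ n = inverse s ^ (n - k)" if "k \<le> n" for k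
      using s that by (simp add: power_diff power_inverse divide_inverse)
    ultimately show "(\<Sum>k\<le>n. coeff q k * inverse s ^ (n - k)) = poly q s / s ^ n"
      by (simp add: sum_divide_distrib flip: times_divide_eq_right)
  qed
  thus ?thesis by (rule Lim_transform_eventually[OF L])
qed

text \<open>If \<open>a\<close> is the degree in \<open>s\<close> of \<open>u(s) (log x(1)) u(-s)\<close>, then \<open>u(s) x(t s\<^sup>-\<^sup>a) u(-s)\<close> has a
  limit for large \<open>s\<close>.  For root subgroups \<open>u\<close> and \<open>x\<close> of weights \<open>\<alpha>\<close> and \<open>\<beta>\<close> it is a root subgroup of weight
  \<open>a \<alpha> + \<beta>\<close>, which is not a root for distinct simple roots \<open>\<alpha>\<close>, \<open>-\<beta>\<close>.\<close>

lemma noncommuting_limit: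
  fixes x u :: "complex \<Rightarrow> complex^'m^'m"
  assumes x: "\<And>s t. x (s + t) = x s ** x t" "\<And>t a b. x t $ a $ b = poly (p a b) t" "x 0 = mat 1"
    and u: "\<And>s t. u (s + t) = u s ** u t" "\<And>t a b. u t $ a $ b = poly (pu a b) t" "u 0 = mat 1"
    and nc: "u s0 ** x t0 \<noteq> x t0 ** u s0"
  shows "\<exists>a R. a > (0::nat) \<and> inj R \<and> (\<forall>s t. R (s + t) = R s ** R t) \<and> R 0 = mat 1 \<and> (\<forall>r c. \<exists>p. \<forall>t. R t $ r $ c = poly p t) \<and>
    (\<forall>t. ((\<lambda>s. u s ** x (t / s ^ a) ** u (- s)) \<longlongrightarrow> R t) at_infinity)"
proof -
  define L :: "nat \<Rightarrow> complex^'m^'m" where "L l = (\<chi> a b. coeff (p a b) l)" for l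
  define Y where "Y l s = u s ** L l ** u (- s)" for l s
  \<comment> \<open>One more than the largest degree, so that the index 1 of the linear coefficient
    is always at most d.\<close>
  define d where "d = Suc (Max (range (\<lambda>(a, b). degree (p a b))))"
  have d: "degree (p a b) \<le> d" for a b
    unfolding d_def by (rule le_SucI, rule Max_ge) (auto intro: image_eqI[of _ _ "(a, b)"])
  have uu: "u s ** u (- s) = mat 1" "u (- s) ** u s = mat 1" for s
    using u(1)[of s "- s"] u(1)[of "- s" s] u(3) by simp_all
  have L0: "L 0 = mat 1"
    using x(2)[of 0] by (simp add: L_def vec_eq_iff x(3) poly_0_coeff_0)
  have Y0: "Y 0 s = mat 1" for s by (simp add: Y_def L0 matrix_mul_rid uu)
  have LS: "L (Suc l) $ a $ b = inverse (of_nat (Suc l)) * (L 1 ** L l) $ a $ b" for l a b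
    using one_parameter_coeffs[OF x(1,2), of l a b]
    by (simp add: L_def matrix_matrix_mult_def field_simps del: of_nat_Suc One_nat_def)
  have YS: "Y (Suc l) s $ r $ c = inverse (of_nat (Suc l)) * (Y 1 s ** Y l s) $ r $ c" for l s r c
  proof -
    have "Y (Suc l) s $ r $ c = (\<Sum>i\<in>{0::nat}. inverse (of_nat (Suc l)) * (u s ** (L 1 ** L l) ** u (- s)) $ r $ c)"
      unfolding Y_def by (rule matrix_sandwich_sum) (simp add: LS del: of_nat_Suc One_nat_def)
    also have "u s ** (L 1 ** L l) ** u (- s) = u s ** L 1 ** (u (- s) ** u s) ** L l ** u (- s)"
      by (simp add: uu matrix_mul_rid matrix_mul_assoc)
    also have "\<dots> = Y 1 s ** Y l s" by (simp add: Y_def matrix_mul_assoc)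
    finally show ?thesis by simp
  qed
  have y: "(u s ** x t ** u (- s)) $ r $ c = (\<Sum>l\<le>d. t ^ l * Y l s $ r $ c)" for s t r c
    unfolding Y_def
  proof (rule matrix_sandwich_sum)
    fix a b
    have "x t $ a $ b = (\<Sum>l\<le>d. coeff (p a b) l * t ^ l)" unfolding x(2) by (rule poly_altdef_le[OF d])
    thus "x t $ a $ b = (\<Sum>l\<le>d. t ^ l * L l $ a $ b)" by (simp add: L_def mult.commute)
  qed
  have "\<exists>q. \<forall>s. Y 1 s $ r $ c = poly q s" for r c
  proof (rule loc_rat_UNIV)
    have um: "(\<lambda>s. u (- s) $ a $ b) = poly (pcompose (pu a b) [:0, -1:])" for a b by (rule ext) (simp add: u(2) poly_pcompose)
    have up: "(\<lambda>s. u s $ a $ b) = poly (pu a b)" for a b by (rule ext) (simp add: u(2))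
    show "loc_rat UNIV (\<lambda>s. Y 1 s $ r $ c)" unfolding Y_def
      by (intro loc_rat_matrix_mult loc_rat_const) (simp_all only: um up loc_rat_poly)
  qed
  then obtain q where q: "\<And>r c s. Y 1 s $ r $ c = poly (q r c) s" by metis
  define a where "a = Max (range (\<lambda>(r, c). degree (q r c)))"
  have a: "degree (q r c) \<le> a" for r c
    unfolding a_def by (rule Max_ge) (auto intro: image_eqI[of _ _ "(r, c)"])
  have "a \<in> range (\<lambda>(r, c). degree (q r c))" unfolding a_def by (rule Max_in) auto
  then obtain r0 c0 where rc: "degree (q r0 c0) = a" by auto
  \<comment> \<open>If a were 0, conjugation by u(s) would fix the linear coefficient of x, hence
    all coefficients by the recursion \<open>YS\<close>, and u would commute with x.\<close>
  have apos: "a > 0"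
  proof (rule ccontr)
    assume "\<not> a > 0"
    hence "degree (q r c) = 0" for r c using a[of r c] by simp
    hence "poly (q r c) s = poly (q r c) 0" for r c s using degree_eq_zeroE[of "q r c"] by (metis poly_pCons poly_0 mult_zero_right)
    hence Y1: "Y 1 s = Y 1 0" for s unfolding vec_eq_iff q by blast
    have Yl: "Y l s = Y l 0" for l s
    proof (induction l)
      case (Suc l) show ?case by (simp add: vec_eq_iff YS Suc Y1[of s] del: of_nat_Suc One_nat_def)
    qed (simp add: Y0)
    have "u s0 ** x t0 ** u (- s0) = u 0 ** x t0 ** u (- 0)" unfolding vec_eq_iff y Yl[of _ s0] by blast
    hence "u s0 ** x t0 ** u (- s0) ** u s0 = x t0 ** u s0" by (simp add: u(3) matrix_mul_lid matrix_mul_rid)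
    moreover have "u s0 ** x t0 ** u (- s0) ** u s0 = u s0 ** x t0"
      using uu(2)[of s0] by (simp add: matrix_mul_rid flip: matrix_mul_assoc)
    ultimately show False using nc by simp
  qed
  have "\<exists>Z :: complex^'m^'m. \<forall>r c. ((\<lambda>s. Y l s $ r $ c / s ^ (a * l)) \<longlongrightarrow> Z $ r $ c) at_infinity" for l
  proof (induction l)
    case 0 show ?case by (intro exI[of _ "mat 1"]) (simp add: Y0)
  next
    case (Suc l)
    then obtain Z :: "complex^'m^'m" where Z: "\<And>r c. ((\<lambda>s. Y l s $ r $ c / s ^ (a * l)) \<longlongrightarrow> Z $ r $ c) at_infinity" by blast
    have "((\<lambda>s. Y (Suc l) s $ r $ c / s ^ (a * Suc l)) \<longlongrightarrow> inverse (of_nat (Suc l)) * (\<Sum>k\<in>UNIV. coeff (q r k) a * Z $ k $ c)) at_infinity" for r c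
    proof -
      have "((\<lambda>s. inverse (of_nat (Suc l)) * (\<Sum>k\<in>UNIV. (poly (q r k) s / s ^ a) * (Y l s $ k $ c / s ^ (a * l)))) \<longlongrightarrow>
        inverse (of_nat (Suc l)) * (\<Sum>k\<in>UNIV. coeff (q r k) a * Z $ k $ c)) at_infinity"
        by (intro tendsto_intros poly_leading_limit a Z)
      moreover have "Y (Suc l) s $ r $ c / s ^ (a * Suc l) = inverse (of_nat (Suc l)) * (\<Sum>k\<in>UNIV. (poly (q r k) s / s ^ a) * (Y l s $ k $ c / s ^ (a * l)))" for s
        unfolding YS q[symmetric] by (simp add: matrix_matrix_mult_def[of "Y 1 s"] power_add mult.commute flip: sum_divide_distrib del: of_nat_Suc One_nat_def)
      ultimately show ?thesis by (simp only:)
    qed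
    thus ?case by (intro exI[of _ "\<chi> r c. inverse (of_nat (Suc l)) * (\<Sum>k\<in>UNIV. coeff (q r k) a * Z $ k $ c)"]) (simp del: of_nat_Suc)
  qed
  then obtain Z :: "nat \<Rightarrow> complex^'m^'m" where Z: "\<And>l r c. ((\<lambda>s. Y l s $ r $ c / s ^ (a * l)) \<longlongrightarrow> Z l $ r $ c) at_infinity" by metis
  have "((\<lambda>s. Y 1 s $ r0 $ c0 / s ^ (a * 1)) \<longlongrightarrow> coeff (q r0 c0) a) at_infinity"
    using poly_leading_limit[OF a, of r0 c0] by (simp add: q del: One_nat_def)
  hence "Z 1 $ r0 $ c0 = coeff (q r0 c0) a" using tendsto_unique[OF _ Z[of 1 r0 c0]] by (simp add: trivial_limit_at_infinity del: One_nat_def)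
  hence Z1: "Z 1 $ r0 $ c0 \<noteq> 0" using rc apos by (metis leading_coeff_0_iff degree_0 less_irrefl)
  define R :: "complex \<Rightarrow> complex^'m^'m" where "R t = (\<chi> r c. \<Sum>l\<le>d. t ^ l * Z l $ r $ c)" for t
  have lim: "((\<lambda>s. u s ** x (t / s ^ a) ** u (- s)) \<longlongrightarrow> R t) at_infinity" for t
    unfolding tendsto_matrix_iff
  proof (intro allI)
    fix r c
    have "((\<lambda>s. \<Sum>l\<le>d. t ^ l * (Y l s $ r $ c / s ^ (a * l))) \<longlongrightarrow> (\<Sum>l\<le>d. t ^ l * Z l $ r $ c)) at_infinity"
      by (intro tendsto_intros Z)
    moreover have "(u s ** x (t / s ^ a) ** u (- s)) $ r $ c = (\<Sum>l\<le>d. t ^ l * (Y l s $ r $ c / s ^ (a * l)))" for s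
      unfolding y by (simp add: power_divide power_mult)
    ultimately show "((\<lambda>s. (u s ** x (t / s ^ a) ** u (- s)) $ r $ c) \<longlongrightarrow> R t $ r $ c) at_infinity" by (simp add: R_def)
  qed
  have nt: "at_infinity \<noteq> (bot :: complex filter)" using trivial_limit_at_infinity by (simp add: trivial_limit_def)
  have Rhom: "R (t + t') = R t ** R t'" for t t'
  proof (rule tendsto_unique[OF nt lim])
    have "u s ** x ((t + t') / s ^ a) ** u (- s) = (u s ** x (t / s ^ a) ** u (- s)) ** (u s ** x (t' / s ^ a) ** u (- s))" for s
    proof -
      have "u s ** x ((t + t') / s ^ a) ** u (- s) = u s ** x (t / s ^ a) ** (u (- s) ** u s) ** x (t' / s ^ a) ** u (- s)"
        by (simp add: uu add_divide_distrib x(1) matrix_mul_rid matrix_mul_assoc)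
      thus ?thesis by (simp add: matrix_mul_assoc)
    qed
    thus "((\<lambda>s. u s ** x ((t + t') / s ^ a) ** u (- s)) \<longlongrightarrow> R t ** R t') at_infinity"
      using tendsto_matrix_mult[OF lim lim] by simp
  qed
  have R0: "R 0 = mat 1"
    by (rule tendsto_unique[OF nt lim]) (simp add: x(3) matrix_mul_rid uu)
  have Rp: "R t $ r $ c = poly (\<Sum>l\<le>d. monom (Z l $ r $ c) l) t" for t r c
    by (simp add: R_def poly_sum poly_monom mult.commute)
  \<comment> \<open>All multiples of a kernel element by natural numbers lie in the kernel, which
    makes the polynomial entries of R constant. But the entry at (r0, c0) has linear coefficient
    \<open>Z 1 $ r0 $ c0\<close>, nonzero by the choice of a.\<close>
  have "inj R"
  proof (rule injI, rule ccontr)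
    fix t t' assume e: "R t = R t'" and ne: "t \<noteq> t'"
    define v where "v = t - t'"
    have v: "v \<noteq> 0" using ne by (simp add: v_def)
    have "R v = R t' ** R (- t')" using Rhom[of t "- t'"] e by (simp add: v_def)
    hence Rv: "R v = mat 1" using Rhom[of t' "- t'"] R0 by simp
    have Rn: "R (of_nat n * v) = mat 1" for n
      by (induction n) (simp_all add: R0 Rhom Rv matrix_mul_lid algebra_simps)
    let ?P = "(\<Sum>l\<le>d. monom (Z l $ r0 $ c0) l) - [: mat 1 $ r0 $ c0 :]"
    have "poly ?P w = 0" if "w \<in> range (\<lambda>n. of_nat n * v)" for w
      using that Rn by (auto simp: Rp[symmetric])
    moreover have "infinite (range (\<lambda>n. of_nat n * v))" using v by (intro range_inj_infinite) (auto simp: inj_on_def)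
    ultimately have "?P = 0" using poly_roots_finite[of ?P] by (metis (mono_tags, lifting) finite_subset mem_Collect_eq subsetI)
    hence "coeff ?P 1 = 0" by simp
    moreover have "coeff ?P 1 = Z 1 $ r0 $ c0" using d_def by (simp add: coeff_sum d_def)
    ultimately show False using Z1 by simp
  qed
  thus ?thesis using apos Rhom R0 Rp lim by blast
qed


section \<open>Simply connected groups\<close>

lemma entry_polys_tendsto:
  "p \<in> entry_polys \<Longrightarrow> (x \<longlongrightarrow> g) F \<Longrightarrow> ((\<lambda>n. p (x n)) \<longlongrightarrow> p g) F"
  by (induction rule: entry_polys.induct) (auto intro!: tendsto_intros tendsto_vec_nth)

lemma matrix_monoid_simps [simp]: "carrier (matrix_monoid X) = X" "monoid.mult (matrix_monoid X) = (**)" "one (matrix_monoid X) = mat 1"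
  by (simp_all add: matrix_monoid_def)

context
  fixes X :: "(complex^'m^'m) set"
  assumes X: "algebraic_group X"
begin

lemma algebraic_group_one: "mat 1 \<in> X" 
  and algebraic_group_mult: "g \<in> X \<Longrightarrow> h \<in> X \<Longrightarrow> g ** h \<in> X"
proof -
  interpret group "matrix_monoid X" using X by (simp add: algebraic_group_def)
  show "mat 1 \<in> X" using one_closed by simp
  show "g \<in> X \<Longrightarrow> h \<in> X \<Longrightarrow> g ** h \<in> X" using m_closed by simp
qed

lemma algebraic_group_inv: 
  assumes "g \<in> X" shows "matrix_inv g \<in> X" "g ** matrix_inv g = mat 1" "matrix_inv g ** g = mat 1" "inv\<^bsub>matrix_monoid X\<^esub> g = matrix_inv g"
proof -
  interpret group "matrix_monoid X" using X by (simp add: algebraic_group_def)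
  have i: "inv\<^bsub>matrix_monoid X\<^esub> g \<in> X" "g ** inv\<^bsub>matrix_monoid X\<^esub> g = mat 1" "inv\<^bsub>matrix_monoid X\<^esub> g ** g = mat 1"
    using inv_closed[of g] r_inv[of g] l_inv[of g] assms by simp_all
  have e: "matrix_inv g = inv\<^bsub>matrix_monoid X\<^esub> g" by (rule matrix_inv_unique) (use i in auto)
  show "matrix_inv g \<in> X" "g ** matrix_inv g = mat 1" "matrix_inv g ** g = mat 1" "inv\<^bsub>matrix_monoid X\<^esub> g = matrix_inv g"
    using i by (simp_all add: e)
qed

lemma algebraic_group_limit:
  assumes "(x \<longlongrightarrow> g) F" "F \<noteq> bot" "\<And>n. x n \<in> X" "g ** g' = mat 1" "g' ** g = mat 1"
  shows "g \<in> X"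
proof -
  obtain P where P: "P \<subseteq> entry_polys" "X = {g. invertible g \<and> (\<forall>p\<in>P. p g = 0)}" using X unfolding algebraic_group_def by blast
  have "p g = 0" if "p \<in> P" for p
  proof -
    have "((\<lambda>n. p (x n)) \<longlongrightarrow> p g) F" using entry_polys_tendsto assms(1) P(1) that by blast
    moreover have "p (x n) = 0" for n using assms(3)[of n] P(2) that by blast
    ultimately have "((\<lambda>n. 0) \<longlongrightarrow> p g) F" by simp
    thus ?thesis using tendsto_unique[OF assms(2) _ tendsto_const] by blast
  qed
  moreover have "invertible g" unfolding invertible_def using assms(4,5) by blast
  ultimately show ?thesis using P(2) by blast
qed

end

locale sc_group =
  fixes D :: "('i::{finite,linorder},'m::finite) group_datum"
  assumes datum: "simply_connected_group_datum D"
begin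

lemma alg: "algebraic_group (Grp D)" and tor: "maximal_torus (Grp D) (Tor D)"
  and embed: "algebraic_embedding_SL2 (Grp D) (emb D i)"
  and coroot_Tor': "t \<noteq> 0 \<Longrightarrow> coroot D i t \<in> Tor D"
  and fchar_character: "character_on (Tor D) (fchar D i)"
  and fchar_coroot': "t \<noteq> 0 \<Longrightarrow> fchar D i (coroot D j t) = (if i = j then t else 1)"
  and conj: "h \<in> Tor D \<Longrightarrow> h ** x_up D i t ** matrix_inv h = x_up D i (wchar D (simple_root (Cartan D) i) h * t)"
    "h \<in> Tor D \<Longrightarrow> h ** x_low D i t ** matrix_inv h = x_low D i (wchar D (- simple_root (Cartan D) i) h * t)"
  and inj_rc: "inj (root_comb (Cartan D))"
  and root_dich: "is_root D \<beta> \<Longrightarrow> weight_ge (Cartan D) \<beta> 0 \<or> weight_ge (Cartan D) 0 \<beta>"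
  using datum unfolding simply_connected_group_datum_def semisimple_group_def by blast+

lemma alg_Tor: "algebraic_group (Tor D)" and Tor_Grp: "h \<in> Tor D \<Longrightarrow> h \<in> Grp D"
  using tor unfolding maximal_torus_def algebraic_torus_def by auto

lemma emb_Grp: "g \<in> SL2 \<Longrightarrow> emb D i g \<in> Grp D"
  and emb_hom: "g \<in> SL2 \<Longrightarrow> h \<in> SL2 \<Longrightarrow> emb D i (g ** h) = emb D i g ** emb D i h"
  using embed[of i] unfolding algebraic_embedding_SL2_def hom_def by auto

lemma emb_inj: "g \<in> SL2 \<Longrightarrow> h \<in> SL2 \<Longrightarrow> emb D i g = emb D i h \<Longrightarrow> g = h"
  using embed[of i] unfolding algebraic_embedding_SL2_def inj_on_def by auto

lemma emb_reg: "regular_on SL2 (\<lambda>g. emb D i g $ a $ b)"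
  using embed[of i] unfolding algebraic_embedding_SL2_def by auto

lemma emb_1: "emb D i (mat 1) = mat 1"
proof -
  have "mat 1 \<in> SL2" by (simp add: m2_one)
  hence G: "emb D i (mat 1) \<in> Grp D" and "emb D i (mat 1 ** mat 1) = emb D i (mat 1) ** emb D i (mat 1)"
    by (simp_all only: emb_Grp emb_hom)
  hence e: "emb D i (mat 1) = emb D i (mat 1) ** emb D i (mat 1)" by (simp only: matrix_mul_lid)
  have "mat 1 = matrix_inv (emb D i (mat 1)) ** emb D i (mat 1)" using algebraic_group_inv[OF alg G] by simp
  also have "\<dots> = matrix_inv (emb D i (mat 1)) ** emb D i (mat 1) ** emb D i (mat 1)" by (subst e) (simp only: matrix_mul_assoc)
  also have "\<dots> = emb D i (mat 1)" using algebraic_group_inv[OF alg G] by (simp add: matrix_mul_lid)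
  finally show ?thesis by simp
qed

lemma x_m2: "x_up D i t = emb D i (m2 1 t 0 1)" "x_low D i t = emb D i (m2 1 0 t 1)" "coroot D i t = emb D i (m2 t 0 0 (inverse t))"
  by (simp_all add: x_up_def x_low_def coroot_def m2_def)

lemma x_hom: "x_up D i (s + t) = x_up D i s ** x_up D i t" "x_low D i (s + t) = x_low D i s ** x_low D i t"
  by (simp_all add: x_m2 add.commute flip: emb_hom)

lemma x_0: "x_up D i 0 = mat 1" "x_low D i 0 = mat 1"
  using emb_1 by (simp_all add: x_m2 flip: m2_one)

lemma x_Grp: "x_up D i t \<in> Grp D" "x_low D i t \<in> Grp D"
  by (simp_all add: x_m2 emb_Grp)

lemma x_poly_ex: "\<exists>p. \<forall>t. x_up D i t $ a $ b = poly p t" "\<exists>p. \<forall>t. x_low D i t $ a $ b = poly p t"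
proof -
  have 1: "loc_rat UNIV (\<lambda>t. emb D i (m2 1 t 0 1) $ a $ b)"
    by (rule loc_rat_regular[OF emb_reg]) (auto simp: m2_def[symmetric] intro: loc_rat_2x2[of UNIV "\<lambda>_. 1" "\<lambda>t. t" "\<lambda>_. 0" "\<lambda>_. 1", unfolded m2_def[symmetric]] loc_rat_const loc_rat_id)
  have 2: "loc_rat UNIV (\<lambda>t. emb D i (m2 1 0 t 1) $ a $ b)"
    by (rule loc_rat_regular[OF emb_reg]) (auto simp: m2_def[symmetric] intro: loc_rat_2x2[of UNIV "\<lambda>_. 1" "\<lambda>_. 0" "\<lambda>t. t" "\<lambda>_. 1", unfolded m2_def[symmetric]] loc_rat_const loc_rat_id)
  show "\<exists>p. \<forall>t. x_up D i t $ a $ b = poly p t" "\<exists>p. \<forall>t. x_low D i t $ a $ b = poly p t"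
    using loc_rat_UNIV[OF 1] loc_rat_UNIV[OF 2] by (simp_all add: x_m2)
qed

lemma fchar_nz': "h \<in> Tor D \<Longrightarrow> fchar D i h \<noteq> 0"
  and fchar_mult': "h \<in> Tor D \<Longrightarrow> h' \<in> Tor D \<Longrightarrow> fchar D i (h ** h') = fchar D i h * fchar D i h'"
  using fchar_character[of i] unfolding character_on_def by auto

lemma conj': 
  assumes "h \<in> Tor D"
  shows "h ** x_up D i t = x_up D i (wchar D (simple_root (Cartan D) i) h * t) ** h"
    "h ** x_low D i t = x_low D i (wchar D (- simple_root (Cartan D) i) h * t) ** h"
  using algebraic_group_inv(3)[OF alg_Tor assms]
  by (simp_all add: conj[OF assms, symmetric] matrix_mul_rid flip: matrix_mul_assoc)

lemma x_up_inj: "x_up D i s = x_up D i t \<Longrightarrow> s = t"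
proof -
  assume "x_up D i s = x_up D i t"
  hence "m2 1 s 0 1 = m2 1 t 0 1" unfolding x_m2 by (rule emb_inj[rotated 2]) simp_all
  thus ?thesis by (metis m2_nth(2))
qed

lemma root_comb_not_root:
  assumes "is_root D (root_comb (Cartan D) q)" shows "(\<forall>l. q $ l \<ge> 0) \<or> (\<forall>l. q $ l \<le> 0)"
  using root_dich[OF assms]
proof
  assume "weight_ge (Cartan D) (root_comb (Cartan D) q) 0"
  then obtain k where "\<forall>l. k $ l \<ge> 0" "root_comb (Cartan D) q = root_comb (Cartan D) k" unfolding weight_ge_def by auto
  thus ?thesis using injD[OF inj_rc] by blast
next
  assume "weight_ge (Cartan D) 0 (root_comb (Cartan D) q)"
  then obtain k where k: "\<forall>l. k $ l \<ge> 0" "root_comb (Cartan D) (- q) = root_comb (Cartan D) k"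
    unfolding weight_ge_def by (auto simp: root_comb_minus)
  hence "k = - q" using injD[OF inj_rc] by metis
  thus ?thesis using k(1) by auto
qed

text \<open>Otherwise \<open>noncommuting_limit\<close> produces a root subgroup of weight a alpha_i
  - alpha_j with a > 0, a combination of both signs, against \<open>root_dich\<close>.\<close>

lemma up_low_commute:
  assumes "i \<noteq> j" shows "x_up D i s ** x_low D j t = x_low D j t ** x_up D i s"
proof (rule ccontr)
  assume nc: "x_up D i s ** x_low D j t \<noteq> x_low D j t ** x_up D i s"
  obtain p where p: "\<And>t a b. x_low D j t $ a $ b = poly (p a b) t" using x_poly_ex(2)[of j] by metis
  obtain pu where pu: "\<And>t a b. x_up D i t $ a $ b = poly (pu a b) t" using x_poly_ex(1)[of i] by metis
  from noncommuting_limit[of "x_low D j" p "x_up D i" pu, OF x_hom(2) p x_0(2) x_hom(1) pu x_0(1) nc]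
  obtain a R where a: "a > (0::nat)" and R: "inj R" "\<forall>s t. R (s + t) = R s ** R t" "R 0 = mat 1" "\<forall>r c. \<exists>p. \<forall>t. R t $ r $ c = poly p t"
    and lim: "\<And>t. ((\<lambda>s. x_up D i s ** x_low D j (t / s ^ a) ** x_up D i (- s)) \<longlongrightarrow> R t) at_infinity" by blast
  define q :: "'i weight" where "q = int a *s axis i 1 - axis j 1"
  let ?\<alpha> = "simple_root (Cartan D) i" let ?\<beta> = "simple_root (Cartan D) j"
  have rc: "root_comb (Cartan D) q = int a *s ?\<alpha> - ?\<beta>" by (simp add: q_def root_comb_diff root_comb_smult root_comb_axis)
  have nt: "at_infinity \<noteq> (bot :: complex filter)" using trivial_limit_at_infinity by (simp add: trivial_limit_def)
  have RG: "R t \<in> Grp D" for t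
  proof (rule algebraic_group_limit[OF alg lim nt])
    show "x_up D i s ** x_low D j (t / s ^ a) ** x_up D i (- s) \<in> Grp D" for s
      by (intro algebraic_group_mult[OF alg] x_Grp)
    show "R t ** R (- t) = mat 1" "R (- t) ** R t = mat 1"
      using R(2)[rule_format, of t "- t"] R(2)[rule_format, of "- t" t] R(3) by simp_all
  qed
  have Rc: "h ** R t ** matrix_inv h = R (wchar D (root_comb (Cartan D) q) h * t)" if h: "h \<in> Tor D" for h t
  proof -
    define \<kappa> where "\<kappa> = wchar D ?\<alpha> h"
    define \<mu> where "\<mu> = wchar D (- ?\<beta>) h"
    have \<kappa>: "\<kappa> \<noteq> 0" using fchar_nz'[OF h] by (simp add: \<kappa>_def wchar_def)
    have w: "wchar D (root_comb (Cartan D) q) h = \<mu> * \<kappa> ^ a"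
      unfolding rc diff_conv_add_uminus wchar_add[of D h, OF fchar_nz'[OF h]] by (simp add: wchar_smult_root \<mu>_def \<kappa>_def)
    \<comment> \<open>Conjugation by h replaces s by \<open>\<kappa> * s\<close>. The new parameter
      still tends to infinity, so the limit is again a value of R.\<close>
    have inf: "filterlim (\<lambda>s. \<kappa> * s) at_infinity at_infinity"
      unfolding filterlim_at_infinity_conv_norm_at_top norm_mult
      by (rule filterlim_tendsto_pos_mult_at_top[OF tendsto_const]) (use \<kappa> filterlim_norm_at_top in auto)
    have "((\<lambda>s. h ** (x_up D i s ** x_low D j (t / s ^ a) ** x_up D i (- s)) ** matrix_inv h) \<longlongrightarrow> h ** R t ** matrix_inv h) at_infinity"
      by (intro tendsto_matrix_mult tendsto_const lim)
    moreover have "eventually (\<lambda>s. h ** (x_up D i s ** x_low D j (t / s ^ a) ** x_up D i (- s)) ** matrix_inv h =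
       x_up D i (\<kappa> * s) ** x_low D j (\<mu> * \<kappa> ^ a * t / (\<kappa> * s) ^ a) ** x_up D i (- (\<kappa> * s))) at_infinity"
    proof (rule eventually_mono[OF eventually_not_equal_at_infinity[of 0]])
      fix s :: complex assume "s \<noteq> 0"
      have e: "\<mu> * (t / s ^ a) = \<mu> * \<kappa> ^ a * t / (\<kappa> * s) ^ a" using \<kappa> by (simp add: power_mult_distrib)
      have "h ** (x_up D i s ** x_low D j (t / s ^ a) ** x_up D i (- s)) ** matrix_inv h
        = (h ** x_up D i s) ** x_low D j (t / s ^ a) ** x_up D i (- s) ** matrix_inv h" by (simp add: matrix_mul_assoc)
      also have "\<dots> = x_up D i (\<kappa> * s) ** (h ** x_low D j (t / s ^ a)) ** x_up D i (- s) ** matrix_inv h"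
        by (simp add: conj'(1)[OF h] \<kappa>_def matrix_mul_assoc)
      also have "\<dots> = x_up D i (\<kappa> * s) ** x_low D j (\<mu> * (t / s ^ a)) ** (h ** x_up D i (- s) ** matrix_inv h)"
        by (simp add: conj'(2)[OF h] \<mu>_def matrix_mul_assoc)
      also have "\<dots> = x_up D i (\<kappa> * s) ** x_low D j (\<mu> * \<kappa> ^ a * t / (\<kappa> * s) ^ a) ** x_up D i (- (\<kappa> * s))"
        unfolding conj(1)[OF h] e by (simp add: \<kappa>_def)
      finally show "h ** (x_up D i s ** x_low D j (t / s ^ a) ** x_up D i (- s)) ** matrix_inv h = \<dots>" .
    qed
    ultimately have "((\<lambda>s. x_up D i (\<kappa> * s) ** x_low D j (\<mu> * \<kappa> ^ a * t / (\<kappa> * s) ^ a) ** x_up D i (- (\<kappa> * s))) \<longlongrightarrow> h ** R t ** matrix_inv h) at_infinity"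
      by (rule Lim_transform_eventually)
    moreover have "((\<lambda>s. x_up D i (\<kappa> * s) ** x_low D j (\<mu> * \<kappa> ^ a * t / (\<kappa> * s) ^ a) ** x_up D i (- (\<kappa> * s))) \<longlongrightarrow> R (\<mu> * \<kappa> ^ a * t)) at_infinity"
      by (rule filterlim_compose[OF lim inf])
    ultimately show ?thesis unfolding w using tendsto_unique[OF nt] by blast
  qed
  have qj: "q $ j = -1" "q $ i = int a" using assms by (auto simp: q_def axis_def)
  have "root_comb (Cartan D) q \<noteq> root_comb (Cartan D) 0" using injD[OF inj_rc, of q 0] qj by auto
  hence "is_root D (root_comb (Cartan D) q)"
    unfolding is_root_def using R RG Rc by (intro conjI exI[of _ R]) auto
  from root_comb_not_root[OF this] show False
  proof
    assume "\<forall>l. q $ l \<ge> 0" hence "q $ j \<ge> 0" by blast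
    thus False using qj by simp
  next
    assume "\<forall>l. q $ l \<le> 0" hence "q $ i \<le> 0" by blast
    thus False using qj a by simp
  qed
qed

text \<open>The action of the coroot value at 2 on x_i is computed twice: by the torus law, with
  factor 2^(a_{i,i}), and inside SL_2, with factor 4.\<close>

lemma Cartan_2: "Cartan D $ i $ i = 2"
proof -
  have w: "wchar D \<gamma> (coroot D i 2) = 2 powi (\<gamma> $ i)" for \<gamma>
  proof -
    have "wchar D \<gamma> (coroot D i 2) = (\<Prod>j\<in>UNIV. if j = i then 2 powi (\<gamma> $ i) else 1)"
      unfolding wchar_def by (intro prod.cong) (auto simp: fchar_coroot')
    thus ?thesis by simp
  qed
  have "coroot D i 2 ** x_up D i 1 = x_up D i (2 powi (Cartan D $ i $ i)) ** coroot D i 2"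
    using conj'(1)[OF coroot_Tor', of 2 i i 1] by (simp add: w simple_root_nth)
  moreover have "coroot D i 2 ** x_up D i c = emb D i (m2 2 0 0 (inverse 2) ** m2 1 c 0 1)"
    "x_up D i c ** coroot D i 2 = emb D i (m2 1 c 0 1 ** m2 2 0 0 (inverse 2))" for c
    unfolding x_m2 by (rule emb_hom[symmetric]; simp)+
  ultimately have "emb D i (m2 2 2 0 (inverse 2)) = emb D i (m2 2 ((2 powi (Cartan D $ i $ i)) * inverse 2) 0 (inverse 2))"
    by (simp only: m2_mult mult_1_left mult_1_right mult_zero_left mult_zero_right add_0_left add_0_right)
  hence "m2 2 2 0 (inverse 2) = m2 2 ((2 powi (Cartan D $ i $ i)) * inverse 2) 0 (inverse 2)" by (rule emb_inj[rotated 2]) simp_all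
  hence "(2::complex) = (2 powi (Cartan D $ i $ i)) * inverse 2" by (metis m2_nth(2))
  hence "(2::complex) powi (Cartan D $ i $ i) / 2 = 2" by (simp only: divide_inverse)
  hence "(2::complex) powi (Cartan D $ i $ i) = of_real (2 powi 2)" by simp
  hence "of_real (2 powi (Cartan D $ i $ i)) = (of_real (2 powi 2) :: complex)" by (simp add: of_real_power_int)
  hence "(2::real) powi (Cartan D $ i $ i) = 2 powi 2" unfolding of_real_eq_iff .
  thus ?thesis using power_int_strict_increasing[of "Cartan D $ i $ i" 2 "2::real"] power_int_strict_increasing[of 2 "Cartan D $ i $ i" "2::real"]
    by (cases "Cartan D $ i $ i" "2::int" rule: linorder_cases) simp_all
qed

end

lemma (in sc_group) Tor_diag': "\<exists>P Q :: complex^'m^'m. P ** Q = mat 1 \<and> Q ** P = mat 1 \<and> (\<forall>h\<in>Tor D. \<forall>a b. a \<noteq> b \<longrightarrow> (P ** h ** Q) $ a $ b = 0)"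
proof -
  have "\<exists>g :: complex^'m^'m. invertible g \<and> (\<forall>t\<in>Tor D. \<forall>i j. i \<noteq> j \<longrightarrow> (g ** t ** matrix_inv g) $ i $ j = 0)"
    using tor unfolding maximal_torus_def algebraic_torus_def by (elim conjE)
  then obtain g :: "complex^'m^'m" where g: "invertible g" "\<forall>t\<in>Tor D. \<forall>i j. i \<noteq> j \<longrightarrow> (g ** t ** matrix_inv g) $ i $ j = 0"
    by (elim exE conjE)
  show ?thesis using matrix_inv_works[OF g(1)] g(2) by (intro exI[of _ g] exI[of _ "matrix_inv g"] conjI)
qed

lemma (in sc_group) Tor_inv': "h \<in> Tor D \<Longrightarrow> \<exists>h'\<in>Tor D. h ** h' = mat 1 \<and> h' ** h = mat 1"
  by (rule bexI[of _ "matrix_inv h"]) (simp_all add: algebraic_group_inv[OF alg_Tor])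

sublocale sc_group \<subseteq> pinning D
  by (rule pinning.intro; fact emb_hom emb_1 emb_reg algebraic_group_one[OF alg_Tor] algebraic_group_mult[OF alg_Tor]
   coroot_Tor' fchar_nz' fchar_mult' fchar_coroot' conj' inj_rc up_low_commute Tor_diag' Tor_inv')


section \<open>Minors and coefficients as regular functions\<close>

lemma regular_on_subset: assumes "regular_on X f" "Y \<subseteq> X" shows "regular_on Y f"
  unfolding regular_on_def
proof
  fix x assume "x \<in> Y"
  then obtain p q where "p \<in> entry_polys" "q \<in> entry_polys" "q x \<noteq> 0" "\<forall>y\<in>X. q y \<noteq> 0 \<longrightarrow> f y = p y / q y"
    using assms unfolding regular_on_def by fast
  thus "\<exists>p\<in>entry_polys. \<exists>q\<in>entry_polys. q x \<noteq> 0 \<and> (\<forall>y\<in>Y. q y \<noteq> 0 \<longrightarrow> f y = p y / q y)"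
    using assms(2) by (intro bexI[of _ p] bexI[of _ q]) auto
qed

lemma regular_on_continuous:
  assumes "regular_on X f" shows "continuous_on X f"
  unfolding continuous_on
proof
  fix x assume x: "x \<in> X"
  then obtain p q where pq: "p \<in> entry_polys" "q \<in> entry_polys" "q x \<noteq> 0" "\<And>y. y \<in> X \<Longrightarrow> q y \<noteq> 0 \<Longrightarrow> f y = p y / q y"
    using assms unfolding regular_on_def by metis
  have t: "(p \<longlongrightarrow> p x) (at x within X)" "(q \<longlongrightarrow> q x) (at x within X)"
    using entry_polys_tendsto[OF pq(1) tendsto_ident_at] entry_polys_tendsto[OF pq(2) tendsto_ident_at] by simp_all
  have "((\<lambda>y. p y / q y) \<longlongrightarrow> f x) (at x within X)"
    unfolding pq(4)[OF x pq(3)] by (intro tendsto_divide t pq(3))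
  moreover have "eventually (\<lambda>y. p y / q y = f y) (at x within X)"
    using tendsto_imp_eventually_ne[OF t(2) pq(3)] eventually_at_topological
    by (auto simp: eventually_at_filter pq(4) elim!: eventually_mono)
  ultimately show "(f \<longlongrightarrow> f x) (at x within X)" by (rule Lim_transform_eventually)
qed

lemma regular_on_const: "regular_on X (\<lambda>_. a)"
  unfolding regular_on_def by (intro ballI bexI[of _ "\<lambda>_. a"] bexI[of _ "\<lambda>_. 1"]) (auto intro: entry_polys.const)

lemma regular_on_cong: "regular_on X f \<Longrightarrow> (\<And>x. x \<in> X \<Longrightarrow> f x = g x) \<Longrightarrow> regular_on X g"
  unfolding regular_on_def by simp

lemma regular_on_mult: assumes "regular_on X f" "regular_on X g" shows "regular_on X (\<lambda>x. f x * g x)"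
  unfolding regular_on_def
proof
  fix x assume x: "x \<in> X"
  obtain p q where 1: "p \<in> entry_polys" "q \<in> entry_polys" "q x \<noteq> 0" "\<forall>y\<in>X. q y \<noteq> 0 \<longrightarrow> f y = p y / q y"
    using assms(1) x unfolding regular_on_def by metis
  obtain p' q' where 2: "p' \<in> entry_polys" "q' \<in> entry_polys" "q' x \<noteq> 0" "\<forall>y\<in>X. q' y \<noteq> 0 \<longrightarrow> g y = p' y / q' y"
    using assms(2) x unfolding regular_on_def by metis
  show "\<exists>p\<in>entry_polys. \<exists>q\<in>entry_polys. q x \<noteq> 0 \<and> (\<forall>y\<in>X. q y \<noteq> 0 \<longrightarrow> f y * g y = p y / q y)"
    using 1 2 by (intro bexI[of _ "\<lambda>y. p y * p' y"] bexI[of _ "\<lambda>y. q y * q' y"]) (auto intro: entry_polys.mult)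
qed

lemma regular_on_add: assumes "regular_on X f" "regular_on X g" shows "regular_on X (\<lambda>x. f x + g x)"
  unfolding regular_on_def
proof
  fix x assume x: "x \<in> X"
  obtain p q where 1: "p \<in> entry_polys" "q \<in> entry_polys" "q x \<noteq> 0" "\<forall>y\<in>X. q y \<noteq> 0 \<longrightarrow> f y = p y / q y"
    using assms(1) x unfolding regular_on_def by metis
  obtain p' q' where 2: "p' \<in> entry_polys" "q' \<in> entry_polys" "q' x \<noteq> 0" "\<forall>y\<in>X. q' y \<noteq> 0 \<longrightarrow> g y = p' y / q' y"
    using assms(2) x unfolding regular_on_def by metis
  show "\<exists>p\<in>entry_polys. \<exists>q\<in>entry_polys. q x \<noteq> 0 \<and> (\<forall>y\<in>X. q y \<noteq> 0 \<longrightarrow> f y + g y = p y / q y)"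
    using 1 2 by (intro bexI[of _ "\<lambda>y. p y * q' y + p' y * q y"] bexI[of _ "\<lambda>y. q y * q' y"])
      (auto intro: entry_polys.mult entry_polys.add simp: add_frac_eq)
qed

lemma regular_on_inverse: assumes "regular_on X f" "\<And>x. x \<in> X \<Longrightarrow> f x \<noteq> 0" shows "regular_on X (\<lambda>x. inverse (f x))"
  unfolding regular_on_def
proof
  fix x assume x: "x \<in> X"
  obtain p q where 1: "p \<in> entry_polys" "q \<in> entry_polys" "q x \<noteq> 0" "\<forall>y\<in>X. q y \<noteq> 0 \<longrightarrow> f y = p y / q y"
    using assms(1) x unfolding regular_on_def by metis
  have "p x \<noteq> 0" using 1 x assms(2)[OF x] by auto
  moreover have "inverse (f y) = (q y * q y) / (p y * q y)" if "y \<in> X" "p y * q y \<noteq> 0" for y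
  proof -
    have "f y = p y / q y" using 1(4) that by simp
    thus ?thesis using that by simp
  qed
  ultimately show "\<exists>p\<in>entry_polys. \<exists>q\<in>entry_polys. q x \<noteq> 0 \<and> (\<forall>y\<in>X. q y \<noteq> 0 \<longrightarrow> inverse (f y) = p y / q y)"
    using 1 by (intro bexI[of _ "\<lambda>y. q y * q y"] bexI[of _ "\<lambda>y. p y * q y"]) (auto intro: entry_polys.mult)
qed

lemma regular_on_power: "regular_on X f \<Longrightarrow> regular_on X (\<lambda>x. f x ^ n)"
  by (induction n) (auto intro: regular_on_const regular_on_mult)

lemma regular_on_powi: "regular_on X f \<Longrightarrow> (\<And>x. x \<in> X \<Longrightarrow> f x \<noteq> 0) \<Longrightarrow> regular_on X (\<lambda>x. f x powi n)"
  by (cases "n \<ge> 0") (auto simp: power_int_def intro!: regular_on_power regular_on_inverse)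

lemma regular_on_prod: "(\<And>i. i \<in> S \<Longrightarrow> regular_on X (f i)) \<Longrightarrow> regular_on X (\<lambda>x. \<Prod>i\<in>S. f i x)"
  by (induction S rule: infinite_finite_induct) (auto intro: regular_on_const regular_on_mult)

context sc_group begin

interpretation sw: pinning "swap_datum D" by (rule pinning_swap) (rule pinning_axioms)

lemma GG_Grp: "g \<in> GG \<Longrightarrow> g \<in> Grp D"
  by (induction rule: GG.induct) (auto intro: algebraic_group_one[OF alg] algebraic_group_mult[OF alg] x_Grp Tor_Grp)

lemma N_up_NU: "N_up D = NU UNIV"
proof (intro subset_antisym subsetI)
  fix n assume "n \<in> N_up D"
  thus "n \<in> NU UNIV" unfolding N_up_def
  proof (induction rule: generate.induct)
    case (inv h)
    hence "h \<in> NU UNIV" by (auto intro: NU_up)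
    thus ?case using algebraic_group_inv(4)[OF alg GG_Grp[OF NU_GG]] NU_inv by metis
  qed (auto intro: NU_one NU_up NU_mult)
next
  fix n assume "n \<in> NU UNIV"
  thus "n \<in> N_up D"
  proof (induction rule: NU.induct)
    case NU_one show ?case unfolding N_up_def using generate.one[of "matrix_monoid (Grp D)"] by simp
  next
    case (NU_up_l n j t)
    have "x_up D j t \<in> N_up D" unfolding N_up_def by (rule generate.incl) auto
    thus ?case using NU_up_l(3) generate.eng[of "x_up D j t" "matrix_monoid (Grp D)" _ n] unfolding N_up_def by simp
  qed
qed

lemma N_low_NL: "N_low D = NL UNIV"
proof (intro subset_antisym subsetI)
  fix n assume "n \<in> N_low D"
  thus "n \<in> NL UNIV" unfolding N_low_def
  proof (induction rule: generate.induct)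
    case (inv h)
    hence "h \<in> NL UNIV" by (auto intro: NL_low)
    thus ?case using algebraic_group_inv(4)[OF alg GG_Grp[OF NL_GG]] NL_inv by metis
  qed (auto intro: NL_one NL_low NL_mult)
next
  fix n assume "n \<in> NL UNIV"
  hence "n \<in> sw.NU UNIV" by (simp add: NL_def)
  thus "n \<in> N_low D"
  proof (induction rule: sw.NU.induct)
    case NU_one show ?case unfolding N_low_def using generate.one[of "matrix_monoid (Grp D)"] by simp
  next
    case (NU_up_l n j t)
    have "x_low D j (- t) \<in> N_low D" unfolding N_low_def by (rule generate.incl) auto
    thus ?case using NU_up_l(3) generate.eng[of "x_low D j (- t)" "matrix_monoid (Grp D)" _ n] unfolding N_low_def by simp
  qed
qed

lemma L_cell_LC: "L_cell D = LC"
  unfolding L_cell_def LC_def BL_def B_low_def N_up_NU N_low_NL ..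

text \<open>Conjugating the root subgroup of alpha_j by w gives a root subgroup of weight w alpha_j,
  to which the dichotomy for roots applies.\<close>

lemma word_act_root_dich:
  assumes e: "word_act (Cartan D) ws (simple_root (Cartan D) j) = root_comb (Cartan D) q"
  shows "(\<forall>l. q $ l \<ge> 0) \<or> (\<forall>l. q $ l \<le> 0)"
proof (rule root_comb_not_root)
  define w where "w = w_bar D ws"
  have w: "w \<in> GG" "matrix_inv w \<in> GG" by (simp_all add: w_def GG_w GG_cancel)
  define x where "x t = w ** x_up D j t ** matrix_inv w" for t
  have inj: "inj x"
  proof
    fix s t assume "x s = x t"
    hence "matrix_inv w ** x s ** w = matrix_inv w ** x t ** w" by simp
    moreover have "matrix_inv w ** x s ** w = x_up D j s" for s
      by (simp add: x_def w GG_cancel GG_cancel2 matrix_mul_assoc matrix_mul_lid)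
    ultimately show "s = t" using x_up_inj by simp
  qed
  have hom: "x (s + t) = x s ** x t" for s t
    by (simp add: x_def x_hom GG_cancel2[OF w(1)] matrix_mul_assoc)
  have poly: "\<exists>p. \<forall>t. x t $ a $ b = poly p t" for a b
    by (rule loc_rat_UNIV) (unfold x_def, intro loc_rat_matrix_mult loc_rat_const x_up_rat loc_rat_id)
  have tor: "h ** x t ** matrix_inv h = x (wchar D (root_comb (Cartan D) q) h * t)" if h: "h \<in> Tor D" for h t
  proof -
    obtain h' where h': "h' \<in> Tor D" "h ** w = w ** h'" "wchar D (simple_root (Cartan D) j) h' = wchar D (root_comb (Cartan D) q) h"
      using tor_w_bar[OF h, of ws] e unfolding w_def by metis
    have "h ** x t = (h ** w) ** x_up D j t ** matrix_inv w" by (simp add: x_def matrix_mul_assoc)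
    also have "\<dots> = w ** (h' ** x_up D j t) ** matrix_inv w" by (simp add: h' matrix_mul_assoc)
    also have "\<dots> = w ** x_up D j (wchar D (root_comb (Cartan D) q) h * t) ** (matrix_inv w ** (w ** h')) ** matrix_inv w"
      by (simp add: conj'(1)[OF h'(1)] h'(3) GG_cancel[OF w(1)] matrix_mul_lid matrix_mul_assoc)
    also have "\<dots> = x (wchar D (root_comb (Cartan D) q) h * t) ** h"
      unfolding h'(2)[symmetric] by (simp add: x_def GG_cancel2[OF w(1)] matrix_mul_assoc)
    finally show ?thesis by (simp add: GG_cancel2[OF GG_tor[OF h]])
  qed
  have ne: "root_comb (Cartan D) q \<noteq> 0"
  proof
    assume "root_comb (Cartan D) q = 0"
    hence "word_act (Cartan D) (rev ws) (word_act (Cartan D) ws (simple_root (Cartan D) j)) = 0" by (simp add: e)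
    hence "simple_root (Cartan D) j = 0" using word_act_rev[of "Cartan D"] Cartan_2 by simp
    hence "simple_root (Cartan D) j $ j = 0" by simp
    thus False by (simp add: simple_root_nth Cartan_2)
  qed
  have rng: "range x \<subseteq> Grp D" by (auto simp: x_def intro!: GG_Grp GG_mult w GG_up)
  show "is_root D (root_comb (Cartan D) q)"
    unfolding is_root_def using inj hom poly tor ne rng by blast
qed

lemma Cartan_le_0: assumes "i \<noteq> j" shows "Cartan D $ i $ j \<le> 0"
proof -
  have "word_act (Cartan D) [i] (simple_root (Cartan D) j) = root_comb (Cartan D) (axis j 1 - (Cartan D $ i $ j) *s axis i 1)"
    by (simp add: word_act_def simple_refl_def simple_root_nth root_comb_diff root_comb_smult root_comb_axis)
  from word_act_root_dich[OF this] show ?thesis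
  proof
    assume "\<forall>l. (axis j 1 - (Cartan D $ i $ j) *s axis i 1) $ l \<ge> 0"
    from this[rule_format, of i] show ?thesis using assms by (simp add: axis_def)
  next
    assume "\<forall>l. (axis j 1 - (Cartan D $ i $ j) *s axis i 1) $ l \<le> 0"
    from this[rule_format, of j] show ?thesis using assms by (simp add: axis_def)
  qed
qed

end

locale sc_minors = sc_group D for D :: "('i::{finite,linorder},'m::finite) group_datum" +
  fixes \<Delta> :: "'i weight \<Rightarrow> 'i weight \<Rightarrow> complex^'m^'m \<Rightarrow> complex"
  assumes gen: "generalized_minors D \<Delta>"
begin

definition fm :: "'i \<Rightarrow> complex^'m^'m \<Rightarrow> complex" where "fm i = \<Delta> (fund_weight i) (fund_weight i)"

lemma Delta_regular:
  assumes "reduced_word (Cartan D) us" "reduced_word (Cartan D) vs"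
  shows "regular_on (Grp D) (\<Delta> (word_act (Cartan D) us (fund_weight i)) (word_act (Cartan D) vs (fund_weight i)))"
  using gen assms unfolding generalized_minors_def Let_def by blast

lemma Delta_value:
  assumes "reduced_word (Cartan D) us" "reduced_word (Cartan D) vs" "n' \<in> NL UNIV" "a \<in> Tor D" "n \<in> NU UNIV"
  shows "\<Delta> (word_act (Cartan D) us (fund_weight i)) (word_act (Cartan D) vs (fund_weight i))
     (w_bar D us ** (n' ** a ** n) ** matrix_inv (w_bar D vs)) = fchar D i a"
  using gen assms unfolding generalized_minors_def Let_def N_up_NU N_low_NL wchar_fund by blast

lemma reduced_Nil: "reduced_word (Cartan D) []" by (simp add: reduced_word_def)

lemma fm_regular: "regular_on (Grp D) (fm i)"
  using Delta_regular[OF reduced_Nil reduced_Nil, of i] by (simp add: fm_def)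

lemma fm_regular_GG: "regular_on GG (fm i)"
  by (rule regular_on_subset[OF fm_regular]) (auto intro: GG_Grp)

lemma fm_cont: "continuous_on GG (fm i)"
  by (rule regular_on_continuous[OF fm_regular_GG])

lemma fm_val: "n' \<in> NL UNIV \<Longrightarrow> a \<in> Tor D \<Longrightarrow> n \<in> NU UNIV \<Longrightarrow> fm i (n' ** a ** n) = fchar D i a"
  using Delta_value[OF reduced_Nil reduced_Nil, of n' a n i] by (simp add: fm_def matrix_inv_one matrix_mul_lid matrix_mul_rid)

end

sublocale sc_minors \<subseteq> minors D fm
  by (intro minors.intro minors_axioms.intro; fact pinning_axioms fm_cont fm_val Cartan_2 Cartan_le_0)

sublocale sc_minors \<subseteq> cox_minors D fm
  by (intro cox_minors.intro cox_minors_axioms.intro; fact minors_axioms fm_regular_GG word_act_root_dich inj_rc)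

context sc_minors begin

text \<open>Both sides are continuous and agree on the translate u N_- H N v^-1, from which equality
  extends by \<open>GG_ext\<close>.\<close>

lemma Delta_eq:
  assumes us: "reduced_word (Cartan D) us" and vs: "reduced_word (Cartan D) vs" and g: "g \<in> GG"
  shows "\<Delta> (word_act (Cartan D) us (fund_weight k)) (word_act (Cartan D) vs (fund_weight k)) g
    = fm k (matrix_inv (w_bar D us) ** g ** w_bar D vs)"
proof (rule GG_ext[where u = "w_bar D us" and v = "matrix_inv (w_bar D vs)", OF _ _ GG_w GG_cancel(1)[OF GG_w] _ g])
  show "continuous_on GG (\<Delta> (word_act (Cartan D) us (fund_weight k)) (word_act (Cartan D) vs (fund_weight k)))"
    by (rule regular_on_continuous[OF regular_on_subset[OF Delta_regular[OF us vs]]]) (auto intro: GG_Grp)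
  show "continuous_on GG (\<lambda>g. fm k (matrix_inv (w_bar D us) ** g ** w_bar D vs))"
    by (intro f_cont2 continuous_intros GG_mult GG_w GG_cancel(1))
  fix n' a n assume n: "n' \<in> NL UNIV" "a \<in> Tor D" "n \<in> NU UNIV"
  have "matrix_inv (w_bar D us) ** (w_bar D us ** (n' ** a ** n) ** matrix_inv (w_bar D vs)) ** w_bar D vs
    = (matrix_inv (w_bar D us) ** w_bar D us) ** (n' ** a ** n) ** (matrix_inv (w_bar D vs) ** w_bar D vs)"
    by (simp only: matrix_mul_assoc)
  also have "\<dots> = n' ** a ** n" unfolding GG_cancel(3)[OF GG_w] by (simp only: matrix_mul_lid matrix_mul_rid)
  finally show "\<Delta> (word_act (Cartan D) us (fund_weight k)) (word_act (Cartan D) vs (fund_weight k))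
     (w_bar D us ** (n' ** a ** n) ** matrix_inv (w_bar D vs)) =
     fm k (matrix_inv (w_bar D us) ** (w_bar D us ** (n' ** a ** n) ** matrix_inv (w_bar D vs)) ** w_bar D vs)"
    by (simp only: Delta_value[OF us vs n] fm_val[OF n])
qed

lemma filt_reduced:
  assumes "desc (Cartan D) ws (fund_weight k)"
  shows "reduced_word (Cartan D) (filt (Cartan D) ws (fund_weight k))"
  by (rule sdesc_reduced[OF filt_sdesc[OF assms]])

text \<open>Minors are specified through reduced words, and m copies of the Coxeter word need not be
  reduced. Deleting the letters that fix the weight yields a reduced word and changes neither the
  weight nor, by \<open>f_filt\<close> and \<open>f_filt_left\<close>, the minor.\<close>

lemma Delta_cox_pow:
  assumes "good (Cartan D) m k"
  shows "regular_on (Grp D) (\<Delta> ((cox (Cartan D) ^^ m) (fund_weight k)) ((cox (Cartan D) ^^ m) (fund_weight k)))"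
    "x \<in> GG \<Longrightarrow> \<Delta> ((cox (Cartan D) ^^ m) (fund_weight k)) ((cox (Cartan D) ^^ m) (fund_weight k)) x = XX m k x"
proof -
  let ?us = "filt (Cartan D) (cox_pow_word m) (fund_weight k)"
  note r = filt_reduced[OF good_desc_pow[OF assms]]
  have e: "(cox (Cartan D) ^^ m) (fund_weight k) = word_act (Cartan D) ?us (fund_weight k)"
    by (simp only: filt_act cox_pow_word_act)
  show "regular_on (Grp D) (\<Delta> ((cox (Cartan D) ^^ m) (fund_weight k)) ((cox (Cartan D) ^^ m) (fund_weight k)))"
    unfolding e by (rule Delta_regular[OF r r])
  assume x: "x \<in> GG"
  have "\<Delta> ((cox (Cartan D) ^^ m) (fund_weight k)) ((cox (Cartan D) ^^ m) (fund_weight k)) x = fm k (matrix_inv (w_bar D ?us) ** x ** w_bar D ?us)"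
    unfolding e by (rule Delta_eq[OF r r x])
  also have "\<dots> = fm k (matrix_inv (w_bar D ?us) ** x ** w_bar D (cox_pow_word m))"
    by (rule f_filt[OF GG_mult[OF GG_cancel(1)[OF GG_w] x]])
  also have "\<dots> = fm k (matrix_inv (w_bar D ?us) ** (x ** w_bar D (cox_pow_word m)))" by (simp only: matrix_mul_assoc)
  also have "\<dots> = fm k (matrix_inv (w_bar D (cox_pow_word m)) ** (x ** w_bar D (cox_pow_word m)))"
    by (rule f_filt_left[OF GG_mult[OF x GG_w]])
  also have "\<dots> = XX m k x" by (simp only: XX_def matrix_mul_assoc)
  finally show "\<Delta> ((cox (Cartan D) ^^ m) (fund_weight k)) ((cox (Cartan D) ^^ m) (fund_weight k)) x = XX m k x" .
qed

lemma desc_cox_fund: "desc (Cartan D) cox_word (fund_weight j)"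
  using good_desc[OF good_1, of 0 j] by simp

lemma Delta_cox:
  "regular_on (Grp D) (\<Delta> (fund_weight k) (cox (Cartan D) (fund_weight k)))"
    "x \<in> GG \<Longrightarrow> \<Delta> (fund_weight k) (cox (Cartan D) (fund_weight k)) x = fm k (x ** w_bar D cox_word)"
proof -
  let ?us = "filt (Cartan D) cox_word (fund_weight k)"
  note r = filt_reduced[OF desc_cox_fund[of k]]
  have e: "cox (Cartan D) (fund_weight k) = word_act (Cartan D) ?us (fund_weight k)" by (simp only: filt_act cox_def)
  show "regular_on (Grp D) (\<Delta> (fund_weight k) (cox (Cartan D) (fund_weight k)))"
    using Delta_regular[OF reduced_Nil r, of k] by (simp only: e word_act_Nil)
  assume x: "x \<in> GG"
  have "\<Delta> (fund_weight k) (cox (Cartan D) (fund_weight k)) x = fm k (matrix_inv (w_bar D []) ** x ** w_bar D ?us)"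
    using Delta_eq[OF reduced_Nil r x, of k] by (simp only: e word_act_Nil)
  also have "\<dots> = fm k (x ** w_bar D ?us)" by (simp add: matrix_inv_one matrix_mul_lid)
  also have "\<dots> = fm k (x ** w_bar D cox_word)" by (rule f_filt[OF x])
  finally show "\<Delta> (fund_weight k) (cox (Cartan D) (fund_weight k)) x = fm k (x ** w_bar D cox_word)" .
qed

lemma y_coef_nz: "x \<in> LC \<Longrightarrow> y_coef D \<Delta> j x \<noteq> 0"
  unfolding y_coef_def fun_restrict_def L_cell_LC
  using LC_nonvanishing[OF _ desc_cox_fund] by (auto simp: Delta_cox(2)[OF LC_GG])

lemma y_coef_regular: "regular_on LC (y_coef D \<Delta> j)"
proof -
  have r: "regular_on LC (\<Delta> (fund_weight i) (cox (Cartan D) (fund_weight i)))" for i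
    by (rule regular_on_subset[OF Delta_cox(1)]) (auto intro: GG_Grp LC_GG)
  have nz: "x \<in> LC \<Longrightarrow> \<Delta> (fund_weight i) (cox (Cartan D) (fund_weight i)) x \<noteq> 0" for i x
    using LC_nonvanishing[OF _ desc_cox_fund] by (simp add: Delta_cox(2)[OF LC_GG])
  have "regular_on LC (\<lambda>x. \<Delta> (fund_weight j) (cox (Cartan D) (fund_weight j)) x *
        (\<Prod>i\<in>{i. prec (Cartan D) i j}. \<Delta> (fund_weight i) (cox (Cartan D) (fund_weight i)) x powi (Cartan D $ i $ j)))"
    by (intro regular_on_mult regular_on_prod regular_on_powi r nz)
  thus ?thesis by (rule regular_on_cong) (simp add: y_coef_def fun_restrict_def L_cell_LC)
qed

text \<open>With M solving the triangular system, \<open>chart_right\<close> for the empty word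
  identifies the minors for (omega_i, c omega_i) with the values \<open>M i\<close>. The j-th
  equation of the system is then the formula for the coefficient, other letters before j having
  exponent 0.\<close>

lemma y_coef_chart:
  assumes t: "\<And>i. \<tau> i \<noteq> 0" and y: "\<And>i. y i \<noteq> 0"
  shows "y_coef D \<Delta> j (chart \<tau> y) = y j"
proof -
  have "\<exists>T. (\<forall>i. T i \<noteq> 0) \<and> (\<forall>i\<in>set cox_word. EE (Cartan D) cox_word T i = y i) \<and> ((\<forall>i. posR (y i)) \<longrightarrow> (\<forall>i. posR (T i)))"
    by (rule EE_surj[OF distinct_cox_word]) (rule y)
  then obtain M where M: "\<And>i. M i \<noteq> 0" "\<And>i. EE (Cartan D) cox_word M i = y i" by auto
  have D: "\<Delta> (fund_weight i) (cox (Cartan D) (fund_weight i)) (chart \<tau> y) = M i" for i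
  proof -
    have "\<Delta> (fund_weight i) (cox (Cartan D) (fund_weight i)) (chart \<tau> y) = fm i (chart \<tau> y ** w_bar D cox_word)"
      by (rule Delta_cox(2)[OF chart_GG[OF t]])
    also have "\<dots> = fm i (matrix_inv (w_bar D []) ** chart \<tau> y ** w_bar D cox_word ** w_bar D [])"
      by (simp add: matrix_inv_one matrix_mul_lid matrix_mul_rid)
    also have "\<dots> = (\<Prod>l\<in>UNIV. M l powi (word_act (Cartan D) [] (fund_weight i) $ l))"
      by (rule chart_right[OF t M]) (simp add: desc_cox_fund)
    also have "\<dots> = (\<Prod>l\<in>UNIV. if l = i then M i else 1)" by (intro prod.cong) (auto simp: fund_weight_nth)
    finally show ?thesis by simp
  qed
  obtain us vs where c: "cox_word = us @ j # vs" "set us = {..<j}" "set vs = {j<..}" using cox_word_split[of j] by blast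
  have dus: "distinct (us @ j # vs)" using distinct_cox_word[where 'a = 'i] unfolding c(1) .
  have "y j = (\<Prod>l\<leftarrow>us. M l powi (Cartan D $ l $ j)) * M j"
    unfolding M(2)[symmetric] c(1) by (rule EE_split[OF dus])
  also have "(\<Prod>l\<leftarrow>us. M l powi (Cartan D $ l $ j)) = (\<Prod>l\<in>{..<j}. M l powi (Cartan D $ l $ j))"
    using dus c(2) prod.distinct_set_conv_list[of us "\<lambda>l. M l powi (Cartan D $ l $ j)"] by simp
  also have "\<dots> = (\<Prod>l\<in>{i. prec (Cartan D) i j}. M l powi (Cartan D $ l $ j))"
    by (rule prod.mono_neutral_right) (auto simp: prec_def)
  finally have "y j = (\<Prod>l\<in>{i. prec (Cartan D) i j}. M l powi (Cartan D $ l $ j)) * M j" .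
  thus ?thesis unfolding y_coef_def fun_restrict_def L_cell_LC using chart_in_LC[OF t y] by (simp add: D)
qed

end


section \<open>Denominator vectors\<close>

text \<open>Both sums fit into one large box, where \<open>laurent_coeff\<close> recovers the
  coefficients.\<close>

lemma laurent_unique:
  fixes c c' :: "('v::finite \<Rightarrow> int) \<Rightarrow> complex"
  assumes S: "finite S" "\<And>\<nu>. \<nu> \<in> S \<Longrightarrow> c \<nu> \<noteq> 0" and S': "finite S'" "\<And>\<nu>. \<nu> \<in> S' \<Longrightarrow> c' \<nu> \<noteq> 0"
    and eq: "\<And>z. \<forall>v. z v \<noteq> 0 \<Longrightarrow> (\<Sum>\<nu>\<in>S. c \<nu> * (\<Prod>v\<in>UNIV. z v powi \<nu> v)) = (\<Sum>\<nu>\<in>S'. c' \<nu> * (\<Prod>v\<in>UNIV. z v powi \<nu> v))"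
  shows "S = S'"
proof -
  define N where "N = (\<Sum>\<nu>\<in>S \<union> S'. \<Sum>v\<in>UNIV. nat \<bar>\<nu> v\<bar>)"
  have N: "\<nu> \<in> exp_box N UNIV" if "\<nu> \<in> S \<union> S'" for \<nu>
  proof -
    have "nat \<bar>\<nu> v\<bar> \<le> N" for v
    proof -
      have "nat \<bar>\<nu> v\<bar> \<le> (\<Sum>v\<in>UNIV. nat \<bar>\<nu> v\<bar>)" by (rule member_le_sum) auto
      also have "\<dots> \<le> N" unfolding N_def using that S S' by (intro member_le_sum) auto
      finally show ?thesis .
    qed
    thus ?thesis by (simp add: exp_box_def nat_le_iff)
  qed
  define G where "G z = (\<Sum>\<nu>\<in>S. c \<nu> * (\<Prod>v\<in>UNIV. z v powi \<nu> v))" for z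
  have e: "(\<Sum>\<nu>\<in>T. b \<nu> * (\<Prod>v\<in>UNIV. z v powi \<nu> v)) = (\<Sum>\<nu>\<in>exp_box N UNIV. (if \<nu> \<in> T then b \<nu> else 0) * (\<Prod>v\<in>UNIV. z v powi \<nu> v))"
    if "T \<subseteq> S \<union> S'" for T z and b :: "('v \<Rightarrow> int) \<Rightarrow> complex"
    using N that by (intro sum.mono_neutral_cong_left) (auto simp: finite_exp_box)
  have "(if \<nu> \<in> S then c \<nu> else 0) = (if \<nu> \<in> S' then c' \<nu> else 0)" if "\<nu> \<in> exp_box N UNIV" for \<nu>
  proof -
    have "laurent_coeff N UNIV G \<nu> = (if \<nu> \<in> S then c \<nu> else 0)"
      by (rule laurent_coeff_eq[OF finite that]) (unfold G_def, rule e, simp)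
    moreover have "laurent_coeff N UNIV G \<nu> = (if \<nu> \<in> S' then c' \<nu> else 0)"
      by (rule laurent_coeff_eq[OF finite that]) (unfold G_def, subst eq, assumption, rule e, simp)
    ultimately show ?thesis by simp
  qed
  hence "\<nu> \<in> S \<longleftrightarrow> \<nu> \<in> S'" if "\<nu> \<in> exp_box N UNIV" for \<nu> using that S(2) S'(2) by (metis)
  thus ?thesis using N by blast
qed

abbreviation "cpoly_eval z P \<equiv> cluster_poly_val (\<lambda>a. a) (\<lambda>i. z (Inr i)) (\<lambda>i. z (Inl i)) P"

lemma ground_val_superset:
  "finite K \<Longrightarrow> Poly_Mapping.keys p \<subseteq> K \<Longrightarrow> ground_val (\<lambda>a. a) y p = (\<Sum>l\<in>K. Poly_Mapping.lookup p l * monomial_val y l)"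
  unfolding ground_val_def by (rule sum.mono_neutral_left) (auto simp: in_keys_iff)

lemma ground_val_add: "ground_val (\<lambda>a. a) y (p + q) = ground_val (\<lambda>a. a) y p + ground_val (\<lambda>a. a) y q"
  using Poly_Mapping.keys_add[of p q]
  by (simp add: ground_val_superset[of "Poly_Mapping.keys p \<union> Poly_Mapping.keys q"] lookup_add algebra_simps sum.distrib)

lemma ground_val_0 [simp]: "ground_val cst y 0 = 0"
  by (simp add: ground_val_def)

lemma cluster_poly_val_superset:
  "finite K \<Longrightarrow> Poly_Mapping.keys P \<subseteq> K \<Longrightarrow>
    cluster_poly_val cst y x P = (\<Sum>m\<in>K. ground_val cst y (Poly_Mapping.lookup P m) * (\<Prod>i\<in>UNIV. x i ^ (m $ i)))"
  unfolding cluster_poly_val_def by (rule sum.mono_neutral_left) (auto simp: in_keys_iff)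

lemma cluster_poly_val_add:
  "cluster_poly_val (\<lambda>a. a) y x (P + Q) = cluster_poly_val (\<lambda>a. a) y x P + cluster_poly_val (\<lambda>a. a) y x Q"
  using Poly_Mapping.keys_add[of P Q]
  by (simp add: cluster_poly_val_superset[of "Poly_Mapping.keys P \<union> Poly_Mapping.keys Q"] lookup_add ground_val_add algebra_simps sum.distrib)

lemma cluster_poly_val_sum:
  "cluster_poly_val (\<lambda>a. a) y x (\<Sum>s\<in>S. g s) = (\<Sum>s\<in>S. cluster_poly_val (\<lambda>a. a) y x (g s))"
  by (induction S rule: infinite_finite_induct) (simp_all add: cluster_poly_val_add cluster_poly_val_def[of _ _ _ 0])

lemma ground_val_single: "ground_val (\<lambda>a. a) y (Poly_Mapping.single l c) = c * monomial_val y l"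
  by (subst ground_val_superset[of "{l}"]) simp_all

lemma cluster_poly_val_single:
  "cluster_poly_val (\<lambda>a. a) y x (Poly_Mapping.single m (Poly_Mapping.single l c)) = c * monomial_val y l * (\<Prod>i\<in>UNIV. x i ^ (m $ i))"
  by (subst cluster_poly_val_superset[of "{m}"]) (simp_all add: ground_val_single)

lemma X_var_dvd_iff:
  fixes P :: "'i::finite cluster_poly"
  shows "X_var i dvd P \<longleftrightarrow> (\<forall>m\<in>Poly_Mapping.keys P. m $ i \<ge> 1)"
proof
  assume "X_var i dvd P"
  then obtain Q where Q: "P = X_var i * Q" by (rule dvdE)
  show "\<forall>m\<in>Poly_Mapping.keys P. m $ i \<ge> 1"
  proof
    fix m assume "m \<in> Poly_Mapping.keys P"
    then obtain a b where "m = a + b" "a \<in> Poly_Mapping.keys (X_var i)" using keys_mult[of "X_var i" Q] unfolding Q by blast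
    thus "m $ i \<ge> 1" by (auto simp: X_var_def axis_def split: if_splits)
  qed
next
  assume k: "\<forall>m\<in>Poly_Mapping.keys P. m $ i \<ge> 1"
  have "P = (\<Sum>m\<in>Poly_Mapping.keys P. Poly_Mapping.single m (Poly_Mapping.lookup P m))" 
  proof (rule poly_mapping_eqI)
    fix k
    have "(\<Sum>m\<in>Poly_Mapping.keys P. Poly_Mapping.lookup (Poly_Mapping.single m (Poly_Mapping.lookup P m)) k)
      = (\<Sum>m\<in>Poly_Mapping.keys P. if m = k then Poly_Mapping.lookup P k else 0)"
      by (intro sum.cong) (auto simp: lookup_single when_def)
    thus "Poly_Mapping.lookup P k = Poly_Mapping.lookup (\<Sum>m\<in>Poly_Mapping.keys P. Poly_Mapping.single m (Poly_Mapping.lookup P m)) k"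
      by (simp add: lookup_sum in_keys_iff)
  qed
  moreover have "X_var i dvd Poly_Mapping.single m (Poly_Mapping.lookup P m)" if "m \<in> Poly_Mapping.keys P" for m
  proof
    have "m $ i \<ge> 1" using k that by blast
    hence "m = axis i 1 + (\<chi> l. if l = i then m $ l - 1 else m $ l)" by (simp add: vec_eq_iff axis_def)
    thus "Poly_Mapping.single m (Poly_Mapping.lookup P m) = X_var i * Poly_Mapping.single (\<chi> l. if l = i then m $ l - 1 else m $ l) (Poly_Mapping.lookup P m)"
      by (simp add: X_var_def mult_single)
  qed
  ultimately show "X_var i dvd P" using dvd_sum[of "Poly_Mapping.keys P" "X_var i"] by metis
qed

lemma prod_UNIV_sum:
  fixes g :: "'a::finite + 'b::finite \<Rightarrow> 'c::comm_monoid_mult"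
  shows "(\<Prod>v\<in>UNIV. g v) = (\<Prod>i\<in>UNIV. g (Inl i)) * (\<Prod>i\<in>UNIV. g (Inr i))"
proof -
  have "(\<Prod>v\<in>UNIV. g v) = (\<Prod>v\<in>range Inl \<union> range Inr. g v)" by (simp add: UNIV_sum)
  also have "\<dots> = (\<Prod>v\<in>range Inl. g v) * (\<Prod>v\<in>range Inr. g v)" by (rule prod.union_disjoint) auto
  finally show ?thesis by (simp add: prod.reindex)
qed

text \<open>The exponent vector of one term of P / x^d; the pair holds its exponents in the x_i and
  in the y_i. The map is injective in the pair, so distinct terms of P cannot merge.\<close>

definition expo :: "'i weight \<Rightarrow> (nat^'i) \<times> 'i weight \<Rightarrow> ('i::finite + 'i \<Rightarrow> int)" where
  "expo d ml v = (case v of Inl i \<Rightarrow> int (fst ml $ i) - d $ i | Inr i \<Rightarrow> snd ml $ i)"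

lemma expo_simps [simp]: "expo d ml (Inl i) = int (fst ml $ i) - d $ i" "expo d ml (Inr i) = snd ml $ i"
  by (simp_all add: expo_def)

lemma expo_inj: "expo d ml = expo d ml' \<Longrightarrow> ml = ml'"
proof -
  assume e: "expo d ml = expo d ml'"
  have "fst ml $ i = fst ml' $ i" "snd ml $ i = snd ml' $ i" for i
    using fun_cong[OF e, of "Inl i"] fun_cong[OF e, of "Inr i"] by simp_all
  thus ?thesis by (simp add: prod_eq_iff vec_eq_iff)
qed

lemma expo_monomial:
  fixes z :: "'i::finite + 'i \<Rightarrow> complex"
  assumes "\<forall>v. z v \<noteq> 0"
  shows "(\<Prod>v\<in>UNIV. z v powi expo d (m, l) v) =
    monomial_val (\<lambda>i. z (Inr i)) l * (\<Prod>i\<in>UNIV. z (Inl i) ^ (m $ i)) / monomial_val (\<lambda>i. z (Inl i)) d"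
  using assms by (simp add: prod_UNIV_sum monomial_val_def power_int_diff prod_dividef)

text \<open>Multiplication by x^d makes all exponents of the x_i nonnegative. For each i some term
  is left with exponent 0, so x_i does not divide P.\<close>

lemma laurent_to_cluster_poly:
  fixes d :: "'i::finite weight"
  assumes S: "finite S" "\<And>\<nu>. \<nu> \<in> S \<Longrightarrow> c \<nu> \<noteq> 0"
    and ge: "\<And>\<nu> i. \<nu> \<in> S \<Longrightarrow> \<nu> (Inl i) \<ge> - d $ i" and att: "\<And>i. \<exists>\<nu>\<in>S. \<nu> (Inl i) = - d $ i"
  shows "\<exists>P. (\<forall>i. \<not> X_var i dvd P) \<and> (\<forall>z. (\<forall>v. z v \<noteq> 0) \<longrightarrow>
    cpoly_eval z P / monomial_val (\<lambda>i. z (Inl i)) d = (\<Sum>\<nu>\<in>S. c \<nu> * (\<Prod>v\<in>UNIV. z v powi \<nu> v)))"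
proof -
  define m :: "('i + 'i \<Rightarrow> int) \<Rightarrow> nat^'i" where "m \<nu> = (\<chi> i. nat (\<nu> (Inl i) + d $ i))" for \<nu>
  define l :: "('i + 'i \<Rightarrow> int) \<Rightarrow> 'i weight" where "l \<nu> = (\<chi> i. \<nu> (Inr i))" for \<nu>
  have e: "expo d (m \<nu>, l \<nu>) = \<nu>" if "\<nu> \<in> S" for \<nu>
  proof
    fix v show "expo d (m \<nu>, l \<nu>) v = \<nu> v"
    proof (cases v)
      case (Inl i) thus ?thesis using ge[OF that, of i] by (simp add: m_def)
    next
      case (Inr i) thus ?thesis by (simp add: l_def)
    qed
  qed
  define P where "P = (\<Sum>\<nu>\<in>S. Poly_Mapping.single (m \<nu>) (Poly_Mapping.single (l \<nu>) (c \<nu>)))"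
  have "\<not> X_var i dvd P" for i
  proof
    assume dvd: "X_var i dvd P"
    obtain \<nu> where \<nu>: "\<nu> \<in> S" "\<nu> (Inl i) = - d $ i" using att by blast
    have "Poly_Mapping.lookup (Poly_Mapping.lookup P (m \<nu>)) (l \<nu>) = (\<Sum>\<mu>\<in>S. if \<mu> = \<nu> then c \<mu> else 0)"
      unfolding P_def lookup_sum
    proof (intro sum.cong refl)
      fix \<mu> assume \<mu>: "\<mu> \<in> S"
      show "Poly_Mapping.lookup (Poly_Mapping.lookup (Poly_Mapping.single (m \<mu>) (Poly_Mapping.single (l \<mu>) (c \<mu>))) (m \<nu>)) (l \<nu>) = (if \<mu> = \<nu> then c \<mu> else 0)"
        using e[OF \<mu>] e[OF \<nu>(1)] by (auto simp: lookup_single when_def)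
    qed
    also have "\<dots> = c \<nu>" using S(1) \<nu>(1) by simp
    finally have "Poly_Mapping.lookup P (m \<nu>) \<noteq> 0" using S(2)[OF \<nu>(1)] by auto
    hence "m \<nu> $ i \<ge> 1" using dvd by (simp add: X_var_dvd_iff in_keys_iff)
    thus False using \<nu>(2) by (simp add: m_def)
  qed
  moreover have "cpoly_eval z P / monomial_val (\<lambda>i. z (Inl i)) d = (\<Sum>\<nu>\<in>S. c \<nu> * (\<Prod>v\<in>UNIV. z v powi \<nu> v))" if z: "\<forall>v. z v \<noteq> 0" for z
    unfolding P_def cluster_poly_val_sum sum_divide_distrib
  proof (intro sum.cong refl)
    fix \<nu> assume "\<nu> \<in> S"
    from expo_monomial[OF z, of d "m \<nu>" "l \<nu>"] e[OF this]
    show "cpoly_eval z (Poly_Mapping.single (m \<nu>) (Poly_Mapping.single (l \<nu>) (c \<nu>))) / monomial_val (\<lambda>i. z (Inl i)) d = c \<nu> * (\<Prod>v\<in>UNIV. z v powi \<nu> v)"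
      by (simp add: cluster_poly_val_single mult.assoc)
  qed
  ultimately show ?thesis by blast
qed

text \<open>By uniqueness of Laurent expansions S is the set of exponent vectors of P / x^d, and as
  x_i does not divide P the exponent -d_i is attained. Hence d is determined by S, which makes the
  denominator vector unique.\<close>

lemma cluster_poly_laurent:
  fixes d :: "'i::finite weight"
  assumes P: "\<And>i. \<not> X_var i dvd P" and S: "finite S" "\<And>\<nu>. \<nu> \<in> S \<Longrightarrow> c \<nu> \<noteq> 0"
    and eq: "\<And>z. \<forall>v. z v \<noteq> 0 \<Longrightarrow> cpoly_eval z P / monomial_val (\<lambda>i. z (Inl i)) d = (\<Sum>\<nu>\<in>S. c \<nu> * (\<Prod>v\<in>UNIV. z v powi \<nu> v))"
  shows "(\<forall>\<nu>\<in>S. \<nu> (Inl i) \<ge> - d $ i) \<and> (\<exists>\<nu>\<in>S. \<nu> (Inl i) = - d $ i)"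
proof -
  define K where "K = Sigma (Poly_Mapping.keys P) (\<lambda>m. Poly_Mapping.keys (Poly_Mapping.lookup P m))"
  \<comment> \<open>The coefficients of P, transported to exponent vectors through the injective map
    \<open>expo d\<close>.\<close>
  define b where "b \<nu> = (let ml = (THE ml. expo d ml = \<nu>) in Poly_Mapping.lookup (Poly_Mapping.lookup P (fst ml)) (snd ml))" for \<nu>
  have be: "b (expo d (m, l)) = Poly_Mapping.lookup (Poly_Mapping.lookup P m) l" for m l
  proof -
    have "(THE ml. expo d ml = expo d (m, l)) = (m, l)" by (rule the_equality) (auto dest: expo_inj)
    thus ?thesis by (simp add: b_def)
  qed
  have "S = expo d ` K"
  proof (rule laurent_unique[where c' = b, OF S])
    show "finite (expo d ` K)" by (simp add: K_def)
    show "b \<nu> \<noteq> 0" if "\<nu> \<in> expo d ` K" for \<nu> using that by (auto simp: K_def be in_keys_iff)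
    fix z :: "'i + 'i \<Rightarrow> complex" assume z: "\<forall>v. z v \<noteq> 0"
    have "(\<Sum>\<nu>\<in>S. c \<nu> * (\<Prod>v\<in>UNIV. z v powi \<nu> v)) = cpoly_eval z P / monomial_val (\<lambda>i. z (Inl i)) d" using eq[OF z] by simp
    also have "\<dots> = (\<Sum>m\<in>Poly_Mapping.keys P. \<Sum>l\<in>Poly_Mapping.keys (Poly_Mapping.lookup P m). b (expo d (m, l)) * (\<Prod>v\<in>UNIV. z v powi expo d (m, l) v))"
      by (simp add: cluster_poly_val_def ground_val_def expo_monomial[OF z] be sum_divide_distrib sum_distrib_right mult.assoc)
    also have "\<dots> = (\<Sum>ml\<in>K. b (expo d ml) * (\<Prod>v\<in>UNIV. z v powi expo d ml v))"
      unfolding K_def by (subst sum.Sigma) (auto simp: case_prod_unfold)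
    also have "\<dots> = (\<Sum>\<nu>\<in>expo d ` K. b \<nu> * (\<Prod>v\<in>UNIV. z v powi \<nu> v))"
      by (subst sum.reindex) (auto simp: inj_on_def dest: expo_inj)
    finally show "(\<Sum>\<nu>\<in>S. c \<nu> * (\<Prod>v\<in>UNIV. z v powi \<nu> v)) = (\<Sum>\<nu>\<in>expo d ` K. b \<nu> * (\<Prod>v\<in>UNIV. z v powi \<nu> v))" .
  qed
  moreover obtain m where m: "m \<in> Poly_Mapping.keys P" "m $ i = 0" using P[of i] unfolding X_var_dvd_iff by fastforce
  moreover obtain l where "l \<in> Poly_Mapping.keys (Poly_Mapping.lookup P m)" using m(1) by (metis in_keys_iff keys_eq_empty all_not_in_conv)
  ultimately show ?thesis by (force simp: K_def)
qed

section \<open>From the abstract fraction field to functions on the chart\<close>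

locale sc_field = sc_minors D \<Delta> for D :: "('i::{finite,linorder},'m::finite) group_datum" and \<Delta> +
  fixes \<iota> :: "(complex^'m^'m \<Rightarrow> complex) \<Rightarrow> 'f::field"
  assumes ambient: "fraction_field_of (L_cell D) \<iota>"
begin

definition CR where "CR = coord_ring (L_cell D)"
definition Xf where "Xf i = x_gamma D \<Delta> (fund_weight i)"
definition Yf where "Yf i = y_coef D \<Delta> i"
definition x where "x i = \<iota> (Xf i)"
definition y where "y i = \<iota> (Yf i)"
definition cst where "cst a = \<iota> (fun_restrict (L_cell D) (\<lambda>_. a))"
definition ch :: "('i + 'i \<Rightarrow> complex) \<Rightarrow> complex^'m^'m" where "ch z = chart (\<lambda>i. z (Inl i)) (\<lambda>i. z (Inr i))"

lemma CR_restrict: "regular_on LC f \<Longrightarrow> fun_restrict (L_cell D) f \<in> CR"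
  unfolding CR_def coord_ring_def L_cell_LC fun_restrict_def by (auto elim: regular_on_cong)

lemma CR_out: "f \<in> CR \<Longrightarrow> p \<notin> LC \<Longrightarrow> f p = 0"
  unfolding CR_def coord_ring_def L_cell_LC by auto

lemma CR_mult: "f \<in> CR \<Longrightarrow> g \<in> CR \<Longrightarrow> (\<lambda>p. f p * g p) \<in> CR" and CR_add: "f \<in> CR \<Longrightarrow> g \<in> CR \<Longrightarrow> (\<lambda>p. f p + g p) \<in> CR"
  unfolding CR_def coord_ring_def by (auto intro: regular_on_mult regular_on_add)

lemma \<iota>_mult: "f \<in> CR \<Longrightarrow> g \<in> CR \<Longrightarrow> \<iota> (\<lambda>p. f p * g p) = \<iota> f * \<iota> g"
  and \<iota>_add: "f \<in> CR \<Longrightarrow> g \<in> CR \<Longrightarrow> \<iota> (\<lambda>p. f p + g p) = \<iota> f + \<iota> g"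
  and \<iota>_one: "\<iota> (fun_restrict (L_cell D) (\<lambda>_. 1)) = 1"
  and \<iota>_inj: "f \<in> CR \<Longrightarrow> g \<in> CR \<Longrightarrow> \<iota> f = \<iota> g \<Longrightarrow> f = g"
  using ambient unfolding fraction_field_of_def CR_def inj_on_def by auto

lemma CR_const: "fun_restrict (L_cell D) (\<lambda>_. a) \<in> CR"
  by (intro CR_restrict regular_on_const)

lemma \<iota>_zero: "\<iota> (\<lambda>_. 0) = 0"
proof -
  have "(\<lambda>_. 0) = fun_restrict (L_cell D) (\<lambda>_. 0)" by (auto simp: fun_restrict_def)
  hence "(\<lambda>_. 0) \<in> CR" using CR_const[of 0] by simp
  from \<iota>_add[OF this this] have "\<iota> (\<lambda>_. 0) + 0 = \<iota> (\<lambda>_. 0) + \<iota> (\<lambda>_. 0)" by (simp only: add_0_right)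
  thus ?thesis by (simp only: add_left_cancel)
qed

lemma x_gamma_CR: assumes "good (Cartan D) m k" shows "x_gamma D \<Delta> ((cox (Cartan D) ^^ m) (fund_weight k)) \<in> CR"
  unfolding x_gamma_def
  by (intro CR_restrict regular_on_subset[OF Delta_cox_pow(1)[OF assms]]) (auto intro: GG_Grp LC_GG)

lemma ch_LC: "\<forall>v. z v \<noteq> 0 \<Longrightarrow> ch z \<in> LC"
  unfolding ch_def by (rule chart_in_LC) simp_all

lemma x_gamma_ch:
  assumes "good (Cartan D) m k" "\<forall>v. z v \<noteq> 0"
  shows "x_gamma D \<Delta> ((cox (Cartan D) ^^ m) (fund_weight k)) (ch z) = XX m k (ch z)"
  unfolding x_gamma_def fun_restrict_def L_cell_LC
  using ch_LC[OF assms(2)] Delta_cox_pow(2)[OF assms(1) LC_GG[OF ch_LC[OF assms(2)]]] by simp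

lemma good_0: "good (Cartan D) 0 k" by (simp add: good_def)

lemma Xf_CR: "Xf i \<in> CR" unfolding Xf_def using x_gamma_CR[OF good_0, of i] by simp

lemma Xf_LC: "p \<in> LC \<Longrightarrow> Xf i p = fm i p" by (simp add: Xf_def x_gamma_def fun_restrict_def L_cell_LC fm_def)

lemma Xf_ch: "\<forall>v. z v \<noteq> 0 \<Longrightarrow> Xf i (ch z) = z (Inl i)"
  using f_chart[where \<tau> = "\<lambda>i. z (Inl i)"] by (simp add: Xf_LC ch_LC) (simp add: ch_def)

lemma Yf_CR: "Yf i \<in> CR"
  using CR_restrict[OF y_coef_regular[of i]] unfolding Yf_def y_coef_def fun_restrict_def by (simp add: if_distrib cong: if_cong)

lemma Yf_ch: "\<forall>v. z v \<noteq> 0 \<Longrightarrow> Yf i (ch z) = z (Inr i)"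
  unfolding ch_def Yf_def by (rule y_coef_chart) simp_all

text \<open>The coefficients vanish nowhere on the cell, so their inverses belong to the coordinate
  ring; the x_i, in contrast, have to be inverted in the field.\<close>

definition Yi where "Yi i = fun_restrict (L_cell D) (\<lambda>p. inverse (Yf i p))"

lemma Yi_CR: "Yi i \<in> CR"
  unfolding Yi_def Yf_def by (intro CR_restrict regular_on_inverse y_coef_regular y_coef_nz)

lemma Yi: "\<iota> (Yi i) = inverse (y i)"
proof -
  have "(\<lambda>p. Yf i p * Yi i p) = fun_restrict (L_cell D) (\<lambda>_. 1)"
    using y_coef_nz[of _ i] by (auto simp: Yi_def fun_restrict_def L_cell_LC Yf_def)
  hence "y i * \<iota> (Yi i) = 1" using \<iota>_mult[OF Yf_CR[of i] Yi_CR[of i]] \<iota>_one by (simp add: y_def)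
  thus ?thesis by (metis inverse_unique)
qed

lemma CR_power: assumes "f \<in> CR" 
  shows "fun_restrict (L_cell D) (\<lambda>p. f p ^ n) \<in> CR \<and> \<iota> (fun_restrict (L_cell D) (\<lambda>p. f p ^ n)) = \<iota> f ^ n"
proof (induction n)
  case 0 show ?case using CR_const \<iota>_one by simp
next
  case (Suc n)
  have "fun_restrict (L_cell D) (\<lambda>p. f p ^ Suc n) = (\<lambda>p. f p * fun_restrict (L_cell D) (\<lambda>p. f p ^ n) p)"
    by (auto simp: fun_restrict_def)
  thus ?case using Suc CR_mult[OF assms] \<iota>_mult[OF assms] by simp
qed

definition XM :: "('i \<Rightarrow> nat) \<Rightarrow> complex^'m^'m \<Rightarrow> complex" where
  "XM e = fun_restrict (L_cell D) (\<lambda>p. \<Prod>i\<in>UNIV. Xf i p ^ e i)"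

lemma XM_CR: "XM e \<in> CR" and XM: "\<iota> (XM e) = (\<Prod>i\<in>UNIV. x i ^ e i)"
proof -
  have "fun_restrict (L_cell D) (\<lambda>p. \<Prod>i\<in>S. Xf i p ^ e i) \<in> CR \<and>
    \<iota> (fun_restrict (L_cell D) (\<lambda>p. \<Prod>i\<in>S. Xf i p ^ e i)) = (\<Prod>i\<in>S. x i ^ e i)" for S :: "'i set"
  proof (induction S rule: finite_induct[OF finite])
    case 1 show ?case using CR_const \<iota>_one by simp
  next
    case (2 i S)
    note p = CR_power[OF Xf_CR[of i], of "e i"]
    have "fun_restrict (L_cell D) (\<lambda>p. \<Prod>i\<in>insert i S. Xf i p ^ e i) =
      (\<lambda>p. fun_restrict (L_cell D) (\<lambda>p. Xf i p ^ e i) p * fun_restrict (L_cell D) (\<lambda>p. \<Prod>i\<in>S. Xf i p ^ e i) p)"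
      using 2 by (auto simp: fun_restrict_def)
    thus ?case using 2 p CR_mult \<iota>_mult by (simp add: x_def)
  qed
  from this[of UNIV] show "XM e \<in> CR" "\<iota> (XM e) = (\<Prod>i\<in>UNIV. x i ^ e i)" by (simp_all add: XM_def)
qed

lemma XM_ch: "\<forall>v. z v \<noteq> 0 \<Longrightarrow> XM e (ch z) = (\<Prod>i\<in>UNIV. z (Inl i) ^ e i)"
  using ch_LC by (simp add: XM_def fun_restrict_def L_cell_LC Xf_ch)

lemma x_nz: "x i \<noteq> 0"
proof
  assume "x i = 0"
  hence "\<iota> (Xf i) = \<iota> (\<lambda>_. 0)" by (simp add: x_def \<iota>_zero)
  moreover have "(\<lambda>_. 0) \<in> CR" using CR_const[of 0] by (simp add: fun_restrict_def)
  ultimately have "Xf i = (\<lambda>_. 0)" using \<iota>_inj[OF Xf_CR] by blast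
  thus False using Xf_ch[of "\<lambda>_. 1" i] by simp
qed

text \<open>\<open>rep g w\<close> says that \<open>w\<close> is the element of the ambient field which is the function \<open>g\<close> in the
  coordinates of the chart.\<close>

definition rep :: "(('i + 'i \<Rightarrow> complex) \<Rightarrow> complex) \<Rightarrow> 'f \<Rightarrow> bool" where
  "rep g w \<longleftrightarrow> (\<exists>h\<in>CR. \<exists>e. w * (\<Prod>i\<in>UNIV. x i ^ e i) = \<iota> h \<and>
     (\<forall>z. (\<forall>v. z v \<noteq> 0) \<longrightarrow> h (ch z) = g z * (\<Prod>i\<in>UNIV. z (Inl i) ^ e i)))"

lemma repI: "h \<in> CR \<Longrightarrow> (\<And>z. \<forall>v. z v \<noteq> 0 \<Longrightarrow> h (ch z) = g z) \<Longrightarrow> rep g (\<iota> h)"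
  unfolding rep_def by (intro bexI[of _ h] exI[of _ "\<lambda>_. 0"]) auto

lemma rep_const: "rep (\<lambda>_. a) (cst a)"
  unfolding cst_def by (rule repI[OF CR_const]) (simp add: fun_restrict_def L_cell_LC ch_LC)

lemma rep_x: "rep (\<lambda>z. z (Inl i)) (x i)" and rep_y: "rep (\<lambda>z. z (Inr i)) (y i)"
  unfolding x_def y_def by (rule repI; simp add: Xf_CR Yf_CR Xf_ch Yf_ch)+

lemma rep_inverse_y: "rep (\<lambda>z. inverse (z (Inr i))) (inverse (y i))"
  unfolding Yi[symmetric] by (rule repI[OF Yi_CR]) (simp add: Yi_def fun_restrict_def L_cell_LC ch_LC Yf_ch)

lemma rep_inverse_x: "rep (\<lambda>z. inverse (z (Inl i))) (inverse (x i))"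
proof -
  have d: "(\<Prod>j\<in>UNIV. u j ^ (if j = i then 1 else 0)) = u i" for u :: "'i \<Rightarrow> 'c::comm_semiring_1"
    by (simp add: if_distrib[of "\<lambda>n. _ ^ n"] cong: if_cong)
  show ?thesis unfolding rep_def
    by (rule bexI[OF _ CR_const[of 1]], rule exI[of _ "\<lambda>j. if j = i then 1 else 0"], unfold d)
      (use \<iota>_one in \<open>simp add: x_nz fun_restrict_def L_cell_LC ch_LC\<close>)
qed

lemma rep_mult: assumes "rep g w" "rep g' w'" shows "rep (\<lambda>z. g z * g' z) (w * w')"
proof -
  obtain h e where 1: "h \<in> CR" "w * (\<Prod>i\<in>UNIV. x i ^ e i) = \<iota> h" "\<And>z. \<forall>v. z v \<noteq> 0 \<Longrightarrow> h (ch z) = g z * (\<Prod>i\<in>UNIV. z (Inl i) ^ e i)"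
    using assms(1) unfolding rep_def by blast
  obtain h' e' where 2: "h' \<in> CR" "w' * (\<Prod>i\<in>UNIV. x i ^ e' i) = \<iota> h'" "\<And>z. \<forall>v. z v \<noteq> 0 \<Longrightarrow> h' (ch z) = g' z * (\<Prod>i\<in>UNIV. z (Inl i) ^ e' i)"
    using assms(2) unfolding rep_def by blast
  show ?thesis unfolding rep_def
    by (rule bexI[OF _ CR_mult[OF 1(1) 2(1)]], rule exI[of _ "\<lambda>i. e i + e' i"])
      (simp add: \<iota>_mult 1 2 power_add prod.distrib mult_ac flip: 1(2) 2(2))
qed

lemma rep_add: assumes "rep g w" "rep g' w'" shows "rep (\<lambda>z. g z + g' z) (w + w')"
proof -
  obtain h e where 1: "h \<in> CR" "w * (\<Prod>i\<in>UNIV. x i ^ e i) = \<iota> h" "\<And>z. \<forall>v. z v \<noteq> 0 \<Longrightarrow> h (ch z) = g z * (\<Prod>i\<in>UNIV. z (Inl i) ^ e i)"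
    using assms(1) unfolding rep_def by blast
  obtain h' e' where 2: "h' \<in> CR" "w' * (\<Prod>i\<in>UNIV. x i ^ e' i) = \<iota> h'" "\<And>z. \<forall>v. z v \<noteq> 0 \<Longrightarrow> h' (ch z) = g' z * (\<Prod>i\<in>UNIV. z (Inl i) ^ e' i)"
    using assms(2) unfolding rep_def by blast
  note c = CR_mult[OF 1(1) XM_CR[of e']] CR_mult[OF 2(1) XM_CR[of e]]
  show ?thesis unfolding rep_def
    by (rule bexI[OF _ CR_add[OF c]], rule exI[of _ "\<lambda>i. e i + e' i"])
      (simp add: \<iota>_add c \<iota>_mult 1 2 XM XM_CR XM_ch power_add prod.distrib algebra_simps flip: 1(2) 2(2))
qed

lemma rep_0: "rep (\<lambda>_. 0) 0" and rep_1: "rep (\<lambda>_. 1) 1"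
  using rep_const[of 0] rep_const[of 1] \<iota>_one \<iota>_zero by (simp_all add: cst_def fun_restrict_def cong: if_cong)

lemma rep_sum: "(\<And>s. s \<in> S \<Longrightarrow> rep (g s) (w s)) \<Longrightarrow> rep (\<lambda>z. \<Sum>s\<in>S. g s z) (\<Sum>s\<in>S. w s)"
  by (induction S rule: infinite_finite_induct) (auto intro: rep_0 rep_add)

lemma rep_prod: "(\<And>s. s \<in> S \<Longrightarrow> rep (g s) (w s)) \<Longrightarrow> rep (\<lambda>z. \<Prod>s\<in>S. g s z) (\<Prod>s\<in>S. w s)"
  by (induction S rule: infinite_finite_induct) (auto intro: rep_1 rep_mult)

lemma rep_power: "rep g w \<Longrightarrow> rep (\<lambda>z. g z ^ n) (w ^ n)"
  by (induction n) (auto intro: rep_1 rep_mult)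

lemma rep_powi: "rep g w \<Longrightarrow> rep (\<lambda>z. inverse (g z)) (inverse w) \<Longrightarrow> rep (\<lambda>z. g z powi n) (w powi n)"
  by (cases "n \<ge> 0") (auto simp: power_int_def intro: rep_power)

lemma rep_cluster_poly:
  "rep (\<lambda>z. cpoly_eval z P / monomial_val (\<lambda>i. z (Inl i)) d) (cluster_poly_val cst y x P / monomial_val x d)"
proof -
  have inv: "a / monomial_val u d = a * (\<Prod>i\<in>UNIV. u i powi (- d $ i))" for a and u :: "'i \<Rightarrow> 'c::field"
    by (simp add: monomial_val_def power_int_minus divide_inverse prod_inversef[symmetric])
  show ?thesis unfolding inv unfolding cluster_poly_val_def ground_val_def monomial_val_def
    by (intro rep_mult rep_sum rep_prod rep_powi rep_power rep_const rep_x rep_y rep_inverse_x rep_inverse_y)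
qed

lemma rep_unique_fun:
  assumes "rep g w" "rep g' w" "\<forall>v. z v \<noteq> 0" shows "g z = g' z"
proof -
  obtain h e where 1: "h \<in> CR" "w * (\<Prod>i\<in>UNIV. x i ^ e i) = \<iota> h" "\<And>z. \<forall>v. z v \<noteq> 0 \<Longrightarrow> h (ch z) = g z * (\<Prod>i\<in>UNIV. z (Inl i) ^ e i)"
    using assms(1) unfolding rep_def by blast
  obtain h' e' where 2: "h' \<in> CR" "w * (\<Prod>i\<in>UNIV. x i ^ e' i) = \<iota> h'" "\<And>z. \<forall>v. z v \<noteq> 0 \<Longrightarrow> h' (ch z) = g' z * (\<Prod>i\<in>UNIV. z (Inl i) ^ e' i)"
    using assms(2) unfolding rep_def by blast
  have "\<iota> (\<lambda>p. h p * XM e' p) = \<iota> (\<lambda>p. h' p * XM e p)"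
    by (simp add: \<iota>_mult 1 2 XM_CR XM mult_ac flip: 1(2) 2(2))
  hence "(\<lambda>p. h p * XM e' p) = (\<lambda>p. h' p * XM e p)" by (rule \<iota>_inj[OF CR_mult[OF 1(1) XM_CR] CR_mult[OF 2(1) XM_CR]])
  hence "h (ch z) * XM e' (ch z) = h' (ch z) * XM e (ch z)" by (rule fun_cong)
  thus ?thesis using assms(3) by (simp add: 1(3) 2(3) XM_ch mult_ac)
qed

text \<open>The chart reaches all points of the cell at which no x_i vanishes
  (\<open>LC_generic\<close>). One extra factor of each x_i, hence the \<open>Suc\<close>, makes
  both functions vanish at the remaining points of the cell, so they agree everywhere and
  injectivity of \<open>\<iota>\<close> applies.\<close>

lemma rep_unique_elem:
  assumes "rep g w" "rep g' w'" "\<And>z. \<forall>v. z v \<noteq> 0 \<Longrightarrow> g z = g' z" shows "w = w'"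
proof -
  obtain h e where 1: "h \<in> CR" "w * (\<Prod>i\<in>UNIV. x i ^ e i) = \<iota> h" "\<And>z. \<forall>v. z v \<noteq> 0 \<Longrightarrow> h (ch z) = g z * (\<Prod>i\<in>UNIV. z (Inl i) ^ e i)"
    using assms(1) unfolding rep_def by blast
  obtain h' e' where 2: "h' \<in> CR" "w' * (\<Prod>i\<in>UNIV. x i ^ e' i) = \<iota> h'" "\<And>z. \<forall>v. z v \<noteq> 0 \<Longrightarrow> h' (ch z) = g' z * (\<Prod>i\<in>UNIV. z (Inl i) ^ e' i)"
    using assms(2) unfolding rep_def by blast
  have "h p * XM (\<lambda>i. Suc (e' i)) p = h' p * XM (\<lambda>i. Suc (e i)) p" for p
  proof (cases "p \<in> LC \<and> (\<forall>i. fm i p \<noteq> 0)")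
    case True
    then obtain \<tau> t where t: "\<forall>i. \<tau> i \<noteq> 0" "\<forall>i. t i \<noteq> 0" "p = chart \<tau> t" using LC_generic[of p] by blast
    define z where "z v = (case v of Inl i \<Rightarrow> \<tau> i | Inr i \<Rightarrow> t i)" for v
    have z: "\<forall>v. z v \<noteq> 0" "p = ch z" using t by (auto simp: z_def ch_def split: sum.splits)
    show ?thesis using assms(3)[OF z(1)] by (simp add: z(2) 1(3)[OF z(1)] 2(3)[OF z(1)] XM_ch[OF z(1)] prod.distrib mult_ac)
  next
    case False
    show ?thesis
    proof (cases "p \<in> LC")
      case True
      then obtain i where i: "fm i p = 0" using False by blast
      have "XM (\<lambda>i. Suc (e i)) p = 0" for e using i True by (auto simp: XM_def fun_restrict_def Xf_LC intro!: prod_zero)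
      thus ?thesis by simp
    next
      case F: False thus ?thesis by (simp add: CR_out[OF 1(1)] CR_out[OF 2(1)])
    qed
  qed
  hence "\<iota> (\<lambda>p. h p * XM (\<lambda>i. Suc (e' i)) p) = \<iota> (\<lambda>p. h' p * XM (\<lambda>i. Suc (e i)) p)" by simp
  hence "w * (\<Prod>i\<in>UNIV. x i ^ e i) * (\<Prod>i\<in>UNIV. x i ^ Suc (e' i)) = w' * (\<Prod>i\<in>UNIV. x i ^ e' i) * (\<Prod>i\<in>UNIV. x i ^ Suc (e i))"
    by (simp only: \<iota>_mult 1 2 XM_CR XM)
  hence "w * ((\<Prod>i\<in>UNIV. x i ^ e i) * (\<Prod>i\<in>UNIV. x i ^ e' i) * (\<Prod>i\<in>UNIV. x i)) = w' * ((\<Prod>i\<in>UNIV. x i ^ e i) * (\<Prod>i\<in>UNIV. x i ^ e' i) * (\<Prod>i\<in>UNIV. x i))"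
    by (simp add: prod.distrib mult_ac)
  moreover have "(\<Prod>i\<in>UNIV. x i ^ e i) * (\<Prod>i\<in>UNIV. x i ^ e' i) * (\<Prod>i\<in>UNIV. x i) \<noteq> 0" using x_nz by simp
  ultimately show ?thesis by (simp only: mult_cancel_right simp_thms)
qed

text \<open>Existence turns the Laurent expansion on the chart into a polynomial and carries it to
  the field by \<open>rep_unique_elem\<close>. For uniqueness, \<open>rep_unique_fun\<close> carries
  a second presentation from the field to the chart, where the exponents are compared.\<close>

theorem denominator:
  assumes g: "good (Cartan D) m k" and z: "z = \<iota> (x_gamma D \<Delta> ((cox (Cartan D) ^^ m) (fund_weight k)))"
  shows "is_denominator_vector cst y x z (dv m k)" "is_denominator_vector cst y x z d \<Longrightarrow> d = dv m k"
proof -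
  have r: "rep (\<lambda>z. XX m k (ch z)) z" unfolding z by (rule repI[OF x_gamma_CR[OF g] x_gamma_ch[OF g]])
  obtain N c where c: "\<And>z. \<forall>v. z v \<noteq> 0 \<Longrightarrow> XX m k (ch z) = (\<Sum>\<nu>\<in>exp_box N UNIV. c \<nu> * (\<Prod>v\<in>UNIV. z v powi \<nu> v))"
    "\<And>j \<nu>. \<nu> \<in> exp_box N UNIV \<Longrightarrow> c \<nu> \<noteq> 0 \<Longrightarrow> \<nu> (Inl j) \<ge> - dv m k $ j"
    "\<And>j. \<exists>\<nu>\<in>exp_box N UNIV. c \<nu> \<noteq> 0 \<and> \<nu> (Inl j) = - dv m k $ j"
    using XX_laurent[OF g] unfolding ch_def by blast
  define S where "S = {\<nu>\<in>exp_box N UNIV. c \<nu> \<noteq> 0}"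
  have S: "finite S" "\<And>\<nu>. \<nu> \<in> S \<Longrightarrow> c \<nu> \<noteq> 0" "\<And>\<nu> j. \<nu> \<in> S \<Longrightarrow> \<nu> (Inl j) \<ge> - dv m k $ j" "\<And>j. \<exists>\<nu>\<in>S. \<nu> (Inl j) = - dv m k $ j"
    using c(2) c(3)[unfolded Bex_def] by (simp_all add: S_def finite_exp_box Bex_def conj_assoc)
  have cS: "XX m k (ch z) = (\<Sum>\<nu>\<in>S. c \<nu> * (\<Prod>v\<in>UNIV. z v powi \<nu> v))" if "\<forall>v. z v \<noteq> 0" for z
    unfolding c(1)[OF that] S_def by (rule sum.mono_neutral_right) (auto simp: finite_exp_box)
  obtain P where P: "\<forall>i. \<not> X_var i dvd P" "\<And>z. \<forall>v. z v \<noteq> 0 \<Longrightarrow>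
    cpoly_eval z P / monomial_val (\<lambda>i. z (Inl i)) (dv m k) = (\<Sum>\<nu>\<in>S. c \<nu> * (\<Prod>v\<in>UNIV. z v powi \<nu> v))"
    using laurent_to_cluster_poly[where d = "dv m k" and c = c and S = S] S by blast
  have "z = cluster_poly_val cst y x P / monomial_val x (dv m k)"
  proof (rule rep_unique_elem[OF r rep_cluster_poly])
    fix z :: "'i + 'i \<Rightarrow> complex" assume z: "\<forall>v. z v \<noteq> 0"
    show "XX m k (ch z) = cpoly_eval z P / monomial_val (\<lambda>i. z (Inl i)) (dv m k)" unfolding P(2)[OF z] by (rule cS[OF z])
  qed
  thus "is_denominator_vector cst y x z (dv m k)" unfolding is_denominator_vector_def using P(1) by blast
  assume "is_denominator_vector cst y x z d"
  then obtain Q where Q: "\<forall>i. \<not> X_var i dvd Q" "z = cluster_poly_val cst y x Q / monomial_val x d"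
    unfolding is_denominator_vector_def by blast
  have eq: "cpoly_eval w Q / monomial_val (\<lambda>i. w (Inl i)) d = (\<Sum>\<nu>\<in>S. c \<nu> * (\<Prod>v\<in>UNIV. w v powi \<nu> v))" if "\<forall>v. w v \<noteq> 0" for w
    unfolding cS[OF that, symmetric] by (rule rep_unique_fun[OF rep_cluster_poly[of Q d, folded Q(2)] r that])
  have "d $ i = dv m k $ i" for i
  proof -
    have "(\<forall>\<nu>\<in>S. \<nu> (Inl i) \<ge> - d $ i) \<and> (\<exists>\<nu>\<in>S. \<nu> (Inl i) = - d $ i)"
      by (rule cluster_poly_laurent[OF Q(1)[rule_format] S(1,2) eq])
    thus ?thesis using S(3)[of _ i] S(4)[of i] by (metis neg_le_iff_le order_antisym)
  qed
  thus "d = dv m k" by (simp add: vec_eq_iff)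
qed

end

theorem theorem1p8:
  fixes D :: "('i::{finite,linorder}, 'm::finite) group_datum"
    and \<Delta> :: "'i weight \<Rightarrow> 'i weight \<Rightarrow> complex^'m^'m \<Rightarrow> complex"
    and \<iota> :: "(complex^'m^'m \<Rightarrow> complex) \<Rightarrow> 'f::field"
    and \<gamma> :: "'i weight" and z :: 'f and x y :: "'i \<Rightarrow> 'f" and cst :: "complex \<Rightarrow> 'f"
  assumes group: "simply_connected_group_datum D"
    and minors: "generalized_minors D \<Delta>"
    and ambient: "fraction_field_of (L_cell D) \<iota>"
  defines "x \<equiv> \<lambda>i. \<iota> (x_gamma D \<Delta> (fund_weight i))"
    and "y \<equiv> \<lambda>i. \<iota> (y_coef D \<Delta> i)"
    and "cst \<equiv> \<lambda>a. \<iota> (fun_restrict (L_cell D) (\<lambda>_. a))"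
  assumes "\<gamma> \<in> Pi_c (Cartan D)"
    and "z = \<iota> (x_gamma D \<Delta> \<gamma>)"
    and "z \<in> cluster_variables y x (B_c (Cartan D))"
    and "z \<notin> range x"
  shows "(\<exists>!d. is_denominator_vector cst y x z d) \<and>
         root_comb (Cartan D) (denominator_vector cst y x z) = cox_inv (Cartan D) \<gamma> - \<gamma>"
proof -
  interpret F: sc_field D \<Delta> \<iota>
    by unfold_locales (fact group minors ambient)+
  have xyc: "F.x = x" "F.y = y" "F.cst = cst"
    unfolding x_def y_def cst_def by (auto simp: F.x_def F.y_def F.cst_def F.Xf_def F.Yf_def)
  obtain k h m where k: "is_h (Cartan D) k h" "m \<le> h" "\<gamma> = (cox (Cartan D) ^^ m) (fund_weight k)"
    using \<open>\<gamma> \<in> Pi_c (Cartan D)\<close> unfolding Pi_c_def by blast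
  have g: "good (Cartan D) m k"
    using k(1,2) unfolding good_def is_h_def weight_gt_def by (meson order_less_le_trans)
  have z: "z = \<iota> (x_gamma D \<Delta> ((cox (Cartan D) ^^ m) (fund_weight k)))" using assms(8) k(3) by simp
  \<comment> \<open>For m = 0 the variable is an initial one, which is excluded; there
    \<open>dv\<close> stands for - alpha_k and not for c^-1 gamma - gamma.\<close>
  have "m \<noteq> 0" using \<open>z \<notin> range x\<close> z by (auto simp: x_def)
  then obtain p where p: "m = Suc p" by (cases m) auto
  note dv = F.denominator[OF g z, unfolded xyc]
  have "\<exists>!d. is_denominator_vector cst y x z d" using dv by blast
  moreover have "denominator_vector cst y x z = F.dv m k"
    unfolding denominator_vector_def by (rule the_equality) (fact dv(1), erule dv(2))
  moreover have "root_comb (Cartan D) (F.dv m k) = cox_inv (Cartan D) \<gamma> - \<gamma>"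
  proof -
    have "cox_inv (Cartan D) \<gamma> = (cox (Cartan D) ^^ p) (fund_weight k)"
      unfolding k(3) p by (simp add: cox_inv_def cox_def F.act_rev)
    thus ?thesis unfolding p F.root_comb_dv k(3) by (simp only:)
  qed
  ultimately show ?thesis by simp
qed

end
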